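(* Let $f_0$ be a strictly positive probability density on $\mathbb{R}^d$, let $f_\theta(x)=f_0(x-\theta)$, and let $f^\star=\sum_{i=1}^{q^\star}\pi_i^\star f_{\theta_i^\star}$ be a nondegenerate mixture. There exists a constant $L^\star$ depending only on $d$, $q^\star$ and $f^\star$ such that for every bounded $\Theta\subset\mathbb{R}^d$ containing $\theta_1^\star,\ldots,\theta_{q^\star}^\star$ (with $T$ as in the context) for which Assumption A holds, $$N_{[]}(\mathcal{H}_q(\varepsilon),\delta)\le\bigg(\frac{C_\Theta\,\varepsilon}{\delta}\bigg)^{10(d+1)q+1}$$ for all $q\ge q^\star$ and all $\varepsilon,\delta>0$ with $\delta/\varepsilon\le1$, where $$C_\Theta=L^\star\,(T\vee1)^{1/3}\,\big(\|H_0\|_4^4\vee\|H_1\|_4^4\vee\|H_2\|_4^4\vee\|H_3\|_2^2\big)^{5/4}.$$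
   Context: $\mu$ is Lebesgue measure on $\mathbb{R}^d$; $a\vee b=\max(a,b)$. $f_0>0$ with $\int f_0\,d\mu=1$. Nondegenerate means $\pi_i^\star>0$ for all $i$, $\sum_i\pi_i^\star=1$, and $\theta_i^\star\neq\theta_j^\star$ for $i\ne j$. $\Theta\subset\mathbb{R}^d$ is bounded and contains all $\theta_i^\star$; $T$ is such that $\Theta$ is included in some closed Euclidean ball of radius $T$ (the diameter of $\Theta$ is denoted $2T$). For $q\ge1$, $$\mathcal{M}_q=\Big\{\sum_{i=1}^q\pi_if_{\theta_i}:\pi_i\ge0,\ \sum_{i=1}^q\pi_i=1,\ \theta_i\in\Theta\Big\}.$$ $\|g\|_p=(\int|g|^pf^\star d\mu)^{1/p}$ is the norm of $L^p(f^\star d\mu)$. For $\varepsilon>0$, $$\mathcal{H}_q(\varepsilon)=\big\{\sqrt{f/f^\star}:f\in\mathcal{M}_q,\ \|\sqrt{f/f^\star}-1\|_2\le\varepsilon\big\}\subset L^2(f^\star d\mu).$$ (Note $\|\sqrt{f/f^\star}-1\|_2=h(f,f^\star)$ is the Hellinger distance $[\int(\sqrt f-\sqrt{f^\star})^2d\mu]^{1/2}$.) Bracketing number: for $S\subseteq L^2(f^\star d\mu)$ and $\delta>0$, $N_{[]}(S,\delta)$ is the smallest $n$ for which there exist $l_i,u_i\in L^2(f^\star d\mu)$, $i=1,\dots,n$, with $\|u_i-l_i\|_2\le\delta$ and $S\subseteq\bigcup_{i=1}^n\{g:l_i\le g\le u_i\}$. Define $H_0(x)=\sup_{\theta\in\Theta}f_\theta(x)/f^\star(x)$,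 $H_1(x)=\sup_{\theta\in\Theta}\max_{i}|\partial f_\theta(x)/\partial\theta^i|/f^\star(x)$, $H_2(x)=\sup_{\theta\in\Theta}\max_{i,j}|\partial^2f_\theta(x)/\partial\theta^i\partial\theta^j|/f^\star(x)$, $H_3(x)=\sup_{\theta\in\Theta}\max_{i,j,k}|\partial^3f_\theta(x)/\partial\theta^i\partial\theta^j\partial\theta^k|/f^\star(x)$, with indices ranging over $1,\dots,d$. Assumption A: (1) $f_0\in C^3$, and $f_0(x)$ and the first partial derivatives $(\partial f_0/\partial\theta^i)(x)$ (i.e. $\partial f_\theta(x)/\partial\theta^i$ at $\theta=0$) vanish as $\|x\|\to\infty$; (2) $H_k\in L^4(f^\star d\mu)$ for $k=0,1,2$ and $H_3\in L^2(f^\star d\mu)$. *)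

theory Defs
  imports "HOL-Analysis.Analysis"
begin

definition Lp_space :: "real \<Rightarrow> 'a measure \<Rightarrow> ('a \<Rightarrow> real) set" where
  "Lp_space p M = {g \<in> borel_measurable M. integrable M (\<lambda>x. \<bar>g x\<bar> powr p)}"

text \<open>Only meaningful for members of \<^const>\<open>Lp_space\<close>: the Bochner integral of a
  non-integrable function is 0.\<close>
definition Lp_norm :: "real \<Rightarrow> 'a measure \<Rightarrow> ('a \<Rightarrow> real) \<Rightarrow> real" where
  "Lp_norm p M g = (\<integral>x. \<bar>g x\<bar> powr p \<partial>M) powr (1 / p)"

definition brackets ::
    "'a measure \<Rightarrow> ('a \<Rightarrow> real) set \<Rightarrow> real \<Rightarrow> nat \<Rightarrow> (nat \<Rightarrow> 'a \<Rightarrow> real) \<Rightarrow> (nat \<Rightarrow> 'a \<Rightarrow> real) \<Rightarrow> bool" where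
  "brackets M S \<delta> n l u \<longleftrightarrow>
     (\<forall>i<n. l i \<in> Lp_space 2 M \<and> u i \<in> Lp_space 2 M \<and> Lp_norm 2 M (\<lambda>x. u i x - l i x) \<le> \<delta>) \<and>
     S \<subseteq> (\<Union>i<n. {g. \<forall>x. l i x \<le> g x \<and> g x \<le> u i x})"

text \<open>The value is \<open>\<infinity>\<close> when no finite bracketing exists.\<close>
definition bracketing_number :: "'a measure \<Rightarrow> ('a \<Rightarrow> real) set \<Rightarrow> real \<Rightarrow> enat" where
  "bracketing_number M S \<delta> = Inf {enat n | n. \<exists>l u. brackets M S \<delta> n l u}"

definition partial_deriv :: "'d::finite \<Rightarrow> (real^'d \<Rightarrow> real) \<Rightarrow> real^'d \<Rightarrow> real" where
  "partial_deriv i g x = deriv (\<lambda>t. g (x + t *\<^sub>R axis i 1)) 0"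

primrec C_k :: "nat \<Rightarrow> (real^'d::finite \<Rightarrow> real) \<Rightarrow> bool" where
  "C_k 0 g \<longleftrightarrow> continuous_on UNIV g"
| "C_k (Suc k) g \<longleftrightarrow> g differentiable_on UNIV \<and> (\<forall>i. C_k k (partial_deriv i g))"

definition prob_density :: "(real^'d::finite \<Rightarrow> real) \<Rightarrow> bool" where
  "prob_density f \<longleftrightarrow> (\<forall>x. 0 \<le> f x) \<and> integrable lborel f \<and> (\<integral>x. f x \<partial>lborel) = 1"

definition shifted :: "(real^'d::finite \<Rightarrow> real) \<Rightarrow> real^'d \<Rightarrow> real^'d \<Rightarrow> real" where
  "shifted f0 \<theta> x = f0 (x - \<theta>)"

definition mixture ::
    "(real^'d::finite \<Rightarrow> real) \<Rightarrow> nat \<Rightarrow> (nat \<Rightarrow> real) \<Rightarrow> (nat \<Rightarrow> real^'d) \<Rightarrow> real^'d \<Rightarrow> real" where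
  "mixture f0 q p \<theta> x = (\<Sum>i<q. p i * shifted f0 (\<theta> i) x)"

definition nondegenerate :: "nat \<Rightarrow> (nat \<Rightarrow> real) \<Rightarrow> (nat \<Rightarrow> real^'d::finite) \<Rightarrow> bool" where
  "nondegenerate q p \<theta> \<longleftrightarrow>
     (\<forall>i<q. 0 < p i) \<and> (\<Sum>i<q. p i) = 1 \<and> (\<forall>i<q. \<forall>j<q. i \<noteq> j \<longrightarrow> \<theta> i \<noteq> \<theta> j)"

definition mixtures ::
    "(real^'d::finite \<Rightarrow> real) \<Rightarrow> (real^'d) set \<Rightarrow> nat \<Rightarrow> (real^'d \<Rightarrow> real) set" where
  "mixtures f0 \<Theta> q =
     {mixture f0 q p \<theta> | p \<theta>. (\<forall>i<q. 0 \<le> p i) \<and> (\<Sum>i<q. p i) = 1 \<and> (\<forall>i<q. \<theta> i \<in> \<Theta>)}"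

definition density_measure :: "(real^'d::finite \<Rightarrow> real) \<Rightarrow> (real^'d) measure" where
  "density_measure f = density lborel (\<lambda>x. ennreal (f x))"

definition hellinger_ball ::
    "(real^'d::finite \<Rightarrow> real) \<Rightarrow> (real^'d \<Rightarrow> real) \<Rightarrow> (real^'d) set \<Rightarrow> nat \<Rightarrow> real \<Rightarrow> (real^'d \<Rightarrow> real) set" where
  "hellinger_ball f0 fs \<Theta> q \<epsilon> =
     {(\<lambda>x. sqrt (f x / fs x)) | f. f \<in> mixtures f0 \<Theta> q \<and>
        Lp_norm 2 (density_measure fs) (\<lambda>x. sqrt (f x / fs x) - 1) \<le> \<epsilon>}"

text \<open>The envelopes below use the supremum of real sets. It is the true supremum when \<open>\<Theta>\<close> is
  nonempty and bounded and \<open>f0\<close> is three times continuously differentiable. The derivatives are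
  taken in the shift parameter \<open>\<theta>\<close>, with \<open>x\<close> fixed.\<close>

definition envelope0 ::
    "(real^'d::finite \<Rightarrow> real) \<Rightarrow> (real^'d \<Rightarrow> real) \<Rightarrow> (real^'d) set \<Rightarrow> real^'d \<Rightarrow> real" where
  "envelope0 f0 fs \<Theta> x = (SUP \<theta>\<in>\<Theta>. shifted f0 \<theta> x / fs x)"

definition envelope1 ::
    "(real^'d::finite \<Rightarrow> real) \<Rightarrow> (real^'d \<Rightarrow> real) \<Rightarrow> (real^'d) set \<Rightarrow> real^'d \<Rightarrow> real" where
  "envelope1 f0 fs \<Theta> x =
     (SUP \<theta>\<in>\<Theta>. (MAX i. \<bar>partial_deriv i (\<lambda>\<tau>. shifted f0 \<tau> x) \<theta>\<bar>) / fs x)"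

definition envelope2 ::
    "(real^'d::finite \<Rightarrow> real) \<Rightarrow> (real^'d \<Rightarrow> real) \<Rightarrow> (real^'d) set \<Rightarrow> real^'d \<Rightarrow> real" where
  "envelope2 f0 fs \<Theta> x =
     (SUP \<theta>\<in>\<Theta>. (MAX (i, j).
        \<bar>partial_deriv i (partial_deriv j (\<lambda>\<tau>. shifted f0 \<tau> x)) \<theta>\<bar>) / fs x)"

definition envelope3 ::
    "(real^'d::finite \<Rightarrow> real) \<Rightarrow> (real^'d \<Rightarrow> real) \<Rightarrow> (real^'d) set \<Rightarrow> real^'d \<Rightarrow> real" where
  "envelope3 f0 fs \<Theta> x =
     (SUP \<theta>\<in>\<Theta>. (MAX (i, j, k).
        \<bar>partial_deriv i (partial_deriv j (partial_deriv k (\<lambda>\<tau>. shifted f0 \<tau> x))) \<theta>\<bar>) / fs x)"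

definition assumption_A ::
    "(real^'d::finite \<Rightarrow> real) \<Rightarrow> (real^'d \<Rightarrow> real) \<Rightarrow> (real^'d) set \<Rightarrow> bool" where
  "assumption_A f0 fs \<Theta> \<longleftrightarrow>
     C_k 3 f0 \<and>
     (f0 \<longlongrightarrow> 0) at_infinity \<and>
     (\<forall>i. ((\<lambda>x. partial_deriv i (\<lambda>\<tau>. shifted f0 \<tau> x) 0) \<longlongrightarrow> 0) at_infinity) \<and>
     envelope0 f0 fs \<Theta> \<in> Lp_space 4 (density_measure fs) \<and>
     envelope1 f0 fs \<Theta> \<in> Lp_space 4 (density_measure fs) \<and>
     envelope2 f0 fs \<Theta> \<in> Lp_space 4 (density_measure fs) \<and>
     envelope3 f0 fs \<Theta> \<in> Lp_space 2 (density_measure fs)"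

definition C_Theta ::
    "(real^'d::finite \<Rightarrow> real) \<Rightarrow> (real^'d \<Rightarrow> real) \<Rightarrow> (real^'d) set \<Rightarrow> real \<Rightarrow> real \<Rightarrow> real" where
  "C_Theta f0 fs \<Theta> T L =
     L * (max T 1) powr (1/3) *
     (max (max (Lp_norm 4 (density_measure fs) (envelope0 f0 fs \<Theta>) ^ 4)
               (Lp_norm 4 (density_measure fs) (envelope1 f0 fs \<Theta>) ^ 4))
          (max (Lp_norm 4 (density_measure fs) (envelope2 f0 fs \<Theta>) ^ 4)
               (Lp_norm 2 (density_measure fs) (envelope3 f0 fs \<Theta>) ^ 2))) powr (5/4)"

end

theory Submission
  imports Defs
begin

text \<open>Mixtures in a Hellinger ball of radius \<open>\<epsilon>\<close> are within \<open>2 * \<epsilon>\<close> of \<open>fs\<close> in \<open>L\<^sup>1\<close>. Near the frequency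
  0 the characteristic function of \<open>f0\<close> is bounded away from 0 and can be divided out; testing the
  difference of the mixing measures against products of functions \<open>1 - sin y / y\<close>, whose frequencies
  are small, shows that four quantities are \<open>O(\<epsilon>)\<close>: the weight of the components far from all true
  points, the quadratic spread of the other components around the true points, and the errors of the
  mass and of the first moment at each true point. A mixture is thus \<open>fs\<close> plus \<open>O(\<epsilon>)\<close> combinations of
  translates of \<open>f0\<close>, of its gradients at the true points and of second order terms, and rounding
  these parameters on a scale given by \<open>u = c * \<delta> / (\<epsilon> * sqrt M)\<close>, with \<open>M\<close> the maximum of the envelope
  norms, gives the brackets. The Taylor remainders are the delicate part: \<open>\<Theta>\<close> need not be convex, so
  the envelopes do not control derivatives on segments between two parameters. Instead the space
  variable moves: \<open>x - \<theta>\<close> and \<open>x - \<theta>'\<close> are both joined to the common point \<open>x + z - \<theta>\<close> by paths on which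
  the envelopes at neighbours of \<open>x\<close> apply, and averaging over \<open>z\<close> gives integrable bounds.\<close>

text \<open>The averaged bounds carry the values of \<open>fs\<close> at neighbours of
  \<open>x\<close>, while the norm weighs with \<open>fs x\<close>, which may be far smaller. Where
  the local mean of \<open>fs\<close> is at most a multiple of \<open>fs x\<close>, Cauchy-Schwarz
  suffices. Elsewhere second differences of \<open>fs\<close> show that this mean is
  \<open>O(r ^ 8)\<close> times an integrable function, \<open>r\<close> bounding the parameter
  distance, and interpolation with crude bounds by \<open>H0\<close>, \<open>H1\<close>,
  \<open>H2\<close>, whose fourth powers are integrable against \<open>fs\<close>, closes the gap.
  For the second order remainder this yields the squared size \<open>r ^ (16/3)\<close>, summable
  against \<open>r ^ 4\<close>; hence \<open>r = u ^ 3\<close>. The other exponents follow by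
  balance: components farther than \<open>u ^ 3\<close> from the true points weigh
  \<open>O(\<epsilon> / u ^ 6)\<close>, so rounding their positions to \<open>u ^ 8\<close> costs
  \<open>\<epsilon> * u ^ 2\<close>, like all other errors. Taking square roots yields the geometric
  mean of \<open>\<epsilon> * u ^ 2\<close> and \<open>\<epsilon>\<close>, that is
  \<open>\<epsilon> * u\<close>. A factor \<open>u ^ (-8)\<close> per rounded slot and
  \<open>u ^ (-2)\<close> per parameter of the main part give the exponent 10.\<close>

section \<open>Counting tuples of natural numbers with a bounded sum\<close>

lemma sum_le_count_finite:
  assumes "finite I"
  shows "finite {n \<in> I \<rightarrow>\<^sub>E (UNIV::nat set). sum n I \<le> K}"
proof -
  have "{n \<in> I \<rightarrow>\<^sub>E (UNIV::nat set). sum n I \<le> K} \<subseteq> I \<rightarrow>\<^sub>E {..K}"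
  proof (rule subsetI)
    fix n assume n: "n \<in> {n \<in> I \<rightarrow>\<^sub>E (UNIV::nat set). sum n I \<le> K}"
    show "n \<in> I \<rightarrow>\<^sub>E {..K}"
    proof (rule PiE_I)
      fix i assume "i \<in> I"
      then have "n i \<le> sum n I" using member_le_sum[of i I n] assms by auto
      then show "n i \<in> {..K}" using n by auto
    qed (use n in auto)
  qed
  then show ?thesis using finite_PiE[OF assms, of "\<lambda>_. {..K}"] finite_subset by blast
qed

text \<open>Exponential Markov inequality with parameter \<open>t = N / (N + 1)\<close>.\<close>
lemma card_sum_le:
  fixes N :: real
  assumes "finite I" and N: "0 < N"
  shows "real (card {n \<in> I \<rightarrow>\<^sub>E (UNIV::nat set). real (sum n I) \<le> card I * N}) \<le> (exp 1 * (1 + N)) ^ card I"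
proof -
  define K where "K = nat \<lfloor>card I * N\<rfloor>"
  define S where "S = {n \<in> I \<rightarrow>\<^sub>E (UNIV::nat set). real (sum n I) \<le> card I * N}"
  have SK: "S = {n \<in> I \<rightarrow>\<^sub>E (UNIV::nat set). sum n I \<le> K}"
    unfolding S_def K_def using N by (auto simp: le_nat_floor le_nat_iff le_floor_iff)
  have finS: "finite S" unfolding SK by (rule sum_le_count_finite[OF assms(1)])
  define t where "t = N / (N + 1)"
  have t: "0 < t" "t < 1" "1 - t = 1 / (N+1)" using N by (auto simp: t_def field_simps)
  have sub: "S \<subseteq> I \<rightarrow>\<^sub>E {..K}"
  proof (rule subsetI)
    fix n assume n: "n \<in> S"
    show "n \<in> I \<rightarrow>\<^sub>E {..K}"
    proof (rule PiE_I)
      fix i assume "i \<in> I"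
      then have "n i \<le> sum n I" using member_le_sum[of i I n] assms by auto
      then show "n i \<in> {..K}" using n by (auto simp: SK)
    qed (use n in \<open>auto simp: SK\<close>)
  qed
  \<comment> \<open>The weights \<open>t ^ sum n I\<close> of all tuples factor over
    \<open>I\<close> into geometric series, each at most \<open>N + 1\<close>, while every tuple of
    \<open>S\<close> weighs at least \<open>exp (- card I)\<close>; the quotient bounds the
    count.\<close>
  have "(\<Sum>n\<in>S. t ^ sum n I) \<le> (\<Sum>n\<in>I \<rightarrow>\<^sub>E {..K}. t ^ sum n I)"
    by (rule sum_mono2) (use assms sub t in \<open>auto intro: finite_PiE\<close>)
  also have "\<dots> = (\<Sum>n\<in>I \<rightarrow>\<^sub>E {..K}. \<Prod>i\<in>I. t ^ n i)" by (simp add: power_sum)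
  also have "\<dots> = (\<Prod>i\<in>I. \<Sum>k\<in>{..K}. t ^ k)"
    by (rule prod_sum_PiE[symmetric]) (use assms in auto)
  also have "\<dots> \<le> (\<Prod>i\<in>I. N + 1)"
  proof (rule prod_mono, intro conjI)
    fix i
    show "0 \<le> (\<Sum>k\<in>{..K}. t ^ k)" using t by (intro sum_nonneg) auto
    have "(\<Sum>k\<in>{..K}. t ^ k) = (1 - t ^ Suc K) / (1 - t)"
      using t(2) sum_gp0[of t K] by auto
    also have "\<dots> \<le> 1 / (1 - t)" using t(1,2) by (intro divide_right_mono) auto
    also have "\<dots> = N + 1" using t(3) by simp
    finally show "(\<Sum>k\<in>{..K}. t ^ k) \<le> N + 1" .
  qed
  also have "\<dots> = (N + 1) ^ card I" by simp
  finally have up: "(\<Sum>n\<in>S. t ^ sum n I) \<le> (N + 1) ^ card I" .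
  have et: "exp (- 1 / N) \<le> t"
  proof -
    have "1 + 1 / N \<le> exp (1 / N)" by (rule exp_ge_add_one_self)
    then have "inverse (exp (1/N)) \<le> inverse (1 + 1/N)" using N by (intro le_imp_inverse_le) (auto intro: add_pos_pos)
    also have "inverse (1 + 1/N) = t" using N by (simp add: t_def field_simps)
    finally show ?thesis by (simp add: exp_minus)
  qed
  have low: "exp (- real (card I)) \<le> t ^ sum n I" if "n \<in> S" for n
  proof -
    have "real (sum n I) \<le> card I * N" using that by (simp add: S_def)
    then have "real (sum n I) / N \<le> card I" using N by (simp add: field_simps)
    then have "exp (- real (card I)) \<le> exp (real (sum n I) * (- 1 / N))" by (simp)
    also have "\<dots> = exp (- 1 / N) ^ sum n I" by (rule exp_of_nat_mult)
    also have "\<dots> \<le> t ^ sum n I" by (rule power_mono[OF et]) simp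
    finally show ?thesis .
  qed
  have "real (card S) * exp (- real (card I)) \<le> (\<Sum>n\<in>S. t ^ sum n I)"
    using sum_mono[of S "\<lambda>_. exp (- real (card I))", OF low] by simp
  also note up
  finally have "real (card S) \<le> (N + 1) ^ card I * exp (real (card I))"
    by (simp add: exp_minus field_simps)
  also have "\<dots> = (exp 1 * (1 + N)) ^ card I"
    by (simp add: power_mult_distrib exp_of_nat_mult[symmetric] add.commute mult.commute)
  finally show ?thesis unfolding S_def .
qed

section \<open>Fourier localization of mixtures\<close>

definition char_fn :: "(real^'d::finite \<Rightarrow> real) \<Rightarrow> real^'d \<Rightarrow> complex" where
  "char_fn f \<xi> = (\<integral>x. f x *\<^sub>R cis (\<xi> \<bullet> x) \<partial>lborel)"

lemma continuous_cis_inner [continuous_intros]: "continuous_on A (\<lambda>x. cis (\<xi> \<bullet> x))"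
  unfolding cis_conv_exp by (intro continuous_intros)

lemma borel_measurable_cis_inner [measurable]: "(\<lambda>x::real^'d::finite. cis (\<xi> \<bullet> x)) \<in> borel_measurable borel"
  by (intro borel_measurable_continuous_onI continuous_cis_inner)

lemma integrable_scale_cis:
  fixes f :: "real^'d::finite \<Rightarrow> real"
  assumes "integrable lborel f"
  shows "integrable lborel (\<lambda>x. f x *\<^sub>R cis (\<xi> \<bullet> x))"
proof (rule Bochner_Integration.integrable_bound[OF assms])
  have [measurable]: "f \<in> borel_measurable borel" using assms by auto
  show "(\<lambda>x. f x *\<^sub>R cis (\<xi> \<bullet> x)) \<in> borel_measurable lborel" by measurable
qed auto

text \<open>The transform is 1 at frequency 0 and continuous there by dominated convergence, so no
  sequence of frequencies tending to 0 can keep its values below \<open>1/2\<close>. The radius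
  depends on \<open>f\<close> alone.\<close>

lemma char_fn_near_0:
  assumes "prob_density f"
  shows "\<exists>s>0. \<forall>\<xi>. norm \<xi> \<le> s \<longrightarrow> 1/2 \<le> cmod (char_fn f \<xi>)"
proof -
  have int: "integrable lborel f" and one: "(\<integral>x. f x \<partial>lborel) = 1" and nn: "\<And>x. 0 \<le> f x"
    using assms by (auto simp: prob_density_def)
  have [measurable]: "f \<in> borel_measurable borel" using int by auto
  show ?thesis
  proof (rule ccontr)
    assume neg: "\<not> ?thesis"
    have "\<forall>n. \<exists>\<xi>. norm \<xi> \<le> inverse (Suc n) \<and> cmod (char_fn f \<xi>) < 1/2"
    proof
      fix n :: nat
      show "\<exists>\<xi>. norm \<xi> \<le> inverse (Suc n) \<and> cmod (char_fn f \<xi>) < 1/2"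
        using neg[simplified, rule_format, of "inverse (real (Suc n))"] by (auto simp: not_le)
    qed
    then obtain X where X: "\<And>n. norm (X n) \<le> inverse (Suc n)" "\<And>n. cmod (char_fn f (X n)) < 1/2" by metis
    have X0: "X \<longlonglongrightarrow> 0"
      by (rule Lim_null_comparison[OF _ LIMSEQ_inverse_real_of_nat]) (use X in auto)
    have "(\<lambda>n. char_fn f (X n)) \<longlonglongrightarrow> (\<integral>x. complex_of_real (f x) \<partial>lborel)"
      unfolding char_fn_def
    proof (rule integral_dominated_convergence[where w = f])
      show "AE x in lborel. (\<lambda>i. f x *\<^sub>R cis (X i \<bullet> x)) \<longlonglongrightarrow> complex_of_real (f x)"
      proof (rule AE_I2)
        fix x
        have "(\<lambda>i. X i \<bullet> x) \<longlonglongrightarrow> 0" using tendsto_inner[OF X0 tendsto_const, of x] by simp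
        then have "(\<lambda>i. cis (X i \<bullet> x)) \<longlonglongrightarrow> cis 0"
          unfolding cis_conv_exp by (intro tendsto_intros) 
        then show "(\<lambda>i. f x *\<^sub>R cis (X i \<bullet> x)) \<longlonglongrightarrow> complex_of_real (f x)"
          using tendsto_scaleR[OF tendsto_const, of _ "1::complex" sequentially "f x"] by (simp add: scaleR_conv_of_real)
      qed
    qed (use int nn in \<open>auto\<close>)
    then have "(\<lambda>n. cmod (char_fn f (X n))) \<longlonglongrightarrow> 1"
      using tendsto_norm[of "\<lambda>n. char_fn f (X n)" "1" sequentially] one by (simp del: One_nat_def)
    moreover have "eventually (\<lambda>n. cmod (char_fn f (X n)) \<le> 1/2) sequentially"
      using X(2) by (auto intro!: always_eventually less_imp_le)
    ultimately have "(1::real) \<le> 1/2" using tendsto_upperbound[of _ "1::real" sequentially "1/2"] by auto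
    then show False by simp
  qed
qed

lemma integral_lborel_shift:
  fixes h :: "real^'d::finite \<Rightarrow> 'b::{banach, second_countable_topology}"
  assumes [measurable]: "h \<in> borel_measurable borel"
  shows "(\<integral>x. h (x - t) \<partial>lborel) = (\<integral>x. h x \<partial>lborel)"
proof -
  have "(\<integral>x. h x \<partial>lborel) = (\<integral>x. h x \<partial>(distr lborel borel ((+) (- t))))"
    by (simp add: lborel_distr_plus)
  also have "\<dots> = (\<integral>x. h (- t + x) \<partial>lborel)" by (rule integral_distr) auto
  finally show ?thesis by simp
qed

lemma integrable_lborel_shift:
  fixes h :: "real^'d::finite \<Rightarrow> 'b::{banach, second_countable_topology}"
  assumes "integrable lborel h"
  shows "integrable lborel (\<lambda>x. h (x - t))"
proof -
  have [measurable]: "h \<in> borel_measurable borel" using assms by auto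
  have "integrable (distr lborel borel ((+) (- t))) h" using assms by (simp add: lborel_distr_plus)
  then have "integrable lborel (\<lambda>x. h (- t + x))" by (subst (asm) integrable_distr_eq) auto
  then show ?thesis by simp
qed

text \<open>The transform of a sum of translates factors into the exponential sum of the weighted
  points and the transform of \<open>f\<close>, and a transform never exceeds the L1 norm. Where
  \<open>char_fn f\<close> is bounded below, this controls the exponential sum of a signed discrete
  measure.\<close>

lemma char_sum_bound:
  fixes f :: "real^'d::finite \<Rightarrow> real"
  assumes "finite J" "integrable lborel f"
  shows "cmod (\<Sum>j\<in>J. of_real (m j) * cis (\<xi> \<bullet> t j)) * cmod (char_fn f \<xi>)
      \<le> (\<integral>x. \<bar>\<Sum>j\<in>J. m j * f (x - t j)\<bar> \<partial>lborel)"
proof -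
  have [measurable]: "f \<in> borel_measurable borel" using assms by auto
  have int: "integrable lborel (\<lambda>x. \<Sum>j\<in>J. m j * f (x - t j))"
    using assms by (auto intro!: integrable_lborel_shift)
  have *: "(\<integral>x. f (x - a) *\<^sub>R cis (\<xi> \<bullet> x) \<partial>lborel) = cis (\<xi> \<bullet> a) * char_fn f \<xi>" for a
  proof -
    have "(\<integral>x. f (x - a) *\<^sub>R cis (\<xi> \<bullet> x) \<partial>lborel)
        = (\<integral>x. cis (\<xi> \<bullet> a) * (f (x - a) *\<^sub>R cis (\<xi> \<bullet> (x - a))) \<partial>lborel)"
      by (rule Bochner_Integration.integral_cong) (auto simp: cis_mult inner_diff_right scaleR_conv_of_real mult.left_commute)
    also have "\<dots> = (\<integral>x. cis (\<xi> \<bullet> a) * (f x *\<^sub>R cis (\<xi> \<bullet> x)) \<partial>lborel)"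
      by (rule integral_lborel_shift[where h = "\<lambda>x. cis (\<xi> \<bullet> a) * (f x *\<^sub>R cis (\<xi> \<bullet> x))"]) simp
    also have "\<dots> = cis (\<xi> \<bullet> a) * char_fn f \<xi>"
      unfolding char_fn_def by (rule integral_mult_right_zero)
    finally show ?thesis .
  qed
  have "(\<Sum>j\<in>J. of_real (m j) * cis (\<xi> \<bullet> t j)) * char_fn f \<xi>
     = (\<Sum>j\<in>J. of_real (m j) * (\<integral>x. f (x - t j) *\<^sub>R cis (\<xi> \<bullet> x) \<partial>lborel))"
    unfolding * by (simp add: sum_distrib_right mult.assoc)
  also have "\<dots> = (\<integral>x. (\<Sum>j\<in>J. of_real (m j) * (f (x - t j) *\<^sub>R cis (\<xi> \<bullet> x))) \<partial>lborel)"
    by (subst Bochner_Integration.integral_sum)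
       (intro integrable_mult_right integrable_scale_cis integrable_lborel_shift assms(2), simp only: integral_mult_right_zero)
  also have "\<dots> = (\<integral>x. (\<Sum>j\<in>J. m j * f (x - t j)) *\<^sub>R cis (\<xi> \<bullet> x) \<partial>lborel)"
    by (rule Bochner_Integration.integral_cong) (auto simp: scaleR_conv_of_real sum_distrib_right mult.assoc)
  finally have "cmod (\<Sum>j\<in>J. of_real (m j) * cis (\<xi> \<bullet> t j)) * cmod (char_fn f \<xi>)
     = cmod (\<integral>x. (\<Sum>j\<in>J. m j * f (x - t j)) *\<^sub>R cis (\<xi> \<bullet> x) \<partial>lborel)"
    by (simp only: norm_mult[symmetric])
  also have "\<dots> \<le> (\<integral>x. cmod ((\<Sum>j\<in>J. m j * f (x - t j)) *\<^sub>R cis (\<xi> \<bullet> x)) \<partial>lborel)"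
    by (rule integral_norm_bound)
  finally show ?thesis by simp
qed

section \<open>A band limited substitute for the squared distance\<close>

text \<open>The mean of \<open>1 - cos (t * y)\<close> over \<open>t\<close> in
  \<open>{0..1}\<close>. A single \<open>1 - cos y\<close> would vanish again at the multiples of
  \<open>2 * pi\<close>; the mean vanishes only at 0, quadratically, and still involves only
  frequencies in \<open>{-1..1}\<close>.\<close>

definition sincc :: "real \<Rightarrow> real" where
  "sincc y = (if y = 0 then 0 else 1 - sin y / y)"

lemma sincc_has_integral: "((\<lambda>t. 1 - cos (t * y)) has_integral sincc y) {0..1}"
proof (cases "y = 0")
  case True
  then show ?thesis by (simp add: sincc_def)
next
  case False
  have "((\<lambda>t. 1 - cos (t * y)) has_integral ((1 - sin (1 * y) / y) - (0 - sin (0 * y) / y))) {0..1}"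
  proof (rule fundamental_theorem_of_calculus)
    fix t :: real
    show "((\<lambda>t. t - sin (t * y) / y) has_vector_derivative 1 - cos (t * y)) (at t within {0..1})"
      unfolding has_real_derivative_iff_has_vector_derivative[symmetric]
      by (rule derivative_eq_intros refl | use False in simp)+
  qed auto
  then show ?thesis using False by (simp add: sincc_def)
qed

lemma sin_minus_self_le: "\<bar>sin x - x\<bar> \<le> \<bar>x\<bar>^2 / 2" for x :: real
  using Maclaurin_sin_bound[of x 2] by (simp add: sin_coeff_def eval_nat_numeral)

lemma sin_minus_self_le3: "\<bar>sin x - x\<bar> \<le> \<bar>x\<bar>^3 / 6" for x :: real
  using Maclaurin_sin_bound[of x 3] by (simp add: sin_coeff_def eval_nat_numeral)

lemma one_minus_cos_le: "1 - cos x \<le> x^2 / 2" for x :: real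
proof -
  have "1 - cos x = 2 * (sin (x/2))^2" using cos_double_sin[of "x/2"] by simp
  also have "(sin (x/2))^2 \<le> (x/2)^2"
    using abs_sin_x_le_abs_x[of "x/2"] unfolding abs_le_square_iff .
  finally show ?thesis by (simp add: power2_eq_square)
qed

lemma sincc_ge: "min 1 (y^2) / 9 \<le> sincc y"
proof (cases "\<bar>y\<bar> \<le> 2")
  case True
  have "y^2 * (1/9) \<le> sincc y"
  proof (rule has_integral_le[OF _ sincc_has_integral])
    have "((\<lambda>t. t^2 * (y^2/3)) has_integral (1^3/3 - 0^3/3) * (y^2/3)) {0..1::real}"
    proof (intro has_integral_mult_left fundamental_theorem_of_calculus)
      fix t :: real
      show "((\<lambda>t. t^3/3) has_vector_derivative t^2) (at t within {0..1})"
        unfolding has_real_derivative_iff_has_vector_derivative[symmetric]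
        by (rule derivative_eq_intros refl | simp)+
    qed auto
    then show "((\<lambda>t. t^2 * (y^2/3)) has_integral y^2 * (1/9)) {0..1::real}" by simp
    fix t :: real assume t: "t \<in> {0..1}"
    define w where "w = \<bar>t * y / 2\<bar>"
    have w: "0 \<le> w" "w \<le> 1" using t True by (auto simp: w_def abs_mult mult_le_one intro: mult_le_one[of t "\<bar>y\<bar>/2", simplified])
    \<comment> \<open>Since \<open>w \<le> 1\<close>, the cubic error is at most
      \<open>w / 6\<close>. The resulting factor \<open>2 * (5/6)^2 / 4 = 25/72\<close> still
      exceeds the \<open>1/3\<close> of the minorant, whose integral is
      \<open>y^2 / 9\<close>.\<close>
    have "5/6 * w \<le> sin w"
    proof -
      have "w^3 \<le> w" using w power_decreasing[of 1 3 w] by simp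
      moreover have "\<bar>sin w - w\<bar> \<le> w^3/6" using sin_minus_self_le3[of w] w by simp
      ultimately show ?thesis by linarith
    qed
    then have "(5/6 * w)^2 \<le> (sin w)^2" using w by (intro power_mono) auto
    moreover have "(sin w)^2 = (sin (t*y/2))^2" by (auto simp: w_def abs_if)
    moreover have "1 - cos (t*y) = 2 * (sin (t*y/2))^2" using cos_double_sin[of "t*y/2"] by simp
    moreover have "w^2 = (t*y/2)^2" unfolding w_def by (rule power2_abs)
    ultimately have "2 * (25/36 * (t*y/2)^2) \<le> 1 - cos (t*y)" by (simp add: power_mult_distrib power_divide)
    moreover have "t^2 * (y^2/3) \<le> 2 * (25/36 * (t*y/2)^2)" by (simp add: power_mult_distrib power_divide field_simps)
    ultimately show "t^2 * (y^2/3) \<le> 1 - cos (t*y)" by linarith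
  qed
  then show ?thesis by (auto simp: min_def)
next
  case False
  have "\<bar>sin y\<bar> / \<bar>y\<bar> \<le> 1 / 2" using False by (intro frac_le abs_sin_le_one) simp_all
  then have "\<bar>sin y / y\<bar> \<le> 1 / 2" by (simp only: abs_divide)
  moreover have "sincc y = 1 - sin y / y" using False by (auto simp: sincc_def)
  moreover have "min 1 (y^2) \<le> 1" by simp
  ultimately show ?thesis by linarith
qed

lemma sincc_le: "sincc y \<le> y^2 / 2"
proof -
  have "sincc y \<le> (1 - 0) *\<^sub>R (y^2/2)"
  proof (rule has_integral_le[OF sincc_has_integral has_integral_const_real[THEN has_integral_eq_rhs]])
    fix t :: real assume t: "t \<in> {0..1}"
    have "1 - cos (t*y) \<le> (t*y)^2/2" by (rule one_minus_cos_le)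
    also have "\<dots> \<le> y^2/2" using t by (simp add: power_mult_distrib mult_left_le_one_le power_le_one)
    finally show "1 - cos (t*y) \<le> y^2/2" .
  qed auto
  then show ?thesis by simp
qed

lemma sincc_le_2: "sincc y \<le> 2"
proof -
  have "sincc y \<le> (1 - 0) *\<^sub>R 2"
  proof (rule has_integral_le[OF sincc_has_integral has_integral_const_real[THEN has_integral_eq_rhs]])
    fix t :: real
    show "1 - cos (t*y) \<le> 2" using cos_ge_minus_one[of "t*y"] by linarith
  qed auto
  then show ?thesis by simp
qed

lemma sincc_nonneg: "0 \<le> sincc y"
proof -
  have "0 \<le> min 1 (y^2) / 9" by simp
  with sincc_ge[of y] show ?thesis by linarith
qed

lemma cos_expand: "\<bar>cos (a + b) - cos a + b * sin a\<bar> \<le> b^2" for a b :: real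
proof -
  have "cos (a + b) - cos a + b * sin a = cos a * (cos b - 1) + sin a * (b - sin b)"
    by (simp add: cos_add algebra_simps)
  also have "\<bar>\<dots>\<bar> \<le> 1 * \<bar>cos b - 1\<bar> + 1 * \<bar>b - sin b\<bar>"
    by (intro order_trans[OF abs_triangle_ineq] add_mono) (auto simp only: abs_mult abs_cos_le_one abs_sin_le_one abs_ge_zero intro!: mult_right_mono)
  also have "\<dots> \<le> b^2/2 + b^2/2"
    using one_minus_cos_le[of b] cos_le_one[of b] sin_minus_self_le[of b] by (simp add: abs_minus_commute[of b "sin b"])
  finally show ?thesis by simp
qed

text \<open>The expansion of the cosine with error \<open>b^2\<close> is integrated over
  \<open>t\<close>; the slope \<open>d\<close> is the integral of \<open>t * sin (t * y)\<close>.
  The integral form treats \<open>y = 0\<close> like any other point.\<close>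

lemma sincc_expand: "\<exists>d. \<forall>h. \<bar>sincc (y + h) - sincc y - d * h\<bar> \<le> h^2"
proof -
  have "(\<lambda>t. t * sin (t * y)) integrable_on {0..1}"
    by (intro integrable_continuous_interval continuous_intros)
  then obtain d where d: "((\<lambda>t. t * sin (t * y)) has_integral d) {0..1}" by blast
  have "\<bar>sincc (y + h) - sincc y - d * h\<bar> \<le> h^2" for h
  proof -
    have "((\<lambda>t. (1 - cos (t*(y+h))) - (1 - cos (t*y)) - (t * sin (t*y)) * h) has_integral
       sincc (y + h) - sincc y - d * h) {0..1}"
      by (intro has_integral_diff sincc_has_integral has_integral_mult_left d)
    note hi = this
    have "norm (sincc (y + h) - sincc y - d * h) \<le> h^2 * Henstock_Kurzweil_Integration.content {0..1::real}"
    proof (rule has_integral_bound_real[OF zero_le_power2 finite.emptyI hi])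
      fix t :: real assume t: "t \<in> {0..1} - {}"
      have "\<bar>cos (t*y + t*h) - cos (t*y) + (t*h) * sin (t*y)\<bar> \<le> (t*h)^2" by (rule cos_expand)
      also have "\<dots> \<le> h^2" using t by (simp add: power_mult_distrib mult_left_le_one_le power_le_one)
      finally show "norm (1 - cos (t * (y + h)) - (1 - cos (t * y)) - t * sin (t * y) * h) \<le> h\<^sup>2"
        by (simp add: algebra_simps abs_minus_commute)
    qed
    then show ?thesis by simp
  qed
  then show ?thesis by blast
qed

text \<open>For \<open>s > 0\<close> the bounds below place it between constant multiples of
  \<open>min 1 ((norm u)^2)\<close>, with constants depending on \<open>s\<close> and the dimension
  only.\<close>

definition sinc_gap :: "real \<Rightarrow> real^'d::finite \<Rightarrow> real" where
  "sinc_gap s u = (\<Sum>k\<in>UNIV. sincc (s * u $ k))"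

lemma sinc_gap_nonneg: "0 \<le> sinc_gap s u"
  unfolding sinc_gap_def by (intro sum_nonneg sincc_nonneg)

lemma sinc_gap_0 [simp]: "sinc_gap s 0 = 0"
  by (simp add: sinc_gap_def sincc_def)

lemma norm_sq_vec: "(norm (u::real^'d::finite))^2 = (\<Sum>k\<in>UNIV. (u $ k)^2)"
  by (simp add: norm_vec_def L2_set_def sum_nonneg)

lemma sinc_gap_le_card: "sinc_gap s (u::real^'d::finite) \<le> 2 * real CARD('d)"
  unfolding sinc_gap_def using sum_bounded_above[of UNIV "\<lambda>k. sincc (s * u $ k)" 2] sincc_le_2 by auto

lemma sinc_gap_le: "sinc_gap s u \<le> s^2 / 2 * (norm u)^2"
proof -
  have "sinc_gap s u \<le> (\<Sum>k\<in>UNIV. (s * u $ k)^2 / 2)"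
    unfolding sinc_gap_def by (intro sum_mono sincc_le)
  also have "\<dots> = s^2 / 2 * (norm u)^2"
    by (simp add: norm_sq_vec sum_distrib_left power_mult_distrib)
  finally show ?thesis .
qed

lemma min_sum_le:
  fixes f :: "'a \<Rightarrow> real"
  assumes "finite A" "\<And>k. k \<in> A \<Longrightarrow> 0 \<le> f k"
  shows "min 1 (sum f A) \<le> (\<Sum>k\<in>A. min 1 (f k))"
  using assms
proof (induction A rule: finite_induct)
  case (insert x A)
  then have "0 \<le> (\<Sum>k\<in>A. min 1 (f k))" "0 \<le> f x" "min 1 (sum f A) \<le> (\<Sum>k\<in>A. min 1 (f k))"
    by (auto intro!: sum_nonneg)
  moreover have "0 \<le> sum f A" using insert by (intro sum_nonneg) auto
  ultimately show ?case using insert.hyps by simp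
qed auto

lemma sinc_gap_ge: "min 1 (s^2) / 9 * min 1 ((norm u)^2) \<le> sinc_gap s u"
proof -
  have "min 1 (s^2) * min 1 ((norm u)^2) \<le> min 1 (s^2 * (norm u)^2)"
    by (simp add: mult_le_one mult_mono mult_nonneg_nonneg)
  also have "s^2 * (norm u)^2 = (\<Sum>k\<in>UNIV. (s * u $ k)^2)"
    by (simp add: norm_sq_vec sum_distrib_left power_mult_distrib)
  also have "min 1 (\<Sum>k\<in>UNIV. (s * u $ k)^2) \<le> (\<Sum>k\<in>UNIV. min 1 ((s * u $ k)^2))"
    by (rule min_sum_le) auto
  also have "\<dots> = 9 * (\<Sum>k\<in>UNIV. min 1 ((s * u $ k)^2) / 9)" by (simp add: sum_divide_distrib[symmetric])
  also have "\<dots> \<le> 9 * sinc_gap s u"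
    unfolding sinc_gap_def by (intro mult_left_mono sum_mono sincc_ge) auto
  finally show ?thesis by simp
qed

text \<open>Multiplying by a factor \<^term>\<open>sinc_gap s (t - a)\<close> averages the transform over frequencies
  that are shifted by at most \<open>s\<close> in a coordinate direction.\<close>
lemma fourier_sum_prod_bound:
  fixes t a :: "_ \<Rightarrow> real^'d::finite" and s s0 B :: real
  assumes "finite J" "finite S" "0 < s" "0 \<le> B"
    and B: "\<And>\<xi>. norm \<xi> \<le> s0 \<Longrightarrow> cmod (\<Sum>j\<in>J. of_real (m j) * cis (\<xi> \<bullet> t j)) \<le> B"
    and "norm \<xi> + card S * s \<le> s0"
  shows "cmod (\<Sum>j\<in>J. of_real (m j) * cis (\<xi> \<bullet> t j) * of_real (\<Prod>l\<in>S. sinc_gap s (t j - a l)))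
     \<le> (2 * real CARD('d)) ^ card S * B"
  using assms(2,6)
proof (induction S arbitrary: \<xi> rule: finite_induct)
  case empty
  then show ?case using B[of \<xi>] by simp
next
  case (insert l S)
  define P where "P j = (\<Prod>l\<in>S. sinc_gap s (t j - a l))" for j
  define A where "A \<xi> = (\<Sum>j\<in>J. of_real (m j) * cis (\<xi> \<bullet> t j) * complex_of_real (P j))" for \<xi>
  define K where "K = (2 * real CARD('d)) ^ card S * B"
  have K: "cmod (A \<zeta>) \<le> K" if "norm \<zeta> \<le> norm \<xi> + s" for \<zeta>
    unfolding A_def P_def K_def using insert.prems insert.hyps that
    by (intro insert.IH) (auto simp: algebra_simps)
  have K0: "0 \<le> K" using assms(4) by (auto simp: K_def)
  define c where "c j = of_real (m j) * cis (\<xi> \<bullet> t j) * complex_of_real (P j)" for j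
  have part: "cmod (\<Sum>j\<in>J. c j * of_real (sincc (s * (t j - a l) $ k))) \<le> 2 * K" for k
  proof -
    have hi: "((\<lambda>\<tau>. \<Sum>j\<in>J. c j * of_real (1 - cos (\<tau> * (s * (t j - a l) $ k)))) has_integral
        (\<Sum>j\<in>J. c j * of_real (sincc (s * (t j - a l) $ k)))) {0..1}"
      using has_integral_linear[OF sincc_has_integral bounded_linear_of_real, unfolded o_def]
      by (intro has_integral_sum has_integral_mult_right assms(1)) 
    have "norm (\<Sum>j\<in>J. c j * of_real (sincc (s * (t j - a l) $ k)))
        \<le> (2 * K) * Henstock_Kurzweil_Integration.content {0..1::real}"
    proof (rule has_integral_bound_real[OF _ finite.emptyI hi])
      fix \<tau> :: real assume \<tau>: "\<tau> \<in> {0..1} - {}"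
      define \<eta> :: "real^'d" where "\<eta> = (\<tau> * s) *\<^sub>R axis k 1"
      have n\<eta>: "norm \<eta> \<le> s" using \<tau> assms(3) by (simp add: \<eta>_def abs_mult mult_left_le_one_le)
      have y: "\<tau> * (s * (t j - a l) $ k) = \<eta> \<bullet> (t j - a l)" for j
        by (simp add: \<eta>_def inner_axis' )
      \<comment> \<open>The centre \<open>a l\<close> enters only through unimodular factors. The
        frequencies \<open>\<xi>\<close>, \<open>\<xi> + \<eta>\<close>,
        \<open>\<xi> - \<eta>\<close> carry the weights 1, 1/2, 1/2, which makes the factor 2 per
        coordinate.\<close>
      have e: "c j * of_real (1 - cos (\<tau> * (s * (t j - a l) $ k)))
        = of_real (m j) * cis (\<xi> \<bullet> t j) * complex_of_real (P j)
         - (cis (- (\<eta> \<bullet> a l)) / 2) * (of_real (m j) * cis ((\<xi> + \<eta>) \<bullet> t j) * complex_of_real (P j))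
         - (cis (\<eta> \<bullet> a l) / 2) * (of_real (m j) * cis ((\<xi> - \<eta>) \<bullet> t j) * complex_of_real (P j))" for j
      proof -
        have c1: "cis ((\<xi> + \<eta>) \<bullet> t j) = cis (\<xi> \<bullet> t j) * cis (\<eta> \<bullet> t j)"
             "cis ((\<xi> - \<eta>) \<bullet> t j) = cis (\<xi> \<bullet> t j) * cis (- (\<eta> \<bullet> t j))"
          by (simp_all add: cis_mult inner_add_left inner_diff_left)
        have "complex_of_real (cos (\<eta> \<bullet> (t j - a l))) 
            = (cis (\<eta> \<bullet> (t j - a l)) + cis (- (\<eta> \<bullet> (t j - a l)))) / 2"
          by (simp add: complex_eq_iff)
        also have "cis (\<eta> \<bullet> (t j - a l)) = cis (\<eta> \<bullet> t j) * cis (- (\<eta> \<bullet> a l))"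
          by (simp add: cis_mult inner_diff_right)
        also have "cis (- (\<eta> \<bullet> (t j - a l))) = cis (- (\<eta> \<bullet> t j)) * cis (\<eta> \<bullet> a l)"
          by (simp add: cis_mult inner_diff_right)
        finally show ?thesis unfolding c_def y c1 by (simp add: algebra_simps add_divide_distrib)
      qed
      have "(\<Sum>j\<in>J. c j * of_real (1 - cos (\<tau> * (s * (t j - a l) $ k))))
         = A \<xi> - (cis (- (\<eta> \<bullet> a l)) / 2) * A (\<xi> + \<eta>) - (cis (\<eta> \<bullet> a l) / 2) * A (\<xi> - \<eta>)"
        unfolding e A_def by (simp only: sum_subtractf sum_distrib_left)
      also have "cmod \<dots> \<le> cmod (A \<xi>) + cmod (A (\<xi> + \<eta>)) / 2 + cmod (A (\<xi> - \<eta>)) / 2"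
        by (intro order_trans[OF norm_triangle_ineq4] add_mono) (auto simp: norm_mult norm_divide)
      also have "\<dots> \<le> K + K / 2 + K / 2"
        using assms(3) n\<eta> by (intro add_mono divide_right_mono K)
          (auto intro: order_trans[OF norm_triangle_ineq] order_trans[OF norm_triangle_ineq4])
      finally show "norm (\<Sum>j\<in>J. c j * of_real (1 - cos (\<tau> * (s * (t j - a l) $ k)))) \<le> 2 * K" by simp
    qed (use K0 in auto)
    then show ?thesis by simp
  qed
  have "(\<Sum>j\<in>J. of_real (m j) * cis (\<xi> \<bullet> t j) * of_real (\<Prod>l\<in>insert l S. sinc_gap s (t j - a l)))
    = (\<Sum>j\<in>J. \<Sum>k\<in>UNIV. c j * of_real (sincc (s * (t j - a l) $ k)))"
  proof (intro sum.cong refl)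
    fix j
    have "of_real (m j) * cis (\<xi> \<bullet> t j) * of_real (\<Prod>l\<in>insert l S. sinc_gap s (t j - a l))
        = c j * of_real (\<Sum>k\<in>UNIV. sincc (s * (t j - a l) $ k))"
      using insert.hyps by (simp add: c_def P_def sinc_gap_def)
    then show "of_real (m j) * cis (\<xi> \<bullet> t j) * of_real (\<Prod>l\<in>insert l S. sinc_gap s (t j - a l))
        = (\<Sum>k\<in>UNIV. c j * of_real (sincc (s * (t j - a l) $ k)))"
      by (simp add: sum_distrib_left)
  qed
  also have "\<dots> = (\<Sum>k\<in>UNIV. \<Sum>j\<in>J. c j * of_real (sincc (s * (t j - a l) $ k)))"
    by (rule sum.swap)
  also have "cmod \<dots> \<le> of_nat (CARD('d)) * (2 * K)"
    by (rule sum_norm_bound) (rule part)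
  also have "\<dots> = (2 * real CARD('d)) ^ card (insert l S) * B"
    using insert.hyps by (simp add: K_def)
  finally show ?case .
qed

text \<open>A first order expansion with quadratic error on the unit ball. It passes to sums and
  products, hence to products of \<open>sinc_gap\<close>; its linear part pairs with the first
  moments of a mixing measure, its error with the quadratic spread.\<close>

definition quad_at :: "'a::real_inner \<Rightarrow> ('a \<Rightarrow> real) \<Rightarrow> bool" where
  "quad_at a H \<longleftrightarrow> (\<exists>w C. 0 \<le> C \<and> (\<forall>x. norm (x - a) \<le> 1 \<longrightarrow>
      \<bar>H x - H a - w \<bullet> (x - a)\<bar> \<le> C * (norm (x - a))^2))"

lemma quad_at_const: "quad_at a (\<lambda>_. c)"
  unfolding quad_at_def by (rule exI[of _ 0], rule exI[of _ 0]) auto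

lemma quad_at_add:
  assumes "quad_at a f" "quad_at a g"
  shows "quad_at a (\<lambda>x. f x + g x)"
proof -
  obtain w1 C1 w2 C2 where 1: "0 \<le> C1" "\<And>x. norm (x - a) \<le> 1 \<Longrightarrow> \<bar>f x - f a - w1 \<bullet> (x - a)\<bar> \<le> C1 * (norm (x - a))^2"
    and 2: "0 \<le> C2" "\<And>x. norm (x - a) \<le> 1 \<Longrightarrow> \<bar>g x - g a - w2 \<bullet> (x - a)\<bar> \<le> C2 * (norm (x - a))^2"
    using assms unfolding quad_at_def by metis
  have "\<bar>f x + g x - (f a + g a) - (w1 + w2) \<bullet> (x - a)\<bar> \<le> (C1 + C2) * (norm (x - a))^2" if "norm (x - a) \<le> 1" for x
    using 1(2)[OF that] 2(2)[OF that] by (simp add: inner_add_left algebra_simps)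
  then show ?thesis unfolding quad_at_def using 1(1) 2(1) by (metis add_nonneg_nonneg)
qed

lemma quad_at_mult:
  assumes "quad_at a f" "quad_at a g"
  shows "quad_at a (\<lambda>x. f x * g x)"
proof -
  obtain w1 C1 w2 C2 where 1: "0 \<le> C1" "\<And>x. norm (x - a) \<le> 1 \<Longrightarrow> \<bar>f x - f a - w1 \<bullet> (x - a)\<bar> \<le> C1 * (norm (x - a))^2"
    and 2: "0 \<le> C2" "\<And>x. norm (x - a) \<le> 1 \<Longrightarrow> \<bar>g x - g a - w2 \<bullet> (x - a)\<bar> \<le> C2 * (norm (x - a))^2"
    using assms unfolding quad_at_def by metis
  define w where "w = f a *\<^sub>R w2 + g a *\<^sub>R w1"
  define C where "C = \<bar>f a\<bar> * C2 + \<bar>g a\<bar> * C1 + (norm w1 + C1) * (norm w2 + C2)"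
  have "\<bar>f x * g x - f a * g a - w \<bullet> (x - a)\<bar> \<le> C * (norm (x - a))^2" if n: "norm (x - a) \<le> 1" for x
  proof -
    define u where "u = x - a"
    have n: "norm u \<le> 1" using that by (simp add: u_def)
    have lin: "\<bar>f x - f a\<bar> \<le> (norm w1 + C1) * norm u" "\<bar>g x - g a\<bar> \<le> (norm w2 + C2) * norm u"
    proof -
      have sq: "(norm u)^2 \<le> norm u" using n power_decreasing[of 1 2 "norm u"] by simp
      have "\<bar>f x - f a\<bar> \<le> C1 * (norm u)^2 + norm w1 * norm u"
        using 1(2)[OF that] Cauchy_Schwarz_ineq2[of w1 u] by (simp add: u_def)
      also have "\<dots> \<le> C1 * norm u + norm w1 * norm u" using sq 1(1) by (intro add_mono mult_left_mono) auto
      finally show "\<bar>f x - f a\<bar> \<le> (norm w1 + C1) * norm u" by (simp add: algebra_simps)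
      have "\<bar>g x - g a\<bar> \<le> C2 * (norm u)^2 + norm w2 * norm u"
        using 2(2)[OF that] Cauchy_Schwarz_ineq2[of w2 u] by (simp add: u_def)
      also have "\<dots> \<le> C2 * norm u + norm w2 * norm u" using sq 2(1) by (intro add_mono mult_left_mono) auto
      finally show "\<bar>g x - g a\<bar> \<le> (norm w2 + C2) * norm u" by (simp add: algebra_simps)
    qed
    have "f x * g x - f a * g a - w \<bullet> u
       = f a * (g x - g a - w2 \<bullet> u) + g a * (f x - f a - w1 \<bullet> u) + (f x - f a) * (g x - g a)"
      by (simp add: w_def inner_add_left algebra_simps)
    also have "\<bar>\<dots>\<bar> \<le> \<bar>f a\<bar> * \<bar>g x - g a - w2 \<bullet> u\<bar> + \<bar>g a\<bar> * \<bar>f x - f a - w1 \<bullet> u\<bar> + \<bar>f x - f a\<bar> * \<bar>g x - g a\<bar>"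
      by (simp only: abs_mult[symmetric])
    also have "\<dots> \<le> \<bar>f a\<bar> * (C2 * (norm u)^2) + \<bar>g a\<bar> * (C1 * (norm u)^2) + ((norm w1 + C1) * norm u) * ((norm w2 + C2) * norm u)"
      using 1 2 that lin by (intro add_mono mult_mono) (auto simp: u_def)
    also have "\<dots> = C * (norm u)^2" by (simp add: C_def algebra_simps power2_eq_square)
    finally show ?thesis by (simp add: u_def)
  qed
  moreover have "0 \<le> C" using 1(1) 2(1) by (auto simp: C_def)
  ultimately show ?thesis unfolding quad_at_def by blast
qed

lemma quad_at_sum: "finite A \<Longrightarrow> (\<And>k. k \<in> A \<Longrightarrow> quad_at a (f k)) \<Longrightarrow> quad_at a (\<lambda>x. \<Sum>k\<in>A. f k x)"
  by (induction A rule: finite_induct) (auto intro: quad_at_const quad_at_add)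

lemma quad_at_prod: "finite A \<Longrightarrow> (\<And>k. k \<in> A \<Longrightarrow> quad_at a (f k)) \<Longrightarrow> quad_at a (\<lambda>x. \<Prod>k\<in>A. f k x)"
  by (induction A rule: finite_induct) (auto intro: quad_at_const quad_at_mult)

lemma quad_at_sinc_gap: "quad_at a (\<lambda>x. sinc_gap s (x - c))"
  unfolding sinc_gap_def
proof (rule quad_at_sum)
  fix k :: 'a
  obtain d where d: "\<And>h. \<bar>sincc (s * (a - c) $ k + h) - sincc (s * (a - c) $ k) - d * h\<bar> \<le> h^2"
    using sincc_expand by blast
  have "\<bar>sincc (s * (x - c) $ k) - sincc (s * (a - c) $ k) - ((d * s) *\<^sub>R axis k 1) \<bullet> (x - a)\<bar> \<le> s^2 * (norm (x - a))^2" for x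
  proof -
    have "\<bar>sincc (s * (x - c) $ k) - sincc (s * (a - c) $ k) - ((d * s) *\<^sub>R axis k 1) \<bullet> (x - a)\<bar> \<le> (s * (x - a) $ k)^2"
      using d[of "s * (x - a) $ k"] by (simp add: inner_axis' algebra_simps)
    also have "\<dots> \<le> s^2 * (norm (x - a))^2"
      unfolding power_mult_distrib using component_le_norm_cart[of "x - a" k]
      by (intro mult_left_mono) (auto simp: abs_le_square_iff[symmetric])
    finally show ?thesis .
  qed
  then show "quad_at a (\<lambda>x. sincc (s * (x - c) $ k))"
    unfolding quad_at_def by (intro exI[of _ "(d * s) *\<^sub>R axis k 1"] exI[of _ "s^2"]) auto
qed auto

text \<open>The label is \<open>n\<close> when no point \<open>ts i\<close> is within distance \<open>r\<close>.\<close>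
definition label :: "nat \<Rightarrow> (nat \<Rightarrow> real^'d::finite) \<Rightarrow> real \<Rightarrow> real^'d \<Rightarrow> nat" where
  "label n ts r \<theta> = (if \<exists>i<n. norm (\<theta> - ts i) \<le> r then LEAST i. i < n \<and> norm (\<theta> - ts i) \<le> r else n)"

text \<open>One scale for both second order defects: spread around a true point, and mass far from
  all of them. The product of the \<open>sinc_gap\<close> factors of all points dominates a multiple
  of it.\<close>

definition loc_weight :: "nat \<Rightarrow> (nat \<Rightarrow> real^'d::finite) \<Rightarrow> real \<Rightarrow> real^'d \<Rightarrow> real" where
  "loc_weight n ts r \<theta> = (if label n ts r \<theta> < n then (norm (\<theta> - ts (label n ts r \<theta>)))^2 else 1)"

lemma loc_weight_nonneg: "0 \<le> loc_weight n ts r \<theta>"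
  by (simp add: loc_weight_def)

lemma label_lessD:
  assumes "label n ts r \<theta> < n"
  shows "norm (\<theta> - ts (label n ts r \<theta>)) \<le> r"
proof -
  have ex: "\<exists>i<n. norm (\<theta> - ts i) \<le> r" using assms by (auto simp: label_def split: if_splits)
  then have "norm (\<theta> - ts (LEAST i. i < n \<and> norm (\<theta> - ts i) \<le> r)) \<le> r"
    by (rule LeastI2_ex) auto
  then show ?thesis using ex by (simp add: label_def)
qed

lemma label_le: "label n ts r \<theta> \<le> n"
proof (cases "\<exists>i<n. norm (\<theta> - ts i) \<le> r")
  case True
  then have "(LEAST i. i < n \<and> norm (\<theta> - ts i) \<le> r) < n" by (rule LeastI2_ex) auto
  then show ?thesis using True by (simp add: label_def)
next
  case False
  then have "label n ts r \<theta> = n" unfolding label_def by (rule if_not_P)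
  then show ?thesis by simp
qed

lemma not_labelD:
  assumes "\<not> label n ts r \<theta> < n" "i < n"
  shows "r < norm (\<theta> - ts i)"
proof (rule ccontr)
  assume "\<not> r < norm (\<theta> - ts i)"
  then have ex: "\<exists>i<n. norm (\<theta> - ts i) \<le> r" using assms(2) by auto
  then have "(LEAST i. i < n \<and> norm (\<theta> - ts i) \<le> r) < n" by (rule LeastI2_ex) auto
  then show False using assms(1) ex by (simp add: label_def)
qed

text \<open>Replaces a test function \<open>H\<close> by its model \<open>G\<close> at one true
  point. The error of the model on label \<open>i\<close> and the whole of \<open>H\<close> on the
  other labels are both dominated by \<open>loc_weight\<close>, whose weighted sum is estimated
  separately.\<close>

lemma sum_localize:
  fixes p :: "nat \<Rightarrow> real" and \<theta> :: "nat \<Rightarrow> real^'d::finite"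
  assumes p: "\<And>j. j < q \<Longrightarrow> 0 \<le> p j"
    and E: "\<And>\<theta>. label n ts r \<theta> = i \<Longrightarrow> \<bar>H \<theta> - G \<theta>\<bar> \<le> C * loc_weight n ts r \<theta>"
    and F: "\<And>\<theta>. label n ts r \<theta> \<noteq> i \<Longrightarrow> \<bar>H \<theta>\<bar> \<le> C * loc_weight n ts r \<theta>"
  shows "\<bar>(\<Sum>j<q. p j * H (\<theta> j)) - (\<Sum>j\<in>{j. j < q \<and> label n ts r (\<theta> j) = i}. p j * G (\<theta> j))\<bar>
     \<le> C * (\<Sum>j<q. p j * loc_weight n ts r (\<theta> j))"
proof -
  let ?N = "{j. j < q \<and> label n ts r (\<theta> j) = i}"
  have "(\<Sum>j\<in>?N. p j * G (\<theta> j)) = (\<Sum>j<q. p j * (if label n ts r (\<theta> j) = i then G (\<theta> j) else 0))"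
    by (intro sum.mono_neutral_cong_left) auto
  then have "\<bar>(\<Sum>j<q. p j * H (\<theta> j)) - (\<Sum>j\<in>?N. p j * G (\<theta> j))\<bar>
     = \<bar>\<Sum>j<q. p j * (H (\<theta> j) - (if label n ts r (\<theta> j) = i then G (\<theta> j) else 0))\<bar>"
    by (simp add: sum_subtractf right_diff_distrib)
  also have "\<dots> \<le> (\<Sum>j<q. p j * (C * loc_weight n ts r (\<theta> j)))"
  proof (rule order_trans[OF sum_abs sum_mono])
    fix j assume "j \<in> {..<q}"
    then show "\<bar>p j * (H (\<theta> j) - (if label n ts r (\<theta> j) = i then G (\<theta> j) else 0))\<bar> \<le> p j * (C * loc_weight n ts r (\<theta> j))"
      using E[of "\<theta> j"] F[of "\<theta> j"] p[of j] unfolding abs_mult by (intro mult_mono) auto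
  qed
  also have "\<dots> = C * (\<Sum>j<q. p j * loc_weight n ts r (\<theta> j))"
    by (simp add: sum_distrib_left mult_ac)
  finally show ?thesis .
qed

lemma Im_cis_shift: "Im (cis (- b) * (of_real c * cis a * of_real y)) = c * (sin (a - b) * y)"
  by (simp add: sin_diff algebra_simps)

section \<open>Testing the difference of two mixing measures\<close>

locale star_points =
  fixes f0 :: "real^'d::finite \<Rightarrow> real" and n :: nat and ts :: "nat \<Rightarrow> real^'d" and s0 r :: real
  assumes dens: "prob_density f0"
    and n_pos: "0 < n"
    and s0_pos: "0 < s0" and s0: "\<And>\<xi>. norm \<xi> \<le> s0 \<Longrightarrow> 1/2 \<le> cmod (char_fn f0 \<xi>)"
    and r: "0 < r" "r \<le> 1" and sep: "\<And>i j. i < n \<Longrightarrow> j < n \<Longrightarrow> i \<noteq> j \<Longrightarrow> 2 * r < norm (ts i - ts j)"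
begin

text \<open>Up to \<open>n\<close> factors \<open>sinc_gap\<close> shift the frequency by at most
  \<open>s\<close> each, and one more \<open>s\<close> is reserved for the base frequency of the
  first moment test; the total stays within \<open>s0\<close>.\<close>

definition s where "s = s0 / (n + 1)"

lemma s: "0 < s" "(n + 1) * s = s0"
  using s0_pos by (auto simp: s_def field_simps)

definition gap_prod :: "nat set \<Rightarrow> real^'d \<Rightarrow> real" where
  "gap_prod S \<theta> = (\<Prod>l\<in>S. sinc_gap s (\<theta> - ts l))"

lemma gap_prod_nonneg: "0 \<le> gap_prod S \<theta>"
  by (simp add: gap_prod_def prod_nonneg sinc_gap_nonneg)

lemma gap_prod_zero: "finite S \<Longrightarrow> l \<in> S \<Longrightarrow> gap_prod S (ts l) = 0"
  unfolding gap_prod_def by (rule prod_zero) (auto intro!: bexI[of _ l])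

lemma gap_prod_le: "S \<subseteq> {..<n} \<Longrightarrow> gap_prod S \<theta> \<le> (2 * real CARD('d)) ^ n"
proof -
  assume S: "S \<subseteq> {..<n}"
  have "gap_prod S \<theta> \<le> (\<Prod>l\<in>S. 2 * real CARD('d))"
    unfolding gap_prod_def by (intro prod_mono) (auto simp: sinc_gap_nonneg sinc_gap_le_card)
  also have "\<dots> = (2 * real CARD('d)) ^ card S" by simp
  also have "\<dots> \<le> (2 * real CARD('d)) ^ n"
  proof -
    have "card S \<le> n" using card_mono[OF _ S] by simp
    moreover have "1 \<le> 2 * real CARD('d)" using one_le_card_finite[where 'a='d] by linarith
    ultimately show ?thesis using power_increasing[of "card S" n "2 * real CARD('d)"] by simp
  qed
  finally show ?thesis by simp
qed

lemma gap_prod_le_sq: "S \<subseteq> {..<n} \<Longrightarrow> l \<in> S \<Longrightarrow> gap_prod S \<theta> \<le> s^2 / 2 * (2 * real CARD('d)) ^ n * (norm (\<theta> - ts l))^2"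
proof -
  assume S: "S \<subseteq> {..<n}" "l \<in> S"
  have fin: "finite S" using S finite_subset by blast
  have "gap_prod S \<theta> = sinc_gap s (\<theta> - ts l) * gap_prod (S - {l}) \<theta>"
    unfolding gap_prod_def by (rule prod.remove[OF fin S(2)])
  also have "\<dots> \<le> (s^2 / 2 * (norm (\<theta> - ts l))^2) * (2 * real CARD('d)) ^ n"
    using S by (intro mult_mono sinc_gap_le gap_prod_le gap_prod_nonneg) auto
  finally show ?thesis by (simp add: mult_ac)
qed

definition c0 where "c0 = min 1 (s^2) / 9"

lemma c0: "0 < c0" "c0 \<le> 1" using s by (auto simp: c0_def min_def)

lemma gap_ge: "c0 * min 1 ((norm u)^2) \<le> sinc_gap s u"
  unfolding c0_def by (rule sinc_gap_ge)

lemma gap_far: "r \<le> norm u \<Longrightarrow> c0 * r^2 \<le> sinc_gap s u"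
proof -
  assume "r \<le> norm u"
  then have "r^2 \<le> min 1 ((norm u)^2)" using r by (auto simp: power_le_one intro: power_mono)
  then show ?thesis using gap_ge[of u] c0 by (meson mult_left_mono less_imp_le order_trans)
qed

lemma label_unique: "label n ts r \<theta> < n \<Longrightarrow> l < n \<Longrightarrow> l \<noteq> label n ts r \<theta> \<Longrightarrow> r \<le> norm (\<theta> - ts l)"
proof -
  assume a: "label n ts r \<theta> < n" "l < n" "l \<noteq> label n ts r \<theta>"
  have "2 * r < norm (ts l - ts (label n ts r \<theta>))" using a by (intro sep) auto
  also have "\<dots> \<le> norm (\<theta> - ts (label n ts r \<theta>)) + norm (\<theta> - ts l)"
    by norm
  finally show ?thesis using label_lessD[OF a(1)] by linarith
qed

lemma label_eqI: "i < n \<Longrightarrow> norm (\<theta> - ts i) < r \<Longrightarrow> label n ts r \<theta> = i"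
  using label_unique[of \<theta> i] not_labelD[of n ts r \<theta> i] by fastforce

text \<open>At most one true point is within \<open>r\<close>; its factor supplies the squared
  distance, and every other factor is at least \<open>c0 * r^2\<close> because its point is at
  distance at least \<open>r\<close>.\<close>

lemma gap_prod_ge_loc: "(c0 * r^2) ^ n * loc_weight n ts r \<theta> \<le> gap_prod {..<n} \<theta>"
proof (cases "label n ts r \<theta> < n")
  case False
  have "(\<Prod>l<n. c0 * r^2) \<le> gap_prod {..<n} \<theta>"
    unfolding gap_prod_def using c0 r not_labelD[OF False] by (intro prod_mono conjI gap_far) (auto intro: less_imp_le)
  then show ?thesis using False by (simp add: loc_weight_def)
next
  case True
  let ?i = "label n ts r \<theta>"
  have nle: "norm (\<theta> - ts ?i) \<le> 1" using label_lessD[OF True] r by simp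
  have "(\<Prod>l<n. if l = ?i then c0 * r^2 * (norm (\<theta> - ts ?i))^2 else c0 * r^2) \<le> gap_prod {..<n} \<theta>"
    unfolding gap_prod_def
  proof (rule prod_mono, intro conjI)
    fix l assume l: "l \<in> {..<n}"
    show "0 \<le> (if l = ?i then c0 * r^2 * (norm (\<theta> - ts ?i))^2 else c0 * r^2)" using c0 by auto
    show "(if l = ?i then c0 * r^2 * (norm (\<theta> - ts ?i))^2 else c0 * r^2) \<le> sinc_gap s (\<theta> - ts l)"
    proof (cases "l = ?i")
      case False
      then show ?thesis using gap_far label_unique[OF True] l by auto
    next
      case eq: True
      have "c0 * r^2 * (norm (\<theta> - ts ?i))^2 \<le> c0 * 1 * (norm (\<theta> - ts ?i))^2"
        using c0 r by (intro mult_mono) (auto simp: power_le_one)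
      also have "\<dots> = c0 * min 1 ((norm (\<theta> - ts ?i))^2)" using nle by (simp add: power_le_one min_absorb2)
      also have "\<dots> \<le> sinc_gap s (\<theta> - ts ?i)" by (rule gap_ge)
      finally show ?thesis using eq by simp
    qed
  qed
  also have "(\<Prod>l<n. if l = ?i then c0 * r^2 * (norm (\<theta> - ts ?i))^2 else c0 * r^2)
     = (\<Prod>l<n. c0 * r^2 * (if l = ?i then (norm (\<theta> - ts ?i))^2 else 1))"
    by (intro prod.cong) auto
  also have "\<dots> = (c0 * r^2) ^ n * (norm (\<theta> - ts ?i))^2"
    using True by (simp only: prod.distrib prod.delta finite_lessThan) (simp add: power_mult_distrib)
  finally show ?thesis using True by (simp add: loc_weight_def)
qed

definition Fnorm :: "nat \<Rightarrow> (nat \<Rightarrow> real) \<Rightarrow> (nat \<Rightarrow> real^'d) \<Rightarrow> (nat \<Rightarrow> real) \<Rightarrow> real" where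
  "Fnorm q p \<theta> ps = (\<integral>x. \<bar>mixture f0 q p \<theta> x - mixture f0 n ps ts x\<bar> \<partial>lborel)"

definition K0 :: real where "K0 = (2 * real CARD('d)) ^ n * 2"

text \<open>Components and true points form one signed measure on a disjoint union, the true points
  with negative weights. Dividing by the transform of \<open>f0\<close>, at least \<open>1/2\<close>
  up to frequency \<open>s0\<close>, accounts for the factor 2 in \<open>K0\<close>.\<close>

lemma gap_prod_test_bound:
  assumes "S \<subseteq> {..<n}" "norm \<xi> \<le> s"
  shows "cmod ((\<Sum>j<q. of_real (p j) * cis (\<xi> \<bullet> \<theta> j) * of_real (gap_prod S (\<theta> j)))
       - (\<Sum>i<n. of_real (ps i) * cis (\<xi> \<bullet> ts i) * of_real (gap_prod S (ts i)))) \<le> K0 * Fnorm q p \<theta> ps"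
proof -
  define J where "J = {..<q} <+> {..<n}"
  define m where "m = case_sum p (\<lambda>i. - ps i)"
  define t where "t = case_sum \<theta> ts"
  have int: "integrable lborel f0" using dens by (simp add: prob_density_def)
  have J: "sum h J = (\<Sum>j<q. h (Inl j)) + (\<Sum>i<n. h (Inr i))" for h :: "nat + nat \<Rightarrow> 'z::comm_monoid_add"
    unfolding J_def by (simp add: sum.Plus)
  have fin: "finite J" by (simp add: J_def)
  have F: "(\<integral>x. \<bar>\<Sum>j\<in>J. m j * f0 (x - t j)\<bar> \<partial>lborel) = Fnorm q p \<theta> ps"
    by (simp add: J m_def t_def Fnorm_def mixture_def shifted_def sum_negf)
  have F0: "0 \<le> Fnorm q p \<theta> ps" unfolding Fnorm_def by (rule Bochner_Integration.integral_nonneg) auto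
  have B: "cmod (\<Sum>j\<in>J. of_real (m j) * cis (\<xi> \<bullet> t j)) \<le> 2 * Fnorm q p \<theta> ps" if "norm \<xi> \<le> s0" for \<xi>
  proof -
    have "cmod (\<Sum>j\<in>J. of_real (m j) * cis (\<xi> \<bullet> t j)) * (1/2)
      \<le> cmod (\<Sum>j\<in>J. of_real (m j) * cis (\<xi> \<bullet> t j)) * cmod (char_fn f0 \<xi>)"
      using s0[OF that] by (intro mult_left_mono) auto
    also have "\<dots> \<le> Fnorm q p \<theta> ps" using char_sum_bound[OF fin int, of m \<xi> t] F by simp
    finally show ?thesis by simp
  qed
  have cS: "card S \<le> n" using card_mono[OF _ assms(1)] by simp
  have "cmod (\<Sum>j\<in>J. of_real (m j) * cis (\<xi> \<bullet> t j) * of_real (\<Prod>l\<in>S. sinc_gap s (t j - ts l)))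
     \<le> (2 * real CARD('d)) ^ card S * (2 * Fnorm q p \<theta> ps)"
  proof (rule fourier_sum_prod_bound[OF fin _ s(1) _ B])
    show "finite S" using assms finite_subset by blast
    have "norm \<xi> + card S * s \<le> s + n * s" using assms(2) cS s(1) by (intro add_mono mult_right_mono) auto
    also have "\<dots> = s0" using s(2) by (simp add: algebra_simps)
    finally show "norm \<xi> + card S * s \<le> s0" .
  qed (use F0 in auto)
  also have "\<dots> \<le> (2 * real CARD('d)) ^ n * (2 * Fnorm q p \<theta> ps)"
  proof -
    have "1 \<le> 2 * real CARD('d)" using one_le_card_finite[where 'a='d] by linarith
    then have "(2 * real CARD('d)) ^ card S \<le> (2 * real CARD('d)) ^ n" using cS by (intro power_increasing) auto
    then show ?thesis using F0 by (simp add: mult_right_mono)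
  qed
  also have "\<dots> = K0 * Fnorm q p \<theta> ps" by (simp add: K0_def)
  finally show ?thesis by (simp add: J m_def t_def gap_prod_def sum_negf)
qed

lemma Fnorm_nonneg: "0 \<le> Fnorm q p \<theta> ps" unfolding Fnorm_def by (rule Bochner_Integration.integral_nonneg) auto

text \<open>Test at frequency 0 with the product over all true points: it vanishes at each
  \<open>ts i\<close>, so the weights \<open>ps\<close> drop out, and by positivity of
  \<open>p\<close> no cancellation can occur on the other side.\<close>

lemma sum_loc_weight_le:
  assumes p: "\<And>j. j < q \<Longrightarrow> 0 \<le> p j"
  shows "(\<Sum>j<q. p j * loc_weight n ts r (\<theta> j)) \<le> K0 / (c0 * r^2) ^ n * Fnorm q p \<theta> ps"
proof -
  have pos: "0 < (c0 * r^2) ^ n" using c0 r by simp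
  have z: "(\<Sum>i<n. of_real (ps i) * cis (0 \<bullet> ts i) * complex_of_real (gap_prod {..<n} (ts i))) = 0"
    by (rule sum.neutral) (auto simp: gap_prod_zero)
  have "(\<Sum>j<q. of_real (p j) * cis (0 \<bullet> \<theta> j) * complex_of_real (gap_prod {..<n} (\<theta> j)))
     = of_real (\<Sum>j<q. p j * gap_prod {..<n} (\<theta> j))" by simp
  then have "\<bar>\<Sum>j<q. p j * gap_prod {..<n} (\<theta> j)\<bar> \<le> K0 * Fnorm q p \<theta> ps"
    using gap_prod_test_bound[of "{..<n}" 0 p \<theta> q ps] s(1) unfolding z by (simp del: of_real_sum of_real_mult)
  moreover have "(\<Sum>j<q. p j * ((c0 * r^2) ^ n * loc_weight n ts r (\<theta> j))) \<le> (\<Sum>j<q. p j * gap_prod {..<n} (\<theta> j))"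
    using p by (intro sum_mono mult_left_mono gap_prod_ge_loc) auto
  moreover have "(\<Sum>j<q. p j * ((c0 * r^2) ^ n * loc_weight n ts r (\<theta> j)))
     = (c0 * r^2) ^ n * (\<Sum>j<q. p j * loc_weight n ts r (\<theta> j))" by (simp add: sum_distrib_left mult_ac)
  ultimately have "(c0 * r^2) ^ n * (\<Sum>j<q. p j * loc_weight n ts r (\<theta> j)) \<le> K0 * Fnorm q p \<theta> ps" by linarith
  then show ?thesis using pos by (simp add: field_simps)
qed

text \<open>The omitted factor is that of \<open>i\<close>, so a parameter with another true label
  keeps the factor of its own point, which supplies the squared distance. Far from all points the
  weight is 1 and a constant bound is enough.\<close>

lemma gap_prod_loc_le:
  assumes "i < n" "label n ts r \<theta> \<noteq> i"
  shows "gap_prod ({..<n} - {i}) \<theta> \<le> (1 + s^2) * (2 * real CARD('d)) ^ n * loc_weight n ts r \<theta>"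
proof (cases "label n ts r \<theta> < n")
  case True
  have "gap_prod ({..<n} - {i}) \<theta> \<le> s^2 / 2 * (2 * real CARD('d)) ^ n * (norm (\<theta> - ts (label n ts r \<theta>)))^2"
    using True assms by (intro gap_prod_le_sq) auto
  also have "\<dots> \<le> (1 + s^2) * (2 * real CARD('d)) ^ n * (norm (\<theta> - ts (label n ts r \<theta>)))^2"
    by (intro mult_right_mono) auto
  finally show ?thesis using True by (simp add: loc_weight_def)
next
  case False
  have "gap_prod ({..<n} - {i}) \<theta> \<le> 1 * (2 * real CARD('d)) ^ n" using gap_prod_le[of "{..<n} - {i}" \<theta>] by auto
  also have "\<dots> \<le> (1 + s^2) * (2 * real CARD('d)) ^ n" by (intro mult_right_mono) auto
  finally show ?thesis using False by (simp add: loc_weight_def)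
qed

lemma gap_prod_self_pos: "i < n \<Longrightarrow> 0 < gap_prod ({..<n} - {i}) (ts i)"
  unfolding gap_prod_def
proof (rule prod_pos)
  fix l assume "i < n" "l \<in> {..<n} - {i}"
  then have "r \<le> norm (ts i - ts l)" using sep[of i l] r by auto
  then have "c0 * r^2 \<le> sinc_gap s (ts i - ts l)" by (rule gap_far)
  moreover have "0 < c0 * r^2" using c0 r by simp
  ultimately show "0 < sinc_gap s (ts i - ts l)" by linarith
qed

text \<open>The product \<open>P\<close> over the true points other than \<open>i\<close> isolates
  \<open>ts i\<close>. A sine test centred at \<open>ts i\<close> gives the first moments; the test
  at frequency 0 then gives the mass, up to the linear part \<open>w\<close> of \<open>P\<close>,
  which only meets the first moments already bounded.\<close>

lemma local_moments:
  assumes i: "i < n"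
  shows "\<exists>C\<ge>0. \<forall>q p \<theta> ps. (\<forall>j<q. 0 \<le> p j) \<longrightarrow>
     \<bar>(\<Sum>j\<in>{j. j < q \<and> label n ts r (\<theta> j) = i}. p j) - ps i\<bar> \<le> C * Fnorm q p \<theta> ps \<and>
     (\<forall>k. \<bar>\<Sum>j\<in>{j. j < q \<and> label n ts r (\<theta> j) = i}. p j * (\<theta> j - ts i) $ k\<bar> \<le> C * Fnorm q p \<theta> ps)"
proof -
  define S where "S = {..<n} - {i}"
  define P where "P = gap_prod S"
  have "quad_at (ts i) P"
    unfolding P_def gap_prod_def S_def by (intro quad_at_prod quad_at_sinc_gap) auto
  then obtain w C1 where C1: "0 \<le> C1" and PE: "\<And>x. norm (x - ts i) \<le> 1 \<Longrightarrow>
      \<bar>P x - P (ts i) - w \<bullet> (x - ts i)\<bar> \<le> C1 * (norm (x - ts i))^2"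
    unfolding quad_at_def by metis
  define D where "D = (1 + s^2) * (2 * real CARD('d)) ^ n"
  have D0: "0 \<le> D" by (simp add: D_def)
  define A where "A = K0 / (c0 * r^2) ^ n"
  have A0: "0 \<le> A" using c0 by (simp add: A_def K0_def)
  have P0: "0 \<le> P \<theta>" for \<theta> by (simp add: P_def gap_prod_nonneg)
  have PD: "P \<theta> \<le> D" for \<theta>
  proof -
    have "P \<theta> \<le> 1 * (2 * real CARD('d)) ^ n" unfolding P_def S_def using gap_prod_le[of "{..<n} - {i}" \<theta>] by auto
    also have "\<dots> \<le> D" unfolding D_def by (intro mult_right_mono) auto
    finally show ?thesis .
  qed
  have Pz: "P (ts l) = 0" if "l < n" "l \<noteq> i" for l unfolding P_def S_def using that by (intro gap_prod_zero) auto
  have Pi: "0 < P (ts i)" unfolding P_def S_def by (rule gap_prod_self_pos[OF i])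
  have off: "P \<theta> \<le> D * loc_weight n ts r \<theta>" if "label n ts r \<theta> \<noteq> i" for \<theta>
    unfolding P_def S_def D_def by (rule gap_prod_loc_le[OF i that])
  have near: "norm (\<theta> - ts i) \<le> 1 \<and> loc_weight n ts r \<theta> = (norm (\<theta> - ts i))^2" if "label n ts r \<theta> = i" for \<theta>
    using label_lessD[of n ts r \<theta>] that i r by (auto simp: loc_weight_def)
  define E where "E = D + C1 + s * (norm w + C1) + s^2 * D"
  have E0: "0 \<le> E" using D0 C1 s(1) by (auto simp: E_def)
  define Cb where "Cb = (K0 + E * A) / (s * P (ts i))"
  define Ca where "Ca = (K0 + E * A + (\<Sum>k\<in>UNIV. \<bar>w $ k\<bar> * Cb)) / P (ts i)"
  have K00: "0 \<le> K0" by (simp add: K0_def)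
  have Cb0: "0 \<le> Cb" using K00 E0 A0 s(1) Pi by (auto simp: Cb_def)
  have Ca0: "0 \<le> Ca" using K00 E0 A0 Pi Cb0 by (auto simp: Ca_def sum_nonneg)
  show ?thesis
  proof (intro exI[of _ "Ca + Cb"] conjI allI impI)
    show "0 \<le> Ca + Cb" using Ca0 Cb0 by simp
    fix q and p ps :: "nat \<Rightarrow> real" and \<theta> :: "nat \<Rightarrow> real^'d" assume p: "\<forall>j<q. 0 \<le> p j"
    define F where "F = Fnorm q p \<theta> ps"
    have F0: "0 \<le> F" by (simp add: F_def Fnorm_nonneg)
    let ?N = "{j. j < q \<and> label n ts r (\<theta> j) = i}"
    have loc: "(\<Sum>j<q. p j * loc_weight n ts r (\<theta> j)) \<le> A * F"
      unfolding A_def F_def using p by (intro sum_loc_weight_le) auto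
    have sub: "S \<subseteq> {..<n}" by (auto simp: S_def)
    have b: "\<bar>\<Sum>j\<in>?N. p j * (\<theta> j - ts i) $ k\<bar> \<le> Cb * F" for k
    proof -
      \<comment> \<open>The frequency \<open>s\<close> along axis \<open>k\<close>, with the phase
        moved to \<open>ts i\<close>. The imaginary part contains a sine vanishing at
        \<open>ts i\<close>, and \<open>P\<close> vanishes at the other true points, so the weights
        \<open>ps\<close> disappear.\<close>
      define \<xi> :: "real^'d" where "\<xi> = s *\<^sub>R axis k 1"
      define H where "H \<theta> = sin (s * (\<theta> - ts i) $ k) * P \<theta>" for \<theta>
      have n\<xi>: "norm \<xi> \<le> s" using s(1) by (simp add: \<xi>_def)
      have \<xi>i: "\<xi> \<bullet> x = s * x $ k" for x by (simp add: \<xi>_def inner_axis')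
      have im: "Im (cis (- (\<xi> \<bullet> ts i)) * (of_real c * cis (\<xi> \<bullet> x) * complex_of_real (P x))) = c * H x" for c x
        unfolding Im_cis_shift H_def \<xi>i by (simp add: right_diff_distrib)
      define Z where "Z = cis (- (\<xi> \<bullet> ts i)) * ((\<Sum>j<q. of_real (p j) * cis (\<xi> \<bullet> \<theta> j) * of_real (P (\<theta> j)))
       - (\<Sum>i<n. of_real (ps i) * cis (\<xi> \<bullet> ts i) * of_real (P (ts i))))"
      have "cmod (cis (- (\<xi> \<bullet> ts i)) * ((\<Sum>j<q. of_real (p j) * cis (\<xi> \<bullet> \<theta> j) * of_real (P (\<theta> j)))
       - (\<Sum>i<n. of_real (ps i) * cis (\<xi> \<bullet> ts i) * of_real (P (ts i))))) \<le> K0 * F"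
        using gap_prod_test_bound[OF sub n\<xi>, of p \<theta> q ps] by (simp add: norm_mult P_def F_def)
      then have "cmod Z \<le> K0 * F" by (simp only: Z_def)
      then have "\<bar>Im Z\<bar> \<le> K0 * F" using abs_Im_le_cmod[of Z] by linarith
      moreover have "Im Z = (\<Sum>j<q. p j * H (\<theta> j)) - (\<Sum>l<n. ps l * H (ts l))"
        unfolding Z_def right_diff_distrib sum_distrib_left minus_complex.sel Im_sum im ..
      ultimately have "\<bar>(\<Sum>j<q. p j * H (\<theta> j)) - (\<Sum>l<n. ps l * H (ts l))\<bar> \<le> K0 * F" by simp
      moreover have "(\<Sum>l<n. ps l * H (ts l)) = 0"
      proof (rule sum.neutral, rule ballI)
        fix l assume "l \<in> {..<n}"
        then show "ps l * H (ts l) = 0" using Pz[of l] by (cases "l = i") (auto simp: H_def)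
      qed
      ultimately have H1: "\<bar>\<Sum>j<q. p j * H (\<theta> j)\<bar> \<le> K0 * F" by simp
      have "\<bar>(\<Sum>j<q. p j * H (\<theta> j)) - (\<Sum>j\<in>?N. p j * (P (ts i) * s * (\<theta> j - ts i) $ k))\<bar>
         \<le> E * (\<Sum>j<q. p j * loc_weight n ts r (\<theta> j))"
      proof (rule sum_localize)
        fix x assume x: "label n ts r x = i"
        define v where "v = x - ts i"
        have v1: "norm v \<le> 1" and lw: "loc_weight n ts r x = (norm v)^2" using near[OF x] by (auto simp: v_def)
        have vk: "\<bar>v $ k\<bar> \<le> norm v" by (rule component_le_norm_cart)
        have sq: "(norm v)^2 \<le> norm v" using v1 power_decreasing[of 1 2 "norm v"] by simp
        have lin: "\<bar>P x - P (ts i)\<bar> \<le> (norm w + C1) * norm v"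
        proof -
          have "\<bar>P x - P (ts i)\<bar> \<le> C1 * (norm v)^2 + norm w * norm v"
            using PE[of x] v1 Cauchy_Schwarz_ineq2[of w v] by (simp add: v_def)
          also have "\<dots> \<le> C1 * norm v + norm w * norm v" using sq C1 by (intro add_mono mult_left_mono) auto
          finally show ?thesis by (simp add: algebra_simps)
        qed
        have "H x - P (ts i) * s * v $ k = (sin (s * v $ k) - s * v $ k) * P x + (s * v $ k) * (P x - P (ts i))"
          by (simp add: H_def v_def algebra_simps)
        also have "\<bar>\<dots>\<bar> \<le> \<bar>sin (s * v $ k) - s * v $ k\<bar> * P x + \<bar>s * v $ k\<bar> * \<bar>P x - P (ts i)\<bar>"
          using P0[of x] by (intro order_trans[OF abs_triangle_ineq]) (simp add: abs_mult)
        also have "\<dots> \<le> (s * norm v)^2 * D + (s * norm v) * ((norm w + C1) * norm v)"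
        proof (intro add_mono mult_mono PD P0 lin)
          have "\<bar>sin (s * v $ k) - s * v $ k\<bar> \<le> \<bar>s * v $ k\<bar>^2 / 2" by (rule sin_minus_self_le)
          also have "\<dots> \<le> \<bar>s * v $ k\<bar>^2" by simp
          also have "\<dots> \<le> (s * norm v)^2" using vk s(1) by (intro power_mono) (auto simp: abs_mult)
          finally show "\<bar>sin (s * v $ k) - s * v $ k\<bar> \<le> (s * norm v)^2" .
          show "\<bar>s * v $ k\<bar> \<le> s * norm v" using vk s(1) by (auto simp: abs_mult)
        qed (use s(1) in auto)
        also have "\<dots> = (s^2 * D + s * (norm w + C1)) * (norm v)^2" by (simp add: algebra_simps power2_eq_square)
        also have "\<dots> \<le> E * (norm v)^2" using D0 C1 by (intro mult_right_mono) (auto simp: E_def)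
        finally show "\<bar>H x - P (ts i) * s * (x - ts i) $ k\<bar> \<le> E * loc_weight n ts r x" by (simp add: lw v_def)
      next
        fix x assume x: "label n ts r x \<noteq> i"
        have "\<bar>H x\<bar> \<le> 1 * P x" unfolding H_def abs_mult using P0[of x] by (intro mult_mono) auto
        also have "\<dots> \<le> D * loc_weight n ts r x" using off[OF x] by simp
        also have "\<dots> \<le> E * loc_weight n ts r x" using D0 C1 s(1) by (intro mult_right_mono loc_weight_nonneg) (auto simp: E_def)
        finally show "\<bar>H x\<bar> \<le> E * loc_weight n ts r x" .
      qed (use p in auto)
      also have "\<dots> \<le> E * (A * F)" using loc E0 by (rule mult_left_mono)
      finally have "\<bar>\<Sum>j\<in>?N. p j * (P (ts i) * s * (\<theta> j - ts i) $ k)\<bar> \<le> (K0 + E * A) * F"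
        using H1 by (simp add: algebra_simps)
      moreover have "(\<Sum>j\<in>?N. p j * (P (ts i) * s * (\<theta> j - ts i) $ k)) = (s * P (ts i)) * (\<Sum>j\<in>?N. p j * (\<theta> j - ts i) $ k)"
        by (simp add: sum_distrib_left mult_ac)
      ultimately show ?thesis using s(1) Pi by (simp add: Cb_def abs_mult field_simps)
    qed
    show "\<bar>\<Sum>j\<in>?N. p j * (\<theta> j - ts i) $ k\<bar> \<le> (Ca + Cb) * Fnorm q p \<theta> ps" for k
      using b[of k] Ca0 F0 by (simp add: F_def algebra_simps add_increasing)
    have z: "(\<Sum>l<n. of_real (ps l) * cis (0 \<bullet> ts l) * complex_of_real (P (ts l))) = of_real (ps i * P (ts i))"
      using i Pz by (subst sum.remove[of _ i]) auto
    have "(\<Sum>j<q. of_real (p j) * cis (0 \<bullet> \<theta> j) * complex_of_real (P (\<theta> j)))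
     = of_real (\<Sum>j<q. p j * P (\<theta> j))" by simp
    then have H1: "\<bar>(\<Sum>j<q. p j * P (\<theta> j)) - ps i * P (ts i)\<bar> \<le> K0 * F"
      using gap_prod_test_bound[OF sub, of 0 p \<theta> q ps] s(1) unfolding P_def[symmetric] z
      by (simp add: F_def del: of_real_sum of_real_mult flip: of_real_diff)
    have H2: "\<bar>(\<Sum>j<q. p j * P (\<theta> j)) - (\<Sum>j\<in>?N. p j * (P (ts i) + w \<bullet> (\<theta> j - ts i)))\<bar>
         \<le> E * (\<Sum>j<q. p j * loc_weight n ts r (\<theta> j))"
    proof (rule sum_localize)
      fix x assume x: "label n ts r x = i"
      have "\<bar>P x - (P (ts i) + w \<bullet> (x - ts i))\<bar> \<le> C1 * loc_weight n ts r x"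
        using PE[of x] near[OF x] by (simp add: algebra_simps)
      also have "\<dots> \<le> E * loc_weight n ts r x" using D0 C1 s(1) by (intro mult_right_mono loc_weight_nonneg) (auto simp: E_def)
      finally show "\<bar>P x - (P (ts i) + w \<bullet> (x - ts i))\<bar> \<le> E * loc_weight n ts r x" .
    next
      fix x assume x: "label n ts r x \<noteq> i"
      have "\<bar>P x\<bar> \<le> D * loc_weight n ts r x" using off[OF x] P0[of x] by simp
      also have "\<dots> \<le> E * loc_weight n ts r x" using D0 C1 s(1) by (intro mult_right_mono loc_weight_nonneg) (auto simp: E_def)
      finally show "\<bar>P x\<bar> \<le> E * loc_weight n ts r x" .
    qed (use p in auto)
    also have "\<dots> \<le> E * (A * F)" using loc E0 by (rule mult_left_mono)
    finally have H2: "\<bar>(\<Sum>j<q. p j * P (\<theta> j)) - (\<Sum>j\<in>?N. p j * (P (ts i) + w \<bullet> (\<theta> j - ts i)))\<bar> \<le> E * A * F" by simp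
    \<comment> \<open>The linear model splits into \<open>P (ts i)\<close> times the mass and a
      combination of the first moments, for which \<open>b\<close> is available.\<close>
    have e: "(\<Sum>j\<in>?N. p j * (P (ts i) + w \<bullet> (\<theta> j - ts i)))
       = P (ts i) * (\<Sum>j\<in>?N. p j) + (\<Sum>k\<in>UNIV. w $ k * (\<Sum>j\<in>?N. p j * (\<theta> j - ts i) $ k))"
    proof -
      have "(\<Sum>j\<in>?N. p j * (w \<bullet> (\<theta> j - ts i))) = (\<Sum>k\<in>UNIV. w $ k * (\<Sum>j\<in>?N. p j * (\<theta> j - ts i) $ k))"
        unfolding inner_vec_def sum_distrib_left by (subst sum.swap) (simp add: mult_ac)
      then show ?thesis by (simp only: distrib_left sum.distrib sum_distrib_left mult.commute[of "P (ts i)"])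
    qed
    have wb: "\<bar>\<Sum>k\<in>UNIV. w $ k * (\<Sum>j\<in>?N. p j * (\<theta> j - ts i) $ k)\<bar> \<le> (\<Sum>k\<in>UNIV. \<bar>w $ k\<bar> * Cb) * F"
      unfolding sum_distrib_right
      by (intro order_trans[OF sum_abs] sum_mono) (simp only: abs_mult mult.assoc, intro mult_left_mono b abs_ge_zero)
    have "\<bar>P (ts i) * ((\<Sum>j\<in>?N. p j) - ps i)\<bar> \<le> (K0 + E * A + (\<Sum>k\<in>UNIV. \<bar>w $ k\<bar> * Cb)) * F"
      using H1 H2 wb unfolding e by (simp add: algebra_simps)
    then have "P (ts i) * \<bar>(\<Sum>j\<in>?N. p j) - ps i\<bar> \<le> P (ts i) * (Ca * F)"
      using Pi by (simp add: Ca_def abs_mult)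
    then have "\<bar>(\<Sum>j\<in>?N. p j) - ps i\<bar> \<le> Ca * F" by (rule mult_left_le_imp_le[OF _ Pi])
    also have "\<dots> \<le> (Ca + Cb) * F" using Cb0 F0 by (intro mult_right_mono) auto
    finally show "\<bar>(\<Sum>j\<in>?N. p j) - ps i\<bar> \<le> (Ca + Cb) * Fnorm q p \<theta> ps" by (simp add: F_def)
  qed
qed

end

lemma local_geometry:
  fixes f0 :: "real^'d::finite \<Rightarrow> real" and ts :: "nat \<Rightarrow> real^'d"
  assumes "prob_density f0" "0 < n" and inj: "\<And>i j. i < n \<Longrightarrow> j < n \<Longrightarrow> i \<noteq> j \<Longrightarrow> ts i \<noteq> ts j"
  obtains r C where "0 < r" "r \<le> 1" "1 \<le> C"
    "\<And>i \<theta>. i < n \<Longrightarrow> norm (\<theta> - ts i) < r \<Longrightarrow> label n ts r \<theta> = i"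
    "\<And>q p \<theta> ps B. (\<And>j. j < q \<Longrightarrow> 0 \<le> p j) \<Longrightarrow>
        (\<integral>x. \<bar>mixture f0 q p \<theta> x - mixture f0 n ps ts x\<bar> \<partial>lborel) \<le> B \<Longrightarrow>
        (\<Sum>j<q. p j * loc_weight n ts r (\<theta> j)) \<le> C * B"
    "\<And>q p \<theta> ps B i. (\<And>j. j < q \<Longrightarrow> 0 \<le> p j) \<Longrightarrow>
        (\<integral>x. \<bar>mixture f0 q p \<theta> x - mixture f0 n ps ts x\<bar> \<partial>lborel) \<le> B \<Longrightarrow> i < n \<Longrightarrow>
        \<bar>(\<Sum>j\<in>{j. j < q \<and> label n ts r (\<theta> j) = i}. p j) - ps i\<bar> \<le> C * B"
    "\<And>q p \<theta> ps B i k. (\<And>j. j < q \<Longrightarrow> 0 \<le> p j) \<Longrightarrow>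
        (\<integral>x. \<bar>mixture f0 q p \<theta> x - mixture f0 n ps ts x\<bar> \<partial>lborel) \<le> B \<Longrightarrow> i < n \<Longrightarrow>
        \<bar>\<Sum>j\<in>{j. j < q \<and> label n ts r (\<theta> j) = i}. p j * (\<theta> j - ts i) $ k\<bar> \<le> C * B"
proof -
  obtain s0 where s0: "0 < s0" "\<forall>\<xi>. norm \<xi> \<le> s0 \<longrightarrow> 1/2 \<le> cmod (char_fn f0 \<xi>)"
    using char_fn_near_0[OF assms(1)] by auto
  define D where "D = insert 1 ((\<lambda>(i, j). norm (ts i - ts j)) ` {(i, j). i < n \<and> j < n \<and> i \<noteq> j})"
  have finD: "finite D"
    unfolding D_def by (intro finite.insertI finite_imageI, rule finite_subset[of _ "{..<n} \<times> {..<n}"]) auto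
  \<comment> \<open>One third makes \<open>2 * r\<close> strictly smaller than every mutual
    distance; the element 1 of \<open>D\<close> ensures \<open>r \<le> 1\<close>.\<close>
  define r where "r = Min D / 3"
  have Dpos: "0 < Min D" using finD inj by (subst Min_gr_iff) (auto simp: D_def)
  have r: "0 < r" "r \<le> 1" using Dpos Min_le[OF finD, of 1] by (auto simp: r_def D_def)
  have sep: "2 * r < norm (ts i - ts j)" if "i < n" "j < n" "i \<noteq> j" for i j
  proof -
    have "Min D \<le> norm (ts i - ts j)" using that by (intro Min_le[OF finD]) (auto simp: D_def)
    then show ?thesis using Dpos by (simp add: r_def)
  qed
  interpret star_points f0 n ts s0 r
    using assms s0 r sep by unfold_locales auto
  have "\<forall>i\<in>{..<n}. \<exists>C\<ge>0. \<forall>q p \<theta> ps. (\<forall>j<q. 0 \<le> p j) \<longrightarrow>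
     \<bar>(\<Sum>j\<in>{j. j < q \<and> label n ts r (\<theta> j) = i}. p j) - ps i\<bar> \<le> C * Fnorm q p \<theta> ps \<and>
     (\<forall>k. \<bar>\<Sum>j\<in>{j. j < q \<and> label n ts r (\<theta> j) = i}. p j * (\<theta> j - ts i) $ k\<bar> \<le> C * Fnorm q p \<theta> ps)"
    using local_moments by blast
  from bchoice[OF this] obtain Cm where Cm': "\<forall>i\<in>{..<n}. 0 \<le> Cm i \<and> (\<forall>q p \<theta> ps. (\<forall>j<q. 0 \<le> p j) \<longrightarrow>
     \<bar>(\<Sum>j\<in>{j. j < q \<and> label n ts r (\<theta> j) = i}. p j) - ps i\<bar> \<le> Cm i * Fnorm q p \<theta> ps \<and>
     (\<forall>k. \<bar>\<Sum>j\<in>{j. j < q \<and> label n ts r (\<theta> j) = i}. p j * (\<theta> j - ts i) $ k\<bar> \<le> Cm i * Fnorm q p \<theta> ps))" ..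
  have Cm: "\<And>i. i < n \<Longrightarrow> 0 \<le> Cm i"
    and Cma: "\<And>i q p \<theta> ps. i < n \<Longrightarrow> (\<And>j. j < q \<Longrightarrow> 0 \<le> p j) \<Longrightarrow>
      \<bar>(\<Sum>j\<in>{j. j < q \<and> label n ts r (\<theta> j) = i}. p j) - ps i\<bar> \<le> Cm i * Fnorm q p \<theta> ps"
    and Cmb: "\<And>i q p \<theta> ps k. i < n \<Longrightarrow> (\<And>j. j < q \<Longrightarrow> 0 \<le> p j) \<Longrightarrow>
      \<bar>\<Sum>j\<in>{j. j < q \<and> label n ts r (\<theta> j) = i}. p j * (\<theta> j - ts i) $ k\<bar> \<le> Cm i * Fnorm q p \<theta> ps"
    using Cm' by simp_all
  define A where "A = K0 / (c0 * r^2) ^ n"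
  have A0: "0 \<le> A" using c0 by (simp add: A_def K0_def)
  define C where "C = 1 + A + (\<Sum>i<n. Cm i)"
  have "0 \<le> (\<Sum>i<n. Cm i)" using Cm by (intro sum_nonneg) auto
  then have C: "1 \<le> C" "A \<le> C" using A0 by (auto simp: C_def)
  have CmC: "Cm i \<le> C" if "i < n" for i
  proof -
    have "Cm i \<le> (\<Sum>i<n. Cm i)" using that Cm by (intro member_le_sum) auto
    then show ?thesis using A0 by (simp add: C_def)
  qed
  have up: "c * Fnorm q p \<theta> ps \<le> C * B" if "c \<le> C" "Fnorm q p \<theta> ps \<le> B" for c q p \<theta> ps B
  proof -
    have "c * Fnorm q p \<theta> ps \<le> C * Fnorm q p \<theta> ps" using that(1) Fnorm_nonneg by (rule mult_right_mono)
    also have "\<dots> \<le> C * B" using C(1) that(2) by (intro mult_left_mono) auto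
    finally show ?thesis .
  qed
  show ?thesis
  proof (rule that[OF r C(1)])
    show "\<And>i \<theta>. i < n \<Longrightarrow> norm (\<theta> - ts i) < r \<Longrightarrow> label n ts r \<theta> = i" by (rule label_eqI)
  next
    fix q p ps B and \<theta> :: "nat \<Rightarrow> real^'d"
    assume p: "\<And>j. j < q \<Longrightarrow> 0 \<le> p j" and B: "(\<integral>x. \<bar>mixture f0 q p \<theta> x - mixture f0 n ps ts x\<bar> \<partial>lborel) \<le> B"
    have "(\<Sum>j<q. p j * loc_weight n ts r (\<theta> j)) \<le> A * Fnorm q p \<theta> ps"
      unfolding A_def by (rule sum_loc_weight_le) (rule p)
    also have "\<dots> \<le> C * B" by (rule up[OF C(2)]) (use B in \<open>simp only: Fnorm_def\<close>)
    finally show "(\<Sum>j<q. p j * loc_weight n ts r (\<theta> j)) \<le> C * B" .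
  next
    fix q p ps B i k and \<theta> :: "nat \<Rightarrow> real^'d"
    assume p: "\<And>j. j < q \<Longrightarrow> 0 \<le> p j" and B: "(\<integral>x. \<bar>mixture f0 q p \<theta> x - mixture f0 n ps ts x\<bar> \<partial>lborel) \<le> B"
      and i: "i < n"
    have F: "Cm i * Fnorm q p \<theta> ps \<le> C * B" by (rule up[OF CmC[OF i]]) (use B in \<open>simp only: Fnorm_def\<close>)
    show "\<bar>(\<Sum>j\<in>{j. j < q \<and> label n ts r (\<theta> j) = i}. p j) - ps i\<bar> \<le> C * B"
      by (rule order_trans[OF Cma F]) (fact i, rule p)
    show "\<bar>\<Sum>j\<in>{j. j < q \<and> label n ts r (\<theta> j) = i}. p j * (\<theta> j - ts i) $ k\<bar> \<le> C * B"
      by (rule order_trans[OF Cmb F]) (fact i, rule p)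
  qed
qed

section \<open>Taylor remainders averaged over the space variable\<close>

text \<open>The directional derivative, written through partial derivatives: it is linear in
  \<open>z\<close> by algebra, its iterates stay in the classes \<open>C_k\<close>, and bounds on
  partial derivatives apply to it directly.\<close>

definition dird :: "real^'d::finite \<Rightarrow> (real^'d \<Rightarrow> real) \<Rightarrow> real^'d \<Rightarrow> real" where
  "dird z g y = (\<Sum>i\<in>UNIV. z $ i * partial_deriv i g y)"

lemma line_has_real_derivative_linear:
  assumes "(g has_derivative D) (at (a + t *\<^sub>R z))"
  shows "((\<lambda>t. g (a + t *\<^sub>R z)) has_real_derivative D z) (at t)"
proof -
  have "((\<lambda>t. a + t *\<^sub>R z) has_derivative (\<lambda>h. h *\<^sub>R z)) (at t)"
    by (auto intro!: derivative_eq_intros)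
  from has_derivative_compose[OF this assms]
  have "((\<lambda>t. g (a + t *\<^sub>R z)) has_derivative (\<lambda>h. D (h *\<^sub>R z))) (at t)" .
  moreover have "D (h *\<^sub>R z) = D z * h" for h
    using assms linear_scale[OF bounded_linear.linear[OF has_derivative_bounded_linear]] by fastforce
  ultimately show ?thesis by (simp add: has_field_derivative_def)
qed

lemma partial_deriv_eqI:
  assumes "((\<lambda>t. g (x + t *\<^sub>R axis i 1)) has_real_derivative c) (at 0)"
  shows "partial_deriv i g x = c"
  unfolding partial_deriv_def using assms by (rule DERIV_imp_deriv)

lemma partial_deriv_has_derivative:
  assumes "(g has_derivative D) (at x)"
  shows "partial_deriv i g x = D (axis i 1)"
  by (rule partial_deriv_eqI, rule line_has_real_derivative_linear) (use assms in simp)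

lemma dird_has_derivative:
  assumes "(g has_derivative D) (at x)"
  shows "dird z g x = D z"
proof -
  have lin: "linear D" using assms by (intro bounded_linear.linear has_derivative_bounded_linear)
  have "D z = D (\<Sum>i\<in>UNIV. z $ i *\<^sub>R axis i 1)" by (simp add: basis_expansion[of z, unfolded scalar_mult_eq_scaleR])
  also have "\<dots> = (\<Sum>i\<in>UNIV. z $ i * D (axis i 1))"
    by (simp add: linear_sum[OF lin] linear_scale[OF lin] o_def)
  finally show ?thesis by (simp add: dird_def partial_deriv_has_derivative[OF assms])
qed

lemma line_has_real_derivative:
  assumes "g differentiable (at (a + t *\<^sub>R z))"
  shows "((\<lambda>t. g (a + t *\<^sub>R z)) has_real_derivative dird z g (a + t *\<^sub>R z)) (at t)"
proof -
  obtain D where D: "(g has_derivative D) (at (a + t *\<^sub>R z))" using assms unfolding differentiable_def ..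
  show ?thesis using line_has_real_derivative_linear[OF D] dird_has_derivative[OF D, of z] by simp
qed

lemma C_k_differentiable: "C_k (Suc k) g \<Longrightarrow> g differentiable (at x)"
  by (simp add: differentiable_on_def)

lemma C_k_continuous: "C_k k g \<Longrightarrow> continuous_on UNIV g"
  by (cases k) (auto intro: differentiable_imp_continuous_on)

lemma partial_deriv_lincomb:
  fixes f :: "'i \<Rightarrow> real^'d::finite \<Rightarrow> real"
  assumes "finite A" "\<And>j. j \<in> A \<Longrightarrow> f j differentiable (at x)"
  shows "partial_deriv i (\<lambda>x. \<Sum>j\<in>A. c j * f j x) x = (\<Sum>j\<in>A. c j * partial_deriv i (f j) x)"
proof (rule partial_deriv_eqI)
  have d: "((\<lambda>t. f j (x + t *\<^sub>R axis i 1)) has_real_derivative partial_deriv i (f j) x) (at 0)" if j: "j \<in> A" for j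
  proof -
    obtain D where D: "(f j has_derivative D) (at x)" using assms(2)[OF j] unfolding differentiable_def ..
    show ?thesis using line_has_real_derivative_linear[of "f j" D x 0 "axis i 1"] D partial_deriv_has_derivative[OF D, of i] by simp
  qed
  show "((\<lambda>t. \<Sum>j\<in>A. c j * f j (x + t *\<^sub>R axis i 1)) has_real_derivative (\<Sum>j\<in>A. c j * partial_deriv i (f j) x)) (at 0)"
    by (intro DERIV_sum DERIV_cmult d)
qed

lemma C_k_lincomb:
  assumes "finite A" "\<And>j. j \<in> A \<Longrightarrow> C_k k (f j)"
  shows "C_k k (\<lambda>x. \<Sum>j\<in>A. c j * f j x)"
  using assms(2)
proof (induction k arbitrary: f)
  case 0
  then show ?case by (auto intro!: continuous_intros)
next
  case (Suc k)
  have diff: "f j differentiable (at x)" if "j \<in> A" for j x using Suc.prems[OF that] by (rule C_k_differentiable)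
  have "partial_deriv i (\<lambda>x. \<Sum>j\<in>A. c j * f j x) = (\<lambda>x. \<Sum>j\<in>A. c j * partial_deriv i (f j) x)" for i
    by (rule ext, rule partial_deriv_lincomb[OF assms(1)]) (rule diff)
  moreover have "C_k k (\<lambda>x. \<Sum>j\<in>A. c j * partial_deriv i (f j) x)" for i
    by (rule Suc.IH) (use Suc.prems in auto)
  moreover have "(\<lambda>x. \<Sum>j\<in>A. c j * f j x) differentiable_on UNIV"
    unfolding differentiable_on_def using assms(1) diff by (auto intro!: derivative_intros)
  ultimately show ?case by simp
qed

lemma C_k_dird: "C_k (Suc k) g \<Longrightarrow> C_k k (dird z g)"
  unfolding dird_def[abs_def] by (rule C_k_lincomb) auto

lemma dird_expand2:
  assumes "C_k 2 g"
  shows "dird w (dird z g) y = (\<Sum>j\<in>UNIV. \<Sum>i\<in>UNIV. w $ j * z $ i * partial_deriv j (partial_deriv i g) y)"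
proof -
  have "C_k 1 (partial_deriv i g)" for i using assms by (simp add: eval_nat_numeral)
  then have d: "partial_deriv i g differentiable (at y)" for i y by (simp add: differentiable_on_def)
  show ?thesis
    unfolding dird_def[of w] unfolding dird_def[abs_def]
    by (subst partial_deriv_lincomb) (auto simp: d sum_distrib_left mult_ac)
qed

lemma dird_expand3:
  assumes "C_k 3 g"
  shows "dird v (dird w (dird z g)) y = (\<Sum>k\<in>UNIV. \<Sum>j\<in>UNIV. \<Sum>i\<in>UNIV. v $ k * w $ j * z $ i *
     partial_deriv k (partial_deriv j (partial_deriv i g)) y)"
proof -
  have "C_k 2 (partial_deriv i g)" for i using assms by (simp add: eval_nat_numeral)
  then have d: "C_k 1 (partial_deriv j (partial_deriv i g))" for i j by (simp add: eval_nat_numeral)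
  then have d: "partial_deriv j (partial_deriv i g) differentiable (at y)" for i j y by (simp add: differentiable_on_def)
  have C2: "C_k 2 g" using assms
    by (auto simp: eval_nat_numeral intro: differentiable_imp_continuous_on)
  have e: "dird w (dird z g) = (\<lambda>y. \<Sum>j\<in>UNIV. w $ j * (\<Sum>i\<in>UNIV. z $ i * partial_deriv j (partial_deriv i g) y))"
    by (rule ext) (simp add: dird_expand2[OF C2] sum_distrib_left mult_ac)
  have "dird v (dird w (dird z g)) y = (\<Sum>k\<in>UNIV. v $ k * (\<Sum>j\<in>UNIV. w $ j * (\<Sum>i\<in>UNIV. z $ i *
      partial_deriv k (partial_deriv j (partial_deriv i g)) y)))"
    unfolding dird_def[of v] e by (subst partial_deriv_lincomb | simp add: d)+
  also have "\<dots> = (\<Sum>k\<in>UNIV. \<Sum>j\<in>UNIV. \<Sum>i\<in>UNIV. v $ k * w $ j * z $ i *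
     partial_deriv k (partial_deriv j (partial_deriv i g)) y)"
    by (simp add: sum_distrib_left mult_ac)
  finally show ?thesis .
qed

lemma sum_abs_le_card:
  fixes f :: "'d::finite \<Rightarrow> real" and B :: real
  assumes "\<And>i. \<bar>f i\<bar> \<le> B"
  shows "\<bar>\<Sum>i\<in>UNIV. f i\<bar> \<le> CARD('d) * B"
  using sum_norm_bound[of UNIV f B] assms by simp

lemma dird_bound1:
  fixes B :: real
  assumes "\<And>i. \<bar>partial_deriv i g y\<bar> \<le> B"
  shows "\<bar>dird z (g :: real^'d::finite \<Rightarrow> real) y\<bar> \<le> CARD('d) * (norm z * B)"
  unfolding dird_def
  by (intro sum_abs_le_card) (auto simp: abs_mult intro!: mult_mono component_le_norm_cart assms)

lemma dird_bound2:
  fixes B :: real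
  assumes "C_k 2 (g :: real^'d::finite \<Rightarrow> real)" "\<And>i j. \<bar>partial_deriv i (partial_deriv j g) y\<bar> \<le> B"
  shows "\<bar>dird w (dird z g) y\<bar> \<le> real CARD('d)^2 * (norm w * norm z * B)"
proof -
  have "\<bar>dird w (dird z g) y\<bar> \<le> CARD('d) * (CARD('d) * (norm w * norm z * B))"
    unfolding dird_expand2[OF assms(1)]
    by (intro sum_abs_le_card) (auto simp: abs_mult intro!: mult_mono component_le_norm_cart assms mult_nonneg_nonneg)
  then show ?thesis by (simp add: power2_eq_square)
qed

lemma dird_bound3:
  fixes B :: real
  assumes "C_k 3 (g :: real^'d::finite \<Rightarrow> real)" "\<And>i j k. \<bar>partial_deriv i (partial_deriv j (partial_deriv k g)) y\<bar> \<le> B"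
  shows "\<bar>dird v (dird w (dird z g)) y\<bar> \<le> real CARD('d)^3 * (norm v * norm w * norm z * B)"
proof -
  have "\<bar>dird v (dird w (dird z g)) y\<bar> \<le> CARD('d) * (CARD('d) * (CARD('d) * (norm v * norm w * norm z * B)))"
    unfolding dird_expand3[OF assms(1)]
    by (intro sum_abs_le_card) (auto simp: abs_mult intro!: mult_mono component_le_norm_cart assms mult_nonneg_nonneg)
  then show ?thesis by (simp add: power3_eq_cube)
qed

lemma dird_lin: "dird (w - z) g y = dird w g y - dird z g y" "dird (- z) g y = - dird z g y"
  by (simp_all add: dird_def left_diff_distrib sum_subtractf sum_negf)

lemma dird_bilin:
  assumes "C_k 2 g"
  shows "dird (w - w') (dird z g) y = dird w (dird z g) y - dird w' (dird z g) y"
    "dird w (dird (z - z') g) y = dird w (dird z g) y - dird w (dird z' g) y"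
    "dird (- w) (dird z g) y = - dird w (dird z g) y"
    "dird w (dird (- z) g) y = - dird w (dird z g) y"
  unfolding dird_expand2[OF assms]
  by (simp_all add: algebra_simps sum_subtractf sum_negf)

section \<open>Integrals along segments and their averages\<close>

definition path_int :: "(real^'d::finite \<Rightarrow> ennreal) \<Rightarrow> real^'d \<Rightarrow> real^'d \<Rightarrow> ennreal" where
  "path_int G x z = (\<integral>\<^sup>+t\<in>{0..1}. G (x + t *\<^sub>R z) \<partial>lborel)"

text \<open>The function is followed along a segment from \<open>a\<close>, the majorant along the
  parallel segment from \<open>x\<close>. In the applications \<open>a = x - \<theta>\<close>, so
  that both run with the same space displacement. One integral over the whole segment serves for all
  pairs \<open>s\<close>, \<open>s'\<close>.\<close>

lemma path_diff_le:
  fixes g :: "real^'d::finite \<Rightarrow> real"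
  assumes g: "C_k 1 g" and s: "s \<in> {0..1}" "s' \<in> {0..1}" and \<kappa>: "0 \<le> \<kappa>"
    and G: "\<And>t. t \<in> {0..1} \<Longrightarrow> ennreal \<bar>dird z g (a + t *\<^sub>R z)\<bar> \<le> ennreal \<kappa> * G (x + t *\<^sub>R z)"
    and [measurable]: "G \<in> borel_measurable borel"
  shows "ennreal \<bar>g (a + s *\<^sub>R z) - g (a + s' *\<^sub>R z)\<bar> \<le> ennreal \<kappa> * path_int G x z"
proof -
  have main: "ennreal \<bar>g (a + s *\<^sub>R z) - g (a + s' *\<^sub>R z)\<bar> \<le> ennreal \<kappa> * path_int G x z"
    if s: "0 \<le> s'" "s' \<le> s" "s \<le> 1" for s s'
  proof -
    define h where "h t = dird z g (a + t *\<^sub>R z)" for t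
    have "C_k 0 (dird z g)" using C_k_dird[of 0 g z] g by simp
    then have "continuous_on UNIV (dird z g)" by simp
    then have ch: "continuous_on UNIV h" unfolding h_def[abs_def]
      by (rule continuous_on_compose2) (auto intro!: continuous_intros)
    have [measurable]: "h \<in> borel_measurable borel" by (rule borel_measurable_continuous_onI[OF ch])
    have hi: "(h has_integral (g (a + s *\<^sub>R z) - g (a + s' *\<^sub>R z))) {s'..s}"
    proof (rule fundamental_theorem_of_calculus[OF s(2)])
      fix t
      have "((\<lambda>t. g (a + t *\<^sub>R z)) has_real_derivative h t) (at t)"
        unfolding h_def using C_k_differentiable[of 0 g] g by (intro line_has_real_derivative) simp
      then show "((\<lambda>t. g (a + t *\<^sub>R z)) has_vector_derivative h t) (at t within {s'..s})"
        by (simp add: has_real_derivative_iff_has_vector_derivative has_vector_derivative_at_within)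
    qed
    have "(\<lambda>t. norm (h t)) integrable_on {s'..s}"
      by (intro integrable_continuous_interval continuous_intros continuous_on_subset[OF ch]) auto
    then have ih: "((\<lambda>t. \<bar>h t\<bar>) has_integral integral {s'..s} (\<lambda>t. \<bar>h t\<bar>)) {s'..s}" by (simp add: integrable_integral)
    have "\<bar>g (a + s *\<^sub>R z) - g (a + s' *\<^sub>R z)\<bar> \<le> integral {s'..s} (\<lambda>t. \<bar>h t\<bar>)"
      using integral_norm_bound_integral[of h "{s'..s}" "\<lambda>t. \<bar>h t\<bar>"] hi ih integral_unique[OF hi]
      by (auto simp: integrable_on_def)
    then have "ennreal \<bar>g (a + s *\<^sub>R z) - g (a + s' *\<^sub>R z)\<bar> \<le> ennreal (integral {s'..s} (\<lambda>t. \<bar>h t\<bar>))"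
      by (rule ennreal_leI)
    also have "\<dots> = (\<integral>\<^sup>+t\<in>{s'..s}. ennreal \<bar>h t\<bar> \<partial>lborel)"
    proof -
      have "(\<integral>\<^sup>+t. ennreal (indicator {s'..s} t * \<bar>h t\<bar>) \<partial>lborel) = ennreal (integral {s'..s} (\<lambda>t. \<bar>h t\<bar>))"
        by (rule nn_integral_has_integral_lebesgue[OF _ ih]) simp
      moreover have "(\<integral>\<^sup>+t. ennreal (indicator {s'..s} t * \<bar>h t\<bar>) \<partial>lborel) = (\<integral>\<^sup>+t\<in>{s'..s}. ennreal \<bar>h t\<bar> \<partial>lborel)"
        by (intro nn_integral_cong) (auto simp: indicator_def)
      ultimately show ?thesis by simp
    qed
    also have "\<dots> \<le> (\<integral>\<^sup>+t. ennreal \<kappa> * (G (x + t *\<^sub>R z) * indicator {0..1} t) \<partial>lborel)"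
    proof (rule nn_integral_mono)
      fix t
      show "ennreal \<bar>h t\<bar> * indicator {s'..s} t \<le> ennreal \<kappa> * (G (x + t *\<^sub>R z) * indicator {0..1} t)"
        using G[of t] s by (auto simp: h_def indicator_def)
    qed
    also have "\<dots> = ennreal \<kappa> * path_int G x z"
      unfolding path_int_def by (rule nn_integral_cmult) measurable
    finally show ?thesis .
  qed
  show ?thesis
  proof (cases "s' \<le> s")
    case True then show ?thesis using main[of s' s] s by auto
  next
    case False then show ?thesis using main[of s s'] s by (auto simp: abs_minus_commute)
  qed
qed

text \<open>The assumption concerns the oscillation of the derivative along the segment, not a
  second derivative: an integral along the segment bounds this oscillation by one constant for all
  intermediate points.\<close>

lemma taylor1:
  assumes "C_k 1 g" "\<And>s. s \<in> {0..1} \<Longrightarrow> \<bar>dird z g (a + s *\<^sub>R z) - dird z g a\<bar> \<le> C" "t \<in> {0..1}"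
  shows "\<bar>g (a + t *\<^sub>R z) - g a - t * dird z g a\<bar> \<le> C"
proof (cases "t = 0")
  case True
  then show ?thesis using order_trans[OF abs_ge_zero assms(2)[of 0]] by simp
next
  case False
  then have t: "0 < t" "t \<le> 1" using assms(3) by auto
  have "\<exists>\<xi>>0. \<xi> < t \<and> g (a + t *\<^sub>R z) - g (a + 0 *\<^sub>R z) = (t - 0) * dird z g (a + \<xi> *\<^sub>R z)"
    by (rule MVT2[OF t(1)]) (use C_k_differentiable[of 0 g] assms(1) in \<open>auto intro!: line_has_real_derivative\<close>)
  then obtain \<xi> where \<xi>: "0 < \<xi>" "\<xi> < t" "g (a + t *\<^sub>R z) - g a = t * dird z g (a + \<xi> *\<^sub>R z)" by auto
  then have "\<bar>g (a + t *\<^sub>R z) - g a - t * dird z g a\<bar> = t * \<bar>dird z g (a + \<xi> *\<^sub>R z) - dird z g a\<bar>"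
    using t by (simp add: abs_mult right_diff_distrib[symmetric])
  also have "\<dots> \<le> 1 * C" using t \<xi> assms(2)[of \<xi>] by (intro mult_mono) auto
  finally show ?thesis by simp
qed

lemma taylor2:
  assumes "C_k 2 g" "\<And>s. s \<in> {0..1} \<Longrightarrow> \<bar>dird z (dird z g) (a + s *\<^sub>R z) - dird z (dird z g) a\<bar> \<le> C"
  shows "\<bar>g (a + z) - g a - dird z g a - dird z (dird z g) a / 2\<bar> \<le> C / 2"
proof -
  define D where "D m = (if m = 0 then (\<lambda>t. g (a + t *\<^sub>R z)) else if m = 1 then (\<lambda>t. dird z g (a + t *\<^sub>R z))
     else (\<lambda>t. dird z (dird z g) (a + t *\<^sub>R z)))" for m :: nat
  have g1: "C_k (Suc (Suc 0)) g" using assms(1) by (simp only: numeral_2_eq_2)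
  have d0: "g differentiable (at y)" for y by (rule C_k_differentiable[OF g1])
  have d1: "dird z g differentiable (at y)" for y by (rule C_k_differentiable[OF C_k_dird[OF g1]])
  have "\<exists>t>0. t < 1 \<and> g (a + 1 *\<^sub>R z) = (\<Sum>m<2. D m 0 / fact m * 1 ^ m) + D 2 t / fact 2 * 1 ^ 2"
  proof (rule Maclaurin)
    show "\<forall>m t. m < 2 \<and> 0 \<le> t \<and> t \<le> 1 \<longrightarrow> (D m has_real_derivative D (Suc m) t) (at t)"
    proof (intro allI impI)
      fix m :: nat and t :: real assume "m < 2 \<and> 0 \<le> t \<and> t \<le> 1"
      then consider "m = 0" | "m = 1" by linarith
      then show "(D m has_real_derivative D (Suc m) t) (at t)"
        by cases (simp_all add: D_def line_has_real_derivative d0 d1)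
    qed
  qed (auto simp: D_def)
  then obtain t where t: "0 < t" "t < 1" "g (a + z) = g a + dird z g a + dird z (dird z g) (a + t *\<^sub>R z) / 2"
    by (auto simp: D_def eval_nat_numeral)
  then have "\<bar>g (a + z) - g a - dird z g a - dird z (dird z g) a / 2\<bar> = \<bar>dird z (dird z g) (a + t *\<^sub>R z) - dird z (dird z g) a\<bar> / 2"
    by (simp add: diff_divide_distrib[symmetric])
  also have "\<dots> \<le> C / 2" using assms(2)[of t] t by simp
  finally show ?thesis .
qed

lemma ball_borel [measurable]: "ball a r \<in> sets borel"
  by simp

lemma path_int_measurable [measurable]:
  fixes G :: "real^'d::finite \<Rightarrow> ennreal"
  assumes [measurable]: "G \<in> borel_measurable borel" "f \<in> borel_measurable M" "g \<in> borel_measurable M"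
  shows "(\<lambda>w. path_int G (f w) (g w)) \<in> borel_measurable M"
  unfolding path_int_def by measurable

text \<open>Not normalized: the total mass of the average is the volume of the ball of radius 2,
  later called \<open>V2\<close>.\<close>

definition avg :: "real \<Rightarrow> (real^'d::finite \<Rightarrow> ennreal) \<Rightarrow> real^'d \<Rightarrow> ennreal" where
  "avg r G x = (\<integral>\<^sup>+y\<in>ball 0 2. path_int G x (r *\<^sub>R y) \<partial>lborel)"

lemma avg_measurable [measurable]:
  fixes G :: "real^'d::finite \<Rightarrow> ennreal"
  assumes [measurable]: "G \<in> borel_measurable borel"
  shows "avg r G \<in> borel_measurable borel"
  unfolding avg_def by measurable

lemma path_int_mono: "(\<And>x. G x \<le> G' x) \<Longrightarrow> path_int G x z \<le> path_int G' x z"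
  unfolding path_int_def by (intro nn_integral_mono mult_right_mono) auto

lemma avg_mono: "(\<And>x. G x \<le> G' x) \<Longrightarrow> avg r G x \<le> avg r G' x"
  unfolding avg_def by (intro nn_integral_mono mult_right_mono path_int_mono) auto

lemma avg_lincomb:
  fixes G :: "real^'d::finite \<Rightarrow> ennreal"
  assumes [measurable]: "G \<in> borel_measurable borel" "G' \<in> borel_measurable borel"
  shows "avg r (\<lambda>x. c * G x + c' * G' x) x = c * avg r G x + c' * avg r G' x"
proof -
  have p: "path_int (\<lambda>x. c * G x + c' * G' x) x z = c * path_int G x z + c' * path_int G' x z" for x z
  proof -
    have "path_int (\<lambda>x. c * G x + c' * G' x) x z
      = (\<integral>\<^sup>+t. c * (G (x + t *\<^sub>R z) * indicator {0..1} t) + c' * (G' (x + t *\<^sub>R z) * indicator {0..1} t) \<partial>lborel)"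
      unfolding path_int_def by (intro nn_integral_cong) (auto simp: indicator_def)
    also have "\<dots> = c * path_int G x z + c' * path_int G' x z"
      unfolding path_int_def by (subst nn_integral_add) (auto simp: nn_integral_cmult)
    finally show ?thesis .
  qed
  have "avg r (\<lambda>x. c * G x + c' * G' x) x
      = (\<integral>\<^sup>+y. c * (path_int G x (r *\<^sub>R y) * indicator (ball 0 2) y) + c' * (path_int G' x (r *\<^sub>R y) * indicator (ball 0 2) y) \<partial>lborel)"
    unfolding avg_def p by (intro nn_integral_cong) (auto simp: indicator_def)
  also have "\<dots> = c * avg r G x + c' * avg r G' x"
    unfolding avg_def by (subst nn_integral_add) (auto simp: nn_integral_cmult)
  finally show ?thesis .
qed

lemma nn_integral_lborel_shift:
  fixes h :: "real^'d::finite \<Rightarrow> ennreal"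
  assumes [measurable]: "h \<in> borel_measurable borel"
  shows "(\<integral>\<^sup>+x. h (x + a) \<partial>lborel) = (\<integral>\<^sup>+x. h x \<partial>lborel)"
proof -
  have "(\<integral>\<^sup>+x. h x \<partial>lborel) = (\<integral>\<^sup>+x. h x \<partial>(distr lborel borel ((+) a)))"
    by (simp add: lborel_distr_plus)
  also have "\<dots> = (\<integral>\<^sup>+x. h (a + x) \<partial>lborel)" by (rule nn_integral_distr) auto
  finally show ?thesis by (simp add: add.commute)
qed

lemma nn_integral_lborel_uminus:
  fixes h :: "real^'d::finite \<Rightarrow> ennreal"
  assumes [measurable]: "h \<in> borel_measurable borel"
  shows "(\<integral>\<^sup>+x. h (- x) \<partial>lborel) = (\<integral>\<^sup>+x. h x \<partial>lborel)"
proof -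
  have "(lborel :: (real^'d) measure) = distr lborel borel uminus"
    using lborel_affine[of "-1" "0 :: real^'d"] by (simp add: density_1)
  then have "(\<integral>\<^sup>+x. h x \<partial>lborel) = (\<integral>\<^sup>+x. h x \<partial>(distr lborel borel uminus))" by simp
  also have "\<dots> = (\<integral>\<^sup>+x. h (- x) \<partial>lborel)" by (rule nn_integral_distr) auto
  finally show ?thesis by simp
qed

text \<open>By Tonelli and translation invariance each displaced copy of \<open>G\<close> has the
  same integral. The result does not depend on \<open>r\<close>, which later allows summation over
  infinitely many scales.\<close>

lemma nn_integral_avg:
  fixes G :: "real^'d::finite \<Rightarrow> ennreal"
  assumes [measurable]: "G \<in> borel_measurable borel"
  shows "(\<integral>\<^sup>+x. avg r G x \<partial>lborel) = emeasure lborel (ball 0 2 :: (real^'d) set) * (\<integral>\<^sup>+x. G x \<partial>lborel)"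
proof -
  have p: "(\<integral>\<^sup>+x. path_int G x z \<partial>lborel) = (\<integral>\<^sup>+x. G x \<partial>lborel)" for z
  proof -
    have "(\<integral>\<^sup>+x. path_int G x z \<partial>lborel) = (\<integral>\<^sup>+t. \<integral>\<^sup>+x. G (x + t *\<^sub>R z) * indicator {0..1} t \<partial>lborel \<partial>lborel)"
      unfolding path_int_def by (rule lborel_pair.Fubini'[symmetric]) measurable
    also have "\<dots> = (\<integral>\<^sup>+t. (\<integral>\<^sup>+x. G x \<partial>lborel) * indicator {0..1::real} t \<partial>lborel)"
      by (intro nn_integral_cong) (simp add: nn_integral_multc nn_integral_lborel_shift)
    also have "\<dots> = (\<integral>\<^sup>+x. G x \<partial>lborel)" by (simp add: nn_integral_cmult)
    finally show ?thesis .
  qed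
  have "(\<integral>\<^sup>+x. avg r G x \<partial>lborel) = (\<integral>\<^sup>+y. \<integral>\<^sup>+x. path_int G x (r *\<^sub>R y) * indicator (ball 0 2) y \<partial>lborel \<partial>lborel)"
    unfolding avg_def by (rule lborel_pair.Fubini'[symmetric]) measurable
  also have "\<dots> = (\<integral>\<^sup>+y. (\<integral>\<^sup>+x. G x \<partial>lborel) * indicator (ball 0 2 :: (real^'d) set) y \<partial>lborel)"
    by (intro nn_integral_cong) (simp add: nn_integral_multc p)
  also have "\<dots> = emeasure lborel (ball 0 2 :: (real^'d) set) * (\<integral>\<^sup>+x. G x \<partial>lborel)"
    by (simp add: nn_integral_cmult mult.commute)
  finally show ?thesis .
qed

text \<open>The second path is the first one translated by \<open>- v\<close>; averaging over the bigger ball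
  absorbs the translation uniformly in \<open>v\<close>.\<close>
lemma avg_of_paths:
  fixes G :: "real^'d::finite \<Rightarrow> ennreal"
  assumes [measurable]: "G \<in> borel_measurable borel" and r: "0 < r" and v: "norm v \<le> r"
  shows "(\<integral>\<^sup>+y\<in>ball 0 1. (path_int G x (r *\<^sub>R y) + path_int G x (r *\<^sub>R y - v)) \<partial>lborel) \<le> 2 * avg r G x"
proof -
  have "(\<integral>\<^sup>+y\<in>ball 0 1. path_int G x (r *\<^sub>R y) \<partial>lborel) \<le> avg r G x"
    unfolding avg_def by (intro nn_integral_mono) (auto simp: indicator_def)
  moreover have "(\<integral>\<^sup>+y\<in>ball 0 1. path_int G x (r *\<^sub>R y - v) \<partial>lborel) \<le> avg r G x"
  proof -
    have "(\<integral>\<^sup>+y\<in>ball 0 1. path_int G x (r *\<^sub>R y - v) \<partial>lborel)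
       \<le> (\<integral>\<^sup>+y. path_int G x (r *\<^sub>R (y + - (v /\<^sub>R r))) * indicator (ball 0 2) (y + - (v /\<^sub>R r)) \<partial>lborel)"
    proof (rule nn_integral_mono)
      fix y :: "real^'d"
      have "norm (y - v /\<^sub>R r) \<le> norm y + norm v / r"
        using norm_triangle_ineq4[of y "v /\<^sub>R r"] r by (simp add: divide_inverse mult.commute)
      also have "norm v / r \<le> 1" using v r by simp
      finally have "norm y < 1 \<Longrightarrow> norm (y - v /\<^sub>R r) < 2" by simp
      then show "path_int G x (r *\<^sub>R y - v) * indicator (ball 0 1) y
         \<le> path_int G x (r *\<^sub>R (y + - (v /\<^sub>R r))) * indicator (ball 0 2) (y + - (v /\<^sub>R r))"
        using r by (auto simp: indicator_def scaleR_diff_right)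
    qed
    also have "\<dots> = avg r G x"
      unfolding avg_def by (rule nn_integral_lborel_shift[where h = "\<lambda>y. path_int G x (r *\<^sub>R y) * indicator (ball 0 2) y"]) measurable
    finally show ?thesis .
  qed
  ultimately have "(\<integral>\<^sup>+y\<in>ball 0 1. path_int G x (r *\<^sub>R y) \<partial>lborel) + (\<integral>\<^sup>+y\<in>ball 0 1. path_int G x (r *\<^sub>R y - v) \<partial>lborel) \<le> 2 * avg r G x"
    by (simp add: mult_2 add_mono)
  then show ?thesis by (simp add: distrib_right nn_integral_add)
qed

text \<open>\<open>X\<close> compares two fixed parameters and does not involve the intermediate
  point. Integrating over all \<open>y\<close> in the unit ball turns a bound valid for each choice
  of paths into a bound by the average.\<close>

lemma const_le_avg:
  fixes G :: "real^'d::finite \<Rightarrow> ennreal"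
  assumes [measurable]: "G \<in> borel_measurable borel" and r: "0 < r" and v: "norm v \<le> r"
    and X: "\<And>y. norm y < 1 \<Longrightarrow> X \<le> c * (path_int G x (r *\<^sub>R y) + path_int G x (r *\<^sub>R y - v))"
  shows "emeasure lborel (ball 0 1 :: (real^'d) set) * X \<le> 2 * c * avg r G x"
proof -
  have "emeasure lborel (ball 0 1 :: (real^'d) set) * X = (\<integral>\<^sup>+y\<in>ball 0 1. X \<partial>(lborel::(real^'d) measure))"
    by (subst nn_integral_cmult_indicator) (auto simp: mult.commute)
  also have "\<dots> \<le> (\<integral>\<^sup>+y. c * ((path_int G x (r *\<^sub>R y) + path_int G x (r *\<^sub>R y - v)) * indicator (ball 0 1) y) \<partial>lborel)"
    by (intro nn_integral_mono) (use X in \<open>auto simp: indicator_def\<close>)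
  also have "\<dots> = c * (\<integral>\<^sup>+y\<in>ball 0 1. (path_int G x (r *\<^sub>R y) + path_int G x (r *\<^sub>R y - v)) \<partial>lborel)"
    by (rule nn_integral_cmult) measurable
  also have "\<dots> \<le> c * (2 * avg r G x)" by (intro mult_left_mono avg_of_paths r v) auto
  finally show ?thesis by (simp add: mult_ac)
qed

text \<open>The variant for bounds that need the displacements \<open>y\<close> and
  \<open>- y\<close> together because a term odd in the displacement has to cancel.\<close>

lemma const_le_avg_sym:
  fixes G :: "real^'d::finite \<Rightarrow> ennreal"
  assumes [measurable]: "G \<in> borel_measurable borel" and r: "0 < r" and v: "norm v \<le> r"
    and X: "\<And>y. norm y < 1 \<Longrightarrow> X \<le> c * (path_int G x (r *\<^sub>R y) + path_int G x (r *\<^sub>R y - v)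
        + (path_int G x (r *\<^sub>R (- y)) + path_int G x (r *\<^sub>R (- y) - v)))"
  shows "emeasure lborel (ball 0 1 :: (real^'d) set) * X \<le> 4 * c * avg r G x"
proof -
  define Q where "Q y = (path_int G x (r *\<^sub>R y) + path_int G x (r *\<^sub>R y - v)) * indicator (ball 0 1) y" for y
  have [measurable]: "Q \<in> borel_measurable borel" unfolding Q_def by measurable
  have "emeasure lborel (ball 0 1 :: (real^'d) set) * X = (\<integral>\<^sup>+y\<in>ball 0 1. X \<partial>(lborel::(real^'d) measure))"
    by (subst nn_integral_cmult_indicator) (auto simp: mult.commute)
  also have "\<dots> \<le> (\<integral>\<^sup>+y. c * (Q y + Q (- y)) \<partial>lborel)"
    by (intro nn_integral_mono) (use X in \<open>auto simp: indicator_def Q_def\<close>)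
  also have "\<dots> = c * ((\<integral>\<^sup>+y. Q y \<partial>lborel) + (\<integral>\<^sup>+y. Q (- y) \<partial>lborel))"
    by (simp add: nn_integral_cmult nn_integral_add)
  also have "\<dots> = c * (2 * (\<integral>\<^sup>+y. Q y \<partial>lborel))" by (simp add: nn_integral_lborel_uminus mult_2)
  also have "\<dots> \<le> c * (2 * (2 * avg r G x))"
    unfolding Q_def by (intro mult_left_mono avg_of_paths r v) auto
  finally show ?thesis by (simp add: mult_ac)
qed

lemma two_avg_eq:
  fixes G :: "real^'d::finite \<Rightarrow> ennreal"
  assumes [measurable]: "G \<in> borel_measurable borel"
  shows "2 * avg r G x = (\<integral>\<^sup>+y\<in>ball 0 2. (path_int G x (r *\<^sub>R y) + path_int G x (- (r *\<^sub>R y))) \<partial>lborel)"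
proof -
  define Q where "Q y = path_int G x (r *\<^sub>R y) * indicator (ball 0 2) y" for y
  have [measurable]: "Q \<in> borel_measurable borel" unfolding Q_def by measurable
  have "2 * avg r G x = (\<integral>\<^sup>+y. Q y \<partial>lborel) + (\<integral>\<^sup>+y. Q (- y) \<partial>lborel)"
  proof -
    have "(\<integral>\<^sup>+y. Q (- y) \<partial>lborel) = (\<integral>\<^sup>+y. Q y \<partial>lborel)" by (rule nn_integral_lborel_uminus) measurable
    moreover have "(\<integral>\<^sup>+y. Q y \<partial>lborel) = avg r G x" by (simp only: Q_def avg_def)
    ultimately show ?thesis by (simp only: mult_2)
  qed
  also have "\<dots> = (\<integral>\<^sup>+y. Q y + Q (- y) \<partial>lborel)" by (simp add: nn_integral_add)
  also have "\<dots> = (\<integral>\<^sup>+y\<in>ball 0 2. (path_int G x (r *\<^sub>R y) + path_int G x (- (r *\<^sub>R y))) \<partial>lborel)"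
    by (intro nn_integral_cong) (auto simp: Q_def indicator_def)
  finally show ?thesis .
qed

section \<open>Differences and Taylor remainders along segments\<close>

locale mix_env =
  fixes f0 fs :: "real^'d::finite \<Rightarrow> real" and H0 H1 H2 H3 :: "real^'d \<Rightarrow> real"
    and \<Theta> :: "(real^'d) set" and n :: nat and ps :: "nat \<Rightarrow> real" and ts :: "nat \<Rightarrow> real^'d"
  assumes C3: "C_k 3 f0" and f0_pos: "\<And>x. 0 < f0 x"
    and meas [measurable]: "H0 \<in> borel_measurable borel" "H1 \<in> borel_measurable borel"
       "H2 \<in> borel_measurable borel" "H3 \<in> borel_measurable borel" "fs \<in> borel_measurable borel"
    and H_nonneg: "\<And>x. 0 \<le> H0 x" "\<And>x. 0 \<le> H1 x" "\<And>x. 0 \<le> H2 x" "\<And>x. 0 \<le> H3 x"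
    and fs_pos: "\<And>x. 0 < fs x"
    and b0: "\<And>x \<theta>. \<theta> \<in> \<Theta> \<Longrightarrow> f0 (x - \<theta>) \<le> H0 x * fs x"
    and b1: "\<And>x \<theta> i. \<theta> \<in> \<Theta> \<Longrightarrow> \<bar>partial_deriv i f0 (x - \<theta>)\<bar> \<le> H1 x * fs x"
    and b2: "\<And>x \<theta> i j. \<theta> \<in> \<Theta> \<Longrightarrow> \<bar>partial_deriv i (partial_deriv j f0) (x - \<theta>)\<bar> \<le> H2 x * fs x"
    and b3: "\<And>x \<theta> i j k. \<theta> \<in> \<Theta> \<Longrightarrow> \<bar>partial_deriv i (partial_deriv j (partial_deriv k f0)) (x - \<theta>)\<bar> \<le> H3 x * fs x"
    and fs_eq: "fs = mixture f0 n ps ts" and ts: "\<And>i. i < n \<Longrightarrow> ts i \<in> \<Theta>"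
    and ps: "\<And>i. i < n \<Longrightarrow> 0 \<le> ps i" "(\<Sum>i<n. ps i) = 1"
begin

lemma d1: "1 \<le> real CARD('d)" using one_le_card_finite[where 'a='d] by linarith

definition G :: "(real^'d \<Rightarrow> real) \<Rightarrow> real^'d \<Rightarrow> ennreal" where "G H x = ennreal (H x * fs x)"

lemma G_meas [measurable]: "H \<in> borel_measurable borel \<Longrightarrow> G H \<in> borel_measurable borel"
  unfolding G_def by (intro measurable_compose[OF _ measurable_ennreal] borel_measurable_times meas(5))

lemma C2: "C_k 2 f0" using C3 by (auto simp: eval_nat_numeral intro: differentiable_imp_continuous_on)
lemma C1: "C_k 1 f0" using C3 by (auto simp: eval_nat_numeral intro: differentiable_imp_continuous_on)
lemma C2d: "C_k 2 (dird a f0)" using C_k_dird[of 2 f0] C3 by (simp add: eval_nat_numeral)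
lemma C1d: "C_k 1 (dird a f0)" using C_k_dird[of 1 f0] C2 by (simp add: eval_nat_numeral)
lemma C1dd: "C_k 1 (dird a (dird b f0))" using C_k_dird[of 1 "dird b f0"] C2d by (simp add: eval_nat_numeral)

lemma ennreal_path_bound:
  fixes g :: "real^'d \<Rightarrow> real"
  assumes "\<bar>a\<bar> \<le> \<kappa> * (H x * fs x)" "0 \<le> \<kappa>"
  shows "ennreal \<bar>a\<bar> \<le> ennreal \<kappa> * G H x"
proof -
  have "ennreal \<bar>a\<bar> \<le> ennreal (\<kappa> * (H x * fs x))" using assms(1) by (rule ennreal_leI)
  also have "\<dots> = ennreal \<kappa> * G H x" unfolding G_def using assms(2) by (rule ennreal_mult')
  finally show ?thesis .
qed

text \<open>The point \<open>x - \<theta> + t *\<^sub>R z\<close> equals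
  \<open>(x + t *\<^sub>R z) - \<theta>\<close>, so the envelope at the space point
  \<open>x + t *\<^sub>R z\<close> applies with the parameter \<open>\<theta>\<close>
  unchanged.\<close>

lemma path1:
  assumes "\<theta> \<in> \<Theta>" "s \<in> {0..1}" "s' \<in> {0..1}"
  shows "ennreal \<bar>f0 (x - \<theta> + s *\<^sub>R z) - f0 (x - \<theta> + s' *\<^sub>R z)\<bar> \<le> ennreal (real CARD('d) * norm z) * path_int (G H1) x z"
proof (rule path_diff_le[OF C1 assms(2,3)])
  fix t :: real
  show "ennreal \<bar>dird z f0 (x - \<theta> + t *\<^sub>R z)\<bar> \<le> ennreal (real CARD('d) * norm z) * G H1 (x + t *\<^sub>R z)"
    using dird_bound1[of f0 "x - \<theta> + t *\<^sub>R z" "H1 (x + t *\<^sub>R z) * fs (x + t *\<^sub>R z)" z] b1[OF assms(1), of _ "x + t *\<^sub>R z"]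
    by (intro ennreal_path_bound) (auto simp: algebra_simps)
qed auto

lemma path2:
  assumes "\<theta> \<in> \<Theta>" "s \<in> {0..1}" "s' \<in> {0..1}"
  shows "ennreal \<bar>dird a f0 (x - \<theta> + s *\<^sub>R z) - dird a f0 (x - \<theta> + s' *\<^sub>R z)\<bar>
     \<le> ennreal (real CARD('d)^2 * (norm z * norm a)) * path_int (G H2) x z"
proof (rule path_diff_le[OF C1d assms(2,3)])
  fix t :: real
  show "ennreal \<bar>dird z (dird a f0) (x - \<theta> + t *\<^sub>R z)\<bar> \<le> ennreal (real CARD('d)^2 * (norm z * norm a)) * G H2 (x + t *\<^sub>R z)"
    using dird_bound2[OF C2, of "x - \<theta> + t *\<^sub>R z" "H2 (x + t *\<^sub>R z) * fs (x + t *\<^sub>R z)" z a] b2[OF assms(1), of _ _ "x + t *\<^sub>R z"]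
    by (intro ennreal_path_bound) (auto simp: algebra_simps)
qed auto

lemma path3:
  assumes "\<theta> \<in> \<Theta>" "s \<in> {0..1}" "s' \<in> {0..1}"
  shows "ennreal \<bar>dird a (dird b f0) (x - \<theta> + s *\<^sub>R z) - dird a (dird b f0) (x - \<theta> + s' *\<^sub>R z)\<bar>
     \<le> ennreal (real CARD('d)^3 * (norm z * norm a * norm b)) * path_int (G H3) x z"
proof (rule path_diff_le[OF C1dd assms(2,3)])
  fix t :: real
  show "ennreal \<bar>dird z (dird a (dird b f0)) (x - \<theta> + t *\<^sub>R z)\<bar> \<le> ennreal (real CARD('d)^3 * (norm z * norm a * norm b)) * G H3 (x + t *\<^sub>R z)"
    using dird_bound3[OF C3, of "x - \<theta> + t *\<^sub>R z" "H3 (x + t *\<^sub>R z) * fs (x + t *\<^sub>R z)" z a b] b3[OF assms(1), of _ _ _ "x + t *\<^sub>R z"]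
    by (intro ennreal_path_bound) (auto simp: algebra_simps)
qed auto

lemma real_of_ennreal_bound:
  assumes "ennreal \<bar>a\<bar> \<le> ennreal \<kappa> * ennreal k" "\<kappa> \<le> \<kappa>'" "0 \<le> \<kappa>" "0 \<le> k"
  shows "\<bar>a\<bar> \<le> \<kappa>' * k"
proof -
  have "ennreal \<bar>a\<bar> \<le> ennreal (\<kappa> * k)" using assms by (simp add: ennreal_mult)
  then have "\<bar>a\<bar> \<le> \<kappa> * k" using assms by (simp add: ennreal_le_iff)
  also have "\<dots> \<le> \<kappa>' * k" using assms by (intro mult_right_mono)
  finally show ?thesis .
qed

lemma finite_pathsI:
  assumes c: "0 < c"
    and fin: "\<And>k1 k2. 0 \<le> k1 \<Longrightarrow> 0 \<le> k2 \<Longrightarrow> A = ennreal k1 \<Longrightarrow> B = ennreal k2 \<Longrightarrow> X \<le> c * (k1 + k2)"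
  shows "ennreal X \<le> ennreal c * (A + B)"
proof (cases "A = top \<or> B = top")
  case True
  then have "ennreal c * (A + B) = top" using c by (auto simp: ennreal_mult_eq_top_iff)
  then show ?thesis by simp
next
  case False
  then obtain k1 k2 where k: "0 \<le> k1" "A = ennreal k1" "0 \<le> k2" "B = ennreal k2"
    by (cases A; cases B) auto
  have "ennreal X \<le> ennreal (c * (k1 + k2))" using fin[of k1 k2] k by (intro ennreal_leI) auto
  also have "\<dots> = ennreal c * (A + B)" using k c by (simp add: ennreal_mult)
  finally show ?thesis .
qed

text \<open>The second displacement \<open>z - (\<theta> - \<theta>')\<close>, which leads from
  \<open>x - \<theta>'\<close> to the common point, has norm at most \<open>2 * r\<close>; the first
  is at most \<open>r\<close>. One constant covers both.\<close>

lemma shift_diff_bound: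
  assumes \<theta>: "\<theta> \<in> \<Theta>" "\<theta>' \<in> \<Theta>" and r: "0 < r" "norm (\<theta> - \<theta>') \<le> r" "norm z \<le> r"
  shows "ennreal \<bar>f0 (x - \<theta>) - f0 (x - \<theta>')\<bar> \<le> ennreal (2 * real CARD('d) * r) * (path_int (G H1) x z + path_int (G H1) x (z - (\<theta> - \<theta>')))"
proof (rule finite_pathsI)
  show "0 < 2 * real CARD('d) * r" using r d1 by simp
  define z0 where "z0 = z - (\<theta> - \<theta>')"
  have nz0: "norm z0 \<le> 2 * r" using norm_triangle_ineq4[of z "\<theta> - \<theta>'"] r by (simp add: z0_def)
  fix k1 k2 assume k: "0 \<le> k1" "0 \<le> k2" and K: "path_int (G H1) x z = ennreal k1" "path_int (G H1) x (z - (\<theta> - \<theta>')) = ennreal k2"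
  have p: "x - \<theta>' + z0 = x - \<theta> + z" by (simp add: z0_def)
  have "\<bar>f0 (x - \<theta>) - f0 (x - \<theta> + z)\<bar> \<le> (2 * real CARD('d) * r) * k1"
    by (rule real_of_ennreal_bound[OF path1[OF \<theta>(1), of 0 1 x z, unfolded K, simplified]]) (use r k in \<open>auto intro: mult_mono\<close>)
  moreover have "\<bar>f0 (x - \<theta>' + z0) - f0 (x - \<theta>')\<bar> \<le> (2 * real CARD('d) * r) * k2"
    by (rule real_of_ennreal_bound[OF path1[OF \<theta>(2), of 1 0 x z0, unfolded K[folded z0_def], simplified]]) (use r k nz0 in \<open>auto intro: mult_mono\<close>)
  ultimately show "\<bar>f0 (x - \<theta>) - f0 (x - \<theta>')\<bar> \<le> 2 * real CARD('d) * r * (k1 + k2)"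
    unfolding p by (simp add: algebra_simps)
qed

text \<open>The function is expanded at the common point back to \<open>x - \<theta>\<close>, and at
  \<open>x - \<theta>'\<close> forward to the common point. After the derivative at the common point
  is moved to \<open>x - \<theta>'\<close>, the two directions differ exactly by
  \<open>\<theta> - \<theta>'\<close>.\<close>

lemma taylor_rem1_bound:
  assumes \<theta>: "\<theta> \<in> \<Theta>" "\<theta>' \<in> \<Theta>" and r: "0 < r" "norm (\<theta> - \<theta>') \<le> r" "norm z \<le> r"
  shows "ennreal \<bar>f0 (x - \<theta>) - f0 (x - \<theta>') + dird (\<theta> - \<theta>') f0 (x - \<theta>')\<bar>
    \<le> ennreal (8 * real CARD('d)^2 * r^2) * (path_int (G H2) x z + path_int (G H2) x (z - (\<theta> - \<theta>')))"
proof (rule finite_pathsI)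
  show "0 < 8 * real CARD('d)^2 * r^2" using r d1 by simp
  define z0 where "z0 = z - (\<theta> - \<theta>')"
  have nz0: "norm z0 \<le> 2 * r" using norm_triangle_ineq4[of z "\<theta> - \<theta>'"] r by (simp add: z0_def)
  fix k1 k2 assume k: "0 \<le> k1" "0 \<le> k2" and K: "path_int (G H2) x z = ennreal k1" "path_int (G H2) x (z - (\<theta> - \<theta>')) = ennreal k2"
  define p where "p = x - \<theta> + z"
  have p0: "x - \<theta>' + z0 = p" by (simp add: z0_def p_def)
  define c where "c = 4 * real CARD('d)^2 * r^2"
  have le: "real CARD('d)^2 * (norm u * norm w) \<le> c" if "norm u \<le> 2 * r" "norm w \<le> 2 * r" for u w :: "real^'d"
  proof -
    have "norm u * norm w \<le> (2 * r) * (2 * r)" using that r by (intro mult_mono) auto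
    then have "real CARD('d)^2 * (norm u * norm w) \<le> real CARD('d)^2 * ((2 * r) * (2 * r))" by (intro mult_left_mono) auto
    then show ?thesis by (simp add: c_def power2_eq_square mult_ac)
  qed
  have nz: "norm z \<le> 2 * r" using r by simp
  have e1: "\<bar>f0 (p + 1 *\<^sub>R (- z)) - f0 p - 1 * dird (- z) f0 p\<bar> \<le> c * k1"
  proof (rule taylor1[OF C1])
    fix s :: real assume s: "s \<in> {0..1}"
    have qq: "x - \<theta> + (1 - s) *\<^sub>R z = p + s *\<^sub>R (- z)" "x - \<theta> + 1 *\<^sub>R z = p" by (simp_all add: p_def algebra_simps)
    show "\<bar>dird (- z) f0 (p + s *\<^sub>R (- z)) - dird (- z) f0 p\<bar> \<le> c * k1"
      using real_of_ennreal_bound[OF path2[OF \<theta>(1), of "1 - s" 1 "- z" x z, unfolded K qq] le[of z "- z"]] s k nz by auto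
  qed auto
  have e2: "\<bar>f0 (x - \<theta>' + 1 *\<^sub>R z0) - f0 (x - \<theta>') - 1 * dird z0 f0 (x - \<theta>')\<bar> \<le> c * k2"
  proof (rule taylor1[OF C1])
    fix s :: real assume s: "s \<in> {0..1}"
    show "\<bar>dird z0 f0 (x - \<theta>' + s *\<^sub>R z0) - dird z0 f0 (x - \<theta>')\<bar> \<le> c * k2"
      using real_of_ennreal_bound[OF path2[OF \<theta>(2), of s 0 "z0" x z0, unfolded K[folded z0_def]] le[of z0 z0]] s k nz0 by auto
  qed auto
  have e3: "\<bar>dird z f0 p - dird z f0 (x - \<theta>')\<bar> \<le> c * k2"
    using real_of_ennreal_bound[OF path2[OF \<theta>(2), of 1 0 z x z0, unfolded K[folded z0_def]] le[of z0 z]] k nz nz0 p0 by auto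
  have e4: "dird z0 f0 (x - \<theta>') - dird z f0 (x - \<theta>') = - dird (\<theta> - \<theta>') f0 (x - \<theta>')"
    unfolding z0_def by (simp only: dird_lin)
  have "\<bar>f0 (x - \<theta>) - f0 (x - \<theta>') + dird (\<theta> - \<theta>') f0 (x - \<theta>')\<bar> \<le> c * k1 + 2 * (c * k2)"
    using e1 e2 e3 e4 unfolding p0[symmetric] by (simp add: dird_lin p0 p_def) 
  also have "\<dots> \<le> 8 * real CARD('d)^2 * r^2 * (k1 + k2)"
    using k by (simp add: c_def algebra_simps)
  finally show "\<bar>f0 (x - \<theta>) - f0 (x - \<theta>') + dird (\<theta> - \<theta>') f0 (x - \<theta>')\<bar> \<le> 8 * real CARD('d)^2 * r^2 * (k1 + k2)" .
qed

definition rem2 :: "real^'d \<Rightarrow> real^'d \<Rightarrow> real^'d \<Rightarrow> real" where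
  "rem2 \<theta> \<theta>' x = f0 (x - \<theta>) - f0 (x - \<theta>') + dird (\<theta> - \<theta>') f0 (x - \<theta>')
     - dird (\<theta> - \<theta>') (dird (\<theta> - \<theta>') f0) (x - \<theta>') / 2"

text \<open>The commutator term, which vanishes by symmetry of second derivatives, is odd in \<open>z\<close> and
  cancels below when \<open>z\<close> is averaged with \<open>- z\<close>; so no symmetry theorem is needed.\<close>
lemma rem2_half_path_bound:
  fixes z :: "real^'d"
  assumes \<theta>: "\<theta> \<in> \<Theta>" "\<theta>' \<in> \<Theta>" and r: "0 < r" "norm (\<theta> - \<theta>') \<le> r" "norm z \<le> r"
  shows "ennreal \<bar>rem2 \<theta> \<theta>' x - (dird (\<theta> - \<theta>') (dird z f0) (x - \<theta>') - dird z (dird (\<theta> - \<theta>') f0) (x - \<theta>')) / 2\<bar>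
    \<le> ennreal (16 * real CARD('d)^3 * r^3) * (path_int (G H3) x z + path_int (G H3) x (z - (\<theta> - \<theta>')))"
proof (rule finite_pathsI)
  show "0 < 16 * real CARD('d)^3 * r^3" using r d1 by simp
  define v where "v = \<theta> - \<theta>'"
  define z0 where "z0 = z - v"
  have nz0: "norm z0 \<le> 2 * r" using norm_triangle_ineq4[of z v] r by (simp add: z0_def v_def)
  fix k1 k2 assume k: "0 \<le> k1" "0 \<le> k2" and K: "path_int (G H3) x z = ennreal k1" "path_int (G H3) x (z - (\<theta> - \<theta>')) = ennreal k2"
  note K2 = K(2)[folded v_def, folded z0_def]
  define p where "p = x - \<theta> + z"
  define y where "y = x - \<theta>'"
  have p0: "y + z0 = p" by (simp add: z0_def p_def v_def y_def)
  have py: "p - z = x - \<theta>" by (simp add: p_def)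
  define c where "c = 8 * real CARD('d)^3 * r^3"
  have le: "real CARD('d)^3 * (norm u * norm w * norm w') \<le> c" if "norm u \<le> 2 * r" "norm w \<le> 2 * r" "norm w' \<le> 2 * r" for u w w' :: "real^'d"
  proof -
    have "norm u * norm w * norm w' \<le> (2 * r) * (2 * r) * (2 * r)" using that r by (intro mult_mono) auto
    then have "real CARD('d)^3 * (norm u * norm w * norm w') \<le> real CARD('d)^3 * ((2 * r) * (2 * r) * (2 * r))" by (intro mult_left_mono) auto
    then show ?thesis by (simp add: c_def power3_eq_cube mult_ac)
  qed
  have nz: "norm z \<le> 2 * r" using r by simp
  have e1: "\<bar>f0 (p + (- z)) - f0 p - dird (- z) f0 p - dird (- z) (dird (- z) f0) p / 2\<bar> \<le> c * k1 / 2"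
  proof (rule taylor2[OF C2])
    fix s :: real assume s: "s \<in> {0..1}"
    have qq: "x - \<theta> + (1 - s) *\<^sub>R z = p + s *\<^sub>R (- z)" "x - \<theta> + 1 *\<^sub>R z = p" by (simp_all add: p_def algebra_simps)
    show "\<bar>dird (- z) (dird (- z) f0) (p + s *\<^sub>R (- z)) - dird (- z) (dird (- z) f0) p\<bar> \<le> c * k1"
      using real_of_ennreal_bound[OF path3[OF \<theta>(1), of "1 - s" 1 "- z" "- z" x z, unfolded K qq] le[of z "- z" "- z"]] s k nz by auto
  qed
  have e2: "\<bar>f0 (y + z0) - f0 y - dird z0 f0 y - dird z0 (dird z0 f0) y / 2\<bar> \<le> c * k2 / 2"
  proof (rule taylor2[OF C2])
    fix s :: real assume s: "s \<in> {0..1}"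
    show "\<bar>dird z0 (dird z0 f0) (y + s *\<^sub>R z0) - dird z0 (dird z0 f0) y\<bar> \<le> c * k2"
      using real_of_ennreal_bound[OF path3[OF \<theta>(2), of s 0 z0 z0 x z0, unfolded K2] le[of z0 z0 z0]] s k nz0 by (auto simp: y_def)
  qed
  have e3: "\<bar>dird z f0 (y + 1 *\<^sub>R z0) - dird z f0 y - 1 * dird z0 (dird z f0) y\<bar> \<le> c * k2"
  proof (rule taylor1[OF C1d])
    fix s :: real assume s: "s \<in> {0..1}"
    show "\<bar>dird z0 (dird z f0) (y + s *\<^sub>R z0) - dird z0 (dird z f0) y\<bar> \<le> c * k2"
      using real_of_ennreal_bound[OF path3[OF \<theta>(2), of s 0 z0 z x z0, unfolded K2] le[of z0 z0 z]] s k nz nz0 by (auto simp: y_def)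
  qed auto
  have e4: "\<bar>dird z (dird z f0) (y + 1 *\<^sub>R z0) - dird z (dird z f0) (y + 0 *\<^sub>R z0)\<bar> \<le> c * k2"
    using real_of_ennreal_bound[OF path3[OF \<theta>(2), of 1 0 z z x z0, unfolded K2] le[of z0 z z]] k nz nz0 by (auto simp: y_def)
  \<comment> \<open>Everything is rewritten at \<open>y\<close> by linearity in the direction. In
    the sum of the four estimates all terms in \<open>z\<close> alone cancel, and of the mixed
    second derivatives only half the commutator survives.\<close>
  have D: "dird z0 f0 y = dird z f0 y - dird v f0 y" by (simp add: z0_def dird_lin)
  have B0: "dird z0 (dird z0 f0) y = dird z (dird z f0) y - dird z (dird v f0) y - dird v (dird z f0) y + dird v (dird v f0) y"
    by (simp add: z0_def dird_bilin[OF C2])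
  have B1: "dird z0 (dird z f0) y = dird z (dird z f0) y - dird v (dird z f0) y"
    by (simp add: z0_def dird_bilin[OF C2])
  have B2: "dird (- z) (dird (- z) f0) p = dird z (dird z f0) p" "dird (- z) f0 p = - dird z f0 p"
    by (simp_all add: dird_lin dird_bilin[OF C2])
  have R: "rem2 \<theta> \<theta>' x = f0 (p - z) - f0 y + dird v f0 y - dird v (dird v f0) y / 2"
    by (simp add: rem2_def v_def y_def py)
  have e1': "\<bar>f0 (p - z) - f0 p + dird z f0 p - dird z (dird z f0) p / 2\<bar> \<le> c * k1 / 2"
    using e1 by (simp add: B2)
  have e2': "\<bar>f0 p - f0 y - (dird z f0 y - dird v f0 y)
      - (dird z (dird z f0) y - dird z (dird v f0) y - dird v (dird z f0) y + dird v (dird v f0) y) / 2\<bar> \<le> c * k2 / 2"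
    using e2 unfolding p0 D B0 .
  have e3': "\<bar>dird z f0 p - dird z f0 y - (dird z (dird z f0) y - dird v (dird z f0) y)\<bar> \<le> c * k2"
    using e3 by (simp add: p0 B1)
  have e4': "\<bar>dird z (dird z f0) p - dird z (dird z f0) y\<bar> \<le> c * k2" using e4 by (simp add: p0)
  have "\<bar>rem2 \<theta> \<theta>' x - (dird v (dird z f0) y - dird z (dird v f0) y) / 2\<bar> \<le> c * k1 / 2 + c * k2 / 2 + c * k2 + c * k2 / 2"
  proof -
    have tri: "\<bar>a + b - e + g / 2\<bar> \<le> A + B + E + Q / 2"
      if "\<bar>a\<bar> \<le> A" "\<bar>b\<bar> \<le> B" "\<bar>e\<bar> \<le> E" "\<bar>g\<bar> \<le> Q" for a b e g A B E Q :: real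
      using that by linarith
    show ?thesis unfolding R by (rule order_trans[OF eq_refl tri[OF e1' e2' e3' e4']]) (simp add: field_simps)
  qed
  also have "\<dots> \<le> 2 * (c * k1) + 2 * (c * k2)"
    using k r d1 by (auto simp: c_def)
  also have "\<dots> = 16 * real CARD('d)^3 * r^3 * (k1 + k2)" by (simp add: c_def algebra_simps)
  finally show "\<bar>rem2 \<theta> \<theta>' x - (dird (\<theta> - \<theta>') (dird z f0) (x - \<theta>') - dird z (dird (\<theta> - \<theta>') f0) (x - \<theta>')) / 2\<bar>
     \<le> 16 * real CARD('d)^3 * r^3 * (k1 + k2)" by (simp add: v_def y_def)
qed

lemma rem2_path_bound:
  assumes \<theta>: "\<theta> \<in> \<Theta>" "\<theta>' \<in> \<Theta>" and r: "0 < r" "norm (\<theta> - \<theta>') \<le> r" "norm z \<le> r"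
  shows "ennreal \<bar>rem2 \<theta> \<theta>' x\<bar> \<le> ennreal (16 * real CARD('d)^3 * r^3) * (path_int (G H3) x z + path_int (G H3) x (z - (\<theta> - \<theta>'))
     + (path_int (G H3) x (- z) + path_int (G H3) x (- z - (\<theta> - \<theta>'))))"
proof -
  let ?c = "\<lambda>z. (dird (\<theta> - \<theta>') (dird z f0) (x - \<theta>') - dird z (dird (\<theta> - \<theta>') f0) (x - \<theta>')) / 2"
  have "?c (- z) = - ?c z" by (simp only: dird_bilin(3,4)[OF C2]) (simp add: field_simps)
  then have "\<bar>rem2 \<theta> \<theta>' x\<bar> \<le> \<bar>rem2 \<theta> \<theta>' x - ?c z\<bar> + \<bar>rem2 \<theta> \<theta>' x - ?c (- z)\<bar>" by linarith
  then have "ennreal \<bar>rem2 \<theta> \<theta>' x\<bar> \<le> ennreal \<bar>rem2 \<theta> \<theta>' x - ?c z\<bar> + ennreal \<bar>rem2 \<theta> \<theta>' x - ?c (- z)\<bar>"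
    by (simp add: ennreal_plus[symmetric] del: ennreal_plus)
  also have "\<dots> \<le> ennreal (16 * real CARD('d)^3 * r^3) * (path_int (G H3) x z + path_int (G H3) x (z - (\<theta> - \<theta>')))
     + ennreal (16 * real CARD('d)^3 * r^3) * (path_int (G H3) x (- z) + path_int (G H3) x (- z - (\<theta> - \<theta>')))"
    using r by (intro add_mono rem2_half_path_bound \<theta>) auto
  finally show ?thesis by (simp add: distrib_left)
qed

end

section \<open>Scalar inequalities for interpolation\<close>

text \<open>Young inequalities for all \<open>\<kappa>\<close> amount to Cauchy-Schwarz. The choice
  \<open>\<kappa> = R / (2 * A)\<close> absorbs half of \<open>R\<close> and, unlike the minimizer,
  remains positive when \<open>B = 0\<close>.\<close>

lemma le_opt_sq:
  fixes R A B :: real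
  assumes "0 < A" "0 \<le> B" "0 \<le> R" "\<And>\<kappa>. 0 < \<kappa> \<Longrightarrow> R \<le> A * \<kappa> + B / \<kappa>"
  shows "R^2 \<le> 4 * A * B"
proof (cases "R = 0")
  case False
  then have R: "0 < R" using assms by simp
  have "R \<le> A * (R / (2 * A)) + B / (R / (2 * A))" using R assms(1) by (intro assms(4)) simp
  also have "\<dots> = R / 2 + 2 * A * B / R" using R assms(1) by (simp add: field_simps)
  finally have "R / 2 \<le> 2 * A * B / R" by simp
  then show ?thesis using R by (simp add: field_simps power2_eq_square)
qed (use assms in auto)

text \<open>A Chebyshev argument at the level \<open>l\<close>: as long as
  \<open>R \<le> l * a\<close>, the bounds \<open>l * a\<close> and \<open>B * P\<close> are
  multiplied; otherwise \<open>l < E\<close>, and the factor \<open>(E / l)^2\<close> may be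
  inserted so that the fourth power of \<open>E\<close> takes over.\<close>

lemma two_bounds_sq:
  fixes R a P E c B l :: real
  assumes "0 < a" "0 \<le> P" "0 < l" "0 \<le> R" "R \<le> E * a" "E^4 * a \<le> c * P" "R \<le> B * P" "0 \<le> c" "0 \<le> B" "0 \<le> E"
  shows "R^2 \<le> a * P * (l * B + c / l^2)"
proof (cases "R \<le> l * a")
  case True
  have "R^2 \<le> (l * a) * (B * P)" unfolding power2_eq_square using assms True by (intro mult_mono) auto
  also have "\<dots> \<le> a * P * (l * B + c / l^2)" using assms by (simp add: algebra_simps)
  finally show ?thesis .
next
  case False
  then have "l * a < E * a" using assms(5) by linarith
  then have lE: "l \<le> E" using assms(1) by simp
  have "R^2 \<le> (E * a)^2" using assms by (intro power_mono) auto
  also have "\<dots> \<le> (E * a)^2 * (E / l)^2"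
  proof -
    have "1 \<le> E / l" using lE assms by simp
    then have "1 \<le> (E / l)^2" by (rule one_le_power)
    then show ?thesis using mult_left_mono[of 1 "(E/l)^2" "(E * a)^2"] by simp
  qed
  also have "\<dots> = a * (E^4 * a) / l^2" by (simp add: power_divide power_mult_distrib power2_eq_square eval_nat_numeral)
  also have "\<dots> \<le> a * (c * P) / l^2" using assms by (intro divide_right_mono mult_left_mono) auto
  also have "\<dots> \<le> a * P * (l * B + c / l^2)" using assms by (simp add: algebra_simps)
  finally show ?thesis .
qed

lemma young2:
  fixes t k :: real
  assumes "0 < k" "0 \<le> t"
  shows "t \<le> k + t^2 / k"
proof (cases "t \<le> k")
  case True
  then show ?thesis using assms by (simp add: add_increasing2)
next
  case False
  then have "t * k \<le> t * t" using assms by (intro mult_left_mono) auto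
  then have "t \<le> t^2 / k" using assms by (simp add: field_simps power2_eq_square)
  then show ?thesis using assms by linarith
qed

lemma young4:
  fixes t k :: real
  assumes "0 < k" "0 \<le> t"
  shows "t \<le> k + t^4 / k^3"
proof (cases "t \<le> k")
  case True
  then show ?thesis using assms by (simp add: add_increasing2)
next
  case False
  then have "t * k^3 \<le> t * t^3" using assms by (intro mult_left_mono power_mono) auto
  then have "t \<le> t^4 / k^3" using assms by (simp add: field_simps eval_nat_numeral)
  then show ?thesis using assms by linarith
qed

lemma sq_le_one_plus_fourth: "t^2 \<le> 1 + t^4" for t :: real
proof -
  have "0 \<le> (t^2 - 1)^2" by simp
  then have "2 * t^2 \<le> 1 + t^4" by (simp add: power2_diff power_mult[symmetric])
  then show ?thesis by (smt (verit) zero_le_power2)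
qed

lemma power4_sum3: "(a + b + c)^4 \<le> 27 * (a^4 + b^4 + c^4)" for a b c :: real
proof -
  have sq: "(a + b + c)^2 \<le> 3 * (a^2 + b^2 + c^2)" for a b c :: real
  proof -
    have "0 \<le> (a - b)^2 + (b - c)^2 + (a - c)^2" by simp
    then show ?thesis by (simp add: power2_eq_square algebra_simps)
  qed
  have "(a + b + c)^4 = ((a + b + c)^2)^2" by (simp add: power_mult[symmetric])
  also have "\<dots> \<le> (3 * (a^2 + b^2 + c^2))^2" by (intro power_mono sq) auto
  also have "\<dots> = 9 * (a^2 + b^2 + c^2)^2" by (simp only: power_mult_distrib) simp
  also have "\<dots> \<le> 9 * (3 * ((a^2)^2 + (b^2)^2 + (c^2)^2))" by (intro mult_left_mono sq) auto
  finally show ?thesis by (simp add: power_mult[symmetric])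
qed

text \<open>\<open>V1\<close>, \<open>V2\<close> and \<open>dm\<close> are parameters so that the constants defined below depend on them only, and
  in particular not on \<open>\<Theta>\<close>.\<close>
locale mix_env_vol = mix_env f0 fs H0 H1 H2 H3 \<Theta> n ps ts
  for f0 fs :: "real^'d::finite \<Rightarrow> real" and H0 H1 H2 H3 \<Theta> n ps ts +
  fixes V1 V2 dm :: real
  assumes V1: "emeasure lborel (ball (0::real^'d) 1) = ennreal V1" "0 < V1"
    and V2: "emeasure lborel (ball (0::real^'d) 2) = ennreal V2" "0 < V2"
    and dm: "dm = real CARD('d)"
begin

lemma dm1: "1 \<le> dm" using d1 dm by simp

section \<open>Pointwise bounds at one scale\<close>

text \<open>A common majorant of all moments, so that every Young inequality below ends in the same
  average \<open>avg r (G W)\<close>; the summand 1 lets it dominate the density \<open>fs\<close>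
  as well.\<close>

definition W :: "real^'d \<Rightarrow> real" where "W x = 1 + (H0 x)^4 + (H1 x)^4 + (H2 x)^4 + (H3 x)^2"

lemma W_meas [measurable]: "W \<in> borel_measurable borel"
  unfolding W_def using meas by (intro borel_measurable_add borel_measurable_power borel_measurable_const)

lemma W_ge: "1 \<le> W x" "(H0 x)^4 \<le> W x" "(H1 x)^4 \<le> W x" "(H2 x)^4 \<le> W x" "(H3 x)^2 \<le> W x"
  "(H0 x)^2 \<le> W x" "(H1 x)^2 \<le> W x" "(H2 x)^2 \<le> W x"
proof -
  have "0 \<le> (H0 x)^4" "0 \<le> (H1 x)^4" "0 \<le> (H2 x)^4" "0 \<le> (H3 x)^2" by simp_all
  then show "1 \<le> W x" "(H0 x)^4 \<le> W x" "(H1 x)^4 \<le> W x" "(H2 x)^4 \<le> W x" "(H3 x)^2 \<le> W x"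
     "(H0 x)^2 \<le> W x" "(H1 x)^2 \<le> W x" "(H2 x)^2 \<le> W x"
    using sq_le_one_plus_fourth[of "H0 x"] sq_le_one_plus_fourth[of "H1 x"] sq_le_one_plus_fourth[of "H2 x"]
    unfolding W_def by linarith+
qed

lemma avg_young:
  assumes [measurable]: "H \<in> borel_measurable borel" and H: "\<And>x. 0 \<le> H x" "\<And>x. H x \<le> \<kappa> + \<beta> * W x"
    and "0 \<le> \<kappa>" "0 \<le> \<beta>" and F: "avg r (G (\<lambda>_. 1)) x = ennreal F" "0 \<le> F" and Q: "avg r (G W) x = ennreal Q" "0 \<le> Q"
  shows "avg r (G H) x \<le> ennreal (\<kappa> * F + \<beta> * Q)"
proof -
  have "avg r (G H) x \<le> avg r (\<lambda>x. ennreal \<kappa> * G (\<lambda>_. 1) x + ennreal \<beta> * G W x) x"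
  proof (rule avg_mono)
    fix x
    have "H x * fs x \<le> (\<kappa> + \<beta> * W x) * fs x" using H fs_pos[of x] by (intro mult_right_mono) auto
    then have "G H x \<le> ennreal (\<kappa> * (1 * fs x) + \<beta> * (W x * fs x))"
      unfolding G_def by (intro ennreal_leI) (simp add: algebra_simps)
    also have "\<dots> = ennreal \<kappa> * G (\<lambda>_. 1) x + ennreal \<beta> * G W x"
      unfolding G_def using assms fs_pos[of x] W_ge(1)[of x] by (simp add: ennreal_plus ennreal_mult)
    finally show "G H x \<le> ennreal \<kappa> * G (\<lambda>_. 1) x + ennreal \<beta> * G W x" .
  qed
  also have "\<dots> = ennreal \<kappa> * avg r (G (\<lambda>_. 1)) x + ennreal \<beta> * avg r (G W) x"
    by (rule avg_lincomb) (auto intro: G_meas W_meas)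
  also have "\<dots> = ennreal (\<kappa> * F + \<beta> * Q)" using assms by (simp add: ennreal_plus ennreal_mult)
  finally show ?thesis .
qed

text \<open>Adding the values at \<open>x + t *\<^sub>R z\<close> and
  \<open>x - t *\<^sub>R z\<close> cancels the first order terms of each translate, so only second
  derivatives enter the comparison of \<open>fs\<close> with its value at \<open>x\<close>.\<close>

lemma path_fs:
  assumes r: "0 < r" "norm z \<le> 2 * r"
  shows "path_int (G (\<lambda>_. 1)) x z + path_int (G (\<lambda>_. 1)) x (- z)
     \<le> 2 * ennreal (fs x) + ennreal (4 * dm^2 * r^2) * (path_int (G H2) x z + path_int (G H2) x (- z))"
proof (cases "path_int (G H2) x z = top \<or> path_int (G H2) x (- z) = top")
  case True
  then have "ennreal (4 * dm^2 * r^2) * (path_int (G H2) x z + path_int (G H2) x (- z)) = top"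
    using r dm1 by (auto simp: ennreal_mult_eq_top_iff)
  then show ?thesis by simp
next
  case False
  then obtain k1 k2 where k: "0 \<le> k1" "path_int (G H2) x z = ennreal k1" "0 \<le> k2" "path_int (G H2) x (- z) = ennreal k2"
    by (cases "path_int (G H2) x z"; cases "path_int (G H2) x (- z)") auto
  define c where "c = 4 * dm^2 * r^2"
  have c0: "0 \<le> c" by (simp add: c_def)
  have le: "real CARD('d)^2 * (norm z * norm z) \<le> c"
  proof -
    have "norm z * norm z \<le> (2 * r) * (2 * r)" using r by (intro mult_mono) auto
    then have "real CARD('d)^2 * (norm z * norm z) \<le> real CARD('d)^2 * ((2 * r) * (2 * r))" by (intro mult_left_mono) auto
    then show ?thesis by (simp add: c_def dm power2_eq_square mult_ac)
  qed
  have one: "f0 (x + t *\<^sub>R z - ts i) + f0 (x - t *\<^sub>R z - ts i) \<le> 2 * f0 (x - ts i) + c * (k1 + k2)" if i: "i < n" and t: "t \<in> {0..1}" for i t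
  proof -
    have "\<bar>f0 (x - ts i + t *\<^sub>R z) - f0 (x - ts i) - t * dird z f0 (x - ts i)\<bar> \<le> c * k1"
    proof (rule taylor1[OF C1])
      fix s :: real assume s: "s \<in> {0..1}"
      show "\<bar>dird z f0 (x - ts i + s *\<^sub>R z) - dird z f0 (x - ts i)\<bar> \<le> c * k1"
        using real_of_ennreal_bound[OF path2[OF ts[OF i], of s 0 z x z, unfolded k] le] s k by auto
    qed (use t in auto)
    moreover have "\<bar>f0 (x - ts i + t *\<^sub>R (- z)) - f0 (x - ts i) - t * dird (- z) f0 (x - ts i)\<bar> \<le> c * k2"
    proof (rule taylor1[OF C1])
      fix s :: real assume s: "s \<in> {0..1}"
      show "\<bar>dird (- z) f0 (x - ts i + s *\<^sub>R (- z)) - dird (- z) f0 (x - ts i)\<bar> \<le> c * k2"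
        using real_of_ennreal_bound[OF path2[OF ts[OF i], of s 0 "- z" x "- z", unfolded k]] le s k by auto
    qed (use t in auto)
    moreover have "x - ts i + t *\<^sub>R z = x + t *\<^sub>R z - ts i" "x - ts i + t *\<^sub>R (- z) = x - t *\<^sub>R z - ts i" by simp_all
    ultimately show ?thesis by (simp add: dird_lin algebra_simps abs_le_iff)
  qed
  have all: "fs (x + t *\<^sub>R z) + fs (x + t *\<^sub>R (- z)) \<le> 2 * fs x + c * (k1 + k2)" if t: "t \<in> {0..1}" for t
  proof -
    have "fs (x + t *\<^sub>R z) + fs (x + t *\<^sub>R (- z)) = (\<Sum>i<n. ps i * (f0 (x + t *\<^sub>R z - ts i) + f0 (x - t *\<^sub>R z - ts i)))"
      by (simp add: fs_eq mixture_def shifted_def sum.distrib distrib_left)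
    also have "\<dots> \<le> (\<Sum>i<n. ps i * (2 * f0 (x - ts i) + c * (k1 + k2)))"
      using ps(1) t by (intro sum_mono mult_left_mono one) auto
    also have "\<dots> = 2 * fs x + c * (k1 + k2)"
    proof -
      have "(\<Sum>i<n. ps i * (2 * f0 (x - ts i) + K)) = 2 * fs x + K * (\<Sum>i<n. ps i)" for K
        by (simp add: fs_eq mixture_def shifted_def sum.distrib distrib_left sum_distrib_left mult_ac)
      then show ?thesis using ps(2) by simp
    qed
    finally show ?thesis .
  qed
  have [measurable]: "fs \<in> borel_measurable borel" by (rule meas(5))
  have "path_int (G (\<lambda>_. 1)) x z + path_int (G (\<lambda>_. 1)) x (- z)
      = (\<integral>\<^sup>+t. ennreal (fs (x + t *\<^sub>R z)) * indicator {0..1} t + ennreal (fs (x + t *\<^sub>R (- z))) * indicator {0..1} t \<partial>lborel)"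
    unfolding path_int_def G_def by (subst nn_integral_add) auto
  also have "\<dots> \<le> (\<integral>\<^sup>+t\<in>{0..1::real}. ennreal (2 * fs x + c * (k1 + k2)) \<partial>lborel)"
  proof (rule nn_integral_mono)
    fix t :: real
    show "ennreal (fs (x + t *\<^sub>R z)) * indicator {0..1} t + ennreal (fs (x + t *\<^sub>R (- z))) * indicator {0..1} t
      \<le> ennreal (2 * fs x + c * (k1 + k2)) * indicator {0..1} t"
      using all[of t] fs_pos[of "x + t *\<^sub>R z"] fs_pos[of "x + t *\<^sub>R (- z)"]
      by (auto simp: indicator_def ennreal_plus[symmetric] simp del: ennreal_plus intro!: ennreal_leI)
  qed
  also have "\<dots> = ennreal (2 * fs x + c * (k1 + k2))" by (simp add: nn_integral_cmult_indicator)
  also have "\<dots> = 2 * ennreal (fs x) + ennreal c * (ennreal k1 + ennreal k2)"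
    using c0 k fs_pos[of x] by (simp add: ennreal_plus ennreal_mult less_imp_le)
  finally show ?thesis using k by (simp add: c_def)
qed

lemma avg_fs_le:
  assumes r: "0 < r"
  shows "avg r (G (\<lambda>_. 1)) x \<le> ennreal (V2 * fs x) + ennreal (4 * dm^2 * r^2) * avg r (G H2) x"
proof -
  have [measurable]: "fs \<in> borel_measurable borel" by (rule meas(5))
  have [measurable]: "G H2 \<in> borel_measurable borel" "G (\<lambda>_. 1) \<in> borel_measurable borel" by (auto intro: G_meas meas)
  have "2 * avg r (G (\<lambda>_. 1)) x \<le> (\<integral>\<^sup>+y\<in>ball 0 2. (2 * ennreal (fs x) + ennreal (4 * dm^2 * r^2) * (path_int (G H2) x (r *\<^sub>R y) + path_int (G H2) x (- (r *\<^sub>R y)))) \<partial>lborel)"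
    unfolding two_avg_eq[OF \<open>G (\<lambda>_. 1) \<in> _\<close>]
  proof (rule nn_integral_mono)
    fix y :: "real^'d"
    have "norm (r *\<^sub>R y) \<le> 2 * r" if "norm y < 2" using that r by (simp add: mult.commute)
    then show "(path_int (G (\<lambda>_. 1)) x (r *\<^sub>R y) + path_int (G (\<lambda>_. 1)) x (- (r *\<^sub>R y))) * indicator (ball 0 2) y
       \<le> (2 * ennreal (fs x) + ennreal (4 * dm^2 * r^2) * (path_int (G H2) x (r *\<^sub>R y) + path_int (G H2) x (- (r *\<^sub>R y)))) * indicator (ball 0 2) y"
      using path_fs[OF r, of "r *\<^sub>R y" x] by (auto simp: indicator_def)
  qed
  also have "\<dots> = (\<integral>\<^sup>+y. (2 * ennreal (fs x)) * indicator (ball 0 2) y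
      + ennreal (4 * dm^2 * r^2) * ((path_int (G H2) x (r *\<^sub>R y) + path_int (G H2) x (- (r *\<^sub>R y))) * indicator (ball 0 2) y) \<partial>lborel)"
    by (intro nn_integral_cong) (auto simp: indicator_def)
  also have "\<dots> = 2 * ennreal (fs x) * ennreal V2 + ennreal (4 * dm^2 * r^2) * (2 * avg r (G H2) x)"
    unfolding two_avg_eq[OF \<open>G H2 \<in> _\<close>]
    by (subst nn_integral_add) (auto simp: nn_integral_cmult nn_integral_cmult_indicator V2 simp del: borel_open)
  also have "\<dots> = 2 * (ennreal (V2 * fs x) + ennreal (4 * dm^2 * r^2) * avg r (G H2) x)"
    using V2 fs_pos[of x] by (simp add: ennreal_mult distrib_left mult_ac less_imp_le)
  finally show ?thesis by (subst (asm) ennreal_mult_le_mult_iff) auto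
qed

text \<open>Twice the coefficient \<open>4 * dm^2 * (8 * dm^2)^3\<close> that remains in
  \<open>avg_fs_real_le\<close>; the doubling comes from absorbing half of the mean.\<close>

definition cF :: real where "cF = 8^4 * dm^8"

text \<open>\<open>cA\<close> and \<open>cB\<close> add up the constants of the two cases in
  \<open>osc_bound\<close> and \<open>rem2_bound\<close>. The number \<open>432 = 16 * 27\<close> in
  \<open>cB\<close> is the cost of a fourth power of twice a sum of three terms.\<close>

definition cA :: real where "cA = 16 * (4 * dm / V1)^2 * V2 + (4 * dm / V1) * (2 * cF + 1) + 1"

definition c2 :: real where "c2 = (16 * dm^2 / V1) * (2 * cF + 1) + dm^2 * (cF / (2 * V2) + 1)"
definition cB :: real where "cB = 16 * (64 * dm^3 / V1)^2 * V2 + c2 + 432 * dm^8"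

lemma cF0: "0 \<le> cF" by (simp add: cF_def)

text \<open>Bounds along paths produce the average \<open>Q\<close>, bounds at \<open>x\<close>
  itself produce \<open>W x * fs x\<close>. The integrals of both are controlled by that of
  \<open>G W\<close>.\<close>

definition Pf where "Pf x Q = Q + W x * fs x"

context
  fixes r x Q
  assumes r: "0 < r" "r \<le> 1" and Q: "avg r (G W) x = ennreal Q" "0 \<le> Q"
begin

definition F where "F = enn2real (avg r (G (\<lambda>_. 1)) x)"

lemma F: "avg r (G (\<lambda>_. 1)) x = ennreal F" "0 \<le> F"
proof -
  have "avg r (G (\<lambda>_. 1)) x \<le> avg r (G W) x"
    using W_ge(1) fs_pos by (intro avg_mono) (auto simp: G_def intro!: ennreal_leI)
  then have "avg r (G (\<lambda>_. 1)) x < top" using Q by (auto simp: le_less_trans)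
  then show "avg r (G (\<lambda>_. 1)) x = ennreal F" by (simp add: F_def)
  show "0 \<le> F" by (simp add: F_def)
qed

lemma avg_bound_young:
  assumes "H \<in> borel_measurable borel" "\<And>x. 0 \<le> H x" "\<And>x. H x \<le> \<kappa> + \<beta> * W x" "0 \<le> \<kappa>" "0 \<le> \<beta>" "0 \<le> c"
    and "X \<le> ennreal c * avg r (G H) x"
  shows "X \<le> ennreal (c * (\<kappa> * F + \<beta> * Q))"
proof -
  have "X \<le> ennreal c * ennreal (\<kappa> * F + \<beta> * Q)"
    using assms(7) avg_young[OF assms(1-5) F Q] by (meson mult_left_mono order_trans zero_le)
  also have "\<dots> = ennreal (c * (\<kappa> * F + \<beta> * Q))" using assms F Q by (simp add: ennreal_mult)
  finally show ?thesis .
qed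

lemma H2_young: "0 < \<kappa> \<Longrightarrow> H2 y \<le> \<kappa> / r^2 + r^6 / \<kappa>^3 * W y"
proof -
  assume k: "0 < \<kappa>"
  have "r^2 * H2 y \<le> \<kappa> + (r^2 * H2 y)^4 / \<kappa>^3" using k r H_nonneg(3)[of y] by (intro young4) auto
  also have "(r^2 * H2 y)^4 = r^8 * (H2 y)^4" by (simp add: power_mult_distrib power_mult[symmetric])
  also have "r^8 * (H2 y)^4 / \<kappa>^3 \<le> r^8 * W y / \<kappa>^3" using k W_ge(4)[of y] by (intro divide_right_mono mult_left_mono) auto
  finally show ?thesis using k r by (simp add: field_simps eval_nat_numeral)
qed

text \<open>The second difference term of \<open>avg_fs_le\<close> contains \<open>H2\<close>, which
  Young splits into a small multiple of 1 and a large multiple of \<open>W\<close>. The first part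
  returns a fraction of the finite mean \<open>F\<close>, which is absorbed.\<close>

lemma avg_fs_real_le: "F \<le> 2 * V2 * fs x + cF * r^8 * Q"
proof -
  \<comment> \<open>With this value \<open>4 * dm^2 * \<kappa> = 1/2\<close>, so exactly half of
    \<open>F\<close> is absorbed.\<close>
  define \<kappa> where "\<kappa> = 1 / (8 * dm^2)"
  have k: "0 < \<kappa>" using dm1 by (simp add: \<kappa>_def)
  have "ennreal (4 * dm^2 * r^2) * avg r (G H2) x \<le> ennreal (4 * dm^2 * r^2 * (\<kappa> / r^2 * F + r^6 / \<kappa>^3 * Q))"
    by (rule avg_bound_young[OF meas(3) H_nonneg(3) H2_young]) (use k r in auto)
  then have "ennreal F \<le> ennreal (V2 * fs x) + ennreal (4 * dm^2 * r^2 * (\<kappa> / r^2 * F + r^6 / \<kappa>^3 * Q))"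
    using avg_fs_le[OF r(1), of x] unfolding F(1) by (meson add_left_mono order_trans)
  also have "\<dots> = ennreal (V2 * fs x + 4 * dm^2 * r^2 * (\<kappa> / r^2 * F + r^6 / \<kappa>^3 * Q))"
    using V2 fs_pos[of x] F Q k r by (intro ennreal_plus[symmetric]) (auto intro!: mult_nonneg_nonneg add_nonneg_nonneg)
  finally have "F \<le> V2 * fs x + 4 * dm^2 * r^2 * (\<kappa> / r^2 * F + r^6 / \<kappa>^3 * Q)"
    using V2 fs_pos[of x] F Q k r by (subst (asm) ennreal_le_iff) (auto intro!: mult_nonneg_nonneg add_nonneg_nonneg)
  also have "4 * dm^2 * r^2 * (\<kappa> / r^2 * F + r^6 / \<kappa>^3 * Q) = F / 2 + 4 * dm^2 * (8 * dm^2)^3 * r^8 * Q"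
    using r dm1 by (simp add: \<kappa>_def field_simps eval_nat_numeral)
  also have "4 * dm^2 * (8 * dm^2)^3 = cF / 2" by (simp add: cF_def power_mult_distrib power_mult[symmetric] power_add[symmetric])
  finally show ?thesis by simp
qed

lemma avg_to_real:
  assumes "ennreal V1 * ennreal R \<le> ennreal c * avg r (G H) x" "H \<in> borel_measurable borel" "\<And>x. 0 \<le> H x"
    "\<And>x. H x \<le> \<kappa> + \<beta> * W x" "0 \<le> \<kappa>" "0 \<le> \<beta>" "0 \<le> c" "0 \<le> R"
  shows "R \<le> c / V1 * (\<kappa> * F + \<beta> * Q)"
proof -
  have "ennreal V1 * ennreal R \<le> ennreal (c * (\<kappa> * F + \<beta> * Q))"
    by (rule avg_bound_young[OF assms(2-7)]) (rule assms(1))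
  then have "ennreal (V1 * R) \<le> ennreal (c * (\<kappa> * F + \<beta> * Q))" using V1 assms by (simp add: ennreal_mult)
  then have "V1 * R \<le> c * (\<kappa> * F + \<beta> * Q)" using assms F Q by (subst (asm) ennreal_le_iff) auto
  then show ?thesis using V1 by (simp add: field_simps)
qed

abbreviation "P \<equiv> Pf x Q"

lemma P: "Q \<le> P" "W x * fs x \<le> P" "0 \<le> P" "fs x \<le> P"
proof -
  have "1 * fs x \<le> W x * fs x" using W_ge(1) fs_pos[of x] by (intro mult_right_mono) auto
  then show "Q \<le> P" "W x * fs x \<le> P" "0 \<le> P" "fs x \<le> P"
    using Q(2) fs_pos[of x] unfolding Pf_def mult_1 by linarith+
qed

text \<open>The factor \<open>fs x\<close> on the right is the point: after division by
  \<open>(fs x)^2\<close> and integration against \<open>fs\<close> only the integrable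
  \<open>P\<close> remains. The mean \<open>F\<close> of \<open>fs\<close> near \<open>x\<close>
  decides whether the path bound provides this factor directly.\<close>

lemma osc_bound:
  assumes \<theta>: "\<theta> \<in> \<Theta>" "\<theta>' \<in> \<Theta>" "norm (\<theta> - \<theta>') \<le> r"
  shows "(f0 (x - \<theta>) - f0 (x - \<theta>'))^2 \<le> cA * r^2 * fs x * P"
proof -
  define R where "R = \<bar>f0 (x - \<theta>) - f0 (x - \<theta>')\<bar>"
  define c1 where "c1 = 4 * dm / V1"
  have c1: "0 < c1" using dm1 V1 by (simp add: c1_def)
  have "ennreal V1 * ennreal R \<le> 2 * ennreal (2 * dm * r) * avg r (G H1) x"
    unfolding V1(1)[symmetric]
  proof (rule const_le_avg[OF _ r(1) \<theta>(3)])
    fix y :: "real^'d" assume "norm y < 1"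
    then have "norm (r *\<^sub>R y) \<le> r" using r by (simp add: mult_left_le)
    then show "ennreal R \<le> ennreal (2 * dm * r) * (path_int (G H1) x (r *\<^sub>R y) + path_int (G H1) x (r *\<^sub>R y - (\<theta> - \<theta>')))"
      unfolding R_def dm by (intro shift_diff_bound \<theta> r)
  qed (intro G_meas meas)
  also have "2 * ennreal (2 * dm * r) = ennreal (4 * dm * r)"
    using dm1 r by (subst ennreal_numeral[symmetric], subst ennreal_mult[symmetric]) auto
  finally have main: "ennreal V1 * ennreal R \<le> ennreal (4 * dm * r) * avg r (G H1) x" .
  note conv = avg_to_real[OF main meas(2) H_nonneg(2)]
  have R0: "0 \<le> R" by (simp add: R_def)
  have a0: "0 < fs x" by (rule fs_pos)
  show ?thesis
  proof (cases "F \<le> 4 * V2 * fs x")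
    case True
    have "R^2 \<le> 4 * (4 * c1 * V2 * fs x) * (c1 * r^2 * Q)"
    proof (rule le_opt_sq)
      fix \<kappa> :: real assume k: "0 < \<kappa>"
      have "R \<le> 4 * dm * r / V1 * (\<kappa> / r * F + r / \<kappa> * Q)"
      proof (rule conv)
        fix y
        have "r * H1 y \<le> \<kappa> + (r * H1 y)^2 / \<kappa>" using k r H_nonneg(2)[of y] by (intro young2) auto
        also have "(r * H1 y)^2 / \<kappa> \<le> r^2 * W y / \<kappa>" unfolding power_mult_distrib
          using k W_ge(7)[of y] by (intro divide_right_mono mult_left_mono) auto
        finally show "H1 y \<le> \<kappa> / r + r / \<kappa> * W y" using k r by (simp add: field_simps power2_eq_square)
      qed (use k r dm1 R0 in auto)
      also have "\<dots> = c1 * \<kappa> * F + c1 * r^2 * Q / \<kappa>" using k r V1 by (simp add: c1_def field_simps power2_eq_square)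
      also have "\<dots> \<le> c1 * \<kappa> * (4 * V2 * fs x) + c1 * r^2 * Q / \<kappa>"
        using True c1 k by (intro add_mono mult_left_mono) auto
      finally show "R \<le> 4 * c1 * V2 * fs x * \<kappa> + c1 * r^2 * Q / \<kappa>" by (simp add: mult_ac)
    qed (use c1 V2 a0 R0 Q in auto)
    also have "\<dots> = (16 * c1^2 * V2) * r^2 * fs x * Q" by (simp add: power2_eq_square mult_ac)
    also have "\<dots> \<le> cA * r^2 * fs x * P"
    proof -
      have cc: "0 \<le> c1 * (2 * cF + 1)" using c1 cF0 by simp
      have cAe: "cA = 16 * c1^2 * V2 + c1 * (2 * cF + 1) + 1" by (simp add: cA_def c1_def)
      have cA0: "16 * c1^2 * V2 \<le> cA" "0 \<le> cA" using cc V2 unfolding cAe by (auto intro!: add_nonneg_nonneg)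
      show ?thesis using P(1) Q V2 a0 cA0 by (intro mult_mono mult_nonneg_nonneg) auto
    qed
    finally show ?thesis by (simp add: R_def)
  next
    case False
    \<comment> \<open>Here half of \<open>F\<close> exceeds the \<open>fs x\<close> term of
      \<open>avg_fs_real_le\<close>, so the other term dominates. The path bound becomes
      \<open>O(r^4 * P)\<close>, and interpolation at level \<open>1 / r\<close> with the bound
      \<open>H0 x * fs x\<close> produces the missing factor \<open>fs x\<close>.\<close>
    then have FQ: "F \<le> 2 * cF * r^8 * Q" using avg_fs_real_le by linarith
    define B where "B = c1 * (2 * cF + 1) * r^4"
    have r84: "r^8 \<le> r^4" using r by (intro power_decreasing) auto
    have "R \<le> 4 * dm * r / V1 * (1 / r * F + r^3 * Q)"
    proof (rule conv)
      fix y
      have "H1 y \<le> 1/r + (H1 y)^4 / (1/r)^3" using r H_nonneg(2)[of y] by (intro young4) auto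
      also have "(H1 y)^4 / (1/r)^3 \<le> r^3 * W y" using W_ge(3)[of y] r by (simp add: power_divide field_simps)
      finally show "H1 y \<le> 1 / r + r^3 * W y" by simp
    qed (use r dm1 R0 in auto)
    also have "\<dots> = c1 * (F + r^4 * Q)" using r V1 by (simp add: c1_def field_simps eval_nat_numeral)
    also have "\<dots> \<le> c1 * (2 * cF * r^4 * P + r^4 * P)"
    proof (intro mult_left_mono add_mono)
      have "F \<le> 2 * cF * (r^8 * Q)" using FQ by simp
      also have "\<dots> \<le> 2 * cF * (r^4 * P)" using r84 P(1) Q cF0 by (intro mult_left_mono mult_mono) auto
      finally show "F \<le> 2 * cF * r^4 * P" by simp
    qed (use P(1) r c1 in auto)
    also have "\<dots> = B * P" by (simp add: B_def algebra_simps)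
    finally have RB: "R \<le> B * P" .
    have B0: "0 \<le> B" using c1 cF0 by (auto simp: B_def)
    have "R^2 \<le> fs x * P * (1/r * B + 1 / (1/r)^2)"
    proof (rule two_bounds_sq[where E = "H0 x"])
      show "R \<le> H0 x * fs x" unfolding R_def using b0[OF \<theta>(1), of x] b0[OF \<theta>(2), of x] f0_pos[of "x - \<theta>"] f0_pos[of "x - \<theta>'"]
        by (auto simp: abs_if)
      have "(H0 x)^4 * fs x \<le> W x * fs x" using W_ge(2)[of x] a0 by (intro mult_right_mono) auto
      then show "(H0 x)^4 * fs x \<le> 1 * P" using P(2) by simp
    qed (use a0 P r R0 RB B0 H_nonneg(1) in auto)
    also have "1/r * B + 1 / (1/r)^2 = r^2 * (c1 * (2 * cF + 1) * r + 1)" using r by (simp add: B_def field_simps eval_nat_numeral)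
    also have "fs x * P * (r^2 * (c1 * (2 * cF + 1) * r + 1)) \<le> fs x * P * (r^2 * cA)"
    proof (intro mult_left_mono)
      have "c1 * (2 * cF + 1) * r \<le> c1 * (2 * cF + 1)" using r c1 cF0 by (intro mult_left_le) auto
      then show "c1 * (2 * cF + 1) * r + 1 \<le> cA" using V2 by (auto simp: cA_def c1_def add_increasing)
    qed (use a0 P in auto)
    finally show ?thesis by (simp add: R_def mult_ac)
  qed
qed

text \<open>The same dichotomy as in \<open>osc_bound\<close>. If \<open>F\<close> is comparable to
  \<open>fs x\<close>, third derivatives give \<open>r^6 = u^18\<close>; in the other case
  interpolation gives \<open>u^16\<close>, which therefore determines the exponent.\<close>

lemma rem2_bound:
  assumes \<theta>: "\<theta> \<in> \<Theta>" "\<theta>' \<in> \<Theta>" "norm (\<theta> - \<theta>') \<le> r" and u: "0 < u" "r = u^3"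
  shows "(rem2 \<theta> \<theta>' x)^2 \<le> cB * u^16 * fs x * P"
proof -
  define R where "R = \<bar>rem2 \<theta> \<theta>' x\<bar>"
  define v where "v = \<theta> - \<theta>'"
  have u1: "u \<le> 1" using r u by (metis power_le_one_iff zero_neq_numeral less_imp_le)
  define c3 where "c3 = 64 * dm^3 / V1"
  have c3: "0 < c3" using dm1 V1 by (simp add: c3_def)
  have "ennreal V1 * ennreal R \<le> 4 * ennreal (16 * dm^3 * r^3) * avg r (G H3) x"
    unfolding V1(1)[symmetric]
  proof (rule const_le_avg_sym[OF _ r(1) \<theta>(3)])
    fix y :: "real^'d" assume "norm y < 1"
    then have "norm (r *\<^sub>R y) \<le> r" using r by (simp add: mult_left_le)
    from rem2_path_bound[OF \<theta>(1,2) r(1) \<theta>(3) this, of x]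
    show "ennreal R \<le> ennreal (16 * dm^3 * r^3) * (path_int (G H3) x (r *\<^sub>R y) + path_int (G H3) x (r *\<^sub>R y - (\<theta> - \<theta>'))
       + (path_int (G H3) x (r *\<^sub>R (- y)) + path_int (G H3) x (r *\<^sub>R (- y) - (\<theta> - \<theta>'))))"
      unfolding R_def dm by simp
  qed (intro G_meas meas)
  also have "4 * ennreal (16 * dm^3 * r^3) = ennreal (64 * dm^3 * r^3)"
    using dm1 r by (subst ennreal_numeral[symmetric], subst ennreal_mult[symmetric]) auto
  finally have main3: "ennreal V1 * ennreal R \<le> ennreal (64 * dm^3 * r^3) * avg r (G H3) x" .
  note conv3 = avg_to_real[OF main3 meas(4) H_nonneg(4)]
  have R0: "0 \<le> R" by (simp add: R_def)
  have a0: "0 < fs x" by (rule fs_pos)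
  have c20: "0 \<le> c2" using V1 V2 cF0 dm1 by (auto simp: c2_def)
  show ?thesis
  proof (cases "F \<le> 4 * V2 * fs x")
    case True
    have "R^2 \<le> 4 * (4 * c3 * V2 * fs x) * (c3 * r^6 * Q)"
    proof (rule le_opt_sq)
      fix \<kappa> :: real assume k: "0 < \<kappa>"
      have "R \<le> 64 * dm^3 * r^3 / V1 * (\<kappa> / r^3 * F + r^3 / \<kappa> * Q)"
      proof (rule conv3)
        fix y
        have "r^3 * H3 y \<le> \<kappa> + (r^3 * H3 y)^2 / \<kappa>" using k r H_nonneg(4)[of y] by (intro young2) auto
        also have "(r^3 * H3 y)^2 / \<kappa> \<le> (r^3)^2 * W y / \<kappa>" unfolding power_mult_distrib
          using k W_ge(5)[of y] by (intro divide_right_mono mult_left_mono) auto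
        finally show "H3 y \<le> \<kappa> / r^3 + r^3 / \<kappa> * W y" using k r by (simp add: field_simps power2_eq_square)
      qed (use k r dm1 R0 in auto)
      also have "\<dots> = c3 * \<kappa> * F + c3 * r^6 * Q / \<kappa>" using k r V1 by (simp add: c3_def field_simps eval_nat_numeral)
      also have "\<dots> \<le> c3 * \<kappa> * (4 * V2 * fs x) + c3 * r^6 * Q / \<kappa>"
        using True c3 k by (intro add_mono mult_left_mono) auto
      finally show "R \<le> 4 * c3 * V2 * fs x * \<kappa> + c3 * r^6 * Q / \<kappa>" by (simp add: mult_ac)
    qed (use c3 V2 a0 R0 Q in auto)
    also have "\<dots> = (16 * c3^2 * V2) * r^6 * fs x * Q" by (simp add: power2_eq_square mult_ac)
    also have "\<dots> \<le> cB * u^16 * fs x * P"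
    proof (intro mult_mono P(1))
      show "16 * c3^2 * V2 \<le> cB" using c20 dm1 by (auto simp: cB_def c3_def)
      have "r^6 = u^18" using u by (simp add: power_mult[symmetric])
      also have "\<dots> \<le> u^16" using u u1 by (intro power_decreasing) auto
      finally show "r^6 \<le> u^16" .
      show "0 \<le> cB" using c20 V2 by (auto simp: cB_def)
    qed (use Q c3 V2 a0 r u c20 in \<open>auto simp: cB_def intro!: mult_nonneg_nonneg add_nonneg_nonneg\<close>)
    finally show ?thesis by (simp add: R_def)
  next
    case False
    \<comment> \<open>Now the second derivatives are used instead of the third: their fourth moments
      allow \<open>H2 \<le> 1 / r^2 + r^6 * W\<close>, and with \<open>F = O(r^8 * Q)\<close> the
      remainder is \<open>O(r^8 * P)\<close>.\<close>
    then have FQ: "F \<le> 2 * cF * r^8 * Q" using avg_fs_real_le by linarith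
    define X2 where "X2 = \<bar>f0 (x - \<theta>) - f0 (x - \<theta>') + dird v f0 (x - \<theta>')\<bar>"
    have "ennreal V1 * ennreal X2 \<le> 2 * ennreal (8 * dm^2 * r^2) * avg r (G H2) x"
      unfolding V1(1)[symmetric]
    proof (rule const_le_avg[OF _ r(1) \<theta>(3)])
      fix y :: "real^'d" assume "norm y < 1"
      then have "norm (r *\<^sub>R y) \<le> r" using r by (simp add: mult_left_le)
      then show "ennreal X2 \<le> ennreal (8 * dm^2 * r^2) * (path_int (G H2) x (r *\<^sub>R y) + path_int (G H2) x (r *\<^sub>R y - (\<theta> - \<theta>')))"
        unfolding X2_def dm v_def by (intro taylor_rem1_bound \<theta> r)
    qed (intro G_meas meas)
    also have "2 * ennreal (8 * dm^2 * r^2) = ennreal (16 * dm^2 * r^2)"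
      using dm1 r by (subst ennreal_numeral[symmetric], subst ennreal_mult[symmetric]) auto
    finally have "X2 \<le> 16 * dm^2 * r^2 / V1 * (1 / r^2 * F + r^6 / 1^3 * Q)"
      by (rule avg_to_real[OF _ meas(3) H_nonneg(3) H2_young]) (use r in \<open>auto simp: X2_def\<close>)
    also have "\<dots> = (16 * dm^2 / V1) * (F + r^8 * Q)" using r V1 by (simp add: field_simps eval_nat_numeral)
    also have "\<dots> \<le> (16 * dm^2 / V1) * (2 * cF * r^8 * P + r^8 * P)"
    proof (intro mult_left_mono add_mono)
      have "F \<le> 2 * cF * (r^8 * Q)" using FQ by simp
      also have "\<dots> \<le> 2 * cF * (r^8 * P)" using P(1) Q cF0 r by (intro mult_left_mono mult_mono) auto
      finally show "F \<le> 2 * cF * r^8 * P" by simp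
    qed (use P(1) r V1 in auto)
    finally have X2: "X2 \<le> (16 * dm^2 / V1) * (2 * cF + 1) * (r^8 * P)" by (simp add: algebra_simps add_divide_distrib)
    have nv: "norm v \<le> r" using \<theta>(3) by (simp add: v_def)
    have Dvv: "\<bar>dird v (dird v f0) (x - \<theta>')\<bar> \<le> dm^2 * (r^2 * (H2 x * fs x))"
    proof -
      have "\<bar>dird v (dird v f0) (x - \<theta>')\<bar> \<le> dm^2 * (norm v * norm v * (H2 x * fs x))"
        unfolding dm by (intro dird_bound2 C2 b2 \<theta>)
      also have "\<dots> \<le> dm^2 * (r^2 * (H2 x * fs x))"
        unfolding power2_eq_square[of r] using nv H_nonneg(3)[of x] a0 r by (intro mult_left_mono mult_right_mono mult_mono) auto
      finally show ?thesis .
    qed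
    also have "\<dots> \<le> dm^2 * (cF / (2 * V2) + 1) * (r^8 * P)"
    proof -
      have "r^2 * H2 x \<le> 1 + r^8 * W x" using H2_young[of 1 x] r by (simp add: field_simps eval_nat_numeral)
      then have "r^2 * (H2 x * fs x) \<le> fs x + r^8 * (W x * fs x)"
        using mult_right_mono[of "r^2 * H2 x" "1 + r^8 * W x" "fs x"] a0 by (simp add: algebra_simps)
      also have "\<dots> \<le> cF / (2 * V2) * (r^8 * P) + r^8 * P"
      proof (intro add_mono mult_left_mono P(2))
        have "4 * V2 * fs x \<le> 2 * cF * r^8 * Q" using False FQ by linarith
        also have "\<dots> = 2 * cF * (r^8 * Q)" by simp
        also have "\<dots> \<le> 2 * cF * (r^8 * P)" using P(1) cF0 r by (intro mult_left_mono) auto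
        finally show "fs x \<le> cF / (2 * V2) * (r^8 * P)" using V2 by (simp add: field_simps)
      qed (use r in auto)
      finally have "dm^2 * (r^2 * (H2 x * fs x)) \<le> dm^2 * (cF / (2 * V2) * (r^8 * P) + r^8 * P)" by (rule mult_left_mono) auto
      then show ?thesis by (simp add: algebra_simps)
    qed
    finally have D2: "\<bar>dird v (dird v f0) (x - \<theta>')\<bar> \<le> dm^2 * (cF / (2 * V2) + 1) * (r^8 * P)" .
    have "R \<le> X2 + \<bar>dird v (dird v f0) (x - \<theta>')\<bar>"
      unfolding R_def rem2_def X2_def v_def by (simp add: abs_if)
    also have "\<dots> \<le> c2 * (r^8 * P)" using X2 D2 by (simp add: c2_def algebra_simps)
    finally have RB: "R \<le> (c2 * r^8) * P" by simp
    define E where "E = 2 * dm^2 * (H0 x + H1 x + H2 x)"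
    have Hn: "0 \<le> H0 x" "0 \<le> H1 x" "0 \<le> H2 x" by (rule H_nonneg)+
    have dm2: "1 \<le> dm^2" using dm1 by (rule one_le_power)
    have dm3: "dm \<le> dm^2" using dm1 mult_left_mono[of 1 dm dm] by (simp add: power2_eq_square)
    \<comment> \<open>The level \<open>1 / u^8\<close> equalizes the two terms:
      \<open>r^8 / u^8\<close> and \<open>(u^8)^2\<close> are both \<open>u^16\<close> because
      \<open>r = u^3\<close>. This balance is the origin of the cube.\<close>
    have "R^2 \<le> fs x * P * (1 / u^8 * (c2 * r^8) + (432 * dm^8) / (1 / u^8)^2)"
    proof (rule two_bounds_sq[where E = E])
      have D1: "\<bar>dird v f0 (x - \<theta>')\<bar> \<le> dm^2 * (H1 x * fs x)"
      proof -
        have "\<bar>dird v f0 (x - \<theta>')\<bar> \<le> dm * (norm v * (H1 x * fs x))" unfolding dm by (intro dird_bound1 b1 \<theta>)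
        also have "\<dots> \<le> dm^2 * (1 * (H1 x * fs x))"
          using nv r Hn a0 dm1 dm3 by (intro mult_mono) auto
        finally show ?thesis by simp
      qed
      have D2: "\<bar>dird v (dird v f0) (x - \<theta>')\<bar> \<le> dm^2 * (H2 x * fs x)"
        using Dvv mult_left_mono[OF mult_right_mono[of "r^2" 1 "H2 x * fs x"], of "dm^2"] r Hn a0 by (simp add: power_le_one)
      have D0: "\<bar>f0 (x - \<theta>) - f0 (x - \<theta>')\<bar> \<le> dm^2 * (H0 x * fs x)"
      proof -
        have "\<bar>f0 (x - \<theta>) - f0 (x - \<theta>')\<bar> \<le> 1 * (H0 x * fs x)"
          using b0[OF \<theta>(1), of x] b0[OF \<theta>(2), of x] f0_pos[of "x - \<theta>"] f0_pos[of "x - \<theta>'"] by (auto simp: abs_if)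
        also have "\<dots> \<le> dm^2 * (H0 x * fs x)" using dm2 Hn a0 by (intro mult_right_mono) auto
        finally show ?thesis .
      qed
      have "R \<le> \<bar>f0 (x - \<theta>) - f0 (x - \<theta>')\<bar> + \<bar>dird v f0 (x - \<theta>')\<bar> + \<bar>dird v (dird v f0) (x - \<theta>')\<bar>"
        unfolding R_def rem2_def v_def by (simp add: abs_if)
      also have "\<dots> \<le> dm^2 * (H0 x * fs x) + dm^2 * (H1 x * fs x) + dm^2 * (H2 x * fs x)" using D0 D1 D2 by linarith
      also have "\<dots> \<le> 2 * (dm^2 * (H0 x * fs x) + dm^2 * (H1 x * fs x) + dm^2 * (H2 x * fs x))"
        using Hn a0 by (simp add: mult_nonneg_nonneg add_nonneg_nonneg)
      finally show "R \<le> E * fs x" by (simp add: E_def algebra_simps)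
      have "E^4 = 16 * dm^8 * (H0 x + H1 x + H2 x)^4"
        by (simp add: E_def power_mult_distrib power_mult[symmetric])
      also have "\<dots> \<le> 16 * dm^8 * (27 * ((H0 x)^4 + (H1 x)^4 + (H2 x)^4))"
        by (intro mult_left_mono power4_sum3) auto
      also have "\<dots> \<le> 16 * dm^8 * (27 * W x)"
        by (intro mult_left_mono) (auto simp: W_def)
      finally have "E^4 * fs x \<le> 16 * dm^8 * (27 * W x) * fs x" using a0 by (intro mult_right_mono) auto
      also have "\<dots> = 432 * dm^8 * (W x * fs x)" by simp
      also have "\<dots> \<le> 432 * dm^8 * P" using P(2) by (intro mult_left_mono) auto
      finally show "E^4 * fs x \<le> 432 * dm^8 * P" .
      show "0 \<le> E" using Hn by (simp add: E_def)
    qed (use a0 P u r R0 RB c20 in auto)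
    also have "1 / u^8 * (c2 * r^8) + (432 * dm^8) / (1 / u^8)^2 = u^16 * (c2 + 432 * dm^8)"
    proof -
      have "r^8 = u^8 * u^16" unfolding u(2) by (simp add: power_mult[symmetric] power_add[symmetric])
      moreover have "(1 / u^8)^2 = 1 / u^16" by (simp add: power_divide power_mult[symmetric])
      moreover have "1 / a * (c2 * (a * b)) = b * c2" if "a \<noteq> 0" for a b :: real using that by simp
      ultimately have "1 / u^8 * (c2 * r^8) = u^16 * c2" using u by (simp del: power_add_numeral)
      then show ?thesis using \<open>(1 / u^8)^2 = 1 / u^16\<close> by (simp add: algebra_simps)
    qed
    also have "fs x * P * (u^16 * (c2 + 432 * dm^8)) \<le> fs x * P * (u^16 * cB)"
      using a0 P V2 by (intro mult_left_mono) (auto simp: cB_def)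
    finally show ?thesis by (simp add: R_def mult_ac)
  qed
qed

end

end

section \<open>Integrable envelopes for oscillations and remainders\<close>

lemma pow_swap: "(a ^ m) ^ k = (a ^ k) ^ m" for a :: real
  by (simp add: power_mult[symmetric] mult.commute)

lemma ratio_sq_le:
  fixes a k f p :: real
  assumes "a^2 \<le> k * f * p" "0 < f"
  shows "(a / f)^2 \<le> k / f * p"
proof -
  have "a^2 / f^2 \<le> k * f * p / f^2" using assms by (intro divide_right_mono) auto
  also have "\<dots> = k / f * p" using assms by (simp add: power2_eq_square)
  finally show ?thesis by (simp add: power_divide)
qed

lemma ennreal_mult_top_pos: "0 < c \<Longrightarrow> ennreal c * top = top"
  by (simp add: ennreal_mult_eq_top_iff)

context mix_env_vol
begin

text \<open>Valued in \<open>ennreal\<close>, so that points with an infinite average need no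
  exceptional set; every bound by it is trivial there.\<close>

definition Psi :: "real \<Rightarrow> real^'d \<Rightarrow> ennreal" where
  "Psi r x = avg r (G W) x + G W x"

lemma Psi_meas [measurable]: "Psi r \<in> borel_measurable borel"
proof -
  have [measurable]: "G W \<in> borel_measurable borel" by (rule G_meas[OF W_meas])
  show ?thesis unfolding Psi_def by measurable
qed

lemma cA_pos: "0 < cA"
proof -
  have "0 \<le> (4 * dm / V1) * (2 * cF + 1)" using dm1 V1 cF0 by simp
  then show ?thesis using V2 unfolding cA_def by (intro add_nonneg_pos add_nonneg_nonneg) auto
qed

lemma cB_pos: "0 < cB"
proof -
  have "0 \<le> c2" using V1 V2 cF0 dm1 by (auto simp: c2_def)
  then show ?thesis using V2 dm1 unfolding cB_def by (intro add_nonneg_pos add_nonneg_nonneg) auto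
qed

lemma Psi_real:
  assumes "Psi r x \<noteq> top"
  obtains Q where "avg r (G W) x = ennreal Q" "0 \<le> Q" "Psi r x = ennreal (Pf x Q)"
proof -
  have "avg r (G W) x \<noteq> top" using assms by (auto simp: Psi_def)
  then obtain Q where Q: "avg r (G W) x = ennreal Q" "0 \<le> Q" by (cases "avg r (G W) x") auto
  have "0 \<le> W x * fs x" using W_ge(1)[of x] fs_pos[of x] by simp
  then have "Psi r x = ennreal (Pf x Q)" unfolding Psi_def Pf_def Q(1) G_def using Q(2) by (intro ennreal_plus[symmetric])
  then show ?thesis using that Q by blast
qed

definition osc_sq :: "real \<Rightarrow> real^'d \<Rightarrow> ennreal" where
  "osc_sq r x = ennreal (cA * r^2 / fs x) * Psi r x"

lemma osc_sq:
  assumes \<theta>: "\<theta> \<in> \<Theta>" "\<theta>' \<in> \<Theta>" "norm (\<theta> - \<theta>') \<le> r" and r: "0 < r" "r \<le> 1"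
  shows "ennreal (((f0 (x - \<theta>) - f0 (x - \<theta>')) / fs x)^2) \<le> osc_sq r x"
proof (cases "Psi r x = top")
  case True
  have "0 < cA * r^2 / fs x" using cA_pos r fs_pos[of x] by simp
  then have "osc_sq r x = top" unfolding osc_sq_def True by (rule ennreal_mult_top_pos)
  then show ?thesis by simp
next
  case False
  then obtain Q where Q: "avg r (G W) x = ennreal Q" "0 \<le> Q" "Psi r x = ennreal (Pf x Q)" using Psi_real by blast
  have "(f0 (x - \<theta>) - f0 (x - \<theta>'))^2 \<le> cA * r^2 * fs x * Pf x Q" by (rule osc_bound[OF r Q(1,2) \<theta>])
  then have "((f0 (x - \<theta>) - f0 (x - \<theta>')) / fs x)^2 \<le> cA * r^2 / fs x * Pf x Q"
    by (rule ratio_sq_le) (rule fs_pos)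
  then have "ennreal (((f0 (x - \<theta>) - f0 (x - \<theta>')) / fs x)^2) \<le> ennreal (cA * r^2 / fs x * Pf x Q)" by (rule ennreal_leI)
  also have "\<dots> = osc_sq r x" unfolding osc_sq_def Q(3) using cA_pos fs_pos[of x] by (intro ennreal_mult') (auto simp: less_imp_le)
  finally show ?thesis .
qed

lemma rem_sq:
  assumes \<theta>: "\<theta> \<in> \<Theta>" "\<theta>' \<in> \<Theta>" "norm (\<theta> - \<theta>') \<le> u^3" and u: "0 < u" "u \<le> 1"
  shows "ennreal ((rem2 \<theta> \<theta>' x / fs x)^2) \<le> ennreal (cB * u^16 / fs x) * Psi (u^3) x"
proof (cases "Psi (u^3) x = top")
  case True
  have "0 < cB * u^16 / fs x" using cB_pos u fs_pos[of x] by simp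
  then have "ennreal (cB * u^16 / fs x) * Psi (u^3) x = top" unfolding True by (rule ennreal_mult_top_pos)
  then show ?thesis by simp
next
  case False
  then obtain Q where Q: "avg (u^3) (G W) x = ennreal Q" "0 \<le> Q" "Psi (u^3) x = ennreal (Pf x Q)" using Psi_real by blast
  have u3: "0 < u^3" "u^3 \<le> 1" using u by (auto simp: power_le_one)
  have "(rem2 \<theta> \<theta>' x)^2 \<le> cB * u^16 * fs x * Pf x Q" by (rule rem2_bound[OF u3 Q(1,2) \<theta> u(1) refl])
  then have "(rem2 \<theta> \<theta>' x / fs x)^2 \<le> cB * u^16 / fs x * Pf x Q"
    by (rule ratio_sq_le) (rule fs_pos)
  then have "ennreal ((rem2 \<theta> \<theta>' x / fs x)^2) \<le> ennreal (cB * u^16 / fs x * Pf x Q)" by (rule ennreal_leI)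
  also have "\<dots> = ennreal (cB * u^16 / fs x) * Psi (u^3) x" unfolding Q(3) using cB_pos u fs_pos[of x] by (intro ennreal_mult') (auto simp: less_imp_le)
  finally show ?thesis .
qed

definition rem_env :: "real \<Rightarrow> real^'d \<Rightarrow> ennreal" where
  "rem_env u x = (\<Sum>m. ennreal (4096 * cB * (u / 2^m)^4 / fs x) * Psi ((u / 2^m)^3) x)"

text \<open>A dyadic decomposition of the distance turns the scale by scale estimates into one envelope;
  the factor \<open>u ^ 16\<close> beats \<open>(u ^ 3) ^ 4\<close>, so the sum over scales converges.\<close>
lemma rem_env:
  assumes \<theta>: "\<theta> \<in> \<Theta>" "\<theta>' \<in> \<Theta>" "norm (\<theta> - \<theta>') \<le> u^3" and u: "0 < u" "u \<le> 1"
  shows "ennreal ((rem2 \<theta> \<theta>' x / fs x)^2) \<le> ennreal (norm (\<theta> - \<theta>')^4) * rem_env u x"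
proof (cases "\<theta> = \<theta>'")
  case True
  have "dird 0 g y = 0" for g :: "real^'d \<Rightarrow> real" and y by (simp add: dird_def)
  then show ?thesis using True by (simp add: rem2_def)
next
  case False
  define t where "t = norm (\<theta> - \<theta>')"
  have t: "0 < t" "t \<le> u^3" using False \<theta>(3) by (auto simp: t_def)
  have "(\<lambda>m. (u / 2^m)^3) \<longlonglongrightarrow> 0"
  proof -
    have "(\<lambda>m. u^3 * (1/8)^m) \<longlonglongrightarrow> u^3 * 0" by (intro tendsto_mult tendsto_const LIMSEQ_power_zero) auto
    moreover have "(u / 2^m)^3 = u^3 * (1/8)^m" for m
      using pow_swap[of 2 m 3] by (simp add: power_divide)
    ultimately show ?thesis by simp
  qed
  then have "eventually (\<lambda>m. (u / 2^m)^3 < t) sequentially" using t(1) by (rule order_tendstoD(2))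
  then have "\<exists>m. (u / 2^m)^3 < t" unfolding eventually_sequentially by blast
  then have ex: "(u / 2^(LEAST m. (u / 2^m)^3 < t))^3 < t" by (rule LeastI_ex)
  \<comment> \<open>Index 0 fails because \<open>t \<le> u^3\<close>, so the least index is a
    successor and the scale \<open>w\<close> at its predecessor satisfies
    \<open>(w / 2)^3 < t \<le> w^3\<close>.\<close>
  obtain m where m: "(LEAST m. (u / 2^m)^3 < t) = Suc m"
    using ex t(2) by (cases "LEAST m. (u / 2^m)^3 < t") auto
  define w where "w = u / 2^m"
  have w: "0 < w" "w \<le> 1" using u by (auto simp: w_def field_simps intro: order_trans[OF u(2)] )
  have lo: "(w/2)^3 < t" using ex unfolding m by (simp add: w_def mult.commute)
  have hi: "t \<le> w^3" using not_less_Least[of m "\<lambda>m. (u / 2^m)^3 < t"] m by (simp add: w_def)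
  have "ennreal ((rem2 \<theta> \<theta>' x / fs x)^2) \<le> ennreal (cB * w^16 / fs x) * Psi (w^3) x"
    using hi w by (intro rem_sq \<theta>) (auto simp: t_def)
  also have "\<dots> \<le> ennreal (t^4 * (4096 * cB * w^4 / fs x)) * Psi (w^3) x"
  proof (intro mult_right_mono ennreal_leI)
    \<comment> \<open>\<open>4096 = 2 ^ 12\<close> is the price for passing from \<open>w\<close> to
      \<open>w / 2\<close>; in this way \<open>w ^ 16\<close> becomes \<open>t ^ 4\<close> times the
      summable \<open>w ^ 4\<close>.\<close>
    have "w^12 = 4096 * ((w/2)^3)^4" by (simp add: power_divide power_mult[symmetric])
    also have "\<dots> \<le> 4096 * t^4" using lo w by (intro mult_left_mono power_mono) auto
    finally have "w^12 * (cB * w^4 / fs x) \<le> 4096 * t^4 * (cB * w^4 / fs x)"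
      using cB_pos w fs_pos[of x] by (intro mult_right_mono) (auto simp: less_imp_le)
    then show "cB * w^16 / fs x \<le> t^4 * (4096 * cB * w^4 / fs x)" by (simp add: mult_ac power_add[symmetric])
  qed auto
  also have "\<dots> = ennreal (t^4) * (ennreal (4096 * cB * (u / 2^m)^4 / fs x) * Psi ((u / 2^m)^3) x)"
    using t by (subst ennreal_mult') (auto simp: w_def mult.assoc)
  also have "\<dots> \<le> ennreal (t^4) * rem_env u x"
    unfolding rem_env_def
    using sum_le_suminf[of "\<lambda>m. ennreal (4096 * cB * (u / 2^m)^4 / fs x) * Psi ((u / 2^m)^3) x" "{m}"]
    by (intro mult_left_mono) auto
  finally show ?thesis by (simp add: t_def)
qed

definition J :: ennreal where "J = (\<integral>\<^sup>+x. G W x \<partial>lborel)"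

lemma nn_integral_Psi: "(\<integral>\<^sup>+x. Psi r x \<partial>lborel) = ennreal (V2 + 1) * J"
proof -
  have [measurable]: "G W \<in> borel_measurable borel" by (rule G_meas[OF W_meas])
  have "(\<integral>\<^sup>+x. Psi r x \<partial>lborel) = ennreal V2 * J + J"
    unfolding Psi_def J_def by (subst nn_integral_add) (auto simp: nn_integral_avg V2)
  also have "\<dots> = ennreal (V2 + 1) * J" using V2 by (simp add: ennreal_plus distrib_right)
  finally show ?thesis .
qed

abbreviation "\<mu> \<equiv> density_measure fs"

lemma nn_integral_mu:
  assumes [measurable]: "h \<in> borel_measurable borel"
  shows "(\<integral>\<^sup>+x. h x \<partial>\<mu>) = (\<integral>\<^sup>+x. ennreal (fs x) * h x \<partial>lborel)"
  unfolding density_measure_def using meas(5) by (subst nn_integral_density) auto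

lemma osc_sq_meas [measurable]: "osc_sq r \<in> borel_measurable borel"
  unfolding osc_sq_def by measurable

lemma rem_env_meas [measurable]: "rem_env u \<in> borel_measurable borel"
  unfolding rem_env_def by measurable

text \<open>The factor \<open>1 / fs x\<close> of the envelopes cancels against the density, so
  their norms reduce to Lebesgue integrals of \<open>Psi\<close>, which translation invariance has
  computed.\<close>

lemma fs_cancel: "0 \<le> c \<Longrightarrow> ennreal (fs x) * (ennreal (c / fs x) * p) = ennreal c * p"
  using fs_pos[of x] by (simp add: ennreal_mult[symmetric] mult.assoc[symmetric] less_imp_le)

lemma nn_integral_osc_sq: "(\<integral>\<^sup>+x. osc_sq r x \<partial>\<mu>) = ennreal (cA * r^2 * (V2 + 1)) * J"
proof -
  have "(\<integral>\<^sup>+x. osc_sq r x \<partial>\<mu>) = (\<integral>\<^sup>+x. ennreal (cA * r^2) * Psi r x \<partial>lborel)"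
    unfolding nn_integral_mu[OF osc_sq_meas] unfolding osc_sq_def using cA_pos by (simp add: fs_cancel)
  also have "\<dots> = ennreal (cA * r^2) * (ennreal (V2 + 1) * J)"
    by (subst nn_integral_cmult) (auto simp: nn_integral_Psi)
  also have "\<dots> = ennreal (cA * r^2 * (V2 + 1)) * J"
    using cA_pos V2 by (simp add: ennreal_mult mult.assoc)
  finally show ?thesis .
qed

lemma nn_integral_rem_env: "0 < u \<Longrightarrow> (\<integral>\<^sup>+x. rem_env u x \<partial>\<mu>) \<le> ennreal (8192 * cB * u^4 * (V2 + 1)) * J"
proof -
  assume u: "0 < u"
  have "(\<integral>\<^sup>+x. rem_env u x \<partial>\<mu>) = (\<integral>\<^sup>+x. (\<Sum>m. ennreal (4096 * cB * (u / 2^m)^4) * Psi ((u / 2^m)^3) x) \<partial>lborel)"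
    unfolding nn_integral_mu[OF rem_env_meas] unfolding rem_env_def using cB_pos
    by (simp add: fs_cancel ennreal_suminf_cmult[symmetric] del: ennreal_suminf_cmult)
  also have "\<dots> = (\<Sum>m. (\<integral>\<^sup>+x. ennreal (4096 * cB * (u / 2^m)^4) * Psi ((u / 2^m)^3) x \<partial>lborel))"
    by (rule nn_integral_suminf) measurable
  also have "\<dots> = (\<Sum>m. ennreal (4096 * cB * (u / 2^m)^4) * (ennreal (V2 + 1) * J))"
    by (subst nn_integral_cmult) (auto simp: nn_integral_Psi)
  also have "\<dots> = (\<Sum>m. ennreal (4096 * cB * (u / 2^m)^4)) * (ennreal (V2 + 1) * J)"
    by simp
  \<comment> \<open>A geometric series with ratio \<open>1/16\<close>, since the integral of
    \<open>Psi\<close> is the same at all scales; \<open>4096 * 16/15\<close> is then rounded up to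
    8192.\<close>
  also have "(\<Sum>m. ennreal (4096 * cB * (u / 2^m)^4)) = ennreal (4096 * cB * u^4 * (16/15))"
  proof (rule suminf_ennreal_eq)
    have e: "4096 * cB * (u / 2^m)^4 = 4096 * cB * u^4 * (1/16)^m" for m
      using pow_swap[of 2 m 4] by (simp add: power_divide)
    show "(\<lambda>m. 4096 * cB * (u / 2^m)^4) sums (4096 * cB * u^4 * (16/15))"
      unfolding e using geometric_sums[of "1/16::real"] by (intro sums_mult) simp
  qed (use cB_pos u in auto)
  also have "ennreal (4096 * cB * u^4 * (16/15)) * (ennreal (V2 + 1) * J) = ennreal (4096 * cB * u^4 * (16/15) * (V2 + 1)) * J"
    using cB_pos V2 u by (simp only: mult.assoc[symmetric], subst ennreal_mult[symmetric]) auto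
  also have "\<dots> \<le> ennreal (8192 * cB * u^4 * (V2 + 1)) * J"
    using cB_pos V2 u by (intro mult_right_mono ennreal_leI) auto
  finally show ?thesis .
qed

end

section \<open>Rounding the parameters of a mixture\<close>

lemma sum_abs_le_sqrt:
  fixes a :: "nat \<Rightarrow> real"
  assumes "finite A" "card A \<le> q" "(\<Sum>j\<in>A. (a j)^2) \<le> S"
  shows "(\<Sum>j\<in>A. \<bar>a j\<bar>) \<le> sqrt q * sqrt S"
proof -
  have "(\<Sum>j\<in>A. \<bar>a j\<bar>)^2 \<le> (\<Sum>j\<in>A. \<bar>a j\<bar>^2) * (\<Sum>j\<in>A. 1^2)"
    using Cauchy_Schwarz_ineq_sum[of "\<lambda>j. \<bar>a j\<bar>" "\<lambda>_. 1" A] by simp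
  also have "\<dots> = (\<Sum>j\<in>A. (a j)^2) * card A" by simp
  also have "\<dots> \<le> S * q"
  proof (rule mult_mono[OF assms(3)])
    have "0 \<le> (\<Sum>j\<in>A. (a j)^2)" by (intro sum_nonneg) simp
    then show "0 \<le> S" using assms(3) by linarith
  qed (use assms(2) in auto)
  finally have "(\<Sum>j\<in>A. \<bar>a j\<bar>) \<le> sqrt (S * q)" by (intro real_le_rsqrt)
  then show ?thesis by (simp add: real_sqrt_mult mult.commute)
qed

text \<open>The bookkeeping of \<open>same_code_diff\<close>: \<open>N\<close> is the number of true
  points, \<open>v = u^2\<close>, \<open>e = \<epsilon>\<close>, \<open>a = fs x\<close>,
  \<open>m = dm\<close>, \<open>D = dm^2\<close>, and \<open>O'\<close> is the scaled oscillation
  \<open>Or / u^6\<close>.\<close>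

lemma same_code_terms_sum:
  fixes N v e h0 m h1 D h2 O' a K E :: real
  shows "N * (v * e) * (h0 + m * h1) * a + (2 * D * K * v * e * (h2 * a)) / 2 + K * e * (E * a) + K * e * (E * a)
        + (e * v * ((2 * h0 + m * h1) * a) + (e * a * (K * O') + e * a * (v * (K * m * h1))))
        = e * a * (v * ((N + 2) * h0 + (N * m + m + K * m) * h1 + D * K * h2) + 2 * K * E + K * O')"
proof -
  have 1: "2 * D * K * v * e * (h2 * a) / 2 = D * K * v * e * (h2 * a)" by simp
  show ?thesis unfolding 1 by algebra
qed

locale coding = mix_env_vol f0 fs H0 H1 H2 H3 \<Theta> n ps ts V1 V2 dm
  for f0 fs :: "real^'d::finite \<Rightarrow> real" and H0 H1 H2 H3 \<Theta> n ps ts V1 V2 dm +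
  fixes rr K \<epsilon> u :: real and q :: nat
  assumes rr: "0 < rr" "rr \<le> 1" and K: "1 \<le> K" and eps: "0 < \<epsilon>"
    and u: "0 < u" "u \<le> 1" "u^3 \<le> rr" and q: "0 < q"
begin

abbreviation "lab \<equiv> label n ts rr"
abbreviation "lw \<equiv> loc_weight n ts rr"

text \<open>The radius \<open>u^3\<close> is the range in which \<open>rem_env u\<close> controls
  the second order remainder.\<close>

definition near :: "real^'d \<Rightarrow> bool" where
  "near \<theta> \<longleftrightarrow> lab \<theta> < n \<and> norm (\<theta> - ts (lab \<theta>)) \<le> u^3"

text \<open>What is left of a labelled component after its first order expansion at the true point;
  a component far from all true points is kept entire.\<close>

definition g :: "real^'d \<Rightarrow> real^'d \<Rightarrow> real" where
  "g \<theta> x = (if lab \<theta> < n then f0 (x - \<theta>) - f0 (x - ts (lab \<theta>)) + dird (\<theta> - ts (lab \<theta>)) f0 (x - ts (lab \<theta>))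
     else f0 (x - \<theta>))"

definition ca :: "(nat \<Rightarrow> real) \<Rightarrow> (nat \<Rightarrow> real^'d) \<Rightarrow> nat \<Rightarrow> real" where
  "ca p \<theta> i = (\<Sum>j\<in>{j. j < q \<and> lab (\<theta> j) = i}. p j) - ps i"

definition cb :: "(nat \<Rightarrow> real) \<Rightarrow> (nat \<Rightarrow> real^'d) \<Rightarrow> nat \<Rightarrow> 'd \<Rightarrow> real" where
  "cb p \<theta> i k = (\<Sum>j\<in>{j. j < q \<and> lab (\<theta> j) = i}. p j * (\<theta> j - ts i) $ k)"

text \<open>Near a true point only the sum of \<open>p j\<close> times the squared offsets is controlled, hence the offset
  is rounded after multiplication by \<open>sqrt (p j)\<close>.\<close>
definition wc :: "(nat \<Rightarrow> real) \<Rightarrow> (nat \<Rightarrow> real^'d) \<Rightarrow> nat \<Rightarrow> 'd \<Rightarrow> real" where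
  "wc p \<theta> j k = sqrt (p j) * (\<theta> j - ts (lab (\<theta> j))) $ k"

text \<open>Records the conclusions of \<open>local_geometry\<close> for a mixture whose L1 distance
  from \<open>fs\<close> is at most \<open>2 * \<epsilon>\<close>, with \<open>K\<close> twice the
  constant obtained there.\<close>

definition admissible :: "(nat \<Rightarrow> real) \<Rightarrow> (nat \<Rightarrow> real^'d) \<Rightarrow> bool" where
  "admissible p \<theta> \<longleftrightarrow> (\<forall>j<q. 0 \<le> p j) \<and> (\<forall>j<q. \<theta> j \<in> \<Theta>) \<and> (\<Sum>j<q. p j * lw (\<theta> j)) \<le> K * \<epsilon> \<and>
     (\<forall>i<n. \<bar>ca p \<theta> i\<bar> \<le> K * \<epsilon>) \<and> (\<forall>i<n. \<forall>k. \<bar>cb p \<theta> i k\<bar> \<le> K * \<epsilon>)"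

lemma admissibleD:
  assumes "admissible p \<theta>"
  shows "\<And>j. j < q \<Longrightarrow> 0 \<le> p j" "\<And>j. j < q \<Longrightarrow> \<theta> j \<in> \<Theta>" "(\<Sum>j<q. p j * lw (\<theta> j)) \<le> K * \<epsilon>"
     "\<And>i. i < n \<Longrightarrow> \<bar>ca p \<theta> i\<bar> \<le> K * \<epsilon>" "\<And>i k. i < n \<Longrightarrow> \<bar>cb p \<theta> i k\<bar> \<le> K * \<epsilon>"
  using assms by (auto simp: admissible_def)

lemma sum_by_label:
  fixes \<phi> :: "nat \<Rightarrow> nat \<Rightarrow> real"
  shows "(\<Sum>j<q. if lab (\<theta> j) < n then \<phi> (lab (\<theta> j)) j else 0)
     = (\<Sum>i<n. \<Sum>j\<in>{j. j < q \<and> lab (\<theta> j) = i}. \<phi> i j)"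
proof -
  have "(\<Sum>i<n. \<Sum>j\<in>{j. j < q \<and> lab (\<theta> j) = i}. \<phi> i j) = (\<Sum>i<n. \<Sum>j<q. if lab (\<theta> j) = i then \<phi> i j else 0)"
    by (rule sum.cong[OF refl], rule sum.mono_neutral_cong_left) auto
  also have "\<dots> = (\<Sum>j<q. \<Sum>i<n. if lab (\<theta> j) = i then \<phi> i j else 0)" by (rule sum.swap)
  also have "\<dots> = (\<Sum>j<q. if lab (\<theta> j) < n then \<phi> (lab (\<theta> j)) j else 0)"
    by (rule sum.cong[OF refl]) (simp only: sum.delta' finite_lessThan lessThan_iff)
  finally show ?thesis by simp
qed

text \<open>An exact identity: expanding each labelled component to first order collects masses and
  first moments at the true points, and the masses \<open>ps\<close> add up to
  \<open>fs\<close>.\<close>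

lemma mixture_decomp:
  "mixture f0 q p \<theta> x - fs x
    = (\<Sum>i<n. ca p \<theta> i * f0 (x - ts i) - (\<Sum>k\<in>UNIV. cb p \<theta> i k * partial_deriv k f0 (x - ts i)))
      + (\<Sum>j<q. p j * g (\<theta> j) x)"
proof -
  define \<phi> where "\<phi> i j = p j * (f0 (x - ts i) - dird (\<theta> j - ts i) f0 (x - ts i))" for i j
  have "mixture f0 q p \<theta> x = (\<Sum>j<q. p j * g (\<theta> j) x) + (\<Sum>j<q. if lab (\<theta> j) < n then \<phi> (lab (\<theta> j)) j else 0)"
    unfolding mixture_def shifted_def sum.distrib[symmetric]
  proof (rule sum.cong[OF refl])
    fix j
    have "g (\<theta> j) x + (if lab (\<theta> j) < n then f0 (x - ts (lab (\<theta> j))) - dird (\<theta> j - ts (lab (\<theta> j))) f0 (x - ts (lab (\<theta> j))) else 0)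
        = f0 (x - \<theta> j)" by (simp add: g_def)
    then show "p j * f0 (x - \<theta> j) = p j * g (\<theta> j) x + (if lab (\<theta> j) < n then \<phi> (lab (\<theta> j)) j else 0)"
      unfolding \<phi>_def by (auto simp flip: distrib_left)
  qed
  also have "(\<Sum>j<q. if lab (\<theta> j) < n then \<phi> (lab (\<theta> j)) j else 0) = (\<Sum>i<n. \<Sum>j\<in>{j. j < q \<and> lab (\<theta> j) = i}. \<phi> i j)"
    by (rule sum_by_label)
  also have "\<dots> = (\<Sum>i<n. (ca p \<theta> i + ps i) * f0 (x - ts i) - (\<Sum>k\<in>UNIV. cb p \<theta> i k * partial_deriv k f0 (x - ts i)))"
  proof (intro sum.cong refl)
    fix i
    have s1: "(\<Sum>j\<in>{j. j < q \<and> lab (\<theta> j) = i}. \<phi> i j)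
       = (\<Sum>j\<in>{j. j < q \<and> lab (\<theta> j) = i}. p j * f0 (x - ts i))
         - (\<Sum>j\<in>{j. j < q \<and> lab (\<theta> j) = i}. p j * dird (\<theta> j - ts i) f0 (x - ts i))"
      unfolding \<phi>_def right_diff_distrib by (rule sum_subtractf)
    have s2: "(\<Sum>j\<in>{j. j < q \<and> lab (\<theta> j) = i}. p j * f0 (x - ts i)) = (ca p \<theta> i + ps i) * f0 (x - ts i)"
      unfolding ca_def diff_add_cancel by (rule sum_distrib_right[symmetric])
    have "(\<Sum>j\<in>{j. j < q \<and> lab (\<theta> j) = i}. p j * dird (\<theta> j - ts i) f0 (x - ts i))
       = (\<Sum>k\<in>UNIV. cb p \<theta> i k * partial_deriv k f0 (x - ts i))"
      unfolding dird_def cb_def by (simp only: sum_distrib_left sum_distrib_right mult.assoc) (rule sum.swap)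
    then show "(\<Sum>j\<in>{j. j < q \<and> lab (\<theta> j) = i}. \<phi> i j)
       = (ca p \<theta> i + ps i) * f0 (x - ts i) - (\<Sum>k\<in>UNIV. cb p \<theta> i k * partial_deriv k f0 (x - ts i))"
      by (simp only: s1 s2)
  qed
  also have "\<dots> = (\<Sum>i<n. ca p \<theta> i * f0 (x - ts i) - (\<Sum>k\<in>UNIV. cb p \<theta> i k * partial_deriv k f0 (x - ts i))) + fs x"
  proof -
    have fsx: "fs x = (\<Sum>i<n. ps i * f0 (x - ts i))" unfolding fs_eq mixture_def shifted_def ..
    show ?thesis unfolding fsx sum.distrib[symmetric]
      by (rule sum.cong[OF refl]) (simp add: distrib_right)
  qed
  finally show ?thesis by linarith
qed

lemma main_part_bound:
  fixes h :: real
  assumes "\<And>i. i < n \<Longrightarrow> \<bar>a i\<bar> \<le> h" "\<And>i k. i < n \<Longrightarrow> \<bar>b i k\<bar> \<le> h"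
  shows "\<bar>\<Sum>i<n. a i * f0 (x - ts i) - (\<Sum>k\<in>UNIV. b i k * partial_deriv k f0 (x - ts i))\<bar>
     \<le> n * h * (H0 x + dm * H1 x) * fs x"
proof -
  have "\<bar>a i * f0 (x - ts i) - (\<Sum>k\<in>UNIV. b i k * partial_deriv k f0 (x - ts i))\<bar> \<le> h * (H0 x * fs x) + dm * (h * (H1 x * fs x))"
    if i: "i < n" for i
  proof -
    have h0: "0 \<le> h" using assms(1)[OF i] by simp
    have "\<bar>a i * f0 (x - ts i)\<bar> \<le> h * (H0 x * fs x)"
    proof -
      have "\<bar>f0 (x - ts i)\<bar> \<le> H0 x * fs x" using b0[OF ts[OF i], of x] f0_pos[of "x - ts i"] by simp
      from mult_mono[OF assms(1)[OF i] this h0 abs_ge_zero] show ?thesis by (simp only: abs_mult)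
    qed
    moreover have "\<bar>\<Sum>k\<in>UNIV. b i k * partial_deriv k f0 (x - ts i)\<bar> \<le> dm * (h * (H1 x * fs x))"
      unfolding dm
    proof (rule sum_abs_le_card)
      fix k
      from mult_mono[OF assms(2)[OF i] b1[OF ts[OF i], of k x] h0 abs_ge_zero]
      show "\<bar>b i k * partial_deriv k f0 (x - ts i)\<bar> \<le> h * (H1 x * fs x)" by (simp only: abs_mult)
    qed
    ultimately show ?thesis by linarith
  qed
  then have "\<bar>\<Sum>i<n. a i * f0 (x - ts i) - (\<Sum>k\<in>UNIV. b i k * partial_deriv k f0 (x - ts i))\<bar>
     \<le> (\<Sum>i<n. h * (H0 x * fs x) + dm * (h * (H1 x * fs x)))"
    by (intro order_trans[OF sum_abs] sum_mono) auto
  also have "\<dots> = n * (h * (H0 x * fs x) + dm * (h * (H1 x * fs x)))" by simp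
  also have "\<dots> = n * h * (H0 x + dm * H1 x) * fs x" by algebra
  finally show ?thesis .
qed

lemma g_near: "lab \<theta> < n \<Longrightarrow> g \<theta> x = dird (\<theta> - ts (lab \<theta>)) (dird (\<theta> - ts (lab \<theta>)) f0) (x - ts (lab \<theta>)) / 2 + rem2 \<theta> (ts (lab \<theta>)) x"
  by (simp add: g_def rem2_def)

lemma rem2_le:
  assumes "\<theta> \<in> \<Theta>" "i < n" "norm (\<theta> - ts i) \<le> w^3" "0 < w" "w \<le> 1" and E: "rem_env w x = ennreal (E^2)" "0 \<le> E"
  shows "\<bar>rem2 \<theta> (ts i) x\<bar> \<le> (norm (\<theta> - ts i))^2 * (E * fs x)"
proof -
  have "ennreal ((rem2 \<theta> (ts i) x / fs x)^2) \<le> ennreal (norm (\<theta> - ts i)^4) * ennreal (E^2)"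
    using rem_env[OF assms(1) ts[OF assms(2)] assms(3-5), of x] E by simp
  then have "ennreal ((rem2 \<theta> (ts i) x / fs x)^2) \<le> ennreal ((norm (\<theta> - ts i)^2 * E)^2)"
    by (simp add: ennreal_mult[symmetric] power_mult_distrib power_mult[symmetric])
  then have "(rem2 \<theta> (ts i) x / fs x)^2 \<le> (norm (\<theta> - ts i)^2 * E)^2" by (subst (asm) ennreal_le_iff) auto
  then have "\<bar>rem2 \<theta> (ts i) x / fs x\<bar> \<le> \<bar>norm (\<theta> - ts i)^2 * E\<bar>" by (simp only: abs_le_square_iff)
  moreover have "0 \<le> norm (\<theta> - ts i)^2 * E" using E(2) by simp
  ultimately have "\<bar>rem2 \<theta> (ts i) x / fs x\<bar> \<le> norm (\<theta> - ts i)^2 * E" by (simp only: abs_of_nonneg)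
  then show ?thesis using fs_pos[of x] by (simp add: abs_divide divide_le_eq mult.assoc)
qed

lemma g_bound:
  assumes "\<theta> \<in> \<Theta>"
  shows "\<bar>g \<theta> x\<bar> \<le> (2 * H0 x + dm * H1 x) * fs x"
proof (cases "lab \<theta> < n")
  case True
  let ?t = "ts (lab \<theta>)"
  have t: "?t \<in> \<Theta>" by (rule ts[OF True])
  have Hn: "0 \<le> H0 x" "0 \<le> H1 x" "0 < fs x" by (rule H_nonneg fs_pos)+
  have "\<bar>dird (\<theta> - ?t) f0 (x - ?t)\<bar> \<le> dm * (norm (\<theta> - ?t) * (H1 x * fs x))"
    unfolding dm by (intro dird_bound1 b1 t)
  also have "\<dots> \<le> dm * (1 * (H1 x * fs x))"
    using label_lessD[OF True] rr Hn dm1 by (intro mult_left_mono mult_right_mono) auto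
  finally have "\<bar>dird (\<theta> - ?t) f0 (x - ?t)\<bar> \<le> dm * (H1 x * fs x)" by simp
  then show ?thesis
    using b0[OF assms, of x] b0[OF t, of x] f0_pos[of "x - \<theta>"] f0_pos[of "x - ?t"] True Hn
    by (simp add: g_def algebra_simps abs_if split: if_splits)
next
  case False
  have Hn: "0 \<le> H0 x" "0 \<le> H1 x" "0 < fs x" by (rule H_nonneg fs_pos)+
  have "\<bar>g \<theta> x\<bar> \<le> H0 x * fs x" using b0[OF assms, of x] f0_pos[of "x - \<theta>"] False by (simp add: g_def)
  also have "\<dots> \<le> (2 * H0 x + dm * H1 x) * fs x" using Hn dm1 by (intro mult_right_mono) (auto simp: add_increasing2)
  finally show ?thesis .
qed

text \<open>With equal labels the zeroth order terms at the true point cancel, and the first order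
  terms differ by one derivative in the direction \<open>\<theta> - \<theta>'\<close>, bounded at
  the true point by \<open>H1\<close>. The rest is the oscillation of \<open>f0\<close>.\<close>

lemma g_diff:
  assumes \<theta>: "\<theta> \<in> \<Theta>" "\<theta>' \<in> \<Theta>" "lab \<theta> = lab \<theta>'" "norm (\<theta> - \<theta>') \<le> r" "0 < r" "r \<le> 1"
    and O: "osc_sq r x = ennreal (Or^2)" "0 \<le> Or"
  shows "\<bar>g \<theta> x - g \<theta>' x\<bar> \<le> (Or + dm * r * H1 x) * fs x"
proof -
  have Hn: "0 \<le> H1 x" "0 < fs x" by (rule H_nonneg fs_pos)+
  have "ennreal (((f0 (x - \<theta>) - f0 (x - \<theta>')) / fs x)^2) \<le> ennreal (Or^2)"
    using osc_sq[OF \<theta>(1,2,4-6), of x] O by simp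
  then have "((f0 (x - \<theta>) - f0 (x - \<theta>')) / fs x)^2 \<le> Or^2" by (subst (asm) ennreal_le_iff) auto
  then have "\<bar>(f0 (x - \<theta>) - f0 (x - \<theta>')) / fs x\<bar> \<le> Or" using O(2) by (simp add: abs_le_square_iff[symmetric])
  then have d0: "\<bar>f0 (x - \<theta>) - f0 (x - \<theta>')\<bar> \<le> Or * fs x" using Hn by (simp add: abs_divide divide_le_eq)
  show ?thesis
  proof (cases "lab \<theta> < n")
    case True
    let ?t = "ts (lab \<theta>)"
    have "dird (\<theta> - ?t) f0 (x - ?t) - dird (\<theta>' - ?t) f0 (x - ?t) = dird (\<theta> - \<theta>') f0 (x - ?t)"
      by (simp only: dird_lin)
    moreover have "\<bar>dird (\<theta> - \<theta>') f0 (x - ?t)\<bar> \<le> dm * (norm (\<theta> - \<theta>') * (H1 x * fs x))"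
      unfolding dm by (intro dird_bound1 b1 ts[OF True])
    moreover have "dm * (norm (\<theta> - \<theta>') * (H1 x * fs x)) \<le> dm * (r * (H1 x * fs x))"
      using \<theta>(4) Hn dm1 by (intro mult_left_mono mult_right_mono) auto
    ultimately show ?thesis using d0 True \<theta>(3) by (simp add: g_def algebra_simps)
  next
    case False
    have "0 \<le> dm * r * H1 x * fs x" using dm1 \<theta>(5) Hn by simp
    then show ?thesis using d0 False \<theta>(3) by (simp add: g_def algebra_simps)
  qed
qed

lemma not_near_lw: "\<not> near \<theta> \<Longrightarrow> u^6 \<le> lw \<theta>"
proof (cases "lab \<theta> < n")
  case True
  assume "\<not> near \<theta>"
  then have "u^3 \<le> norm (\<theta> - ts (lab \<theta>))" using True by (simp add: near_def)
  then have "(u^3)^2 \<le> (norm (\<theta> - ts (lab \<theta>)))^2" using u by (intro power_mono) auto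
  then show ?thesis using True by (simp add: loc_weight_def power_mult[symmetric])
next
  case False
  then show ?thesis using u by (simp add: loc_weight_def power_le_one)
qed

lemma near_lw: "near \<theta> \<Longrightarrow> lw \<theta> = (norm (\<theta> - ts (lab \<theta>)))^2"
  by (simp add: near_def loc_weight_def)

lemma sum_sub_le:
  assumes "admissible p \<theta>" "A \<subseteq> {..<q}"
  shows "(\<Sum>j\<in>A. p j * lw (\<theta> j)) \<le> K * \<epsilon>"
proof -
  have "(\<Sum>j\<in>A. p j * lw (\<theta> j)) \<le> (\<Sum>j<q. p j * lw (\<theta> j))"
    by (rule sum_mono2[OF _ assms(2)]) (use admissibleD(1)[OF assms(1)] in \<open>auto intro!: mult_nonneg_nonneg loc_weight_nonneg\<close>)
  also have "\<dots> \<le> K * \<epsilon>" by (rule admissibleD(3)[OF assms(1)])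
  finally show ?thesis .
qed

text \<open>A Chebyshev bound: each component that is not near has local weight at least
  \<open>u^6\<close>.\<close>

lemma not_near_mass:
  assumes "admissible p \<theta>"
  shows "(\<Sum>j\<in>{j. j < q \<and> \<not> near (\<theta> j)}. p j) \<le> K * \<epsilon> / u^6"
proof -
  have "u^6 * (\<Sum>j\<in>{j. j < q \<and> \<not> near (\<theta> j)}. p j) \<le> (\<Sum>j\<in>{j. j < q \<and> \<not> near (\<theta> j)}. p j * lw (\<theta> j))"
    unfolding sum_distrib_left using admissibleD(1)[OF assms] not_near_lw
    by (intro sum_mono) (auto simp: mult.commute intro!: mult_left_mono)
  also have "\<dots> \<le> K * \<epsilon>" by (rule sum_sub_le[OF assms]) auto
  finally show ?thesis using u by (simp add: field_simps)
qed

text \<open>Cauchy-Schwarz over at most \<open>q\<close> indices, since only the squares of these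
  numbers have a sum bounded independently of \<open>q\<close>. The factor \<open>sqrt q\<close>
  cancels against the rounding step \<open>u^2 * sqrt \<epsilon> / sqrt q\<close>.\<close>

lemma wc_sum:
  assumes "admissible p \<theta>" "A \<subseteq> {j. j < q \<and> near (\<theta> j)}"
  shows "(\<Sum>j\<in>A. \<bar>wc p \<theta> j k\<bar>) \<le> sqrt q * sqrt (K * \<epsilon>)"
proof (rule sum_abs_le_sqrt)
  show fin: "finite A" using assms(2) finite_subset by fastforce
  have "A \<subseteq> {..<q}" using assms(2) by auto
  then show "card A \<le> q" using card_mono[of "{..<q}" A] by simp
  have "(\<Sum>j\<in>A. (wc p \<theta> j k)^2) \<le> (\<Sum>j\<in>A. p j * lw (\<theta> j))"
  proof (rule sum_mono)
    fix j assume j: "j \<in> A"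
    then have jq: "j < q" "near (\<theta> j)" using assms(2) by auto
    have "(wc p \<theta> j k)^2 = p j * ((\<theta> j - ts (lab (\<theta> j))) $ k)^2"
      using admissibleD(1)[OF assms(1) jq(1)] by (simp add: wc_def power_mult_distrib)
    also have "\<dots> \<le> p j * lw (\<theta> j)"
      unfolding near_lw[OF jq(2)] using admissibleD(1)[OF assms(1) jq(1)] component_le_norm_cart[of "\<theta> j - ts (lab (\<theta> j))" k]
      by (intro mult_left_mono) (auto simp: abs_le_square_iff[symmetric])
    finally show "(wc p \<theta> j k)^2 \<le> p j * lw (\<theta> j)" .
  qed
  also have "\<dots> \<le> K * \<epsilon>" by (rule sum_sub_le[OF assms(1)]) fact
  finally show "(\<Sum>j\<in>A. (wc p \<theta> j k)^2) \<le> K * \<epsilon>" .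
qed

text \<open>Every tolerance makes its contribution of order \<open>\<epsilon> * u^2\<close>: weights
  \<open>\<epsilon> * u^2 / q\<close> add up over \<open>q\<close> terms, positions
  \<open>u^8\<close> meet a mass \<open>\<epsilon> / u^6\<close>, and scaled offsets
  \<open>u^2 * sqrt \<epsilon> / sqrt q\<close> meet the sum from \<open>wc_sum\<close>.\<close>

definition same_code where
  "same_code p \<theta> p' \<theta>' \<longleftrightarrow>
     (\<forall>j<q. lab (\<theta> j) = lab (\<theta>' j) \<and> near (\<theta> j) = near (\<theta>' j)) \<and>
     (\<forall>i<n. \<bar>ca p \<theta> i - ca p' \<theta>' i\<bar> \<le> u^2 * \<epsilon>) \<and>
     (\<forall>i<n. \<forall>k. \<bar>cb p \<theta> i k - cb p' \<theta>' i k\<bar> \<le> u^2 * \<epsilon>) \<and>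
     (\<forall>j<q. near (\<theta> j) \<longrightarrow> (\<forall>k. \<bar>wc p \<theta> j k - wc p' \<theta>' j k\<bar> \<le> u^2 * sqrt \<epsilon> / sqrt q)) \<and>
     (\<forall>j<q. \<not> near (\<theta> j) \<longrightarrow> \<bar>p j - p' j\<bar> \<le> \<epsilon> * u^2 / q \<and> (\<forall>k. \<bar>(\<theta> j - \<theta>' j) $ k\<bar> \<le> u^8 / dm))"

text \<open>With the factor \<open>sqrt (p j)\<close> inside, weight and offset enter only through
  products \<open>w j k * w j l\<close>. Their differences are linear in the rounding step, and the
  remaining factors are summed by \<open>wc_sum\<close>.\<close>

lemma near_quad_bound:
  assumes admissible: "admissible p \<theta>" "admissible p' \<theta>'" and sc: "same_code p \<theta> p' \<theta>'"
  defines "N \<equiv> {j. j < q \<and> near (\<theta> j)}"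
  shows "\<bar>\<Sum>j\<in>N. p j * dird (\<theta> j - ts (lab (\<theta> j))) (dird (\<theta> j - ts (lab (\<theta> j))) f0) (x - ts (lab (\<theta> j)))
      - p' j * dird (\<theta>' j - ts (lab (\<theta>' j))) (dird (\<theta>' j - ts (lab (\<theta>' j))) f0) (x - ts (lab (\<theta>' j)))\<bar>
    \<le> 2 * dm^2 * K * u^2 * \<epsilon> * (H2 x * fs x)"
proof -
  define w where "w = wc p \<theta>"
  define w' where "w' = wc p' \<theta>'"
  define h where "h = u^2 * sqrt \<epsilon> / sqrt q"
  define B where "B = H2 x * fs x"
  have B0: "0 \<le> B" using H_nonneg(3)[of x] fs_pos[of x] by (simp add: B_def)
  have h0: "0 \<le> h" using eps by (simp add: h_def)
  have N': "N = {j. j < q \<and> near (\<theta>' j)}" using sc by (auto simp: N_def same_code_def)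
  have wd: "\<bar>w j k - w' j k\<bar> \<le> h" if "j \<in> N" for j k using sc that by (auto simp: same_code_def N_def w_def w'_def h_def)
  have exp: "p j * dird (\<theta> j - ts (lab (\<theta> j))) (dird (\<theta> j - ts (lab (\<theta> j))) f0) y
      = (\<Sum>k\<in>UNIV. \<Sum>l\<in>UNIV. wc p \<theta> j k * wc p \<theta> j l * partial_deriv k (partial_deriv l f0) y)"
    if "j < q" "admissible p \<theta>" for j y p \<theta>
  proof -
    have "sqrt (p j) * sqrt (p j) = p j" using admissibleD(1)[OF that(2,1)] by simp
    moreover have "wc p \<theta> j k * wc p \<theta> j l
        = (sqrt (p j) * sqrt (p j)) * ((\<theta> j - ts (lab (\<theta> j))) $ k * (\<theta> j - ts (lab (\<theta> j))) $ l)" for k l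
      unfolding wc_def by (simp only: mult_ac)
    ultimately have "wc p \<theta> j k * wc p \<theta> j l = p j * ((\<theta> j - ts (lab (\<theta> j))) $ k * (\<theta> j - ts (lab (\<theta> j))) $ l)" for k l
      by simp
    then show ?thesis unfolding dird_expand2[OF C2] by (simp add: sum_distrib_left mult_ac)
  qed
  have one: "\<bar>p j * dird (\<theta> j - ts (lab (\<theta> j))) (dird (\<theta> j - ts (lab (\<theta> j))) f0) (x - ts (lab (\<theta> j)))
      - p' j * dird (\<theta>' j - ts (lab (\<theta>' j))) (dird (\<theta>' j - ts (lab (\<theta>' j))) f0) (x - ts (lab (\<theta>' j)))\<bar>
     \<le> (\<Sum>k\<in>UNIV. \<Sum>l\<in>UNIV. h * (\<bar>w j l\<bar> + \<bar>w' j k\<bar>) * B)" if j: "j \<in> N" for j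
  proof -
    have jq: "j < q" "near (\<theta> j)" using j by (auto simp: N_def)
    have le: "lab (\<theta>' j) = lab (\<theta> j)" using sc jq by (auto simp: same_code_def)
    have tn: "ts (lab (\<theta> j)) \<in> \<Theta>" using jq(2) by (auto simp: near_def intro: ts)
    define y where "y = x - ts (lab (\<theta> j))"
    have yle: "x - ts (lab (\<theta>' j)) = y" by (simp add: y_def le)
    have "p j * dird (\<theta> j - ts (lab (\<theta> j))) (dird (\<theta> j - ts (lab (\<theta> j))) f0) (x - ts (lab (\<theta> j)))
      - p' j * dird (\<theta>' j - ts (lab (\<theta>' j))) (dird (\<theta>' j - ts (lab (\<theta>' j))) f0) (x - ts (lab (\<theta>' j)))
      = (\<Sum>k\<in>UNIV. \<Sum>l\<in>UNIV. (w j k * w j l - w' j k * w' j l) * partial_deriv k (partial_deriv l f0) y)"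
      unfolding exp[OF jq(1) admissible(1)] exp[OF jq(1) admissible(2)] yle y_def[symmetric] w_def w'_def
      by (simp add: sum_subtractf left_diff_distrib)
    also have "\<bar>\<dots>\<bar> \<le> (\<Sum>k\<in>UNIV. \<Sum>l\<in>UNIV. h * (\<bar>w j l\<bar> + \<bar>w' j k\<bar>) * B)"
    proof (intro order_trans[OF sum_abs] sum_mono)
      fix k l
      have "w j k * w j l - w' j k * w' j l = (w j k - w' j k) * w j l + w' j k * (w j l - w' j l)" by (simp add: algebra_simps)
      also have "\<bar>\<dots>\<bar> \<le> \<bar>w j k - w' j k\<bar> * \<bar>w j l\<bar> + \<bar>w' j k\<bar> * \<bar>w j l - w' j l\<bar>"
        by (simp only: abs_mult[symmetric] abs_triangle_ineq)
      also have "\<dots> \<le> h * \<bar>w j l\<bar> + \<bar>w' j k\<bar> * h" using wd[OF j] h0 by (intro add_mono mult_mono) auto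
      finally have "\<bar>w j k * w j l - w' j k * w' j l\<bar> \<le> h * (\<bar>w j l\<bar> + \<bar>w' j k\<bar>)" by (simp add: algebra_simps)
      moreover have "\<bar>partial_deriv k (partial_deriv l f0) y\<bar> \<le> B" unfolding y_def B_def by (rule b2[OF tn])
      ultimately show "\<bar>(w j k * w j l - w' j k * w' j l) * partial_deriv k (partial_deriv l f0) y\<bar> \<le> h * (\<bar>w j l\<bar> + \<bar>w' j k\<bar>) * B"
        unfolding abs_mult using h0 by (intro mult_mono) auto
    qed
    finally show ?thesis .
  qed
  have "\<bar>\<Sum>j\<in>N. p j * dird (\<theta> j - ts (lab (\<theta> j))) (dird (\<theta> j - ts (lab (\<theta> j))) f0) (x - ts (lab (\<theta> j)))
      - p' j * dird (\<theta>' j - ts (lab (\<theta>' j))) (dird (\<theta>' j - ts (lab (\<theta>' j))) f0) (x - ts (lab (\<theta>' j)))\<bar>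
    \<le> (\<Sum>j\<in>N. \<Sum>k\<in>UNIV. \<Sum>l\<in>UNIV. h * (\<bar>w j l\<bar> + \<bar>w' j k\<bar>) * B)"
    using one by (intro order_trans[OF sum_abs] sum_mono)
  also have "\<dots> = (\<Sum>k\<in>UNIV. \<Sum>l\<in>UNIV. \<Sum>j\<in>N. h * (\<bar>w j l\<bar> + \<bar>w' j k\<bar>) * B)"
    by (subst sum.swap, intro sum.cong refl, rule sum.swap)
  also have "\<dots> = (\<Sum>k\<in>UNIV. \<Sum>l\<in>UNIV. h * B * ((\<Sum>j\<in>N. \<bar>w j l\<bar>) + (\<Sum>j\<in>N. \<bar>w' j k\<bar>)))"
    by (simp add: sum_distrib_left sum.distrib[symmetric] algebra_simps)
  also have "\<dots> \<le> (\<Sum>k\<in>(UNIV::'d set). \<Sum>l\<in>(UNIV::'d set). h * B * (sqrt q * sqrt (K * \<epsilon>) + sqrt q * sqrt (K * \<epsilon>)))"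
    unfolding w_def w'_def using h0 B0 wc_sum[OF admissible(1), of N] wc_sum[OF admissible(2), of N] N'
    by (intro sum_mono mult_left_mono add_mono) (auto simp: N_def)
  also have "\<dots> = dm^2 * (h * B * (2 * sqrt q * sqrt (K * \<epsilon>)))" by (simp add: dm power2_eq_square)
  also have "h * B * (2 * sqrt q * sqrt (K * \<epsilon>)) = 2 * u^2 * \<epsilon> * sqrt K * B"
  proof -
    have "sqrt \<epsilon> * sqrt \<epsilon> = \<epsilon>" using eps by simp
    then show ?thesis using q by (simp add: h_def real_sqrt_mult) 
  qed
  also have "dm^2 * (2 * u^2 * \<epsilon> * sqrt K * B) \<le> dm^2 * (2 * u^2 * \<epsilon> * K * B)"
  proof -
    have "sqrt K \<le> K" using K by (intro real_le_lsqrt) (auto simp: power2_eq_square)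
    then show ?thesis using u eps B0 by (intro mult_left_mono mult_right_mono) auto
  qed
  finally show ?thesis by (simp add: B_def mult_ac)
qed

definition K1 :: real where "K1 = (n + 3) * dm^2 * K"

text \<open>The difference splits into the main part, the quadratic terms of near components, their
  remainders, and the components that are not near. The remainders are small for each mixture
  separately; the other three pieces use the rounding.\<close>

lemma same_code_diff:
  assumes admissible: "admissible p \<theta>" "admissible p' \<theta>'" and sc: "same_code p \<theta> p' \<theta>'"
    and E: "rem_env u x = ennreal (E^2)" "0 \<le> E" and O: "osc_sq (u^8) x = ennreal (Or^2)" "0 \<le> Or"
  shows "\<bar>mixture f0 q p \<theta> x - mixture f0 q p' \<theta>' x\<bar> \<le> \<epsilon> * K1 * (u^2 * (H0 x + H1 x + H2 x) + E + Or / u^6) * fs x"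
proof -
  define a where "a = fs x"
  have a: "0 < a" by (simp add: a_def fs_pos)
  have Hn: "0 \<le> H0 x" "0 \<le> H1 x" "0 \<le> H2 x" by (rule H_nonneg)+
  define N where "N = {j. j < q \<and> near (\<theta> j)}"
  define M where "M = {j. j < q \<and> \<not> near (\<theta> j)}"
  have split: "(\<Sum>j<q. h j) = (\<Sum>j\<in>N. h j) + (\<Sum>j\<in>M. h j)" for h :: "nat \<Rightarrow> real"
  proof -
    have "{..<q} = N \<union> M" by (auto simp: N_def M_def)
    moreover have "sum h (N \<union> M) = sum h N + sum h M"
      by (rule sum.union_disjoint) (auto simp: N_def M_def)
    ultimately show ?thesis by simp
  qed
  have N': "N = {j. j < q \<and> near (\<theta>' j)}" "M = {j. j < q \<and> \<not> near (\<theta>' j)}" using sc by (auto simp: N_def M_def same_code_def)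
  define Q where "Q p \<theta> j = p j * dird (\<theta> j - ts (lab (\<theta> j))) (dird (\<theta> j - ts (lab (\<theta> j))) f0) (x - ts (lab (\<theta> j)))" for p and \<theta> :: "nat \<Rightarrow> real^'d" and j :: nat
  define R where "R p \<theta> j = p j * rem2 (\<theta> j) (ts (lab (\<theta> j))) x" for p and \<theta> :: "nat \<Rightarrow> real^'d" and j :: nat
  have gN: "p j * g (\<theta> j) x = Q p \<theta> j / 2 + R p \<theta> j" if "near (\<theta> j)" for j p \<theta>
    using g_near[of "\<theta> j" x] that by (simp add: near_def Q_def R_def algebra_simps)
  have Rb: "\<bar>\<Sum>j\<in>{j. j < q \<and> near (\<theta> j)}. R p \<theta> j\<bar> \<le> K * \<epsilon> * (E * a)" if ad: "admissible p \<theta>" for p \<theta>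
  proof -
    have "\<bar>\<Sum>j\<in>{j. j < q \<and> near (\<theta> j)}. R p \<theta> j\<bar> \<le> (\<Sum>j\<in>{j. j < q \<and> near (\<theta> j)}. (p j * lw (\<theta> j)) * (E * a))"
    proof (intro order_trans[OF sum_abs] sum_mono)
      fix j assume "j \<in> {j. j < q \<and> near (\<theta> j)}"
      then have j: "j < q" "near (\<theta> j)" by auto
      have "\<bar>rem2 (\<theta> j) (ts (lab (\<theta> j))) x\<bar> \<le> lw (\<theta> j) * (E * a)"
        unfolding near_lw[OF j(2)] a_def using j admissibleD(2)[OF ad j(1)] u
        by (intro rem2_le[OF _ _ _ _ _ E]) (auto simp: near_def)
      then show "\<bar>R p \<theta> j\<bar> \<le> p j * lw (\<theta> j) * (E * a)"
        unfolding R_def abs_mult using admissibleD(1)[OF ad j(1)] by (simp add: mult.assoc mult_left_mono)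
    qed
    also have "\<dots> = (\<Sum>j\<in>{j. j < q \<and> near (\<theta> j)}. p j * lw (\<theta> j)) * (E * a)" by (simp only: sum_distrib_right)
    also have "\<dots> \<le> K * \<epsilon> * (E * a)" using E a by (intro mult_right_mono sum_sub_le[OF ad]) auto
    finally show ?thesis .
  qed
  have t1: "\<bar>\<Sum>i<n. (ca p \<theta> i - ca p' \<theta>' i) * f0 (x - ts i) - (\<Sum>k\<in>UNIV. (cb p \<theta> i k - cb p' \<theta>' i k) * partial_deriv k f0 (x - ts i))\<bar>
     \<le> n * (u^2 * \<epsilon>) * (H0 x + dm * H1 x) * fs x"
    by (rule main_part_bound) (use sc in \<open>auto simp: same_code_def\<close>)
  have t2: "\<bar>\<Sum>j\<in>N. Q p \<theta> j - Q p' \<theta>' j\<bar> \<le> 2 * dm^2 * K * u^2 * \<epsilon> * (H2 x * a)"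
    unfolding Q_def N_def a_def by (rule near_quad_bound[OF admissible sc])
  have t3: "\<bar>\<Sum>j\<in>N. R p \<theta> j\<bar> \<le> K * \<epsilon> * (E * a)" "\<bar>\<Sum>j\<in>N. R p' \<theta>' j\<bar> \<le> K * \<epsilon> * (E * a)"
    using Rb[OF admissible(1)] Rb[OF admissible(2)] N' by (auto simp: N_def)
  define r where "r = u^8"
  have r: "0 < r" "r \<le> 1" using u by (auto simp: r_def power_le_one)
  have t4: "\<bar>\<Sum>j\<in>M. p j * g (\<theta> j) x - p' j * g (\<theta>' j) x\<bar>
     \<le> \<epsilon> * u^2 * ((2 * H0 x + dm * H1 x) * a) + K * \<epsilon> / u^6 * ((Or + dm * r * H1 x) * a)"
  proof -
    have "\<bar>\<Sum>j\<in>M. p j * g (\<theta> j) x - p' j * g (\<theta>' j) x\<bar>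
       \<le> (\<Sum>j\<in>M. \<epsilon> * u^2 / q * ((2 * H0 x + dm * H1 x) * a) + p' j * ((Or + dm * r * H1 x) * a))"
    proof (intro order_trans[OF sum_abs] sum_mono)
      fix j assume "j \<in> M"
      then have j: "j < q" "\<not> near (\<theta> j)" by (auto simp: M_def)
      have "p j * g (\<theta> j) x - p' j * g (\<theta>' j) x = (p j - p' j) * g (\<theta> j) x + p' j * (g (\<theta> j) x - g (\<theta>' j) x)"
        by (simp add: algebra_simps)
      also have "\<bar>\<dots>\<bar> \<le> \<bar>p j - p' j\<bar> * \<bar>g (\<theta> j) x\<bar> + p' j * \<bar>g (\<theta> j) x - g (\<theta>' j) x\<bar>"
        using admissibleD(1)[OF admissible(2) j(1)] by (intro order_trans[OF abs_triangle_ineq]) (simp add: abs_mult)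
      also have "\<dots> \<le> \<epsilon> * u^2 / q * ((2 * H0 x + dm * H1 x) * a) + p' j * ((Or + dm * r * H1 x) * a)"
      proof (intro add_mono mult_mono)
        show "\<bar>p j - p' j\<bar> \<le> \<epsilon> * u^2 / q" using sc j by (auto simp: same_code_def)
        show "\<bar>g (\<theta> j) x\<bar> \<le> (2 * H0 x + dm * H1 x) * a" unfolding a_def by (rule g_bound[OF admissibleD(2)[OF admissible(1) j(1)]])
        have "norm (\<theta> j - \<theta>' j) \<le> (\<Sum>k\<in>UNIV. \<bar>(\<theta> j - \<theta>' j) $ k\<bar>)" by (rule norm_le_l1_cart)
        also have "\<dots> \<le> (\<Sum>k\<in>(UNIV::'d set). u^8 / dm)" using sc j by (intro sum_mono) (auto simp: same_code_def)
        also have "\<dots> = r" using dm1 by (simp add: r_def dm)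
        finally have nr: "norm (\<theta> j - \<theta>' j) \<le> r" .
        show "\<bar>g (\<theta> j) x - g (\<theta>' j) x\<bar> \<le> (Or + dm * r * H1 x) * a" unfolding a_def
          using O sc j by (intro g_diff admissibleD(2)[OF admissible(1) j(1)] admissibleD(2)[OF admissible(2) j(1)] nr r) (auto simp: same_code_def r_def)
      qed (use eps admissibleD(1)[OF admissible(2) j(1)] in auto)
      finally show "\<bar>p j * g (\<theta> j) x - p' j * g (\<theta>' j) x\<bar>
         \<le> \<epsilon> * u^2 / q * ((2 * H0 x + dm * H1 x) * a) + p' j * ((Or + dm * r * H1 x) * a)" .
    qed
    also have "\<dots> = card M * (\<epsilon> * u^2 / q * ((2 * H0 x + dm * H1 x) * a)) + (\<Sum>j\<in>M. p' j) * ((Or + dm * r * H1 x) * a)"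
      by (simp add: sum.distrib sum_distrib_right)
    also have "\<dots> \<le> q * (\<epsilon> * u^2 / q * ((2 * H0 x + dm * H1 x) * a)) + K * \<epsilon> / u^6 * ((Or + dm * r * H1 x) * a)"
    proof (intro add_mono mult_right_mono)
      have "M \<subseteq> {..<q}" by (auto simp: M_def)
      then show "real (card M) \<le> real q" using card_mono[of "{..<q}" M] by simp
      show "(\<Sum>j\<in>M. p' j) \<le> K * \<epsilon> / u^6" unfolding N'(2) by (rule not_near_mass[OF admissible(2)])
    qed (use eps Hn dm1 a O r in auto)
    finally show ?thesis using q by simp
  qed
  have "mixture f0 q p \<theta> x - mixture f0 q p' \<theta>' x
     = (\<Sum>i<n. (ca p \<theta> i - ca p' \<theta>' i) * f0 (x - ts i) - (\<Sum>k\<in>UNIV. (cb p \<theta> i k - cb p' \<theta>' i k) * partial_deriv k f0 (x - ts i)))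
      + ((\<Sum>j<q. p j * g (\<theta> j) x) - (\<Sum>j<q. p' j * g (\<theta>' j) x))"
  proof -
    let ?S = "\<lambda>p \<theta>. \<Sum>i<n. ca p \<theta> i * f0 (x - ts i) - (\<Sum>k\<in>UNIV. cb p \<theta> i k * partial_deriv k f0 (x - ts i))"
    have "(\<Sum>i<n. (ca p \<theta> i - ca p' \<theta>' i) * f0 (x - ts i) - (\<Sum>k\<in>UNIV. (cb p \<theta> i k - cb p' \<theta>' i k) * partial_deriv k f0 (x - ts i)))
       = (\<Sum>i<n. (ca p \<theta> i * f0 (x - ts i) - (\<Sum>k\<in>UNIV. cb p \<theta> i k * partial_deriv k f0 (x - ts i)))
           - (ca p' \<theta>' i * f0 (x - ts i) - (\<Sum>k\<in>UNIV. cb p' \<theta>' i k * partial_deriv k f0 (x - ts i))))"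
    proof (intro sum.cong refl)
      fix i
      have 1: "(\<Sum>k\<in>UNIV. (cb p \<theta> i k - cb p' \<theta>' i k) * partial_deriv k f0 (x - ts i))
         = (\<Sum>k\<in>UNIV. cb p \<theta> i k * partial_deriv k f0 (x - ts i)) - (\<Sum>k\<in>UNIV. cb p' \<theta>' i k * partial_deriv k f0 (x - ts i))"
        by (simp only: left_diff_distrib sum_subtractf)
      show "(ca p \<theta> i - ca p' \<theta>' i) * f0 (x - ts i) - (\<Sum>k\<in>UNIV. (cb p \<theta> i k - cb p' \<theta>' i k) * partial_deriv k f0 (x - ts i))
       = (ca p \<theta> i * f0 (x - ts i) - (\<Sum>k\<in>UNIV. cb p \<theta> i k * partial_deriv k f0 (x - ts i)))
           - (ca p' \<theta>' i * f0 (x - ts i) - (\<Sum>k\<in>UNIV. cb p' \<theta>' i k * partial_deriv k f0 (x - ts i)))"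
        unfolding 1 left_diff_distrib[of "ca p \<theta> i"] by linarith
    qed
    then have "(\<Sum>i<n. (ca p \<theta> i - ca p' \<theta>' i) * f0 (x - ts i) - (\<Sum>k\<in>UNIV. (cb p \<theta> i k - cb p' \<theta>' i k) * partial_deriv k f0 (x - ts i)))
       = ?S p \<theta> - ?S p' \<theta>'" by (simp only: sum_subtractf[of "\<lambda>i. ca p \<theta> i * f0 (x - ts i) - (\<Sum>k\<in>UNIV. cb p \<theta> i k * partial_deriv k f0 (x - ts i))"])
    then show ?thesis using mixture_decomp[of p \<theta> x] mixture_decomp[of p' \<theta>' x] by linarith
  qed
  also have "(\<Sum>j<q. p j * g (\<theta> j) x) - (\<Sum>j<q. p' j * g (\<theta>' j) x)
     = (\<Sum>j\<in>N. Q p \<theta> j - Q p' \<theta>' j) / 2 + (\<Sum>j\<in>N. R p \<theta> j) - (\<Sum>j\<in>N. R p' \<theta>' j)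
      + (\<Sum>j\<in>M. p j * g (\<theta> j) x - p' j * g (\<theta>' j) x)"
  proof -
    have "(\<Sum>j\<in>N. p j * g (\<theta> j) x) = (\<Sum>j\<in>N. Q p \<theta> j / 2 + R p \<theta> j)" by (intro sum.cong gN refl) (auto simp: N_def)
    then have 1: "(\<Sum>j\<in>N. p j * g (\<theta> j) x) = (\<Sum>j\<in>N. Q p \<theta> j) / 2 + (\<Sum>j\<in>N. R p \<theta> j)"
      by (simp only: sum.distrib sum_divide_distrib)
    have "(\<Sum>j\<in>N. p' j * g (\<theta>' j) x) = (\<Sum>j\<in>N. Q p' \<theta>' j / 2 + R p' \<theta>' j)" by (intro sum.cong gN refl) (auto simp: N')
    then have 2: "(\<Sum>j\<in>N. p' j * g (\<theta>' j) x) = (\<Sum>j\<in>N. Q p' \<theta>' j) / 2 + (\<Sum>j\<in>N. R p' \<theta>' j)"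
      by (simp only: sum.distrib sum_divide_distrib)
    show ?thesis unfolding split[of "\<lambda>j. p j * g (\<theta> j) x"] split[of "\<lambda>j. p' j * g (\<theta>' j) x"] 1 2 sum_subtractf
      by (simp add: diff_divide_distrib)
  qed
  finally have eq: "mixture f0 q p \<theta> x - mixture f0 q p' \<theta>' x
     = (\<Sum>i<n. (ca p \<theta> i - ca p' \<theta>' i) * f0 (x - ts i) - (\<Sum>k\<in>UNIV. (cb p \<theta> i k - cb p' \<theta>' i k) * partial_deriv k f0 (x - ts i)))
      + ((\<Sum>j\<in>N. Q p \<theta> j - Q p' \<theta>' j) / 2 + (\<Sum>j\<in>N. R p \<theta> j) - (\<Sum>j\<in>N. R p' \<theta>' j)
      + (\<Sum>j\<in>M. p j * g (\<theta> j) x - p' j * g (\<theta>' j) x))" .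
  have tri: "\<bar>a + (b / 2 + c - c' + e)\<bar> \<le> A + B / 2 + C + C' + D"
    if "\<bar>a\<bar> \<le> A" "\<bar>b\<bar> \<le> B" "\<bar>c\<bar> \<le> C" "\<bar>c'\<bar> \<le> C'" "\<bar>e\<bar> \<le> D" for a b c c' e A B C C' D :: real
    using that by linarith
  have "\<bar>mixture f0 q p \<theta> x - mixture f0 q p' \<theta>' x\<bar>
     \<le> n * (u^2 * \<epsilon>) * (H0 x + dm * H1 x) * a + (2 * dm^2 * K * u^2 * \<epsilon> * (H2 x * a)) / 2 + K * \<epsilon> * (E * a) + K * \<epsilon> * (E * a)
      + (\<epsilon> * u^2 * ((2 * H0 x + dm * H1 x) * a) + K * \<epsilon> / u^6 * ((Or + dm * r * H1 x) * a))"
    unfolding eq using t1[folded a_def] t2 t3 t4 by (rule tri)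
  also have "\<dots> = \<epsilon> * a * (u^2 * ((real n + 2) * H0 x + (n * dm + dm + K * dm) * H1 x + dm^2 * K * H2 x) + 2 * K * E + K * (Or / u^6))"
  proof -
    \<comment> \<open>The rounding radius \<open>u^8\<close> against the mass bound with
      \<open>u^6\<close> in the denominator: this quotient is the reason for the power 8.\<close>
    have "r / u^6 = u^2" using u by (simp add: r_def power_diff[symmetric])
    note r6 = this
    have gen: "K * \<epsilon> / s * ((Or + dm * r * h) * a) = \<epsilon> * a * (K * (Or / s)) + \<epsilon> * a * ((r / s) * (K * dm * h))"
      if "s \<noteq> 0" for s h using that by (simp add: field_simps)
    have nz: "u^6 \<noteq> 0" using u(1) by simp
    have ru: "K * \<epsilon> / u^6 * ((Or + dm * r * H1 x) * a) = \<epsilon> * a * (K * (Or / u^6)) + \<epsilon> * a * (u^2 * (K * dm * H1 x))"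
      using gen[OF nz, of "H1 x"] unfolding r6 .
    have id: "N * (v * e) * (h0 + m * h1) * a + (2 * D * K * v * e * (h2 * a)) / 2 + K * e * (E * a) + K * e * (E * a)
        + (e * v * ((2 * h0 + m * h1) * a) + (e * a * (K * O') + e * a * (v * (K * m * h1))))
        = e * a * (v * ((N + 2) * h0 + (N * m + m + K * m) * h1 + D * K * h2) + 2 * K * E + K * O')"
      for N v e h0 m h1 D h2 O' :: real by (rule same_code_terms_sum)
    show ?thesis unfolding ru by (rule id)
  qed
  also have "\<dots> \<le> \<epsilon> * a * (u^2 * (K1 * H0 x + K1 * H1 x + K1 * H2 x) + K1 * E + K1 * (Or / u^6))"
  proof -
    have d2: "1 \<le> dm^2" using dm1 by (rule one_le_power)
    have d3: "dm \<le> dm^2" using dm1 mult_left_mono[of 1 dm dm] by (simp add: power2_eq_square)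
    have dK: "1 \<le> dm^2 * K" using mult_mono[OF d2 K] by simp
    have K1e: "K1 = (real n + 3) * (dm^2 * K)" by (simp add: K1_def)
    have k0: "real n + 2 \<le> K1"
    proof -
      have st: "(real n + 3) * 1 \<le> (real n + 3) * (dm^2 * K)" using dK by (intro mult_left_mono) auto
      show ?thesis unfolding K1e by (rule order_trans[OF _ st]) simp
    qed
    have k1: "n * dm + dm + K * dm \<le> K1"
    proof -
      have "real n * 1 \<le> real n * K" using K by (intro mult_left_mono) auto
      then have nK: "real n + 1 + K \<le> (real n + 3) * K" using K unfolding distrib_right by linarith
      have "n * dm + dm + K * dm = dm * (real n + 1 + K)" by (simp add: distrib_left mult.commute)
      also have "\<dots> \<le> dm^2 * ((real n + 3) * K)" using dm1 K by (intro mult_mono[OF d3 nK]) auto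
      finally show ?thesis unfolding K1e by (simp only: mult_ac)
    qed
    have dK0: "0 \<le> dm^2 * K" using K by simp
    have "1 * (dm^2 * K) \<le> (real n + 3) * (dm^2 * K)" using dK0 by (intro mult_right_mono) auto
    then have k2: "dm^2 * K \<le> K1" unfolding K1e by simp
    have k3: "2 * K \<le> K1"
    proof -
      have "1 * K \<le> dm^2 * K" using d2 K by (intro mult_right_mono) auto
      then have "2 * (1 * K) \<le> (real n + 3) * (dm^2 * K)" using K by (intro mult_mono) auto
      then show ?thesis unfolding K1e by simp
    qed
    have "K \<le> K1" using k3 K by linarith
    moreover have "0 \<le> Or / u^6" using O u by simp
    moreover have "0 \<le> \<epsilon> * a" using eps a by simp
    ultimately show ?thesis using k0 k1 k2 k3 Hn E
      by (intro mult_left_mono[of _ _ "\<epsilon> * a"] add_mono mult_left_mono[of _ _ "u^2"] mult_right_mono) auto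
  qed
  also have "\<dots> = \<epsilon> * K1 * (u^2 * (H0 x + H1 x + H2 x) + E + Or / u^6) * fs x"
  proof -
    have "\<epsilon> * a * (v * (k * h0 + k * h1 + k * h2) + k * e + k * o') = \<epsilon> * k * (v * (h0 + h1 + h2) + e + o') * a"
      for v k h0 h1 h2 e o' :: real by algebra
    then show ?thesis unfolding a_def[symmetric] by this
  qed
  finally show ?thesis .
qed

definition K2 :: real where "K2 = (n + 1) * dm^2 * K"

text \<open>Comparison with \<open>fs\<close> itself: a fixed scale \<open>w\<close> with
  \<open>rr \<le> w^3\<close> covers all labelled components, so there is no rounding and no
  smallness beyond the factor \<open>\<epsilon>\<close>.\<close>

lemma adm_diff:
  assumes ad: "admissible p \<theta>" and w: "0 < w" "w \<le> 1" "rr \<le> w^3"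
    and E: "rem_env w x = ennreal (E^2)" "0 \<le> E"
  shows "\<bar>mixture f0 q p \<theta> x - fs x\<bar> \<le> \<epsilon> * K2 * (H0 x + H1 x + H2 x + E) * fs x"
proof -
  define a where "a = fs x"
  have a: "0 < a" by (simp add: a_def fs_pos)
  have Hn: "0 \<le> H0 x" "0 \<le> H1 x" "0 \<le> H2 x" by (rule H_nonneg)+
  have d2: "1 \<le> dm^2" using dm1 by (rule one_le_power)
  have d3: "dm \<le> dm^2" using dm1 mult_left_mono[of 1 dm dm] by (simp add: power2_eq_square)
  have gl: "\<bar>g (\<theta> j) x\<bar> \<le> lw (\<theta> j) * ((H0 x + dm^2 * H2 x + E) * a)" if j: "j < q" for j
  proof (cases "lab (\<theta> j) < n")
    case True
    let ?t = "ts (lab (\<theta> j))"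
    define v where "v = \<theta> j - ?t"
    have lwe: "lw (\<theta> j) = (norm v)^2" using True by (simp add: loc_weight_def v_def)
    have "\<bar>dird v (dird v f0) (x - ?t)\<bar> \<le> dm^2 * (norm v * norm v * (H2 x * a))"
      unfolding dm a_def by (intro dird_bound2 C2 b2 ts[OF True])
    moreover have "\<bar>rem2 (\<theta> j) ?t x\<bar> \<le> (norm v)^2 * (E * a)"
      unfolding v_def a_def using label_lessD[OF True] w by (intro rem2_le[OF admissibleD(2)[OF ad j] True _ _ _ E]) auto
    moreover have "g (\<theta> j) x = dird v (dird v f0) (x - ?t) / 2 + rem2 (\<theta> j) ?t x" unfolding v_def by (rule g_near[OF True])
    ultimately have "\<bar>g (\<theta> j) x\<bar> \<le> dm^2 * (norm v * norm v * (H2 x * a)) + (norm v)^2 * (E * a)" by linarith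
    also have "\<dots> = (norm v)^2 * ((dm^2 * H2 x + E) * a)" by (simp add: power2_eq_square algebra_simps)
    also have "\<dots> \<le> (norm v)^2 * ((H0 x + dm^2 * H2 x + E) * a)" using Hn a by (intro mult_left_mono mult_right_mono) auto
    finally show ?thesis by (simp add: lwe)
  next
    case False
    have "\<bar>g (\<theta> j) x\<bar> \<le> H0 x * a" using b0[OF admissibleD(2)[OF ad j], of x] f0_pos[of "x - \<theta> j"] False by (simp add: g_def a_def)
    also have "\<dots> \<le> (H0 x + dm^2 * H2 x + E) * a" using Hn a E by (intro mult_right_mono) auto
    finally show ?thesis using False by (simp add: loc_weight_def)
  qed
  have "\<bar>\<Sum>j<q. p j * g (\<theta> j) x\<bar> \<le> (\<Sum>j<q. (p j * lw (\<theta> j)) * ((H0 x + dm^2 * H2 x + E) * a))"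
  proof (intro order_trans[OF sum_abs] sum_mono)
    fix j assume "j \<in> {..<q}"
    then show "\<bar>p j * g (\<theta> j) x\<bar> \<le> (p j * lw (\<theta> j)) * ((H0 x + dm^2 * H2 x + E) * a)"
      using gl[of j] admissibleD(1)[OF ad, of j] unfolding abs_mult mult.assoc by (intro mult_mono) auto
  qed
  also have "\<dots> = (\<Sum>j<q. p j * lw (\<theta> j)) * ((H0 x + dm^2 * H2 x + E) * a)" by (simp only: sum_distrib_right)
  also have "\<dots> \<le> (K * \<epsilon>) * ((H0 x + dm^2 * H2 x + E) * a)"
    using Hn E a by (intro mult_right_mono admissibleD(3)[OF ad]) auto
  finally have t2: "\<bar>\<Sum>j<q. p j * g (\<theta> j) x\<bar> \<le> (K * \<epsilon>) * ((H0 x + dm^2 * H2 x + E) * a)" .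
  have t1: "\<bar>\<Sum>i<n. ca p \<theta> i * f0 (x - ts i) - (\<Sum>k\<in>UNIV. cb p \<theta> i k * partial_deriv k f0 (x - ts i))\<bar>
     \<le> n * (K * \<epsilon>) * (H0 x + dm * H1 x) * a" unfolding a_def
    by (rule main_part_bound) (use admissibleD(4,5)[OF ad] in auto)
  have "\<bar>mixture f0 q p \<theta> x - fs x\<bar> \<le> n * (K * \<epsilon>) * (H0 x + dm * H1 x) * a + (K * \<epsilon>) * ((H0 x + dm^2 * H2 x + E) * a)"
    unfolding mixture_decomp using t1 t2 by linarith
  also have "\<dots> = \<epsilon> * a * K * ((n + 1) * H0 x + n * dm * H1 x + dm^2 * H2 x + E)"
    unfolding of_nat_add of_nat_1 by algebra
  also have "\<dots> \<le> \<epsilon> * a * K * (((n + 1) * dm^2) * H0 x + ((n + 1) * dm^2) * H1 x + ((n + 1) * dm^2) * H2 x + ((n + 1) * dm^2) * E)"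
  proof (intro mult_left_mono add_mono mult_right_mono)
    have n1: "(real n + 1) * 1 \<le> (real n + 1) * dm^2" using d2 by (intro mult_left_mono) auto
    then show "real (n + 1) \<le> (n + 1) * dm^2" by simp
    show "n * dm \<le> (n + 1) * dm^2" using d3 dm1 by (intro mult_mono) auto
    show "dm^2 \<le> (n + 1) * dm^2" using mult_right_mono[of 1 "real (n+1)" "dm^2"] by simp
    have "1 * 1 \<le> (real n + 1) * dm^2" using d2 by (intro mult_mono) auto
    then have "E * 1 \<le> E * ((n + 1) * dm^2)" using E by (intro mult_left_mono) (auto simp: add.commute)
    then show "E \<le> (n + 1) * dm^2 * E" by (simp add: mult_ac)
  qed (use Hn eps a K in auto)
  also have "\<dots> = \<epsilon> * K2 * (H0 x + H1 x + H2 x + E) * fs x"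
  proof -
    have "\<epsilon> * a * K * (k * h0 + k * h1 + k * h2 + k * h3) = \<epsilon> * (k * K) * (h0 + h1 + h2 + h3) * a" for k h0 h1 h2 h3 :: real
      by algebra
    then show ?thesis unfolding K2_def a_def[symmetric] by this
  qed
  finally show ?thesis .
qed

end

section \<open>From codes to brackets\<close>

text \<open>Each nonempty code class gets a bracket around one of its own members. Members are
  genuine parameters, whereas a rounded parameter could leave \<open>\<Theta>\<close>, where the
  envelopes give no information.\<close>

lemma bracketing_number_le_code:
  assumes S: "S \<subseteq> F ` P" and C: "finite C" "code ` P \<subseteq> C"
    and br: "\<And>a. a \<in> P \<Longrightarrow> L a \<in> Lp_space 2 M \<and> U a \<in> Lp_space 2 M \<and> Lp_norm 2 M (\<lambda>x. U a x - L a x) \<le> \<delta>"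
    and inb: "\<And>a b x. a \<in> P \<Longrightarrow> b \<in> P \<Longrightarrow> code a = code b \<Longrightarrow> L a x \<le> F b x \<and> F b x \<le> U a x"
  shows "bracketing_number M S \<delta> \<le> enat (card C)"
proof -
  define n where "n = card (code ` P)"
  have fin: "finite (code ` P)" using C finite_subset by blast
  obtain h where h: "bij_betw h {..<n} (code ` P)"
    using ex_bij_betw_nat_finite[OF fin] unfolding n_def by (auto simp: atLeast0LessThan)
  define rep where "rep i = (SOME a. a \<in> P \<and> code a = h i)" for i
  have rep: "rep i \<in> P \<and> code (rep i) = h i" if "i < n" for i
  proof -
    have "h i \<in> code ` P" using h that by (auto simp: bij_betw_def)
    then have "\<exists>a. a \<in> P \<and> code a = h i" by (auto simp: image_iff)
    then show ?thesis unfolding rep_def by (rule someI_ex)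
  qed
  have "brackets M S \<delta> n (\<lambda>i. L (rep i)) (\<lambda>i. U (rep i))"
    unfolding brackets_def
  proof (intro conjI allI impI subsetI)
    fix i assume "i < n"
    then show "L (rep i) \<in> Lp_space 2 M" "U (rep i) \<in> Lp_space 2 M" "Lp_norm 2 M (\<lambda>x. U (rep i) x - L (rep i) x) \<le> \<delta>"
      using br rep by auto
  next
    fix g assume "g \<in> S"
    then obtain b where b: "b \<in> P" "g = F b" using S by auto
    then have "code b \<in> h ` {..<n}" using h by (auto simp: bij_betw_def)
    then obtain i where i: "i < n" "code b = h i" by auto
    then have "\<forall>x. L (rep i) x \<le> g x \<and> g x \<le> U (rep i) x" using inb[of "rep i" b] rep[OF i(1)] b by auto
    then show "g \<in> (\<Union>i<n. {g. \<forall>x. L (rep i) x \<le> g x \<and> g x \<le> U (rep i) x})" using i(1) by auto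
  qed
  then have "bracketing_number M S \<delta> \<le> enat n"
    unfolding bracketing_number_def by (intro Inf_lower) auto
  also have "\<dots> \<le> enat (card C)" unfolding n_def using card_mono[OF C] by simp
  finally show ?thesis .
qed

lemma Lp_of_nn_integral:
  assumes [measurable]: "g \<in> borel_measurable M" and le: "(\<integral>\<^sup>+x. ennreal ((g x)^2) \<partial>M) \<le> ennreal (\<delta>^2)" and "0 \<le> \<delta>"
  shows "g \<in> Lp_space 2 M" "Lp_norm 2 M g \<le> \<delta>"
proof -
  have p: "\<bar>g x\<bar> powr 2 = (g x)^2" for x by simp
  have int: "integrable M (\<lambda>x. (g x)^2)"
    by (rule integrableI_nonneg) (use le in \<open>auto intro: le_less_trans\<close>)
  then show "g \<in> Lp_space 2 M" by (simp add: Lp_space_def)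
  have "ennreal (\<integral>x. (g x)^2 \<partial>M) \<le> ennreal (\<delta>^2)"
    using le by (subst nn_integral_eq_integral[OF int, symmetric]) auto
  then have "(\<integral>x. (g x)^2 \<partial>M) \<le> \<delta>^2" by (subst (asm) ennreal_le_iff) auto
  then have "(\<integral>x. (g x)^2 \<partial>M) powr (1/2) \<le> (\<delta>^2) powr (1/2)" by (intro powr_mono2) auto
  also have "\<dots> = \<delta>" using assms(3) by (simp add: powr_half_sqrt)
  finally show "Lp_norm 2 M g \<le> \<delta>" by (simp add: Lp_norm_def)
qed

text \<open>Where the ratio may be small, \<open>D\<close> itself is compared with \<open>D * Y\<close>, since there \<open>Y > 1 / 2\<close>.\<close>
lemma sqrt_bracket_sq:
  fixes A D Y :: real
  assumes A: "0 \<le> A" "\<bar>A - 1\<bar> \<le> Y" and D: "0 \<le> D"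
  shows "(sqrt (A + D) - sqrt (max 0 (A - D)))^2 \<le> 8 * D^2 + 4 * D * Y"
proof -
  define p where "p = sqrt (A + D)"
  define m where "m = sqrt (max 0 (A - D))"
  have pm: "0 \<le> m" "m \<le> p" using D A by (auto simp: p_def m_def)
  have p2: "p^2 = A + D" using A D by (simp add: p_def)
  have m2: "A - D \<le> m^2" by (simp add: m_def)
  have Y0: "0 \<le> Y" using A by linarith
  show ?thesis
  proof (cases "Y \<le> 1/2")
    case True
    then have A2: "1/2 \<le> A" using A by linarith
    have "(p - m)^2 * A \<le> (p - m)^2 * p^2" using p2 D by (intro mult_left_mono) auto
    also have "\<dots> = ((p - m) * p)^2" by (simp add: power_mult_distrib)
    also have "\<dots> \<le> (2 * D)^2"
    proof (rule power_mono)
      have "(p - m) * p \<le> (p - m) * (p + m)" using pm by (intro mult_left_mono) auto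
      also have "\<dots> = p^2 - m^2" by (simp add: power2_eq_square algebra_simps)
      also have "\<dots> \<le> 2 * D" using p2 m2 by linarith
      finally show "(p - m) * p \<le> 2 * D" .
    qed (use pm in auto)
    finally have "(p - m)^2 * A \<le> 4 * D^2" by (simp add: power_mult_distrib)
    moreover have "(p - m)^2 * (1/2) \<le> (p - m)^2 * A" using A2 by (intro mult_left_mono) auto
    ultimately have "(p - m)^2 \<le> 8 * D^2" by simp
    moreover have "0 \<le> 4 * D * Y" using D Y0 by simp
    ultimately show ?thesis unfolding p_def m_def by linarith
  next
    case False
    have "(p - m)^2 = (p - m) * (p - m)" by (simp add: power2_eq_square)
    also have "\<dots> \<le> (p - m) * (p + m)" using pm by (intro mult_left_mono) auto
    also have "\<dots> = p^2 - m^2" by (simp add: power2_eq_square algebra_simps)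
    also have "\<dots> \<le> 2 * D" using p2 m2 by linarith
    also have "\<dots> \<le> 4 * D * Y" using False D mult_left_mono[of "1/2" Y "4 * D"] by simp
    finally show ?thesis unfolding p_def m_def by (simp add: add_increasing)
  qed
qed

lemma sum5_sq:
  fixes a b c e f :: real
  shows "(a + b + c + e + f)^2 \<le> 5 * (a^2 + b^2 + c^2 + e^2 + f^2)"
proof -
  have "0 \<le> (a-b)^2 + (a-c)^2 + (a-e)^2 + (a-f)^2 + (b-c)^2 + (b-e)^2 + (b-f)^2 + (c-e)^2 + (c-f)^2 + (e-f)^2"
    by (intro add_nonneg_nonneg) auto
  moreover have "5 * (a^2 + b^2 + c^2 + e^2 + f^2) - (a + b + c + e + f)^2
     = (a-b)^2 + (a-c)^2 + (a-e)^2 + (a-f)^2 + (b-c)^2 + (b-e)^2 + (b-f)^2 + (c-e)^2 + (c-f)^2 + (e-f)^2"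
    by algebra
  ultimately show ?thesis by linarith
qed

context mix_env_vol
begin

lemma mixture_le:
  assumes "\<And>j. j < q \<Longrightarrow> 0 \<le> p j" "(\<Sum>j<q. p j) = 1" "\<And>j. j < q \<Longrightarrow> \<theta> j \<in> \<Theta>"
  shows "0 \<le> mixture f0 q p \<theta> x" "mixture f0 q p \<theta> x \<le> H0 x * fs x"
proof -
  show "0 \<le> mixture f0 q p \<theta> x" unfolding mixture_def shifted_def
    using assms(1) f0_pos by (intro sum_nonneg mult_nonneg_nonneg) (auto simp: less_imp_le)
  have "mixture f0 q p \<theta> x \<le> (\<Sum>j<q. p j * (H0 x * fs x))" unfolding mixture_def shifted_def
    using assms b0 by (intro sum_mono mult_left_mono) auto
  also have "\<dots> = (\<Sum>j<q. p j) * (H0 x * fs x)" by (simp only: sum_distrib_right)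
  finally show "mixture f0 q p \<theta> x \<le> H0 x * fs x" using assms(2) by simp
qed

text \<open>\<open>fs\<close> is itself a mixture of translates with parameters in
  \<open>\<Theta>\<close>. Hence \<open>H0\<close> also bounds the deviation of
  \<open>f / fs\<close> from 1.\<close>

lemma H0_ge_1: "1 \<le> H0 x"
proof -
  have "fs x \<le> H0 x * fs x" using mixture_le(2)[of n ps ts x] ps ts by (simp add: fs_eq[symmetric])
  then show ?thesis using fs_pos[of x] by simp
qed

end

section \<open>Envelopes for the rounding error and for the deviation from \<open>fs\<close>\<close>

context coding
begin

text \<open>The scale whose cube is the label radius \<open>rr\<close>, so that
  \<open>rem_env w0\<close> covers every labelled component.\<close>

definition w0 :: real where "w0 = root 3 rr"

lemma w0: "0 < w0" "w0 \<le> 1" "rr \<le> w0^3"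
  using rr by (auto simp: w0_def)

definition diff_env_sq :: "real^'d \<Rightarrow> ennreal" where
  "diff_env_sq x = ennreal (5 * (\<epsilon> * K1)^2) * (ennreal (3 * u^4) * ennreal (W x) + rem_env u x + ennreal (1 / u^12) * osc_sq (u^8) x)"

definition dev_env_sq :: "real^'d \<Rightarrow> ennreal" where
  "dev_env_sq x = ennreal (5 * (\<epsilon> * K2)^2) * (ennreal 3 * ennreal (W x) + rem_env w0 x)"

lemma K1_pos: "0 < K1" using K dm1 by (simp add: K1_def)
lemma K2_pos: "0 < K2" using K dm1 by (simp add: K2_def)

lemma diff_env_sq_bound:
  assumes admissible: "admissible p \<theta>" "admissible p' \<theta>'" and sc: "same_code p \<theta> p' \<theta>'"
  shows "ennreal (((mixture f0 q p \<theta> x - mixture f0 q p' \<theta>' x) / fs x)^2) \<le> diff_env_sq x"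
proof (cases "rem_env u x = top \<or> osc_sq (u^8) x = top")
  case True
  have "0 < 5 * (\<epsilon> * K1)^2" "0 < 1 / u^12" using K1_pos eps u by auto
  then have "diff_env_sq x = top" using True unfolding diff_env_sq_def by (auto simp: ennreal_mult_eq_top_iff)
  then show ?thesis by simp
next
  case False
  then obtain e o' where eo: "0 \<le> e" "rem_env u x = ennreal e" "0 \<le> o'" "osc_sq (u^8) x = ennreal o'"
    by (cases "rem_env u x"; cases "osc_sq (u^8) x") auto
  define E where "E = sqrt e"
  define R where "R = sqrt o'"
  have E: "rem_env u x = ennreal (E^2)" "0 \<le> E" and R: "osc_sq (u^8) x = ennreal (R^2)" "0 \<le> R"
    using eo by (auto simp: E_def R_def)
  have Hn: "0 \<le> H0 x" "0 \<le> H1 x" "0 \<le> H2 x" by (rule H_nonneg)+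
  define Z where "Z = u^2 * H0 x + u^2 * H1 x + u^2 * H2 x + E + R / u^6"
  have "\<bar>mixture f0 q p \<theta> x - mixture f0 q p' \<theta>' x\<bar> \<le> \<epsilon> * K1 * (u^2 * (H0 x + H1 x + H2 x) + E + R / u^6) * fs x"
    by (rule same_code_diff[OF admissible sc E R])
  then have "\<bar>(mixture f0 q p \<theta> x - mixture f0 q p' \<theta>' x) / fs x\<bar> \<le> \<epsilon> * K1 * Z"
    using fs_pos[of x] by (simp add: Z_def abs_divide divide_le_eq distrib_left)
  then have "\<bar>(mixture f0 q p \<theta> x - mixture f0 q p' \<theta>' x) / fs x\<bar>^2 \<le> (\<epsilon> * K1 * Z)^2"
    by (rule power_mono) auto
  then have "((mixture f0 q p \<theta> x - mixture f0 q p' \<theta>' x) / fs x)^2 \<le> (\<epsilon> * K1)^2 * Z^2"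
    by (simp only: power2_abs power_mult_distrib[of "\<epsilon> * K1" Z])
  also have "\<dots> \<le> (\<epsilon> * K1)^2 * (5 * (3 * u^4 * W x + E^2 + 1 / u^12 * R^2))"
  proof (intro mult_left_mono)
    have "Z^2 \<le> 5 * ((u^2 * H0 x)^2 + (u^2 * H1 x)^2 + (u^2 * H2 x)^2 + E^2 + (R / u^6)^2)"
      unfolding Z_def by (rule sum5_sq)
    also have "\<dots> = 5 * (u^4 * ((H0 x)^2 + (H1 x)^2 + (H2 x)^2) + E^2 + 1 / u^12 * R^2)"
      by (simp add: power_mult_distrib power_divide distrib_left power_mult[symmetric])
    also have "\<dots> \<le> 5 * (u^4 * (W x + W x + W x) + E^2 + 1 / u^12 * R^2)"
      using u by (intro mult_left_mono add_mono W_ge) auto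
    finally show "Z^2 \<le> 5 * (3 * u^4 * W x + E^2 + 1 / u^12 * R^2)" by simp
  qed auto
  finally have "ennreal (((mixture f0 q p \<theta> x - mixture f0 q p' \<theta>' x) / fs x)^2)
      \<le> ennreal (5 * (\<epsilon> * K1)^2 * (3 * u^4 * W x + E^2 + 1 / u^12 * R^2))"
    by (intro ennreal_leI) (simp only: mult_ac)
  also have "\<dots> = diff_env_sq x"
  proof -
    have k: "ennreal (1 / u^12 * R^2) = ennreal (1 / u^12) * ennreal (R^2)" by (rule ennreal_mult) auto
    have W0: "0 \<le> 3 * u^4 * W x" "0 \<le> W x" using W_ge(1)[of x] u by auto
    have "ennreal (3 * u^4 * W x + E^2 + 1 / u^12 * R^2) = ennreal (3 * u^4 * W x) + ennreal (E^2) + ennreal (1 / u^12 * R^2)"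
      using W0 by (simp only: ennreal_plus add_nonneg_nonneg zero_le_power2 mult_nonneg_nonneg zero_le_divide_1_iff zero_le_power less_imp_le[OF u(1)])
    also have "\<dots> = ennreal (3 * u^4) * ennreal (W x) + ennreal (E^2) + ennreal (1 / u^12) * ennreal (R^2)"
      unfolding k using W0 by (subst ennreal_mult[symmetric]) auto
    finally have eq: "ennreal (3 * u^4 * W x + E^2 + 1 / u^12 * R^2) = \<dots>" .
    have "0 \<le> 3 * u^4 * W x + E^2 + 1 / u^12 * R^2" "0 \<le> 5 * (\<epsilon> * K1)^2" using W0 by (auto intro!: add_nonneg_nonneg)
    then have "ennreal (5 * (\<epsilon> * K1)^2 * (3 * u^4 * W x + E^2 + 1 / u^12 * R^2))
      = ennreal (5 * (\<epsilon> * K1)^2) * ennreal (3 * u^4 * W x + E^2 + 1 / u^12 * R^2)"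
      by (intro ennreal_mult)
    then show ?thesis unfolding diff_env_sq_def E(1) R(1) eq .
  qed
  finally show ?thesis .
qed

lemma dev_env_sq_bound:
  assumes admissible: "admissible p \<theta>"
  shows "ennreal ((mixture f0 q p \<theta> x / fs x - 1)^2) \<le> dev_env_sq x"
proof (cases "rem_env w0 x = top")
  case True
  have "0 < 5 * (\<epsilon> * K2)^2" using K2_pos eps by auto
  then have "dev_env_sq x = top" using True unfolding dev_env_sq_def by (auto simp: ennreal_mult_eq_top_iff)
  then show ?thesis by simp
next
  case False
  then obtain e where eo: "0 \<le> e" "rem_env w0 x = ennreal e" by (cases "rem_env w0 x") auto
  define E where "E = sqrt e"
  have E: "rem_env w0 x = ennreal (E^2)" "0 \<le> E" using eo by (auto simp: E_def)
  have Hn: "0 \<le> H0 x" "0 \<le> H1 x" "0 \<le> H2 x" by (rule H_nonneg)+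
  define Z where "Z = H0 x + H1 x + H2 x + E + 0"
  have "\<bar>mixture f0 q p \<theta> x - fs x\<bar> \<le> \<epsilon> * K2 * (H0 x + H1 x + H2 x + E) * fs x"
    by (rule adm_diff[OF admissible w0 E])
  moreover have "mixture f0 q p \<theta> x / fs x - 1 = (mixture f0 q p \<theta> x - fs x) / fs x"
    using fs_pos[of x] by (simp add: diff_divide_distrib)
  ultimately have "\<bar>mixture f0 q p \<theta> x / fs x - 1\<bar> \<le> \<epsilon> * K2 * Z"
    using fs_pos[of x] by (simp add: Z_def abs_divide divide_le_eq)
  then have "\<bar>mixture f0 q p \<theta> x / fs x - 1\<bar>^2 \<le> (\<epsilon> * K2 * Z)^2"
    by (rule power_mono) auto
  then have "(mixture f0 q p \<theta> x / fs x - 1)^2 \<le> (\<epsilon> * K2)^2 * Z^2"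
    by (simp only: power2_abs power_mult_distrib[of "\<epsilon> * K2" Z])
  also have "\<dots> \<le> (\<epsilon> * K2)^2 * (5 * (3 * W x + E^2))"
  proof (intro mult_left_mono)
    have "Z^2 \<le> 5 * ((H0 x)^2 + (H1 x)^2 + (H2 x)^2 + E^2 + 0^2)" unfolding Z_def by (rule sum5_sq)
    also have "\<dots> \<le> 5 * (W x + W x + W x + E^2 + 0)" by (intro mult_left_mono add_mono W_ge) auto
    finally show "Z^2 \<le> 5 * (3 * W x + E^2)" by simp
  qed auto
  finally have "ennreal ((mixture f0 q p \<theta> x / fs x - 1)^2) \<le> ennreal (5 * (\<epsilon> * K2)^2 * (3 * W x + E^2))"
    by (intro ennreal_leI) (simp only: mult_ac)
  also have "\<dots> = dev_env_sq x"
    unfolding dev_env_sq_def E(1) using W_ge(1)[of x] by (simp add: ennreal_mult ennreal_plus)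
  finally show ?thesis .
qed

lemma Wmu_meas [measurable]: "(\<lambda>x. ennreal (W x)) \<in> borel_measurable borel"
  using W_meas by measurable

lemma mu_sets [measurable_cong, simp]: "sets \<mu> = sets borel"
  by (simp add: density_measure_def)

lemma diff_env_sq_meas [measurable]: "diff_env_sq \<in> borel_measurable borel" unfolding diff_env_sq_def by measurable
lemma dev_env_sq_meas [measurable]: "dev_env_sq \<in> borel_measurable borel" unfolding dev_env_sq_def by measurable

lemma nn_integral_W: "(\<integral>\<^sup>+x. ennreal (W x) \<partial>\<mu>) = J"
  unfolding nn_integral_mu[OF Wmu_meas] J_def G_def
  using fs_pos W_ge(1) by (intro nn_integral_cong) (simp add: ennreal_mult'[symmetric] less_imp_le mult.commute)

definition cE :: real where "cE = 3 + 8192 * cB * (V2 + 1) + cA * (V2 + 1)"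

lemma cE_pos: "0 < cE" using cB_pos cA_pos V2 by (simp add: cE_def add_pos_pos)

text \<open>The three contributions share the power \<open>u^4\<close>: the tolerances squared, the
  series over scales starting at \<open>u\<close>, and the oscillation at scale \<open>u^8\<close>,
  whose \<open>u^16\<close> is divided by \<open>u^12\<close>.\<close>

lemma nn_integral_diff_env_sq: "(\<integral>\<^sup>+x. diff_env_sq x \<partial>\<mu>) \<le> ennreal (5 * (\<epsilon> * K1)^2 * (u^4 * cE)) * J"
proof -
  have "(\<integral>\<^sup>+x. diff_env_sq x \<partial>\<mu>) = ennreal (5 * (\<epsilon> * K1)^2) * (ennreal (3 * u^4) * (\<integral>\<^sup>+x. ennreal (W x) \<partial>\<mu>)
      + (\<integral>\<^sup>+x. rem_env u x \<partial>\<mu>) + ennreal (1 / u^12) * (\<integral>\<^sup>+x. osc_sq (u^8) x \<partial>\<mu>))"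
    unfolding diff_env_sq_def by (simp add: nn_integral_cmult nn_integral_add)
  also have "\<dots> \<le> ennreal (5 * (\<epsilon> * K1)^2) * (ennreal (3 * u^4) * J
      + ennreal (8192 * cB * u^4 * (V2 + 1)) * J + ennreal (1 / u^12) * (ennreal (cA * (u^8)^2 * (V2 + 1)) * J))"
    unfolding nn_integral_W nn_integral_osc_sq using nn_integral_rem_env[OF u(1)]
    by (intro mult_left_mono add_mono) auto
  also have "ennreal (1 / u^12) * (ennreal (cA * (u^8)^2 * (V2 + 1)) * J) = ennreal (u^4 * (cA * (V2 + 1))) * J"
  proof -
    have "1 / u^12 * (cA * (u^8)^2 * (V2 + 1)) = u^4 * (cA * (V2 + 1))"
      using u by (simp add: power_mult[symmetric] power_add[symmetric] field_simps flip: power_add)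
    then show ?thesis using u cA_pos V2 by (simp add: mult.assoc[symmetric] ennreal_mult[symmetric])
  qed
  also have "ennreal (5 * (\<epsilon> * K1)^2) * (ennreal (3 * u^4) * J + ennreal (8192 * cB * u^4 * (V2 + 1)) * J + ennreal (u^4 * (cA * (V2 + 1))) * J)
     = ennreal (5 * (\<epsilon> * K1)^2) * (ennreal (u^4 * cE) * J)"
  proof -
    have n: "0 \<le> 3 * u^4" "0 \<le> 8192 * cB * u^4 * (V2 + 1)" "0 \<le> u^4 * (cA * (V2 + 1))"
      using u cA_pos cB_pos V2 by auto
    have "ennreal (3 * u^4) + ennreal (8192 * cB * u^4 * (V2 + 1)) + ennreal (u^4 * (cA * (V2 + 1))) = ennreal (u^4 * cE)"
      using n unfolding cE_def by (simp add: ennreal_plus[symmetric] algebra_simps del: ennreal_plus)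
    then show ?thesis by (simp only: distrib_right[symmetric])
  qed
  also have "\<dots> = ennreal (5 * (\<epsilon> * K1)^2 * (u^4 * cE)) * J"
    using u cE_pos by (simp add: mult.assoc[symmetric] ennreal_mult[symmetric])
  finally show ?thesis .
qed

lemma nn_integral_dev_env_sq: "(\<integral>\<^sup>+x. dev_env_sq x \<partial>\<mu>) \<le> ennreal (5 * (\<epsilon> * K2)^2 * cE) * J"
proof -
  have "(\<integral>\<^sup>+x. dev_env_sq x \<partial>\<mu>) = ennreal (5 * (\<epsilon> * K2)^2) * (ennreal 3 * (\<integral>\<^sup>+x. ennreal (W x) \<partial>\<mu>) + (\<integral>\<^sup>+x. rem_env w0 x \<partial>\<mu>))"
    unfolding dev_env_sq_def by (simp add: nn_integral_cmult nn_integral_add)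
  also have "\<dots> \<le> ennreal (5 * (\<epsilon> * K2)^2) * (ennreal 3 * J + ennreal (8192 * cB * w0^4 * (V2 + 1)) * J)"
    unfolding nn_integral_W using nn_integral_rem_env[OF w0(1)] by (intro mult_left_mono add_mono) auto
  also have "\<dots> = ennreal (5 * (\<epsilon> * K2)^2) * (ennreal (3 + 8192 * cB * w0^4 * (V2 + 1)) * J)"
    using cB_pos w0 V2 by (simp add: ennreal_plus distrib_right)
  also have "\<dots> \<le> ennreal (5 * (\<epsilon> * K2)^2) * (ennreal cE * J)"
  proof (intro mult_left_mono mult_right_mono ennreal_leI)
    have "8192 * cB * w0^4 * (V2 + 1) \<le> 8192 * cB * 1 * (V2 + 1)"
      using cB_pos w0 V2 by (intro mult_right_mono mult_left_mono) (auto simp: power_le_one)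
    moreover have "0 \<le> cA * (V2 + 1)" using cA_pos V2 by simp
    ultimately show "3 + 8192 * cB * w0^4 * (V2 + 1) \<le> cE" by (simp add: cE_def)
  qed auto
  also have "\<dots> = ennreal (5 * (\<epsilon> * K2)^2 * cE) * J"
    using cE_pos by (simp add: mult.assoc[symmetric] ennreal_mult[symmetric])
  finally show ?thesis .
qed

text \<open>Truncation by \<open>H0\<close> makes the envelopes finite everywhere.\<close>
definition diff_env :: "real^'d \<Rightarrow> real" where "diff_env x = sqrt (enn2real (min (diff_env_sq x) (ennreal ((H0 x)^2))))"
definition dev_env :: "real^'d \<Rightarrow> real" where "dev_env x = sqrt (enn2real (min (dev_env_sq x) (ennreal ((H0 x)^2))))"

lemma min_env:
  assumes "ennreal (t^2) \<le> q'" "\<bar>t\<bar> \<le> H0 x"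
  shows "\<bar>t\<bar> \<le> sqrt (enn2real (min q' (ennreal ((H0 x)^2))))"
proof -
  have "t^2 \<le> (H0 x)^2" using assms(2) by (metis abs_ge_zero power2_abs power_mono)
  then have "ennreal (t^2) \<le> min q' (ennreal ((H0 x)^2))" using assms(1) by (simp add: ennreal_leI)
  then have "enn2real (ennreal (t^2)) \<le> enn2real (min q' (ennreal ((H0 x)^2)))"
    by (intro enn2real_mono) (auto simp: min_less_iff_disj)
  then have "t^2 \<le> enn2real (min q' (ennreal ((H0 x)^2)))" by simp
  then have "sqrt (t^2) \<le> sqrt (enn2real (min q' (ennreal ((H0 x)^2))))" by (rule real_sqrt_le_mono)
  then show ?thesis by simp
qed

lemma env_sq: "ennreal (diff_env x ^ 2) \<le> diff_env_sq x" "ennreal (dev_env x ^ 2) \<le> dev_env_sq x" "diff_env x \<le> H0 x" "0 \<le> diff_env x" "0 \<le> dev_env x"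
proof -
  have "min q' (ennreal ((H0 x)^2)) < top" for q' by (auto simp: min_less_iff_disj)
  then have *: "ennreal (enn2real (min q' (ennreal ((H0 x)^2)))) = min q' (ennreal ((H0 x)^2))" for q' by simp
  show "ennreal (diff_env x ^ 2) \<le> diff_env_sq x" "ennreal (dev_env x ^ 2) \<le> dev_env_sq x" by (simp_all add: diff_env_def dev_env_def *)
  show "0 \<le> diff_env x" "0 \<le> dev_env x" by (simp_all add: diff_env_def dev_env_def)
  have "enn2real (min (diff_env_sq x) (ennreal ((H0 x)^2))) \<le> enn2real (ennreal ((H0 x)^2))" by (intro enn2real_mono) auto
  then have "diff_env x \<le> sqrt ((H0 x)^2)" unfolding diff_env_def by (intro real_sqrt_le_mono) simp
  then show "diff_env x \<le> H0 x" using H_nonneg(1)[of x] by simp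
qed

lemma env_meas [measurable]: "diff_env \<in> borel_measurable borel" "dev_env \<in> borel_measurable borel"
proof -
  have [measurable]: "H0 \<in> borel_measurable borel" by (rule meas(1))
  show "diff_env \<in> borel_measurable borel" "dev_env \<in> borel_measurable borel" unfolding diff_env_def dev_env_def by measurable
qed

definition cC :: real where "cC = 50 * K1^2 * cE + 10 * K2^2 * cE"

text \<open>\<open>diff_env\<close> has squared norm of order \<open>\<epsilon>^2 * u^4\<close> and
  \<open>dev_env\<close> of order \<open>\<epsilon>^2\<close>; the product term from
  \<open>sqrt_bracket_sq\<close> gives the squared width \<open>\<epsilon>^2 * u^2\<close>.\<close>

lemma bracket_width:
  assumes A: "\<And>x. 0 \<le> A x" "\<And>x. \<bar>A x - 1\<bar> \<le> dev_env x" and [measurable]: "A \<in> borel_measurable borel"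
  shows "(\<integral>\<^sup>+x. ennreal ((sqrt (A x + diff_env x) - sqrt (max 0 (A x - diff_env x)))^2) \<partial>\<mu>) \<le> ennreal (cC * \<epsilon>^2 * u^2) * J"
proof -
  have "ennreal ((sqrt (A x + diff_env x) - sqrt (max 0 (A x - diff_env x)))^2) \<le> ennreal (10 / u^2) * diff_env_sq x + ennreal (2 * u^2) * dev_env_sq x" for x
  proof -
    have "(sqrt (A x + diff_env x) - sqrt (max 0 (A x - diff_env x)))^2 \<le> 8 * diff_env x^2 + 4 * diff_env x * dev_env x"
      by (rule sqrt_bracket_sq[OF A env_sq(4)])
    also have "\<dots> \<le> 10 / u^2 * diff_env x^2 + 2 * u^2 * dev_env x^2"
    proof -
      \<comment> \<open>The weights \<open>1 / u\<close> and \<open>u\<close> give both terms the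
        same size after integration.\<close>
      have "0 \<le> 2 * (diff_env x / u - u * dev_env x)^2" by simp
      also have "\<dots> = 2 / u^2 * diff_env x^2 - 4 * diff_env x * dev_env x + 2 * u^2 * dev_env x^2"
        using u by (simp add: power2_diff power_divide power_mult_distrib algebra_simps)
      finally have "4 * diff_env x * dev_env x \<le> 2 / u^2 * diff_env x^2 + 2 * u^2 * dev_env x^2" by simp
      moreover have "8 * diff_env x^2 \<le> 8 / u^2 * diff_env x^2"
        using u by (intro mult_right_mono) (auto simp: field_simps power_le_one)
      moreover have "10 / u^2 * diff_env x^2 = 8 / u^2 * diff_env x^2 + 2 / u^2 * diff_env x^2" by (simp add: field_simps)
      ultimately show ?thesis by linarith
    qed
    finally have "ennreal ((sqrt (A x + diff_env x) - sqrt (max 0 (A x - diff_env x)))^2) \<le> ennreal (10 / u^2 * diff_env x^2 + 2 * u^2 * dev_env x^2)"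
      by (rule ennreal_leI)
    also have "\<dots> = ennreal (10 / u^2) * ennreal (diff_env x^2) + ennreal (2 * u^2) * ennreal (dev_env x^2)"
      by (subst ennreal_plus) (auto simp: ennreal_mult simp del: times_divide_eq_left)
    also have "\<dots> \<le> ennreal (10 / u^2) * diff_env_sq x + ennreal (2 * u^2) * dev_env_sq x"
      by (intro add_mono mult_left_mono env_sq) auto
    finally show ?thesis .
  qed
  then have "(\<integral>\<^sup>+x. ennreal ((sqrt (A x + diff_env x) - sqrt (max 0 (A x - diff_env x)))^2) \<partial>\<mu>)
     \<le> (\<integral>\<^sup>+x. ennreal (10 / u^2) * diff_env_sq x + ennreal (2 * u^2) * dev_env_sq x \<partial>\<mu>)"
    by (rule nn_integral_mono)
  also have "\<dots> = ennreal (10 / u^2) * (\<integral>\<^sup>+x. diff_env_sq x \<partial>\<mu>) + ennreal (2 * u^2) * (\<integral>\<^sup>+x. dev_env_sq x \<partial>\<mu>)"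
    by (simp add: nn_integral_add nn_integral_cmult)
  also have "\<dots> \<le> ennreal (10 / u^2) * (ennreal (5 * (\<epsilon> * K1)^2 * (u^4 * cE)) * J) + ennreal (2 * u^2) * (ennreal (5 * (\<epsilon> * K2)^2 * cE) * J)"
    by (intro add_mono mult_left_mono nn_integral_diff_env_sq nn_integral_dev_env_sq) auto
  also have "\<dots> = ennreal (10 / u^2 * (5 * (\<epsilon> * K1)^2 * (u^4 * cE))) * J + ennreal (2 * u^2 * (5 * (\<epsilon> * K2)^2 * cE)) * J"
    using cE_pos u by (simp add: mult.assoc[symmetric] ennreal_mult[symmetric] del: times_divide_eq_left)
  also have "10 / u^2 * (5 * (\<epsilon> * K1)^2 * (u^4 * cE)) = 50 * K1^2 * cE * \<epsilon>^2 * u^2"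
  proof -
    have "u^4 = u^2 * u^2" by (simp add: power_add[symmetric])
    then show ?thesis using u by (simp add: power_mult_distrib field_simps)
  qed
  also have "2 * u^2 * (5 * (\<epsilon> * K2)^2 * cE) = 10 * K2^2 * cE * \<epsilon>^2 * u^2" by (simp add: power_mult_distrib)
  also have "ennreal (50 * K1^2 * cE * \<epsilon>^2 * u^2) * J + ennreal (10 * K2^2 * cE * \<epsilon>^2 * u^2) * J = ennreal (cC * \<epsilon>^2 * u^2) * J"
    using cE_pos unfolding cC_def by (subst distrib_right[symmetric], subst ennreal_plus[symmetric]) (auto simp: algebra_simps)
  finally show ?thesis .
qed

end

section \<open>The code of a mixture and the number of codes\<close>

lemma floor_eq_close:
  fixes a b h :: real
  assumes "\<lfloor>a / h\<rfloor> = \<lfloor>b / h\<rfloor>" "0 < h"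
  shows "\<bar>a - b\<bar> \<le> h"
proof -
  have "\<bar>a / h - b / h\<bar> < 1" using assms(1) by linarith
  then have "\<bar>(a - b) / h\<bar> < 1" by (simp add: diff_divide_distrib)
  then show ?thesis using assms(2) by (simp add: abs_divide)
qed

lemma nat_floor_eq_close:
  fixes a b h :: real
  assumes "nat \<lfloor>a / h\<rfloor> = nat \<lfloor>b / h\<rfloor>" "0 < h" "0 \<le> a" "0 \<le> b"
  shows "\<bar>a - b\<bar> \<le> h"
proof (rule floor_eq_close)
  have "0 \<le> \<lfloor>a / h\<rfloor>" "0 \<le> \<lfloor>b / h\<rfloor>" using assms by auto
  then show "\<lfloor>a / h\<rfloor> = \<lfloor>b / h\<rfloor>" using assms(1) by linarith
qed fact

lemma real_nat_floor_le: "0 \<le> a \<Longrightarrow> real (nat \<lfloor>a\<rfloor>) \<le> a"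
  by linarith

context coding
begin

context
  fixes cc :: "real^'d" and T :: real
  assumes cb: "\<Theta> \<subseteq> cball cc T"
begin

definition h\<pi> where "h\<pi> = \<epsilon> * u^2 / q"
definition hw where "hw = u^2 * sqrt \<epsilon> / sqrt q"
definition h\<theta> where "h\<theta> = u^8 / dm"
definition ha where "ha = u^2 * \<epsilon>"

lemma h_pos: "0 < h\<pi>" "0 < hw" "0 < h\<theta>" "0 < ha"
  using u eps q dm1 by (auto simp: h\<pi>_def hw_def h\<theta>_def ha_def)

text \<open>For component \<open>j\<close>, \<open>None\<close> stands for the weight and
  \<open>Some k\<close> for coordinate \<open>k\<close>. The same option type later separates masses
  and first moments at a true point.\<close>

definition slots :: "(nat \<times> 'd option) set" where "slots = {..<q} \<times> UNIV"

definition code1 :: "(nat \<Rightarrow> real^'d) \<Rightarrow> nat \<Rightarrow> nat \<times> bool" where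
  "code1 \<theta> = restrict (\<lambda>j. (lab (\<theta> j), near (\<theta> j))) {..<q}"

text \<open>Signs are stored apart because the tuples counted by \<open>card_sum_le\<close> consist
  of natural numbers, which record \<open>\<bar>wc p \<theta> j k\<bar>\<close> only. Equal signs
  and close absolute values give close numbers.\<close>

definition code2 :: "(nat \<Rightarrow> real) \<Rightarrow> (nat \<Rightarrow> real^'d) \<Rightarrow> nat \<times> 'd \<Rightarrow> bool" where
  "code2 p \<theta> = restrict (\<lambda>(j, k). 0 \<le> wc p \<theta> j k) ({..<q} \<times> UNIV)"

text \<open>The rounding steps shrink with \<open>q\<close>, so single slots can be as large as \<open>q\<close>; only the sum of all
  slots satisfies a bound that leads to a count exponential in \<open>q\<close>.\<close>
definition slot_val :: "(nat \<Rightarrow> real) \<Rightarrow> (nat \<Rightarrow> real^'d) \<Rightarrow> nat \<times> 'd option \<Rightarrow> real" where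
  "slot_val p \<theta> s = (case s of (j, None) \<Rightarrow> (if near (\<theta> j) then 0 else p j / h\<pi>)
     | (j, Some k) \<Rightarrow> (if near (\<theta> j) then \<bar>wc p \<theta> j k\<bar> / hw else (\<theta> j $ k - cc $ k + T) / h\<theta>))"

definition code3 :: "(nat \<Rightarrow> real) \<Rightarrow> (nat \<Rightarrow> real^'d) \<Rightarrow> nat \<times> 'd option \<Rightarrow> nat" where
  "code3 p \<theta> = restrict (\<lambda>s. nat \<lfloor>slot_val p \<theta> s\<rfloor>) slots"

definition code4 :: "(nat \<Rightarrow> real) \<Rightarrow> (nat \<Rightarrow> real^'d) \<Rightarrow> nat \<times> 'd option \<Rightarrow> int" where
  "code4 p \<theta> = restrict (\<lambda>(i, ko). case ko of None \<Rightarrow> \<lfloor>ca p \<theta> i / ha\<rfloor> | Some k \<Rightarrow> \<lfloor>cb p \<theta> i k / ha\<rfloor>) ({..<n} \<times> UNIV)"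

definition code where "code p \<theta> = (code1 \<theta>, code2 p \<theta>, code3 p \<theta>, code4 p \<theta>)"

lemma pos_coord:
  assumes "\<theta> \<in> \<Theta>"
  shows "0 \<le> \<theta> $ k - cc $ k + T" "\<theta> $ k - cc $ k + T \<le> 2 * T"
proof -
  have "norm (\<theta> - cc) \<le> T" using assms cb by (auto simp: dist_norm norm_minus_commute)
  then have "\<bar>(\<theta> - cc) $ k\<bar> \<le> T" using component_le_norm_cart[of "\<theta> - cc" k] by linarith
  then show "0 \<le> \<theta> $ k - cc $ k + T" "\<theta> $ k - cc $ k + T \<le> 2 * T" by auto
qed

lemma code_eq_same:
  assumes admissible: "admissible p \<theta>" "admissible p' \<theta>'" and eq: "code p \<theta> = code p' \<theta>'"
  shows "same_code p \<theta> p' \<theta>'"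
proof -
  have e1: "lab (\<theta> j) = lab (\<theta>' j)" "near (\<theta> j) = near (\<theta>' j)" if "j < q" for j
  proof -
    have "code1 \<theta> j = code1 \<theta>' j" using eq by (simp add: code_def)
    then show "lab (\<theta> j) = lab (\<theta>' j)" "near (\<theta> j) = near (\<theta>' j)" using that by (simp_all add: code1_def)
  qed
  have e2: "(0 \<le> wc p \<theta> j k) = (0 \<le> wc p' \<theta>' j k)" if "j < q" for j k
  proof -
    have "code2 p \<theta> (j, k) = code2 p' \<theta>' (j, k)" using eq by (simp add: code_def)
    then show ?thesis using that by (simp add: code2_def)
  qed
  have e3: "nat \<lfloor>slot_val p \<theta> (j, ko)\<rfloor> = nat \<lfloor>slot_val p' \<theta>' (j, ko)\<rfloor>" if "j < q" for j ko
  proof -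
    have "code3 p \<theta> (j, ko) = code3 p' \<theta>' (j, ko)" using eq by (simp add: code_def)
    then show ?thesis using that by (simp add: code3_def slots_def)
  qed
  have e4: "code4 p \<theta> (i, ko) = code4 p' \<theta>' (i, ko)" for i ko using eq by (simp add: code_def)
  show ?thesis
    unfolding same_code_def
  proof (intro conjI allI impI)
    fix j assume j: "j < q"
    show "lab (\<theta> j) = lab (\<theta>' j)" "near (\<theta> j) = near (\<theta>' j)" using e1[OF j] by auto
    { assume nr: "near (\<theta> j)"
      fix k
      have "nat \<lfloor>\<bar>wc p \<theta> j k\<bar> / hw\<rfloor> = nat \<lfloor>\<bar>wc p' \<theta>' j k\<bar> / hw\<rfloor>"
        using e3[OF j, of "Some k"] nr e1[OF j] by (simp add: slot_val_def)
      then have "\<bar>\<bar>wc p \<theta> j k\<bar> - \<bar>wc p' \<theta>' j k\<bar>\<bar> \<le> hw" by (rule nat_floor_eq_close) (use h_pos in auto)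
      then show "\<bar>wc p \<theta> j k - wc p' \<theta>' j k\<bar> \<le> u^2 * sqrt \<epsilon> / sqrt q"
        using e2[OF j, of k] unfolding hw_def[symmetric] by linarith }
    { assume nr: "\<not> near (\<theta> j)"
      have "nat \<lfloor>p j / h\<pi>\<rfloor> = nat \<lfloor>p' j / h\<pi>\<rfloor>"
        using e3[OF j, of None] nr e1[OF j] by (simp add: slot_val_def)
      then show "\<bar>p j - p' j\<bar> \<le> \<epsilon> * u^2 / q"
        unfolding h\<pi>_def[symmetric] by (rule nat_floor_eq_close) (use h_pos admissibleD(1)[OF admissible(1) j] admissibleD(1)[OF admissible(2) j] in auto)
      fix k
      have "nat \<lfloor>(\<theta> j $ k - cc $ k + T) / h\<theta>\<rfloor> = nat \<lfloor>(\<theta>' j $ k - cc $ k + T) / h\<theta>\<rfloor>"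
        using e3[OF j, of "Some k"] nr e1[OF j] by (simp add: slot_val_def)
      then have "\<bar>(\<theta> j $ k - cc $ k + T) - (\<theta>' j $ k - cc $ k + T)\<bar> \<le> h\<theta>"
        by (rule nat_floor_eq_close) (use h_pos pos_coord(1)[OF admissibleD(2)[OF admissible(1) j]] pos_coord(1)[OF admissibleD(2)[OF admissible(2) j]] in auto)
      then show "\<bar>(\<theta> j - \<theta>' j) $ k\<bar> \<le> u^8 / dm" unfolding h\<theta>_def[symmetric] by simp }
  next
    fix i assume i: "i < n"
    have "\<lfloor>ca p \<theta> i / ha\<rfloor> = \<lfloor>ca p' \<theta>' i / ha\<rfloor>" using e4[of i None] i by (simp add: code4_def)
    then show "\<bar>ca p \<theta> i - ca p' \<theta>' i\<bar> \<le> u^2 * \<epsilon>" unfolding ha_def[symmetric] by (rule floor_eq_close) (rule h_pos)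
    fix k
    have "\<lfloor>cb p \<theta> i k / ha\<rfloor> = \<lfloor>cb p' \<theta>' i k / ha\<rfloor>" using e4[of i "Some k"] i by (simp add: code4_def)
    then show "\<bar>cb p \<theta> i k - cb p' \<theta>' i k\<bar> \<le> u^2 * \<epsilon>" unfolding ha_def[symmetric] by (rule floor_eq_close) (rule h_pos)
  qed
qed

text \<open>The bound on the average slot value: \<open>K / u^8\<close> for weights and scaled
  offsets, and \<open>2 * dm * T / u^8\<close> for positions in a ball of radius \<open>T\<close> on
  a grid of step \<open>u^8 / dm\<close>.\<close>

definition Nb :: real where "Nb = (K + 2 * dm * max T 1) / u^8"

lemma Nb_pos: "0 < Nb" using K dm1 u by (simp add: Nb_def add_pos_pos)

lemma card_slots: "real (card slots) = q * (dm + 1)" "finite slots"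
  by (auto simp: slots_def card_cartesian_product card_UNIV_option dm algebra_simps)

lemma slot_val_nonneg: "admissible p \<theta> \<Longrightarrow> j < q \<Longrightarrow> 0 \<le> slot_val p \<theta> (j, ko)"
  using h_pos admissibleD(1,2)[of p \<theta> j] pos_coord(1)[of "\<theta> j"]
  by (cases ko) (auto simp: slot_val_def intro!: divide_nonneg_pos)

text \<open>Weights that are not near add up to \<open>K * \<epsilon> / u^6\<close>, and near
  offsets to \<open>sqrt q * sqrt (K * \<epsilon>)\<close>; divided by their steps both are at most
  \<open>q * K / u^8\<close>. Only the positions are bounded one by one.\<close>

lemma slot_sum:
  assumes admissible: "admissible p \<theta>"
  shows "(\<Sum>s\<in>slots. slot_val p \<theta> s) \<le> real (card slots) * Nb"
proof -
  have T0: "0 \<le> T"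
  proof -
    have "\<theta> 0 \<in> \<Theta>" using admissibleD(2)[OF admissible q] .
    then have "norm (\<theta> 0 - cc) \<le> T" using cb by (auto simp: dist_norm norm_minus_commute)
    then show ?thesis using norm_ge_zero order_trans by blast
  qed
  have uopt: "(UNIV :: 'd option set) = insert None (Some ` UNIV)" by (auto simp: UNIV_option_conv)
  have "(\<Sum>s\<in>slots. slot_val p \<theta> s) = (\<Sum>j<q. \<Sum>ko\<in>UNIV. slot_val p \<theta> (j, ko))"
    unfolding slots_def by (subst sum.cartesian_product) (simp add: case_prod_unfold)
  also have "\<dots> = (\<Sum>j<q. slot_val p \<theta> (j, None) + (\<Sum>k\<in>UNIV. slot_val p \<theta> (j, Some k)))"
    unfolding uopt by (subst sum.insert) (auto simp: sum.reindex)
  also have "\<dots> = (\<Sum>j<q. slot_val p \<theta> (j, None)) + (\<Sum>k\<in>UNIV. \<Sum>j<q. slot_val p \<theta> (j, Some k))"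
    by (simp only: sum.distrib sum.swap[of _ "{..<q}" UNIV])
  also have "\<dots> \<le> q * (K / u^8) + (\<Sum>k\<in>(UNIV::'d set). q * ((K + 2 * dm * T) / u^8))"
  proof (intro add_mono sum_mono)
    have "(\<Sum>j<q. slot_val p \<theta> (j, None)) = (\<Sum>j\<in>{j. j < q \<and> \<not> near (\<theta> j)}. p j / h\<pi>)"
      by (rule sum.mono_neutral_cong_right) (auto simp: slot_val_def)
    also have "\<dots> = (\<Sum>j\<in>{j. j < q \<and> \<not> near (\<theta> j)}. p j) / h\<pi>" by (simp add: sum_divide_distrib)
    also have "\<dots> \<le> (K * \<epsilon> / u^6) / h\<pi>"
      using h_pos by (intro divide_right_mono not_near_mass[OF admissible]) auto
    also have "\<dots> = q * (K / u^8)"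
    proof -
      have "u^8 = u^6 * u^2" by (simp add: power_add[symmetric])
      then show ?thesis using eps u q by (simp add: h\<pi>_def field_simps)
    qed
    finally show "(\<Sum>j<q. slot_val p \<theta> (j, None)) \<le> q * (K / u^8)" .
    fix k :: 'd
    have split: "(\<Sum>j<q. slot_val p \<theta> (j, Some k))
       = (\<Sum>j\<in>{j. j < q \<and> near (\<theta> j)}. \<bar>wc p \<theta> j k\<bar> / hw) + (\<Sum>j\<in>{j. j < q \<and> \<not> near (\<theta> j)}. (\<theta> j $ k - cc $ k + T) / h\<theta>)"
    proof -
      have "{..<q} = {j. j < q \<and> near (\<theta> j)} \<union> {j. j < q \<and> \<not> near (\<theta> j)}" by auto
      moreover have "(\<Sum>j\<in>{j. j < q \<and> near (\<theta> j)} \<union> {j. j < q \<and> \<not> near (\<theta> j)}. slot_val p \<theta> (j, Some k))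
        = (\<Sum>j\<in>{j. j < q \<and> near (\<theta> j)}. slot_val p \<theta> (j, Some k)) + (\<Sum>j\<in>{j. j < q \<and> \<not> near (\<theta> j)}. slot_val p \<theta> (j, Some k))"
        by (rule sum.union_disjoint) auto
      ultimately show ?thesis by (simp add: slot_val_def)
    qed
    have "(\<Sum>j\<in>{j. j < q \<and> near (\<theta> j)}. \<bar>wc p \<theta> j k\<bar> / hw) = (\<Sum>j\<in>{j. j < q \<and> near (\<theta> j)}. \<bar>wc p \<theta> j k\<bar>) / hw"
      by (simp add: sum_divide_distrib)
    also have "\<dots> \<le> (sqrt q * sqrt (K * \<epsilon>)) / hw"
      using h_pos by (intro divide_right_mono wc_sum[OF admissible]) auto
    also have "\<dots> = q * (sqrt K / u^2)"
    proof -
      have "sqrt q * sqrt q = real q" by simp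
      then show ?thesis using eps u q by (simp add: hw_def real_sqrt_mult field_simps)
    qed
    also have "\<dots> \<le> q * (K / u^8)"
    proof (intro mult_left_mono frac_le)
      show "sqrt K \<le> K" using K by (intro real_le_lsqrt) (auto simp: power2_eq_square)
      show "u^8 \<le> u^2" using u by (intro power_decreasing) auto
    qed (use K u in auto)
    finally have s1: "(\<Sum>j\<in>{j. j < q \<and> near (\<theta> j)}. \<bar>wc p \<theta> j k\<bar> / hw) \<le> q * (K / u^8)" .
    have "(\<Sum>j\<in>{j. j < q \<and> \<not> near (\<theta> j)}. (\<theta> j $ k - cc $ k + T) / h\<theta>) \<le> (\<Sum>j\<in>{j. j < q \<and> \<not> near (\<theta> j)}. 2 * T / h\<theta>)"
      using pos_coord(2) admissibleD(2)[OF admissible] h_pos by (intro sum_mono divide_right_mono) auto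
    also have "\<dots> = card {j. j < q \<and> \<not> near (\<theta> j)} * (2 * T / h\<theta>)" by simp
    also have "\<dots> \<le> q * (2 * T / h\<theta>)"
    proof (intro mult_right_mono)
      have "card {j. j < q \<and> \<not> near (\<theta> j)} \<le> card {..<q}" by (intro card_mono) auto
      then show "real (card {j. j < q \<and> \<not> near (\<theta> j)}) \<le> q" by simp
    qed (use T0 h_pos in auto)
    also have "\<dots> = q * (2 * dm * T / u^8)" by (simp add: h\<theta>_def)
    finally have s2: "(\<Sum>j\<in>{j. j < q \<and> \<not> near (\<theta> j)}. (\<theta> j $ k - cc $ k + T) / h\<theta>) \<le> q * (2 * dm * T / u^8)" .
    show "(\<Sum>j<q. slot_val p \<theta> (j, Some k)) \<le> q * ((K + 2 * dm * T) / u^8)"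
      unfolding split add_divide_distrib[of K] distrib_left using s1 s2 by linarith
  qed
  also have "\<dots> = q * (K / u^8) + dm * (q * ((K + 2 * dm * T) / u^8))" by (simp add: dm)
  also have "\<dots> \<le> q * Nb + dm * (q * Nb)"
  proof -
    have "2 * dm * T \<le> 2 * dm * max T 1" using dm1 by (intro mult_left_mono) auto
    then have "(K + 2 * dm * T) / u^8 \<le> Nb" unfolding Nb_def using u by (intro divide_right_mono) auto
    moreover have "K / u^8 \<le> Nb" unfolding Nb_def using u dm1 by (intro divide_right_mono) auto
    ultimately show ?thesis using dm1 by (intro add_mono mult_left_mono) auto
  qed
  also have "\<dots> = real (card slots) * Nb" unfolding card_slots(1) by (simp add: algebra_simps)
  finally show ?thesis .
qed

definition codes where
  "codes = ({..<q} \<rightarrow>\<^sub>E ({..n} \<times> (UNIV :: bool set))) \<times> (({..<q} \<times> (UNIV :: 'd set)) \<rightarrow>\<^sub>E (UNIV :: bool set))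
     \<times> {m \<in> slots \<rightarrow>\<^sub>E (UNIV::nat set). real (sum m slots) \<le> card slots * Nb}
     \<times> (({..<n} \<times> (UNIV :: 'd option set)) \<rightarrow>\<^sub>E {\<lfloor>- (K / u^2)\<rfloor>..\<lfloor>K / u^2\<rfloor>})"

lemma finite_codes: "finite codes"
proof -
  have "{m \<in> slots \<rightarrow>\<^sub>E (UNIV::nat set). real (sum m slots) \<le> card slots * Nb}
     \<subseteq> {m \<in> slots \<rightarrow>\<^sub>E (UNIV::nat set). sum m slots \<le> nat \<lfloor>card slots * Nb\<rfloor>}"
    by (auto simp: le_nat_floor)
  then have "finite {m \<in> slots \<rightarrow>\<^sub>E (UNIV::nat set). real (sum m slots) \<le> card slots * Nb}"
    using sum_le_count_finite[OF card_slots(2)] finite_subset by blast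
  then show ?thesis unfolding codes_def by (intro finite_cartesian_product finite_PiE) auto
qed

lemma code_in:
  assumes admissible: "admissible p \<theta>"
  shows "code p \<theta> \<in> codes"
proof -
  have 1: "code1 \<theta> \<in> {..<q} \<rightarrow>\<^sub>E ({..n} \<times> (UNIV :: bool set))"
    unfolding code1_def using label_le by (intro restrict_PiE[THEN iffD2] | auto)+
  have 2: "code2 p \<theta> \<in> ({..<q} \<times> (UNIV :: 'd set)) \<rightarrow>\<^sub>E (UNIV :: bool set)"
    unfolding code2_def by auto
  have "real (sum (code3 p \<theta>) slots) = (\<Sum>s\<in>slots. real (nat \<lfloor>slot_val p \<theta> s\<rfloor>))"
    by (simp add: code3_def)
  also have "\<dots> \<le> (\<Sum>s\<in>slots. slot_val p \<theta> s)"
    using slot_val_nonneg[OF admissible] by (intro sum_mono real_nat_floor_le) (auto simp: slots_def)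
  also have "\<dots> \<le> card slots * Nb" by (rule slot_sum[OF admissible])
  finally have 3: "code3 p \<theta> \<in> {m \<in> slots \<rightarrow>\<^sub>E (UNIV::nat set). real (sum m slots) \<le> card slots * Nb}"
    by (auto simp: code3_def)
  have fl: "\<lfloor>c / ha\<rfloor> \<in> {\<lfloor>- (K / u^2)\<rfloor>..\<lfloor>K / u^2\<rfloor>}" if "\<bar>c\<bar> \<le> K * \<epsilon>" for c
  proof -
    have "\<bar>c / ha\<bar> \<le> K * \<epsilon> / ha" using that h_pos by (simp add: abs_divide divide_right_mono)
    also have "\<dots> = K / u^2" using eps by (simp add: ha_def)
    finally have "- (K / u^2) \<le> c / ha" "c / ha \<le> K / u^2" by linarith+
    then show ?thesis using floor_mono by auto
  qed
  have 4: "code4 p \<theta> \<in> ({..<n} \<times> (UNIV :: 'd option set)) \<rightarrow>\<^sub>E {\<lfloor>- (K / u^2)\<rfloor>..\<lfloor>K / u^2\<rfloor>}"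
  proof (rule PiE_I)
    fix s :: "nat \<times> 'd option" assume s: "s \<in> {..<n} \<times> UNIV"
    then obtain i ko where "s = (i, ko)" "i < n" by auto
    then show "code4 p \<theta> s \<in> {\<lfloor>- (K / u^2)\<rfloor>..\<lfloor>K / u^2\<rfloor>}"
      using fl admissibleD(4,5)[OF admissible, of i] by (cases ko) (auto simp: code4_def)
  qed (auto simp: code4_def)
  show ?thesis unfolding codes_def code_def using 1 2 3 4 by blast
qed

text \<open>Labels with near flags, signs and slots give factors exponential in \<open>q\<close>.
  The integers for masses and first moments have absolute value of order \<open>K / u^2\<close> and
  concern the \<open>n\<close> true points only.\<close>

lemma card_codes:
  "real (card codes) \<le> (2 * (real n + 1)) ^ q * 2 ^ (q * CARD('d)) * (exp 1 * (1 + Nb)) ^ (q * (CARD('d) + 1))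
     * (2 * (K / u^2) + 2) ^ (n * (CARD('d) + 1))"
proof -
  have cs: "card slots = q * (CARD('d) + 1)" by (simp add: slots_def card_cartesian_product card_UNIV_option)
  have c1: "card ({..<q} \<rightarrow>\<^sub>E ({..n} \<times> (UNIV :: bool set))) = (2 * (n + 1)) ^ q"
    by (simp add: card_PiE card_cartesian_product mult.commute)
  have c2: "card (({..<q} \<times> (UNIV :: 'd set)) \<rightarrow>\<^sub>E (UNIV :: bool set)) = 2 ^ (q * CARD('d))"
    by (simp add: card_PiE card_cartesian_product)
  have c3: "real (card {m \<in> slots \<rightarrow>\<^sub>E (UNIV::nat set). real (sum m slots) \<le> card slots * Nb}) \<le> (exp 1 * (1 + Nb)) ^ (q * (CARD('d) + 1))"
    using card_sum_le[OF card_slots(2) Nb_pos] unfolding cs .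
  have c4: "real (card (({..<n} \<times> (UNIV :: 'd option set)) \<rightarrow>\<^sub>E {\<lfloor>- (K / u^2)\<rfloor>..\<lfloor>K / u^2\<rfloor>})) \<le> (2 * (K / u^2) + 2) ^ (n * (CARD('d) + 1))"
  proof -
    have "card (({..<n} \<times> (UNIV :: 'd option set)) \<rightarrow>\<^sub>E {\<lfloor>- (K / u^2)\<rfloor>..\<lfloor>K / u^2\<rfloor>})
       = card {\<lfloor>- (K / u^2)\<rfloor>..\<lfloor>K / u^2\<rfloor>} ^ (n * (CARD('d) + 1))"
      by (simp add: card_PiE card_cartesian_product card_UNIV_option)
    moreover have "real (card {\<lfloor>- (K / u^2)\<rfloor>..\<lfloor>K / u^2\<rfloor>}) \<le> 2 * (K / u^2) + 2"
    proof -
      have "0 \<le> K / u^2" using K by simp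
      then show ?thesis unfolding card_atLeastAtMost_int by linarith
    qed
    ultimately show ?thesis by (simp add: power_mono)
  qed
  have "real (card codes) = real ((2 * (n + 1)) ^ q) * (real (2 ^ (q * CARD('d)))
     * (real (card {m \<in> slots \<rightarrow>\<^sub>E (UNIV::nat set). real (sum m slots) \<le> card slots * Nb})
      * real (card (({..<n} \<times> (UNIV :: 'd option set)) \<rightarrow>\<^sub>E {\<lfloor>- (K / u^2)\<rfloor>..\<lfloor>K / u^2\<rfloor>}))))"
    unfolding codes_def card_cartesian_product c1 c2 by simp
  also have "\<dots> \<le> real ((2 * (n + 1)) ^ q) * (real (2 ^ (q * CARD('d)))
     * ((exp 1 * (1 + Nb)) ^ (q * (CARD('d) + 1)) * (2 * (K / u^2) + 2) ^ (n * (CARD('d) + 1))))"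
    using Nb_pos by (intro mult_left_mono mult_mono c3 c4) auto
  finally show ?thesis by (simp add: mult.assoc add.commute)
qed

text \<open>Both \<open>f / fs\<close> and \<open>diff_env\<close> are at most \<open>H0\<close>, so
  the squares of the bracket ends are at most \<open>2 * H0\<close>; integrability of
  \<open>H0\<close> puts the ends into the required space.\<close>

lemma bracketing_bound:
  assumes S: "\<And>g. g \<in> S \<Longrightarrow> \<exists>p \<theta>. admissible p \<theta> \<and> (\<Sum>j<q. p j) = 1 \<and> g = (\<lambda>x. sqrt (mixture f0 q p \<theta> x / fs x))"
    and \<delta>: "0 \<le> \<delta>" "ennreal (cC * \<epsilon>^2 * u^2) * J \<le> ennreal (\<delta>^2)"
    and H0int: "(\<integral>\<^sup>+x. ennreal (H0 x) \<partial>\<mu>) < top"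
    and f0m: "f0 \<in> borel_measurable borel"
  shows "bracketing_number \<mu> S \<delta> \<le> enat (card codes)"
proof -
  define P where "P = {(p, \<theta>). admissible p \<theta> \<and> (\<Sum>j<q. p j) = 1}"
  define A where "A = (\<lambda>(p, \<theta>) x. mixture f0 q p \<theta> x / fs x)"
  define Up where "Up = (\<lambda>a x. sqrt (A a x + diff_env x))"
  define Lo where "Lo = (\<lambda>a x. sqrt (max 0 (A a x - diff_env x)))"
  have [measurable]: "H0 \<in> borel_measurable borel" "fs \<in> borel_measurable borel" by (rule meas)+
  note [measurable] = f0m
  have A01: "0 \<le> A a x \<and> A a x \<le> H0 x" if "a \<in> P" for a x
    using that mixture_le[of q "fst a" "snd a" x] admissibleD[of "fst a" "snd a"] fs_pos[of x]
    by (auto simp: P_def A_def divide_le_eq intro!: divide_nonneg_pos)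
  have Ym: "\<bar>A a x - 1\<bar> \<le> dev_env x" if a: "a \<in> P" for a x
  proof -
    have "\<bar>A a x - 1\<bar> \<le> H0 x" using A01[OF a, of x] H0_ge_1[of x] by linarith
    moreover have "ennreal ((A a x - 1)^2) \<le> dev_env_sq x" using dev_env_sq_bound[of "fst a" "snd a" x] a by (auto simp: P_def A_def)
    ultimately show ?thesis unfolding dev_env_def by (intro min_env)
  qed
  have Dm: "\<bar>A a x - A b x\<bar> \<le> diff_env x" if ab: "a \<in> P" "b \<in> P" "(case a of (p, \<theta>) \<Rightarrow> code p \<theta>) = (case b of (p, \<theta>) \<Rightarrow> code p \<theta>)" for a b x
  proof -
    obtain p \<theta> p' \<theta>' where ab': "a = (p, \<theta>)" "b = (p', \<theta>')" by (cases a, cases b)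
    have admissible: "admissible p \<theta>" "admissible p' \<theta>'" using ab ab' by (auto simp: P_def)
    have "same_code p \<theta> p' \<theta>'" using ab(3) ab' by (intro code_eq_same admissible) auto
    from diff_env_sq_bound[OF admissible this, of x] have "ennreal ((A a x - A b x)^2) \<le> diff_env_sq x"
      by (simp add: A_def ab' diff_divide_distrib)
    moreover have "\<bar>A a x - A b x\<bar> \<le> H0 x" using A01[OF ab(1), of x] A01[OF ab(2), of x] by linarith
    ultimately show ?thesis unfolding diff_env_def by (intro min_env)
  qed
  have Am: "A a \<in> borel_measurable borel" for a
    by (cases a) (auto simp: A_def mixture_def shifted_def[abs_def])
  show ?thesis
  proof (rule bracketing_number_le_code[where P = P and code = "\<lambda>(p, \<theta>). code p \<theta>" and L = Lo and U = Up
        and F = "\<lambda>a x. sqrt (A a x)"])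
    show "S \<subseteq> (\<lambda>a x. sqrt (A a x)) ` P"
    proof
      fix g assume "g \<in> S"
      then obtain p \<theta> where "admissible p \<theta>" "(\<Sum>j<q. p j) = 1" "g = (\<lambda>x. sqrt (mixture f0 q p \<theta> x / fs x))" using S by blast
      then show "g \<in> (\<lambda>a x. sqrt (A a x)) ` P" by (intro image_eqI[of _ _ "(p, \<theta>)"]) (auto simp: A_def P_def)
    qed
    show "finite codes" by (rule finite_codes)
    show "(\<lambda>(p, \<theta>). code p \<theta>) ` P \<subseteq> codes" using code_in by (auto simp: P_def)
  next
    fix a assume a: "a \<in> P"
    note [measurable] = Am[of a]
    have Um: "Up a \<in> borel_measurable \<mu>" "Lo a \<in> borel_measurable \<mu>" unfolding Up_def Lo_def by measurable
    have "(\<integral>\<^sup>+x. ennreal (2 * H0 x) \<partial>\<mu>) = 2 * (\<integral>\<^sup>+x. ennreal (H0 x) \<partial>\<mu>)"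
      using H_nonneg(1) by (subst nn_integral_cmult[symmetric]) (auto simp: ennreal_mult)
    then have fin: "(\<integral>\<^sup>+x. ennreal (2 * H0 x) \<partial>\<mu>) < top" using H0int by (simp add: ennreal_mult_less_top)
    have "Up a x ^ 2 \<le> 2 * H0 x \<and> Lo a x ^ 2 \<le> 2 * H0 x" for x
      using A01[OF a, of x] env_sq(3,4)[of x] by (auto simp: Up_def Lo_def)
    then have "(\<integral>\<^sup>+x. ennreal (Up a x ^ 2) \<partial>\<mu>) \<le> (\<integral>\<^sup>+x. ennreal (2 * H0 x) \<partial>\<mu>)"
      "(\<integral>\<^sup>+x. ennreal (Lo a x ^ 2) \<partial>\<mu>) \<le> (\<integral>\<^sup>+x. ennreal (2 * H0 x) \<partial>\<mu>)"
      by (auto intro!: nn_integral_mono ennreal_leI)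
    then have f2: "(\<integral>\<^sup>+x. ennreal (Up a x ^ 2) \<partial>\<mu>) < top" "(\<integral>\<^sup>+x. ennreal (Lo a x ^ 2) \<partial>\<mu>) < top"
      using fin by (auto intro: le_less_trans)
    have Lp: "g \<in> Lp_space 2 \<mu>" if g: "g \<in> borel_measurable \<mu>" "(\<integral>\<^sup>+x. ennreal (g x ^ 2) \<partial>\<mu>) < top" for g
    proof -
      obtain r where r: "0 \<le> r" "(\<integral>\<^sup>+x. ennreal (g x ^ 2) \<partial>\<mu>) = ennreal r" using g(2)
        by (cases "\<integral>\<^sup>+x. ennreal (g x ^ 2) \<partial>\<mu>") auto
      show ?thesis by (rule Lp_of_nn_integral(1)[OF g(1), of "sqrt r"]) (use r in auto)
    qed
    have "(\<integral>\<^sup>+x. ennreal ((Up a x - Lo a x)^2) \<partial>\<mu>) \<le> ennreal (\<delta>^2)"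
      using bracket_width[of "A a"] A01[OF a] Ym[OF a] Am \<delta>(2) unfolding Up_def Lo_def by (meson order_trans)
    then have "Lp_norm 2 \<mu> (\<lambda>x. Up a x - Lo a x) \<le> \<delta>"
      using Um \<delta>(1) by (intro Lp_of_nn_integral(2)) auto
    then show "Lo a \<in> Lp_space 2 \<mu> \<and> Up a \<in> Lp_space 2 \<mu> \<and> Lp_norm 2 \<mu> (\<lambda>x. Up a x - Lo a x) \<le> \<delta>"
      using Lp Um f2 by blast
  next
    fix a b x assume ab: "a \<in> P" "b \<in> P" "(case a of (p, \<theta>) \<Rightarrow> code p \<theta>) = (case b of (p, \<theta>) \<Rightarrow> code p \<theta>)"
    show "Lo a x \<le> sqrt (A b x) \<and> sqrt (A b x) \<le> Up a x"
      using Dm[OF ab, of x] A01[OF ab(2), of x] unfolding Lo_def Up_def by (auto simp: abs_le_iff)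
  qed
qed

end

end

section \<open>From the envelopes to the entropy bound\<close>

text \<open>Differentiation in the shift changes the sign. The factor \<open>c\<close> carries the
  sign from one derivative to the next when the lemma is iterated.\<close>

lemma partial_deriv_reflect:
  fixes g :: "real^'d::finite \<Rightarrow> real"
  assumes "g differentiable (at (x - \<theta>))"
  shows "partial_deriv i (\<lambda>\<tau>. c * g (x - \<tau>)) \<theta> = - c * partial_deriv i g (x - \<theta>)"
proof (rule partial_deriv_eqI)
  obtain D where D: "(g has_derivative D) (at (x - \<theta>))" using assms unfolding differentiable_def ..
  have "((\<lambda>t. g ((x - \<theta>) + t *\<^sub>R (- axis i 1))) has_real_derivative D (- axis i 1)) (at 0)"
    by (rule line_has_real_derivative_linear) (use D in simp)
  moreover have "D (- axis i 1) = - partial_deriv i g (x - \<theta>)"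
    using partial_deriv_has_derivative[OF D, of i] has_derivative_linear[OF D] by (simp add: linear_neg)
  ultimately show "((\<lambda>t. c * g (x - (\<theta> + t *\<^sub>R axis i 1))) has_real_derivative - c * partial_deriv i g (x - \<theta>)) (at 0)"
    using DERIV_cmult[of "\<lambda>t. g (x - (\<theta> + t *\<^sub>R axis i 1))" "- partial_deriv i g (x - \<theta>)" 0 UNIV c]
    by (simp add: algebra_simps)
qed

lemma partial_deriv_shifted:
  assumes C3: "C_k 3 f0"
  shows "partial_deriv i (\<lambda>\<tau>. shifted f0 \<tau> x) = (\<lambda>\<theta>. (- 1) * partial_deriv i f0 (x - \<theta>))"
    "partial_deriv i (partial_deriv j (\<lambda>\<tau>. shifted f0 \<tau> x)) = (\<lambda>\<theta>. 1 * partial_deriv i (partial_deriv j f0) (x - \<theta>))"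
    "partial_deriv i (partial_deriv j (partial_deriv k (\<lambda>\<tau>. shifted f0 \<tau> x)))
       = (\<lambda>\<theta>. (- 1) * partial_deriv i (partial_deriv j (partial_deriv k f0)) (x - \<theta>))"
proof -
  have d: "f0 differentiable (at y)" "partial_deriv j f0 differentiable (at y)"
    "partial_deriv i (partial_deriv j f0) differentiable (at y)" for y i j
    using C3 by (auto simp: eval_nat_numeral differentiable_on_def)
  have 1: "partial_deriv i (\<lambda>\<tau>. shifted f0 \<tau> x) = (\<lambda>\<theta>. (- 1) * partial_deriv i f0 (x - \<theta>))" for i
  proof
    fix \<theta> show "partial_deriv i (\<lambda>\<tau>. shifted f0 \<tau> x) \<theta> = (- 1) * partial_deriv i f0 (x - \<theta>)"
      using partial_deriv_reflect[OF d(1), of i 1 x \<theta>] by (simp add: shifted_def)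
  qed
  have 2: "partial_deriv i (partial_deriv j (\<lambda>\<tau>. shifted f0 \<tau> x)) = (\<lambda>\<theta>. 1 * partial_deriv i (partial_deriv j f0) (x - \<theta>))" for i j
    unfolding 1 by (rule ext) (subst partial_deriv_reflect[OF d(2)], simp)
  show "partial_deriv i (\<lambda>\<tau>. shifted f0 \<tau> x) = (\<lambda>\<theta>. (- 1) * partial_deriv i f0 (x - \<theta>))"
    "partial_deriv i (partial_deriv j (\<lambda>\<tau>. shifted f0 \<tau> x)) = (\<lambda>\<theta>. 1 * partial_deriv i (partial_deriv j f0) (x - \<theta>))"
    by (rule 1) (rule 2)
  show "partial_deriv i (partial_deriv j (partial_deriv k (\<lambda>\<tau>. shifted f0 \<tau> x)))
       = (\<lambda>\<theta>. (- 1) * partial_deriv i (partial_deriv j (partial_deriv k f0)) (x - \<theta>))"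
    unfolding 2 by (rule ext) (subst partial_deriv_reflect[OF d(3)], simp)
qed

text \<open>The supremum of a real set is an upper bound only if the set is bounded above. The sum
  over the finite index type dominates the maximum and is continuous, hence bounded on the compact
  closure of \<open>\<Theta>\<close>.\<close>

lemma SUP_envelope:
  fixes h :: "'i::finite \<Rightarrow> real^'d::finite \<Rightarrow> real"
  assumes "bounded \<Theta>" "\<theta> \<in> \<Theta>" "0 < c" "\<And>a. continuous_on UNIV (h a)" "\<And>a \<theta>. 0 \<le> h a \<theta>"
  shows "h a \<theta> \<le> (SUP \<theta>\<in>\<Theta>. (MAX a. h a \<theta>) / c) * c" "0 \<le> (SUP \<theta>\<in>\<Theta>. (MAX a. h a \<theta>) / c)"
proof -
  have le: "h a \<theta> \<le> (MAX a. h a \<theta>)" for a \<theta> by (rule Max_ge) auto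
  have "compact ((\<lambda>\<theta>. \<Sum>a\<in>UNIV. h a \<theta>) ` closure \<Theta>)"
    using assms by (intro compact_continuous_image continuous_on_sum) (auto intro: continuous_on_subset)
  then obtain B where B: "\<And>\<theta>. \<theta> \<in> closure \<Theta> \<Longrightarrow> \<bar>\<Sum>a\<in>UNIV. h a \<theta>\<bar> \<le> B"
    using compact_imp_bounded[THEN bounded_iff[THEN iffD1]] by fastforce
  have bdd: "bdd_above ((\<lambda>\<theta>. (MAX a. h a \<theta>) / c) ` \<Theta>)"
  proof (rule bdd_aboveI2)
    fix \<theta> assume "\<theta> \<in> \<Theta>"
    have "(MAX a. h a \<theta>) \<le> (\<Sum>a\<in>UNIV. h a \<theta>)"
      using assms(5) by (subst Max_le_iff) (auto intro!: member_le_sum)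
    also have "\<dots> \<le> B" using B[of \<theta>] closure_subset[of \<Theta>] \<open>\<theta> \<in> \<Theta>\<close> by auto
    finally show "(MAX a. h a \<theta>) / c \<le> B / c" using assms(3) by (simp add: divide_right_mono)
  qed
  have "h a \<theta> / c \<le> (MAX a. h a \<theta>) / c" for a using assms(3) le by (simp add: divide_right_mono)
  also have "(MAX a. h a \<theta>) / c \<le> (SUP \<theta>\<in>\<Theta>. (MAX a. h a \<theta>) / c)" by (rule cSUP_upper[OF assms(2) bdd])
  finally have *: "h a \<theta> / c \<le> (SUP \<theta>\<in>\<Theta>. (MAX a. h a \<theta>) / c)" for a .
  then show "h a \<theta> \<le> (SUP \<theta>\<in>\<Theta>. (MAX a. h a \<theta>) / c) * c" using assms(3) by (simp add: divide_le_eq)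
  have "0 \<le> h a \<theta> / c" using assms by simp
  then show "0 \<le> (SUP \<theta>\<in>\<Theta>. (MAX a. h a \<theta>) / c)" using * order_trans by blast
qed

lemma envelope_bounds:
  assumes C3: "C_k 3 f0" and f0: "\<And>x. 0 \<le> f0 x" and "bounded \<Theta>" "\<theta> \<in> \<Theta>" "0 < fs x"
  shows "0 \<le> envelope0 f0 fs \<Theta> x" "0 \<le> envelope1 f0 fs \<Theta> x" "0 \<le> envelope2 f0 fs \<Theta> x" "0 \<le> envelope3 f0 fs \<Theta> x"
    "f0 (x - \<theta>) \<le> envelope0 f0 fs \<Theta> x * fs x"
    "\<bar>partial_deriv i f0 (x - \<theta>)\<bar> \<le> envelope1 f0 fs \<Theta> x * fs x"
    "\<bar>partial_deriv i (partial_deriv j f0) (x - \<theta>)\<bar> \<le> envelope2 f0 fs \<Theta> x * fs x"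
    "\<bar>partial_deriv i (partial_deriv j (partial_deriv k f0)) (x - \<theta>)\<bar> \<le> envelope3 f0 fs \<Theta> x * fs x"
proof -
  have c: "continuous_on UNIV f0" "continuous_on UNIV (partial_deriv j f0)"
    "continuous_on UNIV (partial_deriv i (partial_deriv j f0))"
    "continuous_on UNIV (partial_deriv i (partial_deriv j (partial_deriv k f0)))" for i j k
    using C3 by (auto simp: eval_nat_numeral intro: differentiable_imp_continuous_on)
  have sc: "continuous_on UNIV (\<lambda>\<theta>. \<bar>g (x - \<theta>)\<bar>)" if "continuous_on UNIV g" for g :: "real^'b \<Rightarrow> real" and x
    using that by (auto intro!: continuous_intros continuous_on_compose2[OF that])
  note S = SUP_envelope[OF assms(3-5)]
  show "0 \<le> envelope0 f0 fs \<Theta> x" "f0 (x - \<theta>) \<le> envelope0 f0 fs \<Theta> x * fs x"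
    \<comment> \<open>The one element index type makes the maximum trivial, so
      \<open>envelope0\<close> is covered as well.\<close>
    using S[of "\<lambda>_::unit. \<lambda>\<theta>. \<bar>f0 (x - \<theta>)\<bar>"] f0 sc[OF c(1), of x] by (auto simp: envelope0_def shifted_def)
  show "0 \<le> envelope1 f0 fs \<Theta> x" "\<bar>partial_deriv i f0 (x - \<theta>)\<bar> \<le> envelope1 f0 fs \<Theta> x * fs x"
    using S[of "\<lambda>i \<theta>. \<bar>partial_deriv i f0 (x - \<theta>)\<bar>"]
    by (auto simp: envelope1_def partial_deriv_shifted[OF C3] sc[OF c(2)])
  show "0 \<le> envelope2 f0 fs \<Theta> x" "\<bar>partial_deriv i (partial_deriv j f0) (x - \<theta>)\<bar> \<le> envelope2 f0 fs \<Theta> x * fs x"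
    using S[of "\<lambda>(i, j) \<theta>. \<bar>partial_deriv i (partial_deriv j f0) (x - \<theta>)\<bar>"] S(1)[of "\<lambda>(i, j) \<theta>. \<bar>partial_deriv i (partial_deriv j f0) (x - \<theta>)\<bar>" "(i, j)"]
    unfolding envelope2_def partial_deriv_shifted(2)[OF C3] case_prod_unfold by (auto simp: sc[OF c(3)])
  show "0 \<le> envelope3 f0 fs \<Theta> x" "\<bar>partial_deriv i (partial_deriv j (partial_deriv k f0)) (x - \<theta>)\<bar> \<le> envelope3 f0 fs \<Theta> x * fs x"
    using S[of "\<lambda>(i, j, k) \<theta>. \<bar>partial_deriv i (partial_deriv j (partial_deriv k f0)) (x - \<theta>)\<bar>"]
      S(1)[of "\<lambda>(i, j, k) \<theta>. \<bar>partial_deriv i (partial_deriv j (partial_deriv k f0)) (x - \<theta>)\<bar>" "(i, j, k)"]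
    unfolding envelope3_def partial_deriv_shifted(3)[OF C3] case_prod_unfold by (auto simp: sc[OF c(4)])
qed

lemma mixture_props:
  assumes "prob_density f0" "continuous_on UNIV f0" "\<And>j. j < q \<Longrightarrow> 0 \<le> p j" "(\<Sum>j<q. p j) = 1"
  shows "mixture f0 q p \<theta> \<in> borel_measurable borel" "integrable lborel (mixture f0 q p \<theta>)"
    "(\<integral>x. mixture f0 q p \<theta> x \<partial>lborel) = 1" "\<And>x. 0 \<le> mixture f0 q p \<theta> x"
proof -
  have [measurable]: "f0 \<in> borel_measurable borel" using assms(2) by (rule borel_measurable_continuous_onI)
  have i: "integrable lborel (\<lambda>x. f0 (x - a))" "(\<integral>x. f0 (x - a) \<partial>lborel) = 1" for a
    using assms(1) by (auto simp: prob_density_def integrable_lborel_shift integral_lborel_shift)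
  show "mixture f0 q p \<theta> \<in> borel_measurable borel" unfolding mixture_def[abs_def] shifted_def by measurable
  show "integrable lborel (mixture f0 q p \<theta>)" "(\<integral>x. mixture f0 q p \<theta> x \<partial>lborel) = 1"
    using i assms(4) by (simp_all add: mixture_def[abs_def] shifted_def)
  show "0 \<le> mixture f0 q p \<theta> x" for x using assms(1,3) by (auto simp: mixture_def shifted_def prob_density_def intro!: sum_nonneg)
qed

lemma mixture_pos:
  assumes "\<And>x. 0 < f0 x" "\<And>j. j < q \<Longrightarrow> 0 \<le> p j" "(\<Sum>j<q. p j) = 1"
  shows "0 < mixture f0 q p \<theta> x"
proof -
  obtain j where "j < q" "0 < p j"
  proof (rule ccontr)
    assume "\<not> thesis"
    then have "(\<Sum>j<q. p j) \<le> 0" using that by (intro sum_nonpos) force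
    then show False using assms(3) by simp
  qed
  then show ?thesis unfolding mixture_def shifted_def
    using assms by (intro sum_pos2[of _ j]) (auto simp: less_imp_le)
qed

text \<open>Factor \<open>f - fs\<close> through the square roots and apply the arithmetic-geometric
  inequality with weight \<open>\<epsilon>\<close>: the squared difference contributes at most
  \<open>\<epsilon>\<close>, and the squared sum, of integral at most 4, contributes
  \<open>\<epsilon>\<close>.\<close>

lemma hellinger_L1:
  fixes f fs :: "real^'d::finite \<Rightarrow> real"
  assumes [measurable]: "f \<in> borel_measurable borel" "fs \<in> borel_measurable borel"
    and f: "integrable lborel f" "(\<integral>x. f x \<partial>lborel) = 1" "\<And>x. 0 \<le> f x"
    and fs: "integrable lborel fs" "(\<integral>x. fs x \<partial>lborel) = 1" "\<And>x. 0 < fs x"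
    and h: "Lp_norm 2 (density_measure fs) (\<lambda>x. sqrt (f x / fs x) - 1) \<le> \<epsilon>" "0 < \<epsilon>"
  shows "(\<integral>x. \<bar>f x - fs x\<bar> \<partial>lborel) \<le> 2 * \<epsilon>"
proof -
  define k where "k x = (sqrt (f x) - sqrt (fs x))^2" for x
  have k_le: "k x \<le> 2 * (f x + fs x)" for x
    using sum_squares_bound[of "- sqrt (f x)" "sqrt (fs x)"] f(3)[of x] fs(3)[of x]
    by (simp add: k_def power2_diff)
  have kint: "integrable lborel k"
    by (rule Bochner_Integration.integrable_bound[of _ "\<lambda>x. 2 * (f x + fs x)"])
      (use f fs k_le in \<open>auto simp: k_def[abs_def] abs_of_nonneg less_imp_le\<close>)
  have "(\<integral>x. \<bar>sqrt (f x / fs x) - 1\<bar> powr 2 \<partial>density_measure fs) = (\<integral>x. fs x * (sqrt (f x / fs x) - 1)^2 \<partial>lborel)"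
    unfolding density_measure_def using fs(3) by (subst integral_density) (auto simp: less_imp_le)
  also have "\<dots> = (\<integral>x. k x \<partial>lborel)"
  proof (rule Bochner_Integration.integral_cong[OF refl])
    fix x
    have "fs x * (sqrt (f x / fs x) - 1)^2 = (sqrt (fs x) * (sqrt (f x / fs x) - 1))^2"
      using fs(3)[of x] by (simp add: power_mult_distrib)
    also have "\<dots> = k x" using fs(3)[of x] by (simp add: k_def right_diff_distrib real_sqrt_divide)
    finally show "fs x * (sqrt (f x / fs x) - 1)^2 = k x" .
  qed
  finally have "sqrt (\<integral>x. k x \<partial>lborel) \<le> \<epsilon>" using h(1) by (simp add: Lp_norm_def powr_half_sqrt k_def)
  then have kle: "(\<integral>x. k x \<partial>lborel) \<le> \<epsilon>^2" by (simp add: real_sqrt_le_iff sqrt_le_D)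
  have "(\<integral>x. \<bar>f x - fs x\<bar> \<partial>lborel) \<le> (\<integral>x. 1 / \<epsilon> * k x + \<epsilon> / 2 * (f x + fs x) \<partial>lborel)"
  proof (rule integral_mono)
    fix x
    define a where "a = sqrt (f x)"
    define b where "b = sqrt (fs x)"
    have ab: "f x = a^2" "fs x = b^2" using f(3)[of x] fs(3)[of x] by (auto simp: a_def b_def)
    have "0 \<le> a" "0 \<le> b" using f(3)[of x] fs(3)[of x] by (auto simp: a_def b_def)
    then have "\<bar>f x - fs x\<bar> = \<bar>a - b\<bar> * (a + b)" unfolding ab by (simp add: power2_eq_square square_diff_square_factored abs_mult mult.commute)
    also have "\<dots> \<le> 1 / \<epsilon> * (a - b)^2 + \<epsilon> / 4 * (a + b)^2"
    proof -
      have "0 \<le> (\<bar>a - b\<bar> - \<epsilon> / 2 * (a + b))^2" by simp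
      then have "\<bar>a - b\<bar> * (a + b) * \<epsilon> \<le> (a - b)^2 + \<epsilon>^2 / 4 * (a + b)^2"
        by (simp add: power2_diff power_mult_distrib power_divide mult_ac)
      then show ?thesis using h(2) by (simp add: field_simps power2_eq_square)
    qed
    also have "\<dots> \<le> 1 / \<epsilon> * (a - b)^2 + \<epsilon> / 4 * (2 * (a^2 + b^2))"
      using h(2) sum_squares_bound[of a b] by (intro add_left_mono mult_left_mono) (auto simp: power2_sum)
    also have "\<dots> = 1 / \<epsilon> * k x + \<epsilon> / 2 * (f x + fs x)" unfolding k_def a_def[symmetric] b_def[symmetric] unfolding ab by (simp add: field_simps)
    finally show "\<bar>f x - fs x\<bar> \<le> 1 / \<epsilon> * k x + \<epsilon> / 2 * (f x + fs x)" .
  qed (use f fs kint in auto)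
  also have "\<dots> = 1 / \<epsilon> * (\<integral>x. k x \<partial>lborel) + \<epsilon> / 2 * 2" using f fs kint by simp
  also have "\<dots> \<le> 1 / \<epsilon> * \<epsilon>^2 + \<epsilon>" using kle h(2) by (intro add_mono mult_left_mono) auto
  also have "\<dots> = 2 * \<epsilon>" using h(2) by (simp add: power2_eq_square)
  finally show ?thesis .
qed

lemma Lp_norm_power:
  fixes m :: nat
  assumes "g \<in> Lp_space (real m) M" "0 < m"
  shows "(\<integral>\<^sup>+x. ennreal (\<bar>g x\<bar> ^ m) \<partial>M) = ennreal (Lp_norm (real m) M g ^ m)"
proof -
  have e: "\<bar>g x\<bar> powr (real m) = \<bar>g x\<bar> ^ m" for x using assms(2) by (cases "g x = 0") (auto simp: powr_realpow)
  have int: "integrable M (\<lambda>x. \<bar>g x\<bar> ^ m)" using assms(1) by (simp add: Lp_space_def e)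
  define I where "I = (\<integral>x. \<bar>g x\<bar> ^ m \<partial>M)"
  have I: "0 \<le> I" unfolding I_def by simp
  have "Lp_norm (real m) M g ^ m = I"
  proof (cases "I = 0")
    case False
    then show ?thesis unfolding Lp_norm_def e I_def[symmetric] using I assms(2)
      by (simp add: powr_realpow[symmetric] powr_powr)
  qed (use assms(2) in \<open>simp add: Lp_norm_def e I_def\<close>)
  moreover have "(\<integral>\<^sup>+x. ennreal (\<bar>g x\<bar> ^ m) \<partial>M) = ennreal I"
    unfolding I_def by (rule nn_integral_eq_integral[OF int]) simp
  ultimately show ?thesis by simp
qed

section \<open>Choice of the constants and the final count\<close>

text \<open>With \<open>X = q * (d + 1)\<close> the slots give \<open>A ^ (8 * X)\<close>; the main
  part gives at most \<open>A ^ (2 * X)\<close> because \<open>n \<le> q\<close>. All bases are at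
  least 1, so the constants may be raised to the same exponent \<open>10 * X + 1\<close>.\<close>

lemma count_arith:
  fixes A B1 B2 n1 E N1 N2 :: real and n q d :: nat
  assumes A: "1 \<le> A" and "1 \<le> n1" "1 \<le> B1" "1 \<le> B2" "0 \<le> N1" "N1 \<le> B1 * A^8" "0 \<le> N2" "N2 \<le> B2 * A^2" "n \<le> q"
  shows "n1 ^ q * 2 ^ (q * d) * N1 ^ (q * (d + 1)) * N2 ^ (n * (d + 1)) \<le> ((n1 * 2 * B1 * B2) * A) ^ (10 * (d + 1) * q + 1)"
proof -
  define X where "X = q * (d + 1)"
  have 1: "n1 ^ q \<le> n1 ^ X" "(2::real) ^ (q * d) \<le> 2 ^ X"
    unfolding X_def using assms by (auto intro!: power_increasing)
  have 2: "N1 ^ X \<le> (B1 * A^8) ^ X" using assms by (intro power_mono)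
  have B2A: "1 \<le> B2 * A^2" using assms by (simp add: mult_ge1_I one_le_power)
  have "N2 ^ (n * (d + 1)) \<le> (B2 * A^2) ^ (n * (d + 1))" using assms by (intro power_mono)
  also have "\<dots> \<le> (B2 * A^2) ^ X" unfolding X_def using B2A assms(9) by (intro power_increasing mult_le_mono1)
  finally have 3: "N2 ^ (n * (d + 1)) \<le> (B2 * A^2) ^ X" .
  have "n1 ^ q * 2 ^ (q * d) * N1 ^ X * N2 ^ (n * (d + 1)) \<le> n1 ^ X * 2 ^ X * (B1 * A^8) ^ X * (B2 * A^2) ^ X"
    using assms by (intro mult_mono 1 2 3) (auto intro!: mult_nonneg_nonneg)
  also have "\<dots> = (n1 * 2 * B1 * B2) ^ X * A ^ (10 * X)"
  proof -
    have "(A^8)^X * (A^2)^X = A ^ (10 * X)" by (simp add: power_mult[symmetric] power_add[symmetric])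
    then show ?thesis by (simp add: power_mult_distrib mult_ac)
  qed
  also have "\<dots> \<le> (n1 * 2 * B1 * B2) ^ (10 * X + 1) * A ^ (10 * X + 1)"
  proof (intro mult_mono power_increasing)
    show "1 \<le> n1 * 2 * B1 * B2" using mult_ge1_I[OF mult_ge1_I[OF assms(2,3)] assms(4)] by simp
  qed (use A assms in auto)
  also have "\<dots> = ((n1 * 2 * B1 * B2) * A) ^ (10 * (d + 1) * q + 1)"
    by (simp only: power_mult_distrib[symmetric] X_def mult_ac)
  finally show ?thesis unfolding X_def .
qed

context mix_env_vol
begin

text \<open>As \<open>H0\<close> is at least 1 and the measure has mass 1, \<open>M\<close> is at
  least 1. The constant summand of \<open>W\<close> then counts as one more \<open>M\<close>, which
  makes five.\<close>

lemma J_le: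
  assumes M: "(\<integral>\<^sup>+x. ennreal (H0 x ^ 4) \<partial>\<mu>) \<le> ennreal M" "(\<integral>\<^sup>+x. ennreal (H1 x ^ 4) \<partial>\<mu>) \<le> ennreal M"
    "(\<integral>\<^sup>+x. ennreal (H2 x ^ 4) \<partial>\<mu>) \<le> ennreal M" "(\<integral>\<^sup>+x. ennreal (H3 x ^ 2) \<partial>\<mu>) \<le> ennreal M"
    and fs: "integrable lborel fs" "(\<integral>x. fs x \<partial>lborel) = 1"
  shows "1 \<le> M" "J \<le> ennreal (5 * M)" "(\<integral>\<^sup>+x. ennreal (H0 x) \<partial>\<mu>) < top"
proof -
  have [measurable]: "H0 \<in> borel_measurable borel" "H1 \<in> borel_measurable borel" "H2 \<in> borel_measurable borel"
    "H3 \<in> borel_measurable borel" "fs \<in> borel_measurable borel" by (rule meas)+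
  have one: "(\<integral>\<^sup>+x. 1 \<partial>\<mu>) = 1"
  proof -
    have "(\<integral>\<^sup>+x. 1 \<partial>\<mu>) = (\<integral>\<^sup>+x. ennreal (fs x) \<partial>lborel)" by (subst nn_integral_mu) auto
    also have "\<dots> = ennreal 1" using fs fs_pos by (subst nn_integral_eq_integral) (auto simp: less_imp_le)
    finally show ?thesis by simp
  qed
  have h0: "1 \<le> H0 x ^ 4" "H0 x \<le> H0 x ^ 4" for x
    using H0_ge_1[of x] one_le_power[of "H0 x" 4] self_le_power[of "H0 x" 4] by auto
  have "(\<integral>\<^sup>+x. 1 \<partial>\<mu>) \<le> (\<integral>\<^sup>+x. ennreal (H0 x ^ 4) \<partial>\<mu>)"
    using h0 by (intro nn_integral_mono) (auto simp: ennreal_1[symmetric] simp del: ennreal_1)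
  then have "1 \<le> ennreal M" using M(1) unfolding one by (rule order_trans)
  then show M1: "1 \<le> M" by simp
  have "(\<integral>\<^sup>+x. ennreal (H0 x) \<partial>\<mu>) \<le> (\<integral>\<^sup>+x. ennreal (H0 x ^ 4) \<partial>\<mu>)"
    using h0 by (intro nn_integral_mono ennreal_leI)
  also have "\<dots> < top" using M(1) by (rule le_less_trans) simp
  finally show "(\<integral>\<^sup>+x. ennreal (H0 x) \<partial>\<mu>) < top" .
  have "J = (\<integral>\<^sup>+x. ennreal (W x) \<partial>\<mu>)"
    unfolding J_def G_def using fs_pos
    by (subst nn_integral_mu) (auto intro!: nn_integral_cong simp: ennreal_mult' less_imp_le mult.commute[of "W _"])
  also have "\<dots> = (\<integral>\<^sup>+x. 1 + ennreal (H0 x ^ 4) + ennreal (H1 x ^ 4) + ennreal (H2 x ^ 4) + ennreal (H3 x ^ 2) \<partial>\<mu>)"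
    unfolding W_def by (intro nn_integral_cong) (simp add: ennreal_plus H_nonneg)
  also have "\<dots> = (\<integral>\<^sup>+x. 1 \<partial>\<mu>) + (\<integral>\<^sup>+x. ennreal (H0 x ^ 4) \<partial>\<mu>) + (\<integral>\<^sup>+x. ennreal (H1 x ^ 4) \<partial>\<mu>)
      + (\<integral>\<^sup>+x. ennreal (H2 x ^ 4) \<partial>\<mu>) + (\<integral>\<^sup>+x. ennreal (H3 x ^ 2) \<partial>\<mu>)"
    by (simp add: nn_integral_add density_measure_def)
  also have "\<dots> \<le> ennreal M + ennreal M + ennreal M + ennreal M + ennreal M"
    using M one M1 by (intro add_mono) (auto simp: ennreal_1[symmetric] simp del: ennreal_1)
  also have "\<dots> = ennreal (5 * M)" using M1 by (simp add: ennreal_plus[symmetric] del: ennreal_plus)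
  finally show "J \<le> ennreal (5 * M)" .
qed

end

lemma envelopes_mix_env:
  assumes f0: "\<And>x. 0 < f0 x" "prob_density f0" and A: "assumption_A f0 fs \<Theta>" and \<Theta>: "bounded \<Theta>" "0 < n" "\<And>i. i < n \<Longrightarrow> ts i \<in> \<Theta>"
    and ps: "\<And>i. i < n \<Longrightarrow> 0 \<le> ps i" "(\<Sum>i<n. ps i) = 1" and fs: "fs = mixture f0 n ps ts"
  shows "mix_env f0 fs (envelope0 f0 fs \<Theta>) (envelope1 f0 fs \<Theta>) (envelope2 f0 fs \<Theta>) (envelope3 f0 fs \<Theta>) \<Theta> n ps ts"
proof
  show C3: "C_k 3 f0" using A by (simp add: assumption_A_def)
  have b: "borel_measurable (density_measure fs) = (borel_measurable borel :: (real^'a \<Rightarrow> real) set)"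
    by (rule measurable_cong_sets) (simp_all add: density_measure_def)
  show "envelope0 f0 fs \<Theta> \<in> borel_measurable borel" "envelope1 f0 fs \<Theta> \<in> borel_measurable borel"
    "envelope2 f0 fs \<Theta> \<in> borel_measurable borel" "envelope3 f0 fs \<Theta> \<in> borel_measurable borel"
    using A by (simp_all add: assumption_A_def Lp_space_def b)
  show "fs \<in> borel_measurable borel" unfolding fs
    using f0 ps C3 by (intro mixture_props C_k_continuous)
  show fp: "0 < fs x" for x unfolding fs using f0 ps by (intro mixture_pos)
  have f00: "0 \<le> f0 x" for x using f0(1)[of x] by simp
  show "0 \<le> envelope0 f0 fs \<Theta> x" "0 \<le> envelope1 f0 fs \<Theta> x" "0 \<le> envelope2 f0 fs \<Theta> x" "0 \<le> envelope3 f0 fs \<Theta> x" for x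
    using envelope_bounds(1-4)[where fs = fs, OF C3 f00 \<Theta>(1) \<Theta>(3)[OF \<Theta>(2)] fp] by auto
  show "f0 (x - \<theta>) \<le> envelope0 f0 fs \<Theta> x * fs x"
    "\<bar>partial_deriv i f0 (x - \<theta>)\<bar> \<le> envelope1 f0 fs \<Theta> x * fs x"
    "\<bar>partial_deriv i (partial_deriv j f0) (x - \<theta>)\<bar> \<le> envelope2 f0 fs \<Theta> x * fs x"
    "\<bar>partial_deriv i (partial_deriv j (partial_deriv k f0)) (x - \<theta>)\<bar> \<le> envelope3 f0 fs \<Theta> x * fs x"
    if "\<theta> \<in> \<Theta>" for x \<theta> i j k by (rule envelope_bounds[where fs = fs, OF C3 f00 \<Theta>(1) that fp])+
qed (use f0 fs \<Theta> ps in auto)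

text \<open>The quantities \<open>r\<close>, \<open>C\<close>, \<open>kC\<close>, \<open>c\<close>,
  \<open>B1\<close>, \<open>B2\<close> are fixed before \<open>\<Theta>\<close>, \<open>T\<close>,
  \<open>q\<close>, \<open>\<epsilon>\<close> and \<open>\<delta>\<close>, so \<open>L\<close> is
  independent of all of these.\<close>

lemma entropy_bound:
  fixes f0 :: "real^'d::finite \<Rightarrow> real" and ts :: "nat \<Rightarrow> real^'d"
  assumes f0: "\<And>x. 0 < f0 x" "prob_density f0" and n: "0 < n"
    and inj: "\<And>i j. i < n \<Longrightarrow> j < n \<Longrightarrow> i \<noteq> j \<Longrightarrow> ts i \<noteq> ts j"
    and ps: "\<And>i. i < n \<Longrightarrow> 0 \<le> ps i" "(\<Sum>i<n. ps i) = 1" and fs: "fs = mixture f0 n ps ts"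
  shows "\<exists>L>0. \<forall>\<Theta> T. bounded \<Theta> \<and> (\<forall>i<n. ts i \<in> \<Theta>) \<and> (\<exists>c. \<Theta> \<subseteq> cball c T) \<and> assumption_A f0 fs \<Theta> \<longrightarrow>
      (\<forall>q\<ge>n. \<forall>\<epsilon>>0. \<forall>\<delta>>0. \<delta> / \<epsilon> \<le> 1 \<longrightarrow>
        ereal_of_enat (bracketing_number (density_measure fs) (hellinger_ball f0 fs \<Theta> q \<epsilon>) \<delta>)
          \<le> ereal ((C_Theta f0 fs \<Theta> T L * \<epsilon> / \<delta>) ^ (10 * (CARD('d) + 1) * q + 1)))"
proof -
  obtain r C where r: "0 < r" "r \<le> 1" and C: "1 \<le> C"
    and lg: "\<And>q p \<theta> B. (\<And>j. j < q \<Longrightarrow> 0 \<le> p j) \<Longrightarrow> (\<integral>x. \<bar>mixture f0 q p \<theta> x - mixture f0 n ps ts x\<bar> \<partial>lborel) \<le> B \<Longrightarrow>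
        (\<Sum>j<q. p j * loc_weight n ts r (\<theta> j)) \<le> C * B"
    "\<And>q p \<theta> B i. (\<And>j. j < q \<Longrightarrow> 0 \<le> p j) \<Longrightarrow> (\<integral>x. \<bar>mixture f0 q p \<theta> x - mixture f0 n ps ts x\<bar> \<partial>lborel) \<le> B \<Longrightarrow> i < n \<Longrightarrow>
        \<bar>(\<Sum>j\<in>{j. j < q \<and> label n ts r (\<theta> j) = i}. p j) - ps i\<bar> \<le> C * B"
    "\<And>q p \<theta> B i k. (\<And>j. j < q \<Longrightarrow> 0 \<le> p j) \<Longrightarrow> (\<integral>x. \<bar>mixture f0 q p \<theta> x - mixture f0 n ps ts x\<bar> \<partial>lborel) \<le> B \<Longrightarrow> i < n \<Longrightarrow>
        \<bar>\<Sum>j\<in>{j. j < q \<and> label n ts r (\<theta> j) = i}. p j * (\<theta> j - ts i) $ k\<bar> \<le> C * B"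
  proof (rule local_geometry[OF f0(2) n inj])
    fix r C :: real
    assume a: "0 < r" "r \<le> 1" "1 \<le> C"
    "\<And>q p \<theta> ps B. (\<And>j. j < q \<Longrightarrow> 0 \<le> p j) \<Longrightarrow> (\<integral>x. \<bar>mixture f0 q p \<theta> x - mixture f0 n ps ts x\<bar> \<partial>lborel) \<le> B \<Longrightarrow>
        (\<Sum>j<q. p j * loc_weight n ts r (\<theta> j)) \<le> C * B"
    "\<And>q p \<theta> ps B i. (\<And>j. j < q \<Longrightarrow> 0 \<le> p j) \<Longrightarrow> (\<integral>x. \<bar>mixture f0 q p \<theta> x - mixture f0 n ps ts x\<bar> \<partial>lborel) \<le> B \<Longrightarrow> i < n \<Longrightarrow>
        \<bar>(\<Sum>j\<in>{j. j < q \<and> label n ts r (\<theta> j) = i}. p j) - ps i\<bar> \<le> C * B"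
    "\<And>q p \<theta> ps B i k. (\<And>j. j < q \<Longrightarrow> 0 \<le> p j) \<Longrightarrow> (\<integral>x. \<bar>mixture f0 q p \<theta> x - mixture f0 n ps ts x\<bar> \<partial>lborel) \<le> B \<Longrightarrow> i < n \<Longrightarrow>
        \<bar>\<Sum>j\<in>{j. j < q \<and> label n ts r (\<theta> j) = i}. p j * (\<theta> j - ts i) $ k\<bar> \<le> C * B"
    show thesis by (rule that[OF a(1-3) a(4)[where ps = ps] a(5)[where ps = ps] a(6)[where ps = ps]])
  qed
  define K where "K = 2 * C"
  define dm where "dm = real CARD('d)"
  define V1 where "V1 = measure lborel (ball (0::real^'d) 1)"
  define V2 where "V2 = measure lborel (ball (0::real^'d) 2)"
  have V: "emeasure lborel (ball (0::real^'d) 1) = ennreal V1" "0 < V1"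
    "emeasure lborel (ball (0::real^'d) 2) = ennreal V2" "0 < V2"
    unfolding V1_def V2_def using emeasure_lborel_ball_finite[of "0::real^'d"]
    by (auto intro!: emeasure_eq_ennreal_measure content_ball_pos simp: less_top[symmetric])
  \<comment> \<open>The constant of the locale is taken here as a function of these five parameters,
    before any \<open>\<Theta>\<close> is given; the interpretation below identifies it with
    \<open>E.cC\<close>.\<close>
  define kC where "kC = coding.cC n V1 V2 dm K"
  \<comment> \<open>The root makes \<open>5 * kC * c^2 \<le> 1\<close>, the minimum with
    \<open>r\<close> gives \<open>u^3 \<le> r\<close>. The absolute value makes the definition
    independent of the sign of \<open>kC\<close>.\<close>
  define c where "c = min r (1 / sqrt (5 * (\<bar>kC\<bar> + 1)))"
  have s5: "0 < sqrt (5 * (\<bar>kC\<bar> + 1))" by simp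
  have c: "0 < c" "c \<le> r" "c \<le> 1" using r s5 by (auto simp: c_def)
  have kc: "5 * kC * c^2 \<le> 1"
  proof -
    have "c^2 \<le> (1 / sqrt (5 * (\<bar>kC\<bar> + 1)))^2" using c by (intro power_mono) (auto simp: c_def)
    also have "\<dots> = 1 / (5 * (\<bar>kC\<bar> + 1))" by (simp add: power_divide)
    finally have "c^2 * (5 * (\<bar>kC\<bar> + 1)) \<le> 1" by (simp add: le_divide_eq)
    moreover have "5 * kC * c^2 \<le> c^2 * (5 * (\<bar>kC\<bar> + 1))"
      using mult_left_mono[of "5 * kC" "5 * (\<bar>kC\<bar> + 1)" "c^2"] by (simp add: mult.commute)
    ultimately show ?thesis by simp
  qed
  have K1: "1 \<le> K" and dm1: "0 \<le> dm" using C by (auto simp: K_def dm_def)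
  define B1 where "B1 = exp 1 * (1 + (K + 2 * dm) / c^8)"
  define B2 where "B2 = 2 * K / c^2 + 2"
  define L where "L = 2 * (real n + 1) * 2 * B1 * B2"
  have B: "1 \<le> B1" "1 \<le> B2"
  proof -
    have "1 * 1 \<le> exp 1 * (1 + (K + 2 * dm) / c^8)" using K1 dm1 c by (intro mult_mono) auto
    then show "1 \<le> B1" by (simp add: B1_def)
    show "1 \<le> B2" using K1 c by (simp add: B2_def add_increasing)
  qed
  have "0 < L" using B by (simp add: L_def)
  moreover have "ereal_of_enat (bracketing_number (density_measure fs) (hellinger_ball f0 fs \<Theta> q \<epsilon>) \<delta>)
          \<le> ereal ((C_Theta f0 fs \<Theta> T L * \<epsilon> / \<delta>) ^ (10 * (CARD('d) + 1) * q + 1))"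
    if \<Theta>: "bounded \<Theta>" "\<And>i. i < n \<Longrightarrow> ts i \<in> \<Theta>" "\<Theta> \<subseteq> cball cc T" "assumption_A f0 fs \<Theta>"
      and q: "n \<le> q" and \<epsilon>: "0 < \<epsilon>" and \<delta>: "0 < \<delta>" "\<delta> / \<epsilon> \<le> 1" for \<Theta> cc T q \<epsilon> \<delta>
  proof -
    let ?H0 = "envelope0 f0 fs \<Theta>" and ?H1 = "envelope1 f0 fs \<Theta>" and ?H2 = "envelope2 f0 fs \<Theta>" and ?H3 = "envelope3 f0 fs \<Theta>"
    let ?\<mu> = "density_measure fs"
    interpret E: mix_env f0 fs ?H0 ?H1 ?H2 ?H3 \<Theta> n ps ts
      by (rule envelopes_mix_env) (use f0 \<Theta> n ps fs in auto)
    interpret E: mix_env_vol f0 fs ?H0 ?H1 ?H2 ?H3 \<Theta> n ps ts V1 V2 dm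
      by unfold_locales (use V dm_def in auto)
    have cont: "continuous_on UNIV f0" by (rule C_k_continuous) (rule E.C3)
    note fsp = mixture_props[OF f0(2) cont ps, of ts, folded fs]
    define M where "M = max (max (Lp_norm 4 ?\<mu> ?H0 ^ 4) (Lp_norm 4 ?\<mu> ?H1 ^ 4)) (max (Lp_norm 4 ?\<mu> ?H2 ^ 4) (Lp_norm 2 ?\<mu> ?H3 ^ 2))"
    have M: "(\<integral>\<^sup>+x. ennreal (?H0 x ^ 4) \<partial>?\<mu>) \<le> ennreal M" "(\<integral>\<^sup>+x. ennreal (?H1 x ^ 4) \<partial>?\<mu>) \<le> ennreal M"
      "(\<integral>\<^sup>+x. ennreal (?H2 x ^ 4) \<partial>?\<mu>) \<le> ennreal M" "(\<integral>\<^sup>+x. ennreal (?H3 x ^ 2) \<partial>?\<mu>) \<le> ennreal M"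
      using \<Theta>(4) Lp_norm_power[of ?H0 4 ?\<mu>] Lp_norm_power[of ?H1 4 ?\<mu>] Lp_norm_power[of ?H2 4 ?\<mu>] Lp_norm_power[of ?H3 2 ?\<mu>]
      by (auto simp: assumption_A_def M_def abs_of_nonneg E.H_nonneg intro!: ennreal_leI)
    note J = E.J_le[OF M fsp(2,3)]
    define \<rho> where "\<rho> = \<delta> / \<epsilon>"
    have \<rho>: "0 < \<rho>" "\<rho> \<le> 1" "\<epsilon> * \<rho> = \<delta>" using \<epsilon> \<delta> by (auto simp: \<rho>_def)
    \<comment> \<open>The squared bracket width is at most
      \<open>kC * \<epsilon>^2 * u^2 * 5 * M\<close>; dividing by \<open>sqrt M\<close> turns this
      into \<open>5 * kC * c^2 * \<delta>^2\<close>.\<close>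
    define u where "u = c * \<rho> / sqrt M"
    have u: "0 < u" "u \<le> c"
    proof -
      show "0 < u" using c \<rho> J(1) by (simp add: u_def)
      have "c * \<rho> \<le> c * sqrt M" using c \<rho> J(1) by (intro mult_left_mono) (auto intro: order_trans[of _ 1])
      then show "u \<le> c" using J(1) by (simp add: u_def divide_le_eq)
    qed
    have u3: "u^3 \<le> r" using power_decreasing[of 1 3 u] u c by simp
    have u2: "u^2 = c^2 * \<rho>^2 / M" using J(1) by (simp add: u_def power_divide power_mult_distrib)
    have u8: "u^8 = c^8 * \<rho>^8 / M^4"
    proof -
      have "(sqrt M)^2 = M" using J(1) by simp
      moreover have "sqrt M ^ 8 = ((sqrt M)^2)^4" unfolding power_mult[symmetric] by (rule arg_cong) simp
      ultimately have "sqrt M ^ 8 = M^4" by (simp only:)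
      then show ?thesis using J(1) by (simp add: u_def power_divide power_mult_distrib)
    qed
    interpret E: coding f0 fs ?H0 ?H1 ?H2 ?H3 \<Theta> n ps ts V1 V2 dm r K \<epsilon> u q
      by unfold_locales (use r K1 \<epsilon> u u3 c q n in auto)
    have br: "bracketing_number ?\<mu> (hellinger_ball f0 fs \<Theta> q \<epsilon>) \<delta> \<le> enat (card (E.codes T))"
    proof (rule E.bracketing_bound[OF \<Theta>(3)])
      fix g assume "g \<in> hellinger_ball f0 fs \<Theta> q \<epsilon>"
      then obtain p \<theta> where p: "\<forall>j<q. 0 \<le> p j" "(\<Sum>j<q. p j) = 1" "\<forall>j<q. \<theta> j \<in> \<Theta>"
        and g: "g = (\<lambda>x. sqrt (mixture f0 q p \<theta> x / fs x))"
        and h: "Lp_norm 2 ?\<mu> (\<lambda>x. sqrt (mixture f0 q p \<theta> x / fs x) - 1) \<le> \<epsilon>"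
        unfolding hellinger_ball_def mixtures_def by blast
      have p0: "0 \<le> p j" if "j < q" for j using p(1) that by blast
      note mp = mixture_props[OF f0(2) cont p0 p(2), of \<theta>]
      have "(\<integral>x. \<bar>mixture f0 q p \<theta> x - fs x\<bar> \<partial>lborel) \<le> 2 * \<epsilon>"
        by (rule hellinger_L1[OF mp(1) fsp(1) mp(2-4) fsp(2,3) E.fs_pos h \<epsilon>])
      then have L1: "(\<integral>x. \<bar>mixture f0 q p \<theta> x - mixture f0 n ps ts x\<bar> \<partial>lborel) \<le> 2 * \<epsilon>" by (simp only: fs)
      have "E.admissible p \<theta>"
        unfolding E.admissible_def E.ca_def E.cb_def
        using p lg(1)[OF p0 L1] lg(2)[OF p0 L1] lg(3)[OF p0 L1] by (simp add: K_def mult_ac)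
      then show "\<exists>p \<theta>. E.admissible p \<theta> \<and> (\<Sum>j<q. p j) = 1 \<and> g = (\<lambda>x. sqrt (mixture f0 q p \<theta> x / fs x))" using p(2) g by blast
    next
      have kC: "kC = E.cC" by (simp add: kC_def)
      have "kC * \<epsilon>^2 * u^2 * (5 * M) = (5 * kC * c^2) * (\<epsilon> * \<rho>)^2"
        using J(1) unfolding u2 by (simp add: power_mult_distrib)
      also have "\<dots> \<le> 1 * (\<epsilon> * \<rho>)^2" by (intro mult_right_mono kc) simp
      finally have le: "kC * \<epsilon>^2 * u^2 * (5 * M) \<le> \<delta>^2" by (simp add: \<rho>)
      have "ennreal (kC * \<epsilon>^2 * u^2) * E.J \<le> ennreal (kC * \<epsilon>^2 * u^2) * ennreal (5 * M)"
        by (intro mult_left_mono J(2) zero_le)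
      also have "\<dots> = ennreal (kC * \<epsilon>^2 * u^2 * (5 * M))" using J(1) by (intro ennreal_mult''[symmetric]) simp
      also have "\<dots> \<le> ennreal (\<delta>^2)" by (intro ennreal_leI le)
      finally show "ennreal (E.cC * \<epsilon>^2 * u^2) * E.J \<le> ennreal (\<delta>^2)" unfolding kC .
      show "(\<integral>\<^sup>+x. ennreal (?H0 x) \<partial>?\<mu>) < top" by (rule J(3))
      show "f0 \<in> borel_measurable borel" using cont by (rule borel_measurable_continuous_onI)
    qed (use \<delta> in simp)
    \<comment> \<open>The exponents are those of \<open>C_Theta\<close>. They dominate what the
      count produces: \<open>T1 = S^3 \<le> S^8\<close> and \<open>M \<le> N^2\<close>, hence
      \<open>T1 / u^8\<close> and \<open>1 / u^2\<close> are at most constants times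
      \<open>A^8\<close> and \<open>A^2\<close>.\<close>
    define N where "N = M powr (5/4)"
    define T1 where "T1 = max T 1"
    define S where "S = T1 powr (1/3)"
    define A where "A = S * N / \<rho>"
    have N: "1 \<le> N" "M \<le> N^2" unfolding N_def using J(1) powr_mono[of 1 "5/2" M] by (auto simp: ge_one_powr_ge_zero powr_power)
    have T1: "1 \<le> T1" by (simp add: T1_def)
    have S: "1 \<le> S" "S^3 = T1" using T1 by (auto simp: S_def ge_one_powr_ge_zero powr_power)
    have SN: "1 \<le> S * N" using mult_ge1_I[OF S(1) N(1)] .
    have A1: "1 \<le> A" unfolding A_def using SN \<rho> by (simp add: le_divide_eq)
    have A2: "M / \<rho>^2 \<le> A^2"
    proof -
      have "1 * M \<le> S^2 * N^2" using S N J(1) by (intro mult_mono) (auto simp: one_le_power)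
      then show ?thesis unfolding A_def using \<rho> by (simp add: power_divide power_mult_distrib divide_right_mono)
    qed
    have A8: "T1 * (M^4 / \<rho>^8) \<le> A^8"
    proof -
      have "M^4 \<le> (N^2)^4" using N J(1) by (intro power_mono) auto
      moreover have "T1 \<le> S^8" unfolding S(2)[symmetric] using S(1) by (intro power_increasing) auto
      ultimately have "T1 * M^4 \<le> S^8 * N^8" using T1 J(1) by (intro mult_mono) (auto simp: power_mult[symmetric])
      then show ?thesis unfolding A_def using \<rho> by (simp add: power_divide power_mult_distrib divide_right_mono)
    qed
    have "real (card (E.codes T)) \<le> (2 * (real n + 1)) ^ q * 2 ^ (q * CARD('d)) * (exp 1 * (1 + E.Nb T)) ^ (q * (CARD('d) + 1))
     * (2 * (K / u^2) + 2) ^ (n * (CARD('d) + 1))" by (rule E.card_codes[OF \<Theta>(3)])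
    also have "\<dots> \<le> ((2 * (real n + 1) * 2 * B1 * B2) * A) ^ (10 * (CARD('d) + 1) * q + 1)"
    proof (rule count_arith[OF A1 _ B _ _ _ _ q])
      have Nb: "0 \<le> E.Nb T" using E.Nb_pos[OF \<Theta>(3)] by simp
      have "E.Nb T = (K + 2 * dm * T1) * (M^4 / \<rho>^8) / c^8"
        unfolding E.Nb_def[OF \<Theta>(3)] u8 T1_def[symmetric] using c \<rho> J(1) by (simp add: field_simps)
      also have "\<dots> \<le> ((K + 2 * dm) * T1) * (M^4 / \<rho>^8) / c^8"
        using T1 K1 c \<rho> J(1) mult_left_mono[of 1 T1 K] by (intro divide_right_mono mult_right_mono) (auto simp: distrib_right)
      also have "\<dots> = (K + 2 * dm) / c^8 * (T1 * (M^4 / \<rho>^8))" by (simp add: mult_ac)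
      also have "\<dots> \<le> (K + 2 * dm) / c^8 * A^8" using K1 dm1 c by (intro mult_left_mono A8) auto
      finally have "1 + E.Nb T \<le> 1 * A^8 + (K + 2 * dm) / c^8 * A^8" using A1 by (intro add_mono) auto
      then have "1 + E.Nb T \<le> (1 + (K + 2 * dm) / c^8) * A^8" by (simp only: distrib_right)
      then show "exp 1 * (1 + E.Nb T) \<le> B1 * A^8" unfolding B1_def by (simp add: mult.assoc)
      show "0 \<le> exp 1 * (1 + E.Nb T)" using Nb by simp
      have "K / u^2 = K / c^2 * (M / \<rho>^2)" unfolding u2 using c \<rho> J(1) by (simp add: field_simps)
      also have "\<dots> \<le> K / c^2 * A^2" using K1 by (intro mult_left_mono A2) auto
      finally have "2 * (K / u^2) + 2 * 1 \<le> 2 * (K / c^2 * A^2) + 2 * A^2" using A1 by (intro add_mono mult_left_mono) auto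
      then show "2 * (K / u^2) + 2 \<le> B2 * A^2" by (simp add: B2_def distrib_right)
      show "0 \<le> 2 * (K / u^2) + 2" using K1 by simp
    qed simp
    also have "(2 * (real n + 1) * 2 * B1 * B2) * A = C_Theta f0 fs \<Theta> T L * \<epsilon> / \<delta>"
      unfolding L_def[symmetric] A_def S_def N_def T1_def \<rho>_def C_Theta_def M_def using \<epsilon> \<delta> by simp
    finally have "ereal (real (card (E.codes T))) \<le> ereal ((C_Theta f0 fs \<Theta> T L * \<epsilon> / \<delta>) ^ (10 * (CARD('d) + 1) * q + 1))" by simp
    moreover have "ereal_of_enat (bracketing_number ?\<mu> (hellinger_ball f0 fs \<Theta> q \<epsilon>) \<delta>) \<le> ereal_of_enat (enat (card (E.codes T)))"
      using br by (simp only: ereal_of_enat_le_iff)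
    ultimately show ?thesis by (simp del: ereal_less_eq) 
  qed
  ultimately show ?thesis by blast
qed

text \<open>The constant has to be chosen before the representation of \<open>fstar\<close>, so two representations must
  have the same support points.\<close>

lemma mixture_support_eq:
  fixes f0 :: "real^'d::finite \<Rightarrow> real"
  assumes "prob_density f0" "nondegenerate n p \<theta>" "nondegenerate n p' \<theta>'" "mixture f0 n p \<theta> = mixture f0 n p' \<theta>'"
  shows "\<theta> ` {..<n} = \<theta>' ` {..<n}"
proof (rule sym, rule card_subset_eq)
  have n: "0 < n" using assms(2) by (cases n) (auto simp: nondegenerate_def)
  have inj: "inj_on \<theta> {..<n}" "inj_on \<theta>' {..<n}" using assms(2,3) by (auto simp: nondegenerate_def inj_on_def)
  then show "card (\<theta>' ` {..<n}) = card (\<theta> ` {..<n})" by (simp add: card_image)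
  show "\<theta>' ` {..<n} \<subseteq> \<theta> ` {..<n}"
  proof (rule local_geometry[OF assms(1) n])
    show "\<theta> i \<noteq> \<theta> j" if "i < n" "j < n" "i \<noteq> j" for i j using assms(2) that by (auto simp: nondegenerate_def)
    fix r C :: real
    assume lg: "\<And>q p' \<theta>' ps B. (\<And>j. j < q \<Longrightarrow> 0 \<le> p' j) \<Longrightarrow> (\<integral>x. \<bar>mixture f0 q p' \<theta>' x - mixture f0 n ps \<theta> x\<bar> \<partial>lborel) \<le> B \<Longrightarrow>
        (\<Sum>j<q. p' j * loc_weight n \<theta> r (\<theta>' j)) \<le> C * B"
    have p': "0 < p' j" if "j < n" for j using assms(3) that by (auto simp: nondegenerate_def)
    have nn: "0 \<le> p' j * loc_weight n \<theta> r (\<theta>' j)" if "j < n" for j using p'[OF that] by (simp add: loc_weight_nonneg)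
    \<comment> \<open>Equal mixtures have L1 distance 0. Since all \<open>p' j\<close> are positive,
      every local weight vanishes, which places each \<open>\<theta>' j\<close> exactly on some
      \<open>\<theta> i\<close>.\<close>
    have "(\<Sum>j<n. p' j * loc_weight n \<theta> r (\<theta>' j)) \<le> C * 0"
      by (rule lg[where ps = p]) (use p' assms(4) in \<open>auto simp: less_imp_le\<close>)
    moreover have "0 \<le> (\<Sum>j<n. p' j * loc_weight n \<theta> r (\<theta>' j))" using nn by (intro sum_nonneg) auto
    ultimately have "(\<Sum>j<n. p' j * loc_weight n \<theta> r (\<theta>' j)) = 0" by simp
    then have z: "p' j * loc_weight n \<theta> r (\<theta>' j) = 0" if "j < n" for j
      using nn that by (subst (asm) sum_nonneg_eq_0_iff) auto
    show ?thesis
    proof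
      fix t assume "t \<in> \<theta>' ` {..<n}"
      then obtain j where j: "j < n" "t = \<theta>' j" by auto
      then have "loc_weight n \<theta> r t = 0" using z[OF j(1)] p'[OF j(1)] by simp
      then show "t \<in> \<theta> ` {..<n}" by (auto simp: loc_weight_def split: if_splits)
    qed
  qed
qed auto

theorem theorem3p3:
  fixes f0 fstar :: "real^'d::finite \<Rightarrow> real" and qstar :: nat
  assumes "\<And>x. 0 < f0 x"
    and "prob_density f0"
  shows "\<exists>L>0. \<forall>(pistar :: nat \<Rightarrow> real) (thetastar :: nat \<Rightarrow> real^'d).
    nondegenerate qstar pistar thetastar \<and> fstar = mixture f0 qstar pistar thetastar \<longrightarrow>
    (\<forall>\<Theta> T. bounded \<Theta> \<and> (\<forall>i<qstar. thetastar i \<in> \<Theta>) \<and> (\<exists>c. \<Theta> \<subseteq> cball c T) \<and>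
        assumption_A f0 fstar \<Theta> \<longrightarrow>
      (\<forall>q\<ge>qstar. \<forall>\<epsilon>>0. \<forall>\<delta>>0. \<delta> / \<epsilon> \<le> 1 \<longrightarrow>
        ereal_of_enat (bracketing_number (density_measure fstar) (hellinger_ball f0 fstar \<Theta> q \<epsilon>) \<delta>)
          \<le> ereal ((C_Theta f0 fstar \<Theta> T L * \<epsilon> / \<delta>) ^ (10 * (CARD('d) + 1) * q + 1))))"
proof (cases "\<exists>p (\<theta> :: nat \<Rightarrow> real^'d). nondegenerate qstar p \<theta> \<and> fstar = mixture f0 qstar p \<theta>")
  case False
  then show ?thesis by (intro exI[of _ 1]) auto
next
  case True
  then obtain p and \<theta> :: "nat \<Rightarrow> real^'d" where nd: "nondegenerate qstar p \<theta>" and fs: "fstar = mixture f0 qstar p \<theta>"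
    by blast
  have "0 < qstar" using nd by (cases qstar) (auto simp: nondegenerate_def)
  have inj: "\<theta> i \<noteq> \<theta> j" if "i < qstar" "j < qstar" "i \<noteq> j" for i j
    using nd that by (auto simp: nondegenerate_def)
  have ps: "0 \<le> p i" if "i < qstar" for i using nd that by (auto simp: nondegenerate_def less_imp_le)
  have ps1: "(\<Sum>i<qstar. p i) = 1" using nd by (simp add: nondegenerate_def)
  obtain L where "0 < L" and L: "\<forall>\<Theta> T. bounded \<Theta> \<and> (\<forall>i<qstar. \<theta> i \<in> \<Theta>) \<and> (\<exists>c. \<Theta> \<subseteq> cball c T) \<and> assumption_A f0 fstar \<Theta> \<longrightarrow>
      (\<forall>q\<ge>qstar. \<forall>\<epsilon>>0. \<forall>\<delta>>0. \<delta> / \<epsilon> \<le> 1 \<longrightarrow>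
        ereal_of_enat (bracketing_number (density_measure fstar) (hellinger_ball f0 fstar \<Theta> q \<epsilon>) \<delta>)
          \<le> ereal ((C_Theta f0 fstar \<Theta> T L * \<epsilon> / \<delta>) ^ (10 * (CARD('d) + 1) * q + 1)))"
    using entropy_bound[OF assms \<open>0 < qstar\<close> inj ps ps1 fs] by blast
  show ?thesis
  proof (intro exI[of _ L] conjI \<open>0 < L\<close> allI impI)
    fix p' :: "nat \<Rightarrow> real" and \<theta>' :: "nat \<Rightarrow> real^'d" and \<Theta> :: "(real^'d) set" and T \<epsilon> \<delta> :: real and q
    assume r: "nondegenerate qstar p' \<theta>' \<and> fstar = mixture f0 qstar p' \<theta>'"
      and \<Theta>: "bounded \<Theta> \<and> (\<forall>i<qstar. \<theta>' i \<in> \<Theta>) \<and> (\<exists>c. \<Theta> \<subseteq> cball c T) \<and> assumption_A f0 fstar \<Theta>"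
      and q: "qstar \<le> q" "0 < \<epsilon>" "0 < \<delta>" "\<delta> / \<epsilon> \<le> 1"
    have "\<theta> ` {..<qstar} = \<theta>' ` {..<qstar}"
      using r fs by (intro mixture_support_eq[OF assms(2) nd]) auto
    then have "\<theta> ` {..<qstar} \<subseteq> \<Theta>" using \<Theta> by auto
    then have "\<forall>i<qstar. \<theta> i \<in> \<Theta>" by auto
    with \<Theta> have "bounded \<Theta> \<and> (\<forall>i<qstar. \<theta> i \<in> \<Theta>) \<and> (\<exists>c. \<Theta> \<subseteq> cball c T) \<and> assumption_A f0 fstar \<Theta>" by blast
    from L[rule_format, OF this q]
    show "ereal_of_enat (bracketing_number (density_measure fstar) (hellinger_ball f0 fstar \<Theta> q \<epsilon>) \<delta>)
          \<le> ereal ((C_Theta f0 fstar \<Theta> T L * \<epsilon> / \<delta>) ^ (10 * (CARD('d) + 1) * q + 1))" .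
  qed
qed

end
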